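(* Let $(A,\Omega^1,d)$ be a surjective first order differential calculus over a field $\mathbb{K}$ equipped with a pivotal structure, i.e. a bimodule $\mathfrak{X}^1$ which is both left and right dual to $\Omega^1$ via chosen maps $\mathrm{coev},\mathrm{ev},\underline{\mathrm{coev}},\underline{\mathrm{ev}}$, and write $\mathrm{coev}(1)=\sum_i db_i\otimes x_i$, $\underline{\mathrm{coev}}(1)=\sum_j y_j\otimes dc_j$. Then $H\mathfrak{X}^1$ is isomorphic as an algebra to the quotient of $IB\mathfrak{X}^1$ (in the presentation given in the context, with $\mathfrak{Y}^1=\mathfrak{X}^1$) by the additional relations $$\sum_j[y_j,\overline a]\bullet[\overline x,c_j]=\overline{\mathrm{ev}(x\otimes da)},\qquad \sum_i[\overline{x_i},a]\bullet[x,\overline{b_i}]=\underline{\mathrm{ev}}(da\otimes x)$$ for all $a\in A$, $x\in\mathfrak{X}^1$.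
   Context: $A$ is a $\mathbb{K}$-algebra, $\Omega^1$ an $A$-bimodule, $d:A\to\Omega^1$ a linear map with $d(ab)=(da)b+a\,db$; the calculus is surjective if $\Omega^1$ is spanned by elements $a\,db$. $A^{\mathrm{op}}$ has elements $\overline a$ with $\overline a\bullet\overline b=\overline{ba}$; $A^e=A\otimes A^{\mathrm{op}}$. $T_{\mathbb{K}}$ is the tensor algebra of a vector space, $\star$ the free product of algebras, $\bullet$ the product in the constructed algebras, $[\cdot,\cdot]$ the commutator for $\bullet$. Duality: $A$-bimodule maps $\mathrm{coev}:A\to\Omega^1\otimes_A\mathfrak{X}^1$, $\mathrm{ev}:\mathfrak{X}^1\otimes_A\Omega^1\to A$, $\underline{\mathrm{coev}}:A\to\mathfrak{X}^1\otimes_A\Omega^1$, $\underline{\mathrm{ev}}:\Omega^1\otimes_A\mathfrak{X}^1\to A$, with $\mathrm{coev}(1)=\sum_i\omega_i\otimes x_i$, $\underline{\mathrm{coev}}(1)=\sum_j y_j\otimes\rho_j$, satisfying $\sum\mathrm{ev}(x\otimes\omega_i)x_i=x$, $\sum\omega_i\mathrm{ev}(x_i\otimes\omega)=\omega$, $\sum\underline{\mathrm{ev}}(\omega\otimes y_j)\rho_j=\omega$, $\sum y_j\underline{\mathrm{ev}}(\rho_j\otimes x)=x$. For a surjective calculus one can choose representatives with $\omega_i=db_i$, $\rho_j=dc_j$. **Definition of $H\mathfrak{X}^1$.** The quotient of $A^e\star T_{\mathbb{K}}\mathfrak{X}^1\star T_{\mathbb{K}}(\mathfrak{X}^1\otimes_{\mathbb{K}}\Omega^1)\star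 T_{\mathbb{K}}(\Omega^1\otimes_{\mathbb{K}}\mathfrak{X}^1)$ (generators $a\overline b$, $x$, $(x,\omega)$, $(\omega,x)$) by (repeated indices summed) (1) $a\bullet x=ax$; (2) $x\bullet a=xa+\mathrm{ev}(x\otimes da)$; (3) $x\bullet\overline a=\overline a\bullet x+(x,da)$; (4) $a\overline{a'}\bullet(x,\omega)\bullet b\overline{b'}=(axb,b'\omega a')$ and $a\overline{a'}\bullet(\omega,x)\bullet b\overline{b'}=(a\omega b,b'xa')$; (5) $(\omega_i,y)\bullet(x_i,\omega)=\overline{\underline{\mathrm{ev}}(\omega\otimes y)}$; (6) $(x,\rho_j)\bullet(\omega,y_j)=\mathrm{ev}(x\otimes\omega)$; (7) $(y_j,\omega)\bullet(\rho_j,x)=\overline{\mathrm{ev}(x\otimes\omega)}$; (8) $(\omega,x_i)\bullet(x,\omega_i)=\underline{\mathrm{ev}}(\omega\otimes x)$. **Presentation of $IB\mathfrak{X}^1$ used here.** The quotient of $A^e\star T_{\mathbb{K}}\mathfrak{X}^1\star T_{\mathbb{K}}\mathfrak{Y}^1$, where $\mathfrak{Y}^1=\mathfrak{X}^1$ is a second copy with elements written $\overline y$, by: (1), (2); $\overline a\bullet\overline y=\overline{ya}$; $\overline y\bullet\overline a=\overline{ay}+\overline{\underline{\mathrm{ev}}(da\otimes y)}$; $\sum_m\overline{s_m}\bullet x\bullet\overline{r_m}=0$ and $\sum_m r_m\bullet\overline y\bullet s_m=0$ for every $\sum_m r_m\otimes s_m\in A\otimes_{\mathbb{K}}A$ with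 $\sum r_ms_m=0$ and $\sum r_m\,ds_m=0$ in $\Omega^1$; $[\overline y,b_i]\bullet x_i=\overline y$; $[x,\overline{c_j}]\bullet\overline{y_j}=x$. *)

theory Defs
  imports "HOL-Algebra.Module" "HOL-Algebra.QuotRing"
begin

section \<open>Algebras, bimodules and first order differential calculi\<close>

text \<open>
  The locale \<^locale>\<open>algebra\<close> of the library only covers commutative algebras; the algebras here
  are unital and associative, but need not be commutative.
\<close>

locale K_algebra = K: field K + module K A + A: ring A for K (structure) and A (structure) +
  assumes smult_mult_left:
      "\<lbrakk>k \<in> carrier K; a \<in> carrier A; b \<in> carrier A\<rbrakk> \<Longrightarrow>
        (k \<odot>\<^bsub>A\<^esub> a) \<otimes>\<^bsub>A\<^esub> b = k \<odot>\<^bsub>A\<^esub> (a \<otimes>\<^bsub>A\<^esub> b)"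
    and smult_mult_right:
      "\<lbrakk>k \<in> carrier K; a \<in> carrier A; b \<in> carrier A\<rbrakk> \<Longrightarrow>
        a \<otimes>\<^bsub>A\<^esub> (k \<odot>\<^bsub>A\<^esub> b) = k \<odot>\<^bsub>A\<^esub> (a \<otimes>\<^bsub>A\<^esub> b)"

definition algebra_iso ::
    "('k, 'r) ring_scheme \<Rightarrow> ('k, 'b, 's) module_scheme \<Rightarrow> ('k, 'c, 't) module_scheme \<Rightarrow> ('b \<Rightarrow> 'c) set"
  where "algebra_iso K B C =
    {h \<in> ring_iso B C. \<forall>k \<in> carrier K. \<forall>b \<in> carrier B. h (k \<odot>\<^bsub>B\<^esub> b) = k \<odot>\<^bsub>C\<^esub> h b}"

definition algebra_isomorphic ::
    "('k, 'r) ring_scheme \<Rightarrow> ('k, 'b, 's) module_scheme \<Rightarrow> ('k, 'c, 't) module_scheme \<Rightarrow> bool"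
  where "algebra_isomorphic K B C \<longleftrightarrow> algebra_iso K B C \<noteq> {}"

definition opposite :: "('k, 'a, 'm) module_scheme \<Rightarrow> ('k, 'a, 'm) module_scheme"
  where "opposite A = A\<lparr>mult := (\<lambda>a b. b \<otimes>\<^bsub>A\<^esub> a)\<rparr>"

text \<open>
  As everywhere in the library, a module is a record with the fields of a ring; for objects that
  are only modules the fields \<^const>\<open>mult\<close> and \<^const>\<open>one\<close> carry no meaning.
\<close>

record ('k, 'a, 'm) bimodule = "('k, 'm) module" +
  lact :: "'a \<Rightarrow> 'm \<Rightarrow> 'm"  (infixr \<open>\<triangleright>\<index>\<close> 75)
  ract :: "'m \<Rightarrow> 'a \<Rightarrow> 'm"  (infixl \<open>\<triangleleft>\<index>\<close> 75)

locale bimodule = K_algebra K A + M: module K M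
  for K (structure) and A (structure)
    and M :: "('k, 'a, 'm, 's) bimodule_scheme" (structure) +
  assumes lact_closed: "\<lbrakk>a \<in> carrier A; m \<in> carrier M\<rbrakk> \<Longrightarrow> a \<triangleright>\<^bsub>M\<^esub> m \<in> carrier M"
    and ract_closed: "\<lbrakk>m \<in> carrier M; a \<in> carrier A\<rbrakk> \<Longrightarrow> m \<triangleleft>\<^bsub>M\<^esub> a \<in> carrier M"
    and lact_add: "\<lbrakk>a \<in> carrier A; m \<in> carrier M; n \<in> carrier M\<rbrakk> \<Longrightarrow>
      a \<triangleright>\<^bsub>M\<^esub> (m \<oplus>\<^bsub>M\<^esub> n) = a \<triangleright>\<^bsub>M\<^esub> m \<oplus>\<^bsub>M\<^esub> a \<triangleright>\<^bsub>M\<^esub> n"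
    and add_lact: "\<lbrakk>a \<in> carrier A; b \<in> carrier A; m \<in> carrier M\<rbrakk> \<Longrightarrow>
      (a \<oplus>\<^bsub>A\<^esub> b) \<triangleright>\<^bsub>M\<^esub> m = a \<triangleright>\<^bsub>M\<^esub> m \<oplus>\<^bsub>M\<^esub> b \<triangleright>\<^bsub>M\<^esub> m"
    and ract_add: "\<lbrakk>m \<in> carrier M; n \<in> carrier M; a \<in> carrier A\<rbrakk> \<Longrightarrow>
      (m \<oplus>\<^bsub>M\<^esub> n) \<triangleleft>\<^bsub>M\<^esub> a = m \<triangleleft>\<^bsub>M\<^esub> a \<oplus>\<^bsub>M\<^esub> n \<triangleleft>\<^bsub>M\<^esub> a"
    and add_ract: "\<lbrakk>m \<in> carrier M; a \<in> carrier A; b \<in> carrier A\<rbrakk> \<Longrightarrow>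
      m \<triangleleft>\<^bsub>M\<^esub> (a \<oplus>\<^bsub>A\<^esub> b) = m \<triangleleft>\<^bsub>M\<^esub> a \<oplus>\<^bsub>M\<^esub> m \<triangleleft>\<^bsub>M\<^esub> b"
    and lact_mult: "\<lbrakk>a \<in> carrier A; b \<in> carrier A; m \<in> carrier M\<rbrakk> \<Longrightarrow>
      (a \<otimes>\<^bsub>A\<^esub> b) \<triangleright>\<^bsub>M\<^esub> m = a \<triangleright>\<^bsub>M\<^esub> (b \<triangleright>\<^bsub>M\<^esub> m)"
    and ract_mult: "\<lbrakk>m \<in> carrier M; a \<in> carrier A; b \<in> carrier A\<rbrakk> \<Longrightarrow>
      m \<triangleleft>\<^bsub>M\<^esub> (a \<otimes>\<^bsub>A\<^esub> b) = (m \<triangleleft>\<^bsub>M\<^esub> a) \<triangleleft>\<^bsub>M\<^esub> b"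
    and lact_one: "m \<in> carrier M \<Longrightarrow> \<one>\<^bsub>A\<^esub> \<triangleright>\<^bsub>M\<^esub> m = m"
    and ract_one: "m \<in> carrier M \<Longrightarrow> m \<triangleleft>\<^bsub>M\<^esub> \<one>\<^bsub>A\<^esub> = m"
    and lact_ract: "\<lbrakk>a \<in> carrier A; m \<in> carrier M; b \<in> carrier A\<rbrakk> \<Longrightarrow>
      (a \<triangleright>\<^bsub>M\<^esub> m) \<triangleleft>\<^bsub>M\<^esub> b = a \<triangleright>\<^bsub>M\<^esub> (m \<triangleleft>\<^bsub>M\<^esub> b)"
    and smult_lact: "\<lbrakk>k \<in> carrier K; a \<in> carrier A; m \<in> carrier M\<rbrakk> \<Longrightarrow>
      (k \<odot>\<^bsub>A\<^esub> a) \<triangleright>\<^bsub>M\<^esub> m = k \<odot>\<^bsub>M\<^esub> (a \<triangleright>\<^bsub>M\<^esub> m)"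
    and smult_ract: "\<lbrakk>k \<in> carrier K; m \<in> carrier M; a \<in> carrier A\<rbrakk> \<Longrightarrow>
      m \<triangleleft>\<^bsub>M\<^esub> (k \<odot>\<^bsub>A\<^esub> a) = k \<odot>\<^bsub>M\<^esub> (m \<triangleleft>\<^bsub>M\<^esub> a)"

definition regular_bimodule :: "('k, 'a) module \<Rightarrow> ('k, 'a, 'a) bimodule"
  where "regular_bimodule A = module.extend A (bimodule.fields (mult A) (mult A))"

definition linear_maps ::
    "('k, 'r) ring_scheme \<Rightarrow> ('k, 'm, 's) module_scheme \<Rightarrow> ('k, 'n, 't) module_scheme \<Rightarrow> ('m \<Rightarrow> 'n) set"
  where "linear_maps K M N =
    {h \<in> carrier M \<rightarrow> carrier N.
      (\<forall>m \<in> carrier M. \<forall>m' \<in> carrier M. h (m \<oplus>\<^bsub>M\<^esub> m') = h m \<oplus>\<^bsub>N\<^esub> h m') \<and>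
      (\<forall>k \<in> carrier K. \<forall>m \<in> carrier M. h (k \<odot>\<^bsub>M\<^esub> m) = k \<odot>\<^bsub>N\<^esub> h m)}"

definition bimodule_maps ::
    "('k, 'r) ring_scheme \<Rightarrow> ('k, 'a) module \<Rightarrow> ('k, 'a, 'm, 's) bimodule_scheme \<Rightarrow>
     ('k, 'a, 'n, 't) bimodule_scheme \<Rightarrow> ('m \<Rightarrow> 'n) set"
  where "bimodule_maps K A M N =
    {h \<in> linear_maps K M N.
      \<forall>a \<in> carrier A. \<forall>m \<in> carrier M.
        h (a \<triangleright>\<^bsub>M\<^esub> m) = a \<triangleright>\<^bsub>N\<^esub> h m \<and> h (m \<triangleleft>\<^bsub>M\<^esub> a) = h m \<triangleleft>\<^bsub>N\<^esub> a}"

definition lin_span :: "('k, 'r) ring_scheme \<Rightarrow> ('k, 'm, 's) module_scheme \<Rightarrow> 'm set \<Rightarrow> 'm set"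
  where "lin_span K M S = \<Inter>{N. submodule N K M \<and> S \<subseteq> N}"

locale first_order_calculus = bimodule K A \<Omega>
  for K :: "'k ring" and A :: "('k, 'a) module" and \<Omega> :: "('k, 'a, 'w) bimodule" +
  fixes d :: "'a \<Rightarrow> 'w"
  assumes d_linear: "d \<in> linear_maps K A \<Omega>"
    and d_Leibniz: "\<lbrakk>a \<in> carrier A; b \<in> carrier A\<rbrakk> \<Longrightarrow>
      d (a \<otimes>\<^bsub>A\<^esub> b) = d a \<triangleleft>\<^bsub>\<Omega>\<^esub> b \<oplus>\<^bsub>\<Omega>\<^esub> a \<triangleright>\<^bsub>\<Omega>\<^esub> d b"

locale surjective_calculus = first_order_calculus +
  assumes d_surjective:
    "lin_span K \<Omega> {a \<triangleright>\<^bsub>\<Omega>\<^esub> d b | a b. a \<in> carrier A \<and> b \<in> carrier A} = carrier \<Omega>"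


section \<open>Quotients, tensor products, tensor algebras and free products\<close>

text \<open>
  The quotient of a module by a submodule, or of an algebra by a two-sided ideal: the library's
  quotient ring with the induced scalar multiplication.
\<close>

definition quotient_module :: "('k, 'm, 's) module_scheme \<Rightarrow> 'm set \<Rightarrow> ('k, 'm set) module"
  where "quotient_module M N =
    ring.extend (M Quot N) (module.fields (\<lambda>k X. \<Union>x \<in> X. N +>\<^bsub>M\<^esub> (k \<odot>\<^bsub>M\<^esub> x)))"

text \<open>Relations imposed on an algebra are given as pairs of a left and a right hand side.\<close>

definition relation_ideal :: "('k, 'b, 's) module_scheme \<Rightarrow> ('b \<times> 'b) set \<Rightarrow> 'b set"
  where "relation_ideal B R = Idl\<^bsub>B\<^esub> {l \<ominus>\<^bsub>B\<^esub> r | l r. (l, r) \<in> R}"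

definition impose :: "('k, 'b, 's) module_scheme \<Rightarrow> ('b \<times> 'b) set \<Rightarrow> ('k, 'b set) module"
  where "impose B R = quotient_module B (relation_ideal B R)"

definition impose_class :: "('k, 'b, 's) module_scheme \<Rightarrow> ('b \<times> 'b) set \<Rightarrow> 'b \<Rightarrow> 'b set"
  where "impose_class B R x = relation_ideal B R +>\<^bsub>B\<^esub> x"

text \<open>
  The monoid algebra: finitely supported functions with the convolution product.  Its underlying
  module is the free module on the carrier of the monoid and does not depend on the multiplication.
\<close>

definition monoid_algebra :: "'k ring \<Rightarrow> ('g, 's) monoid_scheme \<Rightarrow> ('k, 'g \<Rightarrow> 'k) module"
  where "monoid_algebra K G =
    \<lparr>carrier = {f \<in> UNIV \<rightarrow> carrier K. finite {g. f g \<noteq> \<zero>\<^bsub>K\<^esub>} \<and> {g. f g \<noteq> \<zero>\<^bsub>K\<^esub>} \<subseteq> carrier G},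
     mult = (\<lambda>f h z. \<Oplus>\<^bsub>K\<^esub>p \<in> {(x, y). f x \<noteq> \<zero>\<^bsub>K\<^esub> \<and> h y \<noteq> \<zero>\<^bsub>K\<^esub> \<and> x \<otimes>\<^bsub>G\<^esub> y = z}.
       f (fst p) \<otimes>\<^bsub>K\<^esub> h (snd p)),
     one = (\<lambda>g. if g = \<one>\<^bsub>G\<^esub> then \<one>\<^bsub>K\<^esub> else \<zero>\<^bsub>K\<^esub>),
     zero = (\<lambda>g. \<zero>\<^bsub>K\<^esub>),
     add = (\<lambda>f h g. f g \<oplus>\<^bsub>K\<^esub> h g),
     smult = (\<lambda>k f g. k \<otimes>\<^bsub>K\<^esub> f g)\<rparr>"

definition basis_elem :: "'k ring \<Rightarrow> 'g \<Rightarrow> 'g \<Rightarrow> 'k"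
  where "basis_elem K g = (\<lambda>h. if h = g then \<one>\<^bsub>K\<^esub> else \<zero>\<^bsub>K\<^esub>)"

definition push :: "'k ring \<Rightarrow> ('g \<Rightarrow> 'h) \<Rightarrow> ('g \<Rightarrow> 'k) \<Rightarrow> 'h \<Rightarrow> 'k"
  where "push K \<phi> f = (\<lambda>z. \<Oplus>\<^bsub>K\<^esub>g \<in> {g. f g \<noteq> \<zero>\<^bsub>K\<^esub> \<and> \<phi> g = z}. f g)"

text \<open>
  The tensor product over \<open>K\<close> is the free module on the pairs modulo the bilinearity relations.
  The multiplication of pairs is componentwise, so for two algebras this is their tensor product
  as algebras; for two modules only the module structure is meaningful.
\<close>

definition pairs ::
    "'k ring \<Rightarrow> ('k, 'v, 's) module_scheme \<Rightarrow> ('k, 'w, 't) module_scheme \<Rightarrow> ('k, 'v \<times> 'w \<Rightarrow> 'k) module"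
  where "pairs K V W = monoid_algebra K (V \<times>\<times> W)"

definition bilinearity ::
    "'k ring \<Rightarrow> ('k, 'v, 's) module_scheme \<Rightarrow> ('k, 'w, 't) module_scheme \<Rightarrow> ('v \<times> 'w \<Rightarrow> 'k) set"
  where "bilinearity K V W = (let F = pairs K V W; e = basis_elem K in
    {e (v \<oplus>\<^bsub>V\<^esub> v', w) \<ominus>\<^bsub>F\<^esub> (e (v, w) \<oplus>\<^bsub>F\<^esub> e (v', w)) | v v' w.
       v \<in> carrier V \<and> v' \<in> carrier V \<and> w \<in> carrier W} \<union>
    {e (v, w \<oplus>\<^bsub>W\<^esub> w') \<ominus>\<^bsub>F\<^esub> (e (v, w) \<oplus>\<^bsub>F\<^esub> e (v, w')) | v w w'.
       v \<in> carrier V \<and> w \<in> carrier W \<and> w' \<in> carrier W} \<union>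
    {e (k \<odot>\<^bsub>V\<^esub> v, w) \<ominus>\<^bsub>F\<^esub> k \<odot>\<^bsub>F\<^esub> e (v, w) | k v w.
       k \<in> carrier K \<and> v \<in> carrier V \<and> w \<in> carrier W} \<union>
    {e (v, k \<odot>\<^bsub>W\<^esub> w) \<ominus>\<^bsub>F\<^esub> k \<odot>\<^bsub>F\<^esub> e (v, w) | k v w.
       k \<in> carrier K \<and> v \<in> carrier V \<and> w \<in> carrier W})"

definition tensor ::
    "'k ring \<Rightarrow> ('k, 'v, 's) module_scheme \<Rightarrow> ('k, 'w, 't) module_scheme \<Rightarrow> ('k, ('v \<times> 'w \<Rightarrow> 'k) set) module"
  where "tensor K V W = quotient_module (pairs K V W) (lin_span K (pairs K V W) (bilinearity K V W))"

definition tensor_elem ::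
    "'k ring \<Rightarrow> ('k, 'v, 's) module_scheme \<Rightarrow> ('k, 'w, 't) module_scheme \<Rightarrow> 'v \<Rightarrow> 'w \<Rightarrow> ('v \<times> 'w \<Rightarrow> 'k) set"
  where "tensor_elem K V W v w =
    lin_span K (pairs K V W) (bilinearity K V W) +>\<^bsub>pairs K V W\<^esub> basis_elem K (v, w)"

text \<open>
  The tensor product over \<open>A\<close> of two \<open>A\<close>-bimodules, with the outer actions
  \<open>a (m \<otimes> n) = (a m) \<otimes> n\<close> and \<open>(m \<otimes> n) a = m \<otimes> (n a)\<close>.
\<close>

definition balanced_span ::
    "'k ring \<Rightarrow> ('k, 'a) module \<Rightarrow> ('k, 'a, 'm) bimodule \<Rightarrow> ('k, 'a, 'n) bimodule \<Rightarrow> ('m \<times> 'n \<Rightarrow> 'k) set"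
  where "balanced_span K A M N = lin_span K (pairs K M N)
    (bilinearity K M N \<union>
     {basis_elem K (m \<triangleleft>\<^bsub>M\<^esub> a, n) \<ominus>\<^bsub>pairs K M N\<^esub> basis_elem K (m, a \<triangleright>\<^bsub>N\<^esub> n) | m a n.
       m \<in> carrier M \<and> a \<in> carrier A \<and> n \<in> carrier N})"

definition bimodule_tensor ::
    "'k ring \<Rightarrow> ('k, 'a) module \<Rightarrow> ('k, 'a, 'm) bimodule \<Rightarrow> ('k, 'a, 'n) bimodule \<Rightarrow>
     ('k, 'a, ('m \<times> 'n \<Rightarrow> 'k) set) bimodule"
  where "bimodule_tensor K A M N = (let F = pairs K M N; J = balanced_span K A M N in
    module.extend (quotient_module F J)
      (bimodule.fields
        (\<lambda>a X. \<Union>f \<in> X. J +>\<^bsub>F\<^esub> push K (\<lambda>(m, n). (a \<triangleright>\<^bsub>M\<^esub> m, n)) f)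
        (\<lambda>X a. \<Union>f \<in> X. J +>\<^bsub>F\<^esub> push K (\<lambda>(m, n). (m, n \<triangleleft>\<^bsub>N\<^esub> a)) f)))"

definition bimodule_tensor_elem ::
    "'k ring \<Rightarrow> ('k, 'a) module \<Rightarrow> ('k, 'a, 'm) bimodule \<Rightarrow> ('k, 'a, 'n) bimodule \<Rightarrow>
     'm \<Rightarrow> 'n \<Rightarrow> ('m \<times> 'n \<Rightarrow> 'k) set"
  where "bimodule_tensor_elem K A M N m n = balanced_span K A M N +>\<^bsub>pairs K M N\<^esub> basis_elem K (m, n)"

text \<open>
  The tensor algebra is the free algebra on the set \<open>V\<close> modulo linearity of the generators.
  The words of length \<open>n\<close> contribute exactly the free module on \<open>n\<close>-tuples modulo multilinearity,
  which is the \<open>n\<close>-th tensor power.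
\<close>

definition free_algebra :: "'k ring \<Rightarrow> 'g set \<Rightarrow> ('k, 'g list \<Rightarrow> 'k) module"
  where "free_algebra K S = monoid_algebra K \<lparr>carrier = lists S, mult = (@), one = []\<rparr>"

definition linearity ::
    "'k ring \<Rightarrow> ('k, 'v, 's) module_scheme \<Rightarrow> (('v list \<Rightarrow> 'k) \<times> ('v list \<Rightarrow> 'k)) set"
  where "linearity K V = (let F = free_algebra K (carrier V); e = (\<lambda>v. basis_elem K [v]) in
    {(e (v \<oplus>\<^bsub>V\<^esub> w), e v \<oplus>\<^bsub>F\<^esub> e w) | v w. v \<in> carrier V \<and> w \<in> carrier V} \<union>
    {(e (k \<odot>\<^bsub>V\<^esub> v), k \<odot>\<^bsub>F\<^esub> e v) | k v. k \<in> carrier K \<and> v \<in> carrier V})"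

definition tensor_algebra ::
    "'k ring \<Rightarrow> ('k, 'v, 's) module_scheme \<Rightarrow> ('k, ('v list \<Rightarrow> 'k) set) module"
  where "tensor_algebra K V = impose (free_algebra K (carrier V)) (linearity K V)"

definition tensor_incl ::
    "'k ring \<Rightarrow> ('k, 'v, 's) module_scheme \<Rightarrow> 'v \<Rightarrow> ('v list \<Rightarrow> 'k) set"
  where "tensor_incl K V v = impose_class (free_algebra K (carrier V)) (linearity K V) (basis_elem K [v])"

text \<open>
  The free product (coproduct) of two unital algebras is the tensor algebra of their direct sum
  modulo the relations identifying the products and units of the two summands with those of the
  tensor algebra.
\<close>

definition direct_sum ::
    "('k, 'b, 's) module_scheme \<Rightarrow> ('k, 'c, 't) module_scheme \<Rightarrow> ('k, 'b \<times> 'c) module"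
  where "direct_sum B C =
    \<lparr>carrier = carrier B \<times> carrier C,
     mult = (\<lambda>(b, c) (b', c'). (b \<otimes>\<^bsub>B\<^esub> b', c \<otimes>\<^bsub>C\<^esub> c')),
     one = (\<one>\<^bsub>B\<^esub>, \<one>\<^bsub>C\<^esub>),
     zero = (\<zero>\<^bsub>B\<^esub>, \<zero>\<^bsub>C\<^esub>),
     add = (\<lambda>(b, c) (b', c'). (b \<oplus>\<^bsub>B\<^esub> b', c \<oplus>\<^bsub>C\<^esub> c')),
     smult = (\<lambda>k (b, c). (k \<odot>\<^bsub>B\<^esub> b, k \<odot>\<^bsub>C\<^esub> c))\<rparr>"

type_synonym ('k, 'b, 'c) free_prod = "(('b \<times> 'c) list \<Rightarrow> 'k) set set"

definition free_product_relations ::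
    "'k ring \<Rightarrow> ('k, 'b) module \<Rightarrow> ('k, 'c) module \<Rightarrow>
     ((('b \<times> 'c) list \<Rightarrow> 'k) set \<times> (('b \<times> 'c) list \<Rightarrow> 'k) set) set"
  where "free_product_relations K B C =
    (let T = tensor_algebra K (direct_sum B C);
         i = (\<lambda>b. tensor_incl K (direct_sum B C) (b, \<zero>\<^bsub>C\<^esub>));
         j = (\<lambda>c. tensor_incl K (direct_sum B C) (\<zero>\<^bsub>B\<^esub>, c))
     in {(i b \<otimes>\<^bsub>T\<^esub> i b', i (b \<otimes>\<^bsub>B\<^esub> b')) | b b'. b \<in> carrier B \<and> b' \<in> carrier B} \<union>
        {(j c \<otimes>\<^bsub>T\<^esub> j c', j (c \<otimes>\<^bsub>C\<^esub> c')) | c c'. c \<in> carrier C \<and> c' \<in> carrier C} \<union>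
        {(i \<one>\<^bsub>B\<^esub>, \<one>\<^bsub>T\<^esub>), (j \<one>\<^bsub>C\<^esub>, \<one>\<^bsub>T\<^esub>)})"

definition free_product ::
    "'k ring \<Rightarrow> ('k, 'b) module \<Rightarrow> ('k, 'c) module \<Rightarrow> ('k, ('k, 'b, 'c) free_prod) module"
  where "free_product K B C =
    impose (tensor_algebra K (direct_sum B C)) (free_product_relations K B C)"

definition free_inl ::
    "'k ring \<Rightarrow> ('k, 'b) module \<Rightarrow> ('k, 'c) module \<Rightarrow> 'b \<Rightarrow> ('k, 'b, 'c) free_prod"
  where "free_inl K B C b =
    impose_class (tensor_algebra K (direct_sum B C)) (free_product_relations K B C)
      (tensor_incl K (direct_sum B C) (b, \<zero>\<^bsub>C\<^esub>))"

definition free_inr ::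
    "'k ring \<Rightarrow> ('k, 'b) module \<Rightarrow> ('k, 'c) module \<Rightarrow> 'c \<Rightarrow> ('k, 'b, 'c) free_prod"
  where "free_inr K B C c =
    impose_class (tensor_algebra K (direct_sum B C)) (free_product_relations K B C)
      (tensor_incl K (direct_sum B C) (\<zero>\<^bsub>B\<^esub>, c))"

definition commutator :: "('b, 's) ring_scheme \<Rightarrow> 'b \<Rightarrow> 'b \<Rightarrow> 'b"
  where "commutator B u v = u \<otimes>\<^bsub>B\<^esub> v \<ominus>\<^bsub>B\<^esub> v \<otimes>\<^bsub>B\<^esub> u"


section \<open>Duals\<close>

text \<open>
  \<open>duality K A M N coev ev s m n\<close> is the data of evaluation and coevaluation maps with
  \<open>coev 1 = (\<Sum>i<s. m i \<otimes> n i)\<close>.  The maps \<open>ev, coev\<close> making \<open>X\<close> one-sided dual to \<open>\<Omega>\<close> are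
  the case \<open>M = \<Omega>\<close>, \<open>N = X\<close>; the underlined maps for the other side are the case
  \<open>M = X\<close>, \<open>N = \<Omega>\<close>.  As \<open>ev\<close> and \<open>coev\<close> are bimodule maps, the two zig-zag identities do
  not depend on the choice of the representatives \<open>m\<close>, \<open>n\<close>.
\<close>

definition duality ::
    "'k ring \<Rightarrow> ('k, 'a) module \<Rightarrow> ('k, 'a, 'm) bimodule \<Rightarrow> ('k, 'a, 'n) bimodule \<Rightarrow>
     ('a \<Rightarrow> ('m \<times> 'n \<Rightarrow> 'k) set) \<Rightarrow> (('n \<times> 'm \<Rightarrow> 'k) set \<Rightarrow> 'a) \<Rightarrow>
     nat \<Rightarrow> (nat \<Rightarrow> 'm) \<Rightarrow> (nat \<Rightarrow> 'n) \<Rightarrow> bool"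
  where "duality K A M N coev ev s m n \<longleftrightarrow>
    coev \<in> bimodule_maps K A (regular_bimodule A) (bimodule_tensor K A M N) \<and>
    ev \<in> bimodule_maps K A (bimodule_tensor K A N M) (regular_bimodule A) \<and>
    m \<in> {..<s} \<rightarrow> carrier M \<and> n \<in> {..<s} \<rightarrow> carrier N \<and>
    coev \<one>\<^bsub>A\<^esub> = (\<Oplus>\<^bsub>bimodule_tensor K A M N\<^esub>i \<in> {..<s}. bimodule_tensor_elem K A M N (m i) (n i)) \<and>
    (\<forall>x \<in> carrier N. (\<Oplus>\<^bsub>N\<^esub>i \<in> {..<s}. ev (bimodule_tensor_elem K A N M x (m i)) \<triangleright>\<^bsub>N\<^esub> n i) = x) \<and>
    (\<forall>w \<in> carrier M. (\<Oplus>\<^bsub>M\<^esub>i \<in> {..<s}. m i \<triangleleft>\<^bsub>M\<^esub> ev (bimodule_tensor_elem K A N M (n i) w)) = w)"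

text \<open>
  The surjective calculus with a pivotal structure; underlined maps are written \<open>ucoev\<close>, \<open>uev\<close>, and
  \<open>coev 1 = (\<Sum>i<p. d (b i) \<otimes> x i)\<close>, \<open>ucoev 1 = (\<Sum>j<q. y j \<otimes> d (c j))\<close>.
\<close>

locale pivotal_calculus = surjective_calculus K A \<Omega> d + X: bimodule K A X
  for K :: "'k ring" and A :: "('k, 'a) module" and \<Omega> :: "('k, 'a, 'w) bimodule" and d
    and X :: "('k, 'a, 'x) bimodule" +
  fixes coev :: "'a \<Rightarrow> ('w \<times> 'x \<Rightarrow> 'k) set" and ev :: "('x \<times> 'w \<Rightarrow> 'k) set \<Rightarrow> 'a"
    and ucoev :: "'a \<Rightarrow> ('x \<times> 'w \<Rightarrow> 'k) set" and uev :: "('w \<times> 'x \<Rightarrow> 'k) set \<Rightarrow> 'a"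
    and p :: nat and b :: "nat \<Rightarrow> 'a" and x :: "nat \<Rightarrow> 'x"
    and q :: nat and y :: "nat \<Rightarrow> 'x" and c :: "nat \<Rightarrow> 'a"
  assumes b_closed: "b \<in> {..<p} \<rightarrow> carrier A" and c_closed: "c \<in> {..<q} \<rightarrow> carrier A"
    and duality: "duality K A \<Omega> X coev ev p (\<lambda>i. d (b i)) x"
    and uduality: "duality K A X \<Omega> ucoev uev q y (\<lambda>j. d (c j))"


section \<open>The algebras\<close>

text \<open>
  The following locale carries no assumptions; it only fixes the data from which the algebras are
  built.  In the relations \<open>ia a\<close>, \<open>ib a\<close> and \<open>iab a a'\<close>, with prefix \<open>H_\<close> or \<open>B_\<close>, are the
  generators \<open>a\<close>, \<open>bar a\<close> and \<open>a (bar a')\<close>, where the bar is the passage to the opposite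
  algebra; \<open>ix u\<close>, \<open>ixw u w\<close> and \<open>iwx w u\<close> are the generators \<open>u\<close>, \<open>(u, w)\<close> and \<open>(w, u)\<close>.
\<close>

locale calculus_data =
  fixes K :: "'k ring" and A :: "('k, 'a) module" and \<Omega> :: "('k, 'a, 'w) bimodule" and d :: "'a \<Rightarrow> 'w"
    and X :: "('k, 'a, 'x) bimodule"
    and ev :: "('x \<times> 'w \<Rightarrow> 'k) set \<Rightarrow> 'a" and uev :: "('w \<times> 'x \<Rightarrow> 'k) set \<Rightarrow> 'a"
begin

abbreviation Ae where "Ae \<equiv> tensor K A (opposite A)"
abbreviation ae where "ae a a' \<equiv> tensor_elem K A (opposite A) a a'"
abbreviation TX where "TX \<equiv> tensor_algebra K X"
abbreviation XW where "XW \<equiv> tensor K X \<Omega>"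
abbreviation WX where "WX \<equiv> tensor K \<Omega> X"

definition ev_pair :: "'x \<Rightarrow> 'w \<Rightarrow> 'a"
  where "ev_pair u w = ev (bimodule_tensor_elem K A X \<Omega> u w)"

definition uev_pair :: "'w \<Rightarrow> 'x \<Rightarrow> 'a"
  where "uev_pair w u = uev (bimodule_tensor_elem K A \<Omega> X w u)"

subsection \<open>The algebra HX\<close>

abbreviation H1 where "H1 \<equiv> free_product K Ae TX"
abbreviation H2 where "H2 \<equiv> free_product K H1 (tensor_algebra K XW)"

definition H_free where "H_free = free_product K H2 (tensor_algebra K WX)"

definition H_iab where
  "H_iab a a' = free_inl K H2 (tensor_algebra K WX)
    (free_inl K H1 (tensor_algebra K XW) (free_inl K Ae TX (ae a a')))"

definition H_ia where "H_ia a = H_iab a \<one>\<^bsub>A\<^esub>"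

definition H_ib where "H_ib a = H_iab \<one>\<^bsub>A\<^esub> a"

definition H_ix where
  "H_ix u = free_inl K H2 (tensor_algebra K WX)
    (free_inl K H1 (tensor_algebra K XW) (free_inr K Ae TX (tensor_incl K X u)))"

definition H_ixw where
  "H_ixw u w = free_inl K H2 (tensor_algebra K WX)
    (free_inr K H1 (tensor_algebra K XW) (tensor_incl K XW (tensor_elem K X \<Omega> u w)))"

definition H_iwx where
  "H_iwx w u = free_inr K H2 (tensor_algebra K WX) (tensor_incl K WX (tensor_elem K \<Omega> X w u))"

definition H_relations where
  "H_relations p \<omega> x q y \<rho> = (let F = H_free in
    {(H_ia a \<otimes>\<^bsub>F\<^esub> H_ix u, H_ix (a \<triangleright>\<^bsub>X\<^esub> u)) | a u. a \<in> carrier A \<and> u \<in> carrier X} \<union>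
    {(H_ix u \<otimes>\<^bsub>F\<^esub> H_ia a, H_ix (u \<triangleleft>\<^bsub>X\<^esub> a) \<oplus>\<^bsub>F\<^esub> H_ia (ev_pair u (d a))) | a u.
       a \<in> carrier A \<and> u \<in> carrier X} \<union>
    {(H_ix u \<otimes>\<^bsub>F\<^esub> H_ib a, H_ib a \<otimes>\<^bsub>F\<^esub> H_ix u \<oplus>\<^bsub>F\<^esub> H_ixw u (d a)) | a u.
       a \<in> carrier A \<and> u \<in> carrier X} \<union>
    {(H_iab a a' \<otimes>\<^bsub>F\<^esub> H_ixw u w \<otimes>\<^bsub>F\<^esub> H_iab b b',
      H_ixw ((a \<triangleright>\<^bsub>X\<^esub> u) \<triangleleft>\<^bsub>X\<^esub> b) ((b' \<triangleright>\<^bsub>\<Omega>\<^esub> w) \<triangleleft>\<^bsub>\<Omega>\<^esub> a')) | a a' b b' u w.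
       a \<in> carrier A \<and> a' \<in> carrier A \<and> b \<in> carrier A \<and> b' \<in> carrier A \<and>
       u \<in> carrier X \<and> w \<in> carrier \<Omega>} \<union>
    {(H_iab a a' \<otimes>\<^bsub>F\<^esub> H_iwx w u \<otimes>\<^bsub>F\<^esub> H_iab b b',
      H_iwx ((a \<triangleright>\<^bsub>\<Omega>\<^esub> w) \<triangleleft>\<^bsub>\<Omega>\<^esub> b) ((b' \<triangleright>\<^bsub>X\<^esub> u) \<triangleleft>\<^bsub>X\<^esub> a')) | a a' b b' u w.
       a \<in> carrier A \<and> a' \<in> carrier A \<and> b \<in> carrier A \<and> b' \<in> carrier A \<and>
       u \<in> carrier X \<and> w \<in> carrier \<Omega>} \<union>
    {(\<Oplus>\<^bsub>F\<^esub>i \<in> {..<p}. H_iwx (\<omega> i) u \<otimes>\<^bsub>F\<^esub> H_ixw (x i) w, H_ib (uev_pair w u)) | u w.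
       u \<in> carrier X \<and> w \<in> carrier \<Omega>} \<union>
    {(\<Oplus>\<^bsub>F\<^esub>j \<in> {..<q}. H_ixw u (\<rho> j) \<otimes>\<^bsub>F\<^esub> H_iwx w (y j), H_ia (ev_pair u w)) | u w.
       u \<in> carrier X \<and> w \<in> carrier \<Omega>} \<union>
    {(\<Oplus>\<^bsub>F\<^esub>j \<in> {..<q}. H_ixw (y j) w \<otimes>\<^bsub>F\<^esub> H_iwx (\<rho> j) u, H_ib (ev_pair u w)) | u w.
       u \<in> carrier X \<and> w \<in> carrier \<Omega>} \<union>
    {(\<Oplus>\<^bsub>F\<^esub>i \<in> {..<p}. H_iwx w (x i) \<otimes>\<^bsub>F\<^esub> H_ixw u (\<omega> i), H_ia (uev_pair w u)) | u w.
       u \<in> carrier X \<and> w \<in> carrier \<Omega>})"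

definition HX where "HX p \<omega> x q y \<rho> = impose H_free (H_relations p \<omega> x q y \<rho>)"

subsection \<open>The algebra IBX and its quotient\<close>

text \<open>
  The second tensor algebra \<^term>\<open>TX\<close> is the one of the second copy of \<^term>\<open>X\<close>; its generators
  \<open>B_iy u\<close> stand for the barred \<open>u\<close>.
\<close>

abbreviation B1 where "B1 \<equiv> free_product K Ae TX"

definition B_free where "B_free = free_product K B1 TX"

definition B_iab where "B_iab a a' = free_inl K B1 TX (free_inl K Ae TX (ae a a'))"

definition B_ia where "B_ia a = B_iab a \<one>\<^bsub>A\<^esub>"

definition B_ib where "B_ib a = B_iab \<one>\<^bsub>A\<^esub> a"

definition B_ix where "B_ix u = free_inl K B1 TX (free_inr K Ae TX (tensor_incl K X u))"

definition B_iy where "B_iy u = free_inr K B1 TX (tensor_incl K X u)"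

text \<open>
  Finite families \<open>(r m, s m)\<close>, \<open>m < N\<close>, representing an element \<open>\<Sum>m. r m \<otimes> s m\<close> of the tensor
  square of \<open>A\<close> with \<open>\<Sum>m. r m s m = 0\<close> and \<open>\<Sum>m. r m d (s m) = 0\<close>.
\<close>

definition null_family :: "nat \<Rightarrow> (nat \<Rightarrow> 'a) \<Rightarrow> (nat \<Rightarrow> 'a) \<Rightarrow> bool"
  where "null_family N r s \<longleftrightarrow>
    r \<in> {..<N} \<rightarrow> carrier A \<and> s \<in> {..<N} \<rightarrow> carrier A \<and>
    (\<Oplus>\<^bsub>A\<^esub>m \<in> {..<N}. r m \<otimes>\<^bsub>A\<^esub> s m) = \<zero>\<^bsub>A\<^esub> \<and>
    (\<Oplus>\<^bsub>\<Omega>\<^esub>m \<in> {..<N}. r m \<triangleright>\<^bsub>\<Omega>\<^esub> d (s m)) = \<zero>\<^bsub>\<Omega>\<^esub>"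

definition IB_relations where
  "IB_relations p b x q y c = (let F = B_free in
    {(B_ia a \<otimes>\<^bsub>F\<^esub> B_ix u, B_ix (a \<triangleright>\<^bsub>X\<^esub> u)) | a u. a \<in> carrier A \<and> u \<in> carrier X} \<union>
    {(B_ix u \<otimes>\<^bsub>F\<^esub> B_ia a, B_ix (u \<triangleleft>\<^bsub>X\<^esub> a) \<oplus>\<^bsub>F\<^esub> B_ia (ev_pair u (d a))) | a u.
       a \<in> carrier A \<and> u \<in> carrier X} \<union>
    {(B_ib a \<otimes>\<^bsub>F\<^esub> B_iy u, B_iy (u \<triangleleft>\<^bsub>X\<^esub> a)) | a u. a \<in> carrier A \<and> u \<in> carrier X} \<union>
    {(B_iy u \<otimes>\<^bsub>F\<^esub> B_ib a, B_iy (a \<triangleright>\<^bsub>X\<^esub> u) \<oplus>\<^bsub>F\<^esub> B_ib (uev_pair (d a) u)) | a u.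
       a \<in> carrier A \<and> u \<in> carrier X} \<union>
    {(\<Oplus>\<^bsub>F\<^esub>m \<in> {..<N}. B_ib (s m) \<otimes>\<^bsub>F\<^esub> B_ix u \<otimes>\<^bsub>F\<^esub> B_ib (r m), \<zero>\<^bsub>F\<^esub>) | N r s u.
       null_family N r s \<and> u \<in> carrier X} \<union>
    {(\<Oplus>\<^bsub>F\<^esub>m \<in> {..<N}. B_ia (r m) \<otimes>\<^bsub>F\<^esub> B_iy u \<otimes>\<^bsub>F\<^esub> B_ia (s m), \<zero>\<^bsub>F\<^esub>) | N r s u.
       null_family N r s \<and> u \<in> carrier X} \<union>
    {(\<Oplus>\<^bsub>F\<^esub>i \<in> {..<p}. commutator F (B_iy u) (B_ia (b i)) \<otimes>\<^bsub>F\<^esub> B_ix (x i), B_iy u) | u.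
       u \<in> carrier X} \<union>
    {(\<Oplus>\<^bsub>F\<^esub>j \<in> {..<q}. commutator F (B_ix u) (B_ib (c j)) \<otimes>\<^bsub>F\<^esub> B_iy (y j), B_ix u) | u.
       u \<in> carrier X})"

definition IBX where "IBX p b x q y c = impose B_free (IB_relations p b x q y c)"

definition IBX_extra_relations where
  "IBX_extra_relations p b x q y c =
    (let B = IBX p b x q y c;
         cls = impose_class B_free (IB_relations p b x q y c);
         ia = (\<lambda>a. cls (B_ia a)); ib = (\<lambda>a. cls (B_ib a));
         ix = (\<lambda>u. cls (B_ix u)); iy = (\<lambda>u. cls (B_iy u))
     in
      {(\<Oplus>\<^bsub>B\<^esub>j \<in> {..<q}. commutator B (ix (y j)) (ib a) \<otimes>\<^bsub>B\<^esub> commutator B (iy u) (ia (c j)),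
        ib (ev_pair u (d a))) | a u. a \<in> carrier A \<and> u \<in> carrier X} \<union>
      {(\<Oplus>\<^bsub>B\<^esub>i \<in> {..<p}. commutator B (iy (x i)) (ia a) \<otimes>\<^bsub>B\<^esub> commutator B (ix u) (ib (b i)),
        ia (uev_pair (d a) u)) | a u. a \<in> carrier A \<and> u \<in> carrier X})"

definition IBX_quotient where
  "IBX_quotient p b x q y c = impose (IBX p b x q y c) (IBX_extra_relations p b x q y c)"

end

end

theory Submission
  imports Defs
begin

text \<open>
  Both algebras are given by generators and relations, so a homomorphism from either of them to
  an algebra \<open>D\<close> is the same as images of the generators in \<open>D\<close> that satisfy the relations. The
  theorem holds because the two kinds of images determine each other. Write \<open>ia a\<close>, \<open>ib a\<close>,
  \<open>ix u\<close> for the images of \<open>a\<close>, \<open>bar a\<close>, \<open>u\<close>, which are common to both; one side has in addition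
  the images \<open>ixw u w\<close> and \<open>iwx w u\<close> of the pairs, the other the image \<open>iy u\<close> of the barred \<open>u\<close>.

  Given the pairs, put \<open>iy u = \<Sum>i. iwx (d (b i)) u \<cdot> ix (x i)\<close>. Since \<open>\<Sum>i. d (b i) \<otimes> x i\<close>
  commutes with \<open>A\<close>, moving \<open>ia a\<close> through this sum leaves only the terms \<open>ia (ev (x i \<otimes> da))\<close>
  from the relations for \<open>ix (x i) \<cdot> ia a\<close>, and the zig-zag identity turns their contribution
  into \<open>[iy u, ia a] = iwx (d a) u\<close>; the relation for \<open>ix u \<cdot> ib a\<close> says
  \<open>[ix u, ib a] = ixw u (d a)\<close>. So both kinds of pairs are commutators on exact forms. With
  this, each of the four sum relations between pairs has its counterpart: \<open>sum_iwx_ixw\<close> gives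
  the relation for \<open>iy u \<cdot> ib a\<close>, \<open>sum_ixw_iwx\<close> the one recovering \<open>ix u\<close>, and \<open>sum_ixw_iwx'\<close>
  and \<open>sum_iwx_ixw'\<close> at \<open>w = d a\<close> are the two additional relations (\<open>H_rep_imp_B_rep\<close>).

  Conversely these commutators dictate \<open>iwx (a db) u = ia a \<cdot> [iy u, ia b]\<close> and
  \<open>ixw u ((da) b) = ib b \<cdot> [ix u, ib a]\<close>. As the calculus is surjective this prescribes the
  pairs completely, and the relations for sums \<open>\<Sum> r \<otimes> s\<close> with \<open>\<Sum> r s = 0\<close> and \<open>\<Sum> r ds = 0\<close> say
  exactly that it is consistent (\<open>iwx_exists\<close>, \<open>ixw_exists\<close>). The Leibniz rule for commutators
  then gives the actions of \<open>A\<close> and its opposite on the pairs; \<open>sum_iwx_ixw\<close> and \<open>sum_ixw_iwx\<close>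
  result from multiplying the relations that recover \<open>iy u\<close> and \<open>ix u\<close> from the right by \<open>ib s\<close>
  and \<open>ia s\<close>, and \<open>sum_ixw_iwx'\<close> and \<open>sum_iwx_ixw'\<close> from the additional relations
  (\<open>B_rep_imp_H_rep\<close>).

  The universal properties \<open>HA_lift\<close> and \<open>BQ_lift\<close> of the two algebras turn the two translations
  into homomorphisms in both directions. Each composite fixes a generating set, hence is the
  identity (\<open>HA_isomorphic_BQ\<close>). Both universal properties and the generating sets are assembled
  from those of the constructions involved: quotients, monoid algebras, tensor products, tensor
  algebras and free products.
\<close>

section \<open>Linear maps and quotients of modules\<close>

lemma linear_mapsI:
  assumes "\<And>m. m \<in> carrier M \<Longrightarrow> h m \<in> carrier N"
    and "\<And>m m'. \<lbrakk>m \<in> carrier M; m' \<in> carrier M\<rbrakk> \<Longrightarrow> h (m \<oplus>\<^bsub>M\<^esub> m') = h m \<oplus>\<^bsub>N\<^esub> h m'"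
    and "\<And>k m. \<lbrakk>k \<in> carrier K; m \<in> carrier M\<rbrakk> \<Longrightarrow> h (k \<odot>\<^bsub>M\<^esub> m) = k \<odot>\<^bsub>N\<^esub> h m"
  shows "h \<in> linear_maps K M N"
  using assms unfolding linear_maps_def by auto

lemma linear_maps_closed: "\<lbrakk>h \<in> linear_maps K M N; m \<in> carrier M\<rbrakk> \<Longrightarrow> h m \<in> carrier N"
  unfolding linear_maps_def by auto

lemma linear_maps_add:
  "\<lbrakk>h \<in> linear_maps K M N; m \<in> carrier M; m' \<in> carrier M\<rbrakk> \<Longrightarrow> h (m \<oplus>\<^bsub>M\<^esub> m') = h m \<oplus>\<^bsub>N\<^esub> h m'"
  unfolding linear_maps_def by auto

lemma linear_maps_smult:
  "\<lbrakk>h \<in> linear_maps K M N; k \<in> carrier K; m \<in> carrier M\<rbrakk> \<Longrightarrow> h (k \<odot>\<^bsub>M\<^esub> m) = k \<odot>\<^bsub>N\<^esub> h m"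
  unfolding linear_maps_def by auto

lemma linear_maps_comp:
  "\<lbrakk>f \<in> linear_maps K M N; g \<in> linear_maps K N P\<rbrakk> \<Longrightarrow> (\<lambda>m. g (f m)) \<in> linear_maps K M P"
  unfolding linear_maps_def by (auto simp: Pi_iff)

lemma linear_maps_zero:
  assumes "module K M" "module K N" "h \<in> linear_maps K M N"
  shows "h \<zero>\<^bsub>M\<^esub> = \<zero>\<^bsub>N\<^esub>"
proof -
  interpret M: module K M by fact
  interpret N: module K N by fact
  have "h \<zero>\<^bsub>M\<^esub> = h (\<zero>\<^bsub>K\<^esub> \<odot>\<^bsub>M\<^esub> \<zero>\<^bsub>M\<^esub>)" by simp
  also have "\<dots> = \<zero>\<^bsub>K\<^esub> \<odot>\<^bsub>N\<^esub> h \<zero>\<^bsub>M\<^esub>" by (rule linear_maps_smult[OF assms(3)]) auto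
  also have "\<dots> = \<zero>\<^bsub>N\<^esub>" by (simp add: linear_maps_closed[OF assms(3)])
  finally show ?thesis .
qed

lemma linear_maps_uminus:
  assumes "module K M" "module K N" "h \<in> linear_maps K M N" "m \<in> carrier M"
  shows "h (\<ominus>\<^bsub>M\<^esub> m) = \<ominus>\<^bsub>N\<^esub> h m"
proof -
  interpret M: module K M by fact
  interpret N: module K N by fact
  have "h (\<ominus>\<^bsub>M\<^esub> m) \<oplus>\<^bsub>N\<^esub> h m = h \<zero>\<^bsub>M\<^esub>"
    using assms(4) by (simp add: linear_maps_add[OF assms(3), symmetric] M.M.l_neg)
  then show ?thesis
    using assms(4) linear_maps_zero[OF assms(1-3)]
    by (intro N.M.minus_equality[symmetric]) (auto intro: linear_maps_closed[OF assms(3)])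
qed

lemma linear_maps_minus:
  assumes "module K M" "module K N" "h \<in> linear_maps K M N" "m \<in> carrier M" "m' \<in> carrier M"
  shows "h (m \<ominus>\<^bsub>M\<^esub> m') = h m \<ominus>\<^bsub>N\<^esub> h m'"
proof -
  interpret M: module K M by fact
  show ?thesis
    using assms(4,5) unfolding a_minus_def
    by (simp add: linear_maps_add[OF assms(3)] linear_maps_uminus[OF assms(1-3)])
qed

lemma linear_maps_finsum:
  assumes "module K M" "module K N" "h \<in> linear_maps K M N" "finite I" "f \<in> I \<rightarrow> carrier M"
  shows "h (\<Oplus>\<^bsub>M\<^esub>i\<in>I. f i) = (\<Oplus>\<^bsub>N\<^esub>i\<in>I. h (f i))"
proof -
  interpret M: module K M by fact
  interpret N: module K N by fact
  show ?thesis
    using assms(4,5)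
  proof (induction rule: finite_induct)
    case empty
    show ?case using linear_maps_zero[OF assms(1-3)] by simp
  next
    case (insert i I)
    then have f: "f \<in> I \<rightarrow> carrier M" "f i \<in> carrier M" by auto
    then have hf: "(\<lambda>i. h (f i)) \<in> I \<rightarrow> carrier N" "h (f i) \<in> carrier N"
      by (auto intro: linear_maps_closed[OF assms(3)])
    show ?case
      using insert f hf by (simp add: linear_maps_add[OF assms(3)])
  qed
qed

lemma linear_right_minus_eq:
  assumes "module K M" "a \<in> carrier M" "b \<in> carrier M" "a \<ominus>\<^bsub>M\<^esub> b = \<zero>\<^bsub>M\<^esub>"
  shows "a = b"
proof -
  interpret M: module K M by fact
  have "a = (a \<ominus>\<^bsub>M\<^esub> b) \<oplus>\<^bsub>M\<^esub> b"
    using assms(2,3) by (simp add: a_minus_def M.M.a_assoc M.M.l_neg)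
  then show ?thesis using assms(3,4) by simp
qed

lemma module_minus_self:
  assumes "module K M" "a \<in> carrier M"
  shows "a \<ominus>\<^bsub>M\<^esub> a = \<zero>\<^bsub>M\<^esub>"
proof -
  interpret M: module K M by fact
  show ?thesis unfolding a_minus_def using assms(2) by (rule M.M.r_neg)
qed

text \<open>
  A linear map that vanishes on the kernel of a surjective one factors through it.  This serves
  both for quotient maps and for the definition of maps on the span of a family.
\<close>

lemma linear_map_factors:
  assumes M: "module K M" and V: "module K V" and W: "module K W"
    and \<pi>: "\<pi> \<in> linear_maps K M V" and surj: "\<pi> ` carrier M = carrier V"
    and \<psi>: "\<psi> \<in> linear_maps K M W"
    and ker: "\<And>m. \<lbrakk>m \<in> carrier M; \<pi> m = \<zero>\<^bsub>V\<^esub>\<rbrakk> \<Longrightarrow> \<psi> m = \<zero>\<^bsub>W\<^esub>"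
  shows "\<exists>h \<in> linear_maps K V W. \<forall>m \<in> carrier M. h (\<pi> m) = \<psi> m"
proof -
  interpret M: module K M by fact
  interpret V: module K V by fact
  interpret W: module K W by fact
  define h where "h v = \<psi> (SOME m. m \<in> carrier M \<and> \<pi> m = v)" for v
  have eq: "\<psi> m = \<psi> m'" if "m \<in> carrier M" "m' \<in> carrier M" "\<pi> m = \<pi> m'" for m m'
  proof -
    have c: "\<pi> m' \<in> carrier V" "\<psi> m \<in> carrier W" "\<psi> m' \<in> carrier W"
      using that linear_maps_closed[OF \<pi>] linear_maps_closed[OF \<psi>] by auto
    have "\<pi> (m \<ominus>\<^bsub>M\<^esub> m') = \<zero>\<^bsub>V\<^esub>"
      using that c by (simp add: linear_maps_minus[OF M V \<pi>]) (simp add: a_minus_def V.M.r_neg)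
    then have "\<psi> m \<ominus>\<^bsub>W\<^esub> \<psi> m' = \<zero>\<^bsub>W\<^esub>"
      using ker[of "m \<ominus>\<^bsub>M\<^esub> m'"] that by (simp add: linear_maps_minus[OF M W \<psi>])
    then show ?thesis using c linear_right_minus_eq[OF W] by blast
  qed
  have h: "h (\<pi> m) = \<psi> m" if "m \<in> carrier M" for m
    unfolding h_def
  proof (rule someI2[of _ m])
    show "m \<in> carrier M \<and> \<pi> m = \<pi> m" using that by simp
    show "\<psi> m' = \<psi> m" if m': "m' \<in> carrier M \<and> \<pi> m' = \<pi> m" for m'
      by (rule eq) (use m' \<open>m \<in> carrier M\<close> in simp_all)
  qed
  have "h \<in> linear_maps K V W"
  proof (rule linear_mapsI)
    show "h v \<in> carrier W" if "v \<in> carrier V" for v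
      using that h linear_maps_closed[OF \<psi>] unfolding surj[symmetric] by auto
    show "h (v \<oplus>\<^bsub>V\<^esub> v') = h v \<oplus>\<^bsub>W\<^esub> h v'" if v: "v \<in> carrier V" "v' \<in> carrier V" for v v'
    proof -
      obtain m m' where m: "m \<in> carrier M" "m' \<in> carrier M" "v = \<pi> m" "v' = \<pi> m'"
        using v surj by blast
      then show ?thesis
        using h[of "m \<oplus>\<^bsub>M\<^esub> m'"] h by (simp add: linear_maps_add[OF \<pi>] linear_maps_add[OF \<psi>])
    qed
    show "h (k \<odot>\<^bsub>V\<^esub> v) = k \<odot>\<^bsub>W\<^esub> h v" if k: "k \<in> carrier K" "v \<in> carrier V" for k v
    proof -
      obtain m where m: "m \<in> carrier M" "v = \<pi> m"
        using k surj by blast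
      then show ?thesis
        using h[of "k \<odot>\<^bsub>M\<^esub> m"] h k by (simp add: linear_maps_smult[OF \<pi>] linear_maps_smult[OF \<psi>])
    qed
  qed
  with h show ?thesis by blast
qed

lemma submodule_zero: "submodule N K M \<Longrightarrow> \<zero>\<^bsub>M\<^esub> \<in> N"
  using subgroup.one_closed[OF submodule.axioms(1)] by simp

lemma submodule_vimage:
  assumes "module K M" "module K V" "f \<in> linear_maps K M V" "submodule N K V"
  shows "submodule {m \<in> carrier M. f m \<in> N} K M"
proof -
  interpret M: module K M by fact
  interpret V: module K V by fact
  note N = V.submoduleE[OF assms(4)]
  show ?thesis
    using N(3-5) linear_maps_zero[OF assms(1-3)] submodule_zero[OF assms(4)]
    by (intro M.submoduleI)
       (auto simp: linear_maps_uminus[OF assms(1-3)] linear_maps_add[OF assms(3)]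
          linear_maps_smult[OF assms(3)])
qed

lemma submodule_lin_span:
  assumes "module K M" "S \<subseteq> carrier M"
  shows "submodule (lin_span K M S) K M"
proof -
  interpret M: module K M by fact
  have ex: "submodule (carrier M) K M" by (rule M.carrier_is_submodule)
  show ?thesis
    unfolding lin_span_def
  proof (rule M.submoduleI, goal_cases)
    case 1
    show ?case using ex assms(2) by blast
  next
    case 2
    show ?case by (blast intro: submodule_zero)
  next
    case (3 a)
    then show ?case using M.submoduleE(3) by blast
  next
    case (4 a b)
    then show ?case using M.submoduleE(5) by blast
  next
    case (5 a x)
    then show ?case using M.submoduleE(4) by blast
  qed
qed

lemma lin_span_superset: "S \<subseteq> lin_span K M S"
  unfolding lin_span_def by blast

lemma lin_span_minimal: "\<lbrakk>submodule N K M; S \<subseteq> N\<rbrakk> \<Longrightarrow> lin_span K M S \<subseteq> N"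
  unfolding lin_span_def by blast

lemma quotient_module_simps:
  "carrier (quotient_module M N) = (\<lambda>x. N +>\<^bsub>M\<^esub> x) ` carrier M"
  "\<zero>\<^bsub>quotient_module M N\<^esub> = N"
  "\<one>\<^bsub>quotient_module M N\<^esub> = N +>\<^bsub>M\<^esub> \<one>\<^bsub>M\<^esub>"
  "x \<oplus>\<^bsub>quotient_module M N\<^esub> y = x <+>\<^bsub>M\<^esub> y"
  "x \<otimes>\<^bsub>quotient_module M N\<^esub> y = rcoset_mult M N x y"
  "k \<odot>\<^bsub>quotient_module M N\<^esub> x = (\<Union>x \<in> x. N +>\<^bsub>M\<^esub> (k \<odot>\<^bsub>M\<^esub> x))"
  by (simp_all add: quotient_module_def ring.defs module.defs FactRing_def A_RCOSETS_def RCOSETS_def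
        a_r_coset_def UNION_singleton_eq_range)

locale module_quotient = module K M + submodule N K M for K (structure) and M (structure) and N
begin

abbreviation Q where "Q \<equiv> quotient_module M N"
abbreviation cls where "cls x \<equiv> N +>\<^bsub>M\<^esub> x"

sublocale abelian_subgroup N M
  by (rule abelian_subgroupI3) (rule additive_subgroup.intro subgroup_axioms abelian_group_axioms)+

lemma cls_eq_iff:
  assumes "x \<in> carrier M" "y \<in> carrier M"
  shows "cls x = cls y \<longleftrightarrow> x \<ominus>\<^bsub>M\<^esub> y \<in> N"
proof
  assume "cls x = cls y"
  then have "x \<in> cls y" using a_rcos_self[of x] assms by simp
  then show "x \<ominus>\<^bsub>M\<^esub> y \<in> N" using a_rcos_module[of y x] assms by (simp add: a_minus_def)
next
  assume "x \<ominus>\<^bsub>M\<^esub> y \<in> N"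
  then have "x \<in> cls y" using a_rcos_module[of y x] assms by (simp add: a_minus_def)
  then show "cls x = cls y" using a_repr_independence' assms by metis
qed

lemma cls_zero: "cls \<zero>\<^bsub>M\<^esub> = N"
  by (rule a_rcos_const) (rule submodule_zero[OF submodule_axioms])

lemma cls_add:
  "\<lbrakk>x \<in> carrier M; y \<in> carrier M\<rbrakk> \<Longrightarrow> cls x \<oplus>\<^bsub>Q\<^esub> cls y = cls (x \<oplus>\<^bsub>M\<^esub> y)"
  using normal.rcos_sum[OF a_normal] by (simp add: quotient_module_simps set_add_def a_r_coset_def)

lemma cls_smult:
  assumes "k \<in> carrier K" "x \<in> carrier M"
  shows "k \<odot>\<^bsub>Q\<^esub> cls x = cls (k \<odot>\<^bsub>M\<^esub> x)"
proof -
  have "cls (k \<odot>\<^bsub>M\<^esub> x') = cls (k \<odot>\<^bsub>M\<^esub> x)" if "x' \<in> cls x" for x'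
  proof -
    have x': "x' \<in> carrier M" "x' \<ominus>\<^bsub>M\<^esub> x \<in> N"
      using that assms a_elemrcos_carrier a_rcos_module_imp by (auto simp: a_minus_def)
    then have "k \<odot>\<^bsub>M\<^esub> (x' \<ominus>\<^bsub>M\<^esub> x) \<in> N" using assms by auto
    also have "k \<odot>\<^bsub>M\<^esub> (x' \<ominus>\<^bsub>M\<^esub> x) = k \<odot>\<^bsub>M\<^esub> x' \<ominus>\<^bsub>M\<^esub> k \<odot>\<^bsub>M\<^esub> x"
      using assms x' by (simp add: a_minus_def smult_r_distr smult_r_minus)
    finally show ?thesis using assms x' by (simp add: cls_eq_iff)
  qed
  moreover have "x \<in> cls x" using assms by (simp add: a_rcos_self)
  ultimately show ?thesis unfolding quotient_module_simps(6) by blast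
qed

lemma carrier_Q: "carrier Q = cls ` carrier M"
  by (rule quotient_module_simps)

lemma quotient_module: "module K Q"
proof (rule moduleI)
  show "cring K" ..
  have z: "\<zero>\<^bsub>Q\<^esub> = cls \<zero>\<^bsub>M\<^esub>" by (simp add: quotient_module_simps(2) cls_zero)
  show "abelian_group Q"
  proof (rule abelian_groupI)
    show "\<zero>\<^bsub>Q\<^esub> \<in> carrier Q" unfolding z carrier_Q by simp
    show "x \<oplus>\<^bsub>Q\<^esub> y \<in> carrier Q" if "x \<in> carrier Q" "y \<in> carrier Q" for x y
      using that unfolding carrier_Q by (auto simp: cls_add)
    show "x \<oplus>\<^bsub>Q\<^esub> y \<oplus>\<^bsub>Q\<^esub> w = x \<oplus>\<^bsub>Q\<^esub> (y \<oplus>\<^bsub>Q\<^esub> w)"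
      if "x \<in> carrier Q" "y \<in> carrier Q" "w \<in> carrier Q" for x y w
      using that unfolding carrier_Q by (auto simp: cls_add M.a_assoc)
    show "x \<oplus>\<^bsub>Q\<^esub> y = y \<oplus>\<^bsub>Q\<^esub> x" if "x \<in> carrier Q" "y \<in> carrier Q" for x y
      using that unfolding carrier_Q by (auto simp: cls_add M.a_comm)
    show "\<zero>\<^bsub>Q\<^esub> \<oplus>\<^bsub>Q\<^esub> x = x" if "x \<in> carrier Q" for x
      using that unfolding carrier_Q z by (auto simp: cls_add simp del: cls_zero)
    show "\<exists>y\<in>carrier Q. y \<oplus>\<^bsub>Q\<^esub> x = \<zero>\<^bsub>Q\<^esub>" if "x \<in> carrier Q" for x
    proof -
      obtain u where "u \<in> carrier M" "x = cls u" using \<open>x \<in> carrier Q\<close> unfolding carrier_Q by blast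
      then show ?thesis
        unfolding carrier_Q z by (intro bexI[of _ "cls (\<ominus>\<^bsub>M\<^esub> u)"]) (auto simp: cls_add M.l_neg)
    qed
  qed
  show "k \<odot>\<^bsub>Q\<^esub> x \<in> carrier Q" if "k \<in> carrier K" "x \<in> carrier Q" for k x
    using that unfolding carrier_Q by (auto simp: cls_smult)
  show "(k \<oplus> l) \<odot>\<^bsub>Q\<^esub> x = k \<odot>\<^bsub>Q\<^esub> x \<oplus>\<^bsub>Q\<^esub> l \<odot>\<^bsub>Q\<^esub> x"
    if "k \<in> carrier K" "l \<in> carrier K" "x \<in> carrier Q" for k l x
    using that unfolding carrier_Q by (auto simp: cls_smult cls_add smult_l_distr)
  show "k \<odot>\<^bsub>Q\<^esub> (x \<oplus>\<^bsub>Q\<^esub> y) = k \<odot>\<^bsub>Q\<^esub> x \<oplus>\<^bsub>Q\<^esub> k \<odot>\<^bsub>Q\<^esub> y"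
    if "k \<in> carrier K" "x \<in> carrier Q" "y \<in> carrier Q" for k x y
    using that unfolding carrier_Q by (auto simp: cls_smult cls_add smult_r_distr)
  show "(k \<otimes> l) \<odot>\<^bsub>Q\<^esub> x = k \<odot>\<^bsub>Q\<^esub> (l \<odot>\<^bsub>Q\<^esub> x)"
    if "k \<in> carrier K" "l \<in> carrier K" "x \<in> carrier Q" for k l x
    using that unfolding carrier_Q by (auto simp: cls_smult smult_assoc1)
  show "\<one> \<odot>\<^bsub>Q\<^esub> x = x" if "x \<in> carrier Q" for x
    using that unfolding carrier_Q by (auto simp: cls_smult)
qed

lemma cls_linear: "cls \<in> linear_maps K M Q"
  by (rule linear_mapsI) (auto simp: quotient_module_simps(1) cls_add cls_smult)

lemma cls_closed: "x \<in> carrier M \<Longrightarrow> cls x \<in> carrier Q"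
  by (simp add: quotient_module_simps(1))

lemma cls_zero_iff:
  assumes "x \<in> carrier M"
  shows "cls x = \<zero>\<^bsub>Q\<^esub> \<longleftrightarrow> x \<in> N"
  using a_rcos_self[of x] a_rcos_const[of x] assms by (auto simp: quotient_module_simps(2))

lemma quotient_lift:
  assumes "module K P" "f \<in> linear_maps K M P" "\<And>x. x \<in> N \<Longrightarrow> f x = \<zero>\<^bsub>P\<^esub>"
  shows "\<exists>h \<in> linear_maps K Q P. \<forall>x \<in> carrier M. h (cls x) = f x"
  by (rule linear_map_factors[OF module_axioms quotient_module assms(1) cls_linear _ assms(2)])
     (auto simp: cls_zero_iff assms(3) quotient_module_simps(1))

end

section \<open>Algebra homomorphisms and generation\<close>

definition alg_hom ::
    "('k, 'r) ring_scheme \<Rightarrow> ('k, 'b, 's) module_scheme \<Rightarrow> ('k, 'c, 't) module_scheme \<Rightarrow> ('b \<Rightarrow> 'c) set"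
  where "alg_hom K B C =
    {h \<in> ring_hom B C. \<forall>k \<in> carrier K. \<forall>b \<in> carrier B. h (k \<odot>\<^bsub>B\<^esub> b) = k \<odot>\<^bsub>C\<^esub> h b}"

lemma alg_homI:
  assumes "h \<in> linear_maps K B C"
    and "\<And>a b. \<lbrakk>a \<in> carrier B; b \<in> carrier B\<rbrakk> \<Longrightarrow> h (a \<otimes>\<^bsub>B\<^esub> b) = h a \<otimes>\<^bsub>C\<^esub> h b"
    and "h \<one>\<^bsub>B\<^esub> = \<one>\<^bsub>C\<^esub>"
  shows "h \<in> alg_hom K B C"
  using assms unfolding alg_hom_def linear_maps_def ring_hom_def by auto

lemma alg_hom_linear: "h \<in> alg_hom K B C \<Longrightarrow> h \<in> linear_maps K B C"
  unfolding alg_hom_def linear_maps_def ring_hom_def by auto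

lemma alg_hom_closed: "\<lbrakk>h \<in> alg_hom K B C; a \<in> carrier B\<rbrakk> \<Longrightarrow> h a \<in> carrier C"
  unfolding alg_hom_def ring_hom_def by auto

lemma alg_hom_mult:
  "\<lbrakk>h \<in> alg_hom K B C; a \<in> carrier B; b \<in> carrier B\<rbrakk> \<Longrightarrow> h (a \<otimes>\<^bsub>B\<^esub> b) = h a \<otimes>\<^bsub>C\<^esub> h b"
  unfolding alg_hom_def ring_hom_def by auto

lemma alg_hom_one: "h \<in> alg_hom K B C \<Longrightarrow> h \<one>\<^bsub>B\<^esub> = \<one>\<^bsub>C\<^esub>"
  unfolding alg_hom_def ring_hom_def by auto

lemmas alg_hom_add = linear_maps_add[OF alg_hom_linear]
lemmas alg_hom_smult = linear_maps_smult[OF alg_hom_linear]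

lemma alg_hom_comp:
  "\<lbrakk>f \<in> alg_hom K B C; g \<in> alg_hom K C D\<rbrakk> \<Longrightarrow> (\<lambda>a. g (f a)) \<in> alg_hom K B D"
  unfolding alg_hom_def ring_hom_def by (auto simp: Pi_iff)

lemma K_algebra_module: "K_algebra K B \<Longrightarrow> module K B"
  unfolding K_algebra_def by simp

lemma K_algebra_ring: "K_algebra K B \<Longrightarrow> ring B"
  unfolding K_algebra_def by simp

lemma K_algebraI:
  assumes "field K" "module K B" "ring B"
    and "\<And>k a b. \<lbrakk>k \<in> carrier K; a \<in> carrier B; b \<in> carrier B\<rbrakk> \<Longrightarrow>
        (k \<odot>\<^bsub>B\<^esub> a) \<otimes>\<^bsub>B\<^esub> b = k \<odot>\<^bsub>B\<^esub> (a \<otimes>\<^bsub>B\<^esub> b)"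
    and "\<And>k a b. \<lbrakk>k \<in> carrier K; a \<in> carrier B; b \<in> carrier B\<rbrakk> \<Longrightarrow>
        a \<otimes>\<^bsub>B\<^esub> (k \<odot>\<^bsub>B\<^esub> b) = k \<odot>\<^bsub>B\<^esub> (a \<otimes>\<^bsub>B\<^esub> b)"
  shows "K_algebra K B"
  using assms by (intro K_algebra.intro K_algebra_axioms.intro)

lemmas alg_hom_minus =
  linear_maps_minus[OF K_algebra_module K_algebra_module alg_hom_linear]
lemmas alg_hom_zero =
  linear_maps_zero[OF K_algebra_module K_algebra_module alg_hom_linear]
lemmas alg_hom_finsum =
  linear_maps_finsum[OF K_algebra_module K_algebra_module alg_hom_linear]

lemma alg_hom_commutator:
  assumes "K_algebra K B" "K_algebra K C" "h \<in> alg_hom K B C" "a \<in> carrier B" "b \<in> carrier B"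
  shows "h (commutator B a b) = commutator C (h a) (h b)"
proof -
  interpret B: K_algebra K B by fact
  show ?thesis
    unfolding commutator_def using assms(4,5)
    by (simp add: alg_hom_minus[OF assms(1-3)] alg_hom_mult[OF assms(3)])
qed

text \<open>
  The subalgebra generated by \<open>S\<close>, written inductively so that the agreement of two
  homomorphisms propagates from \<open>S\<close> by rule induction.
\<close>

inductive_set alg_span :: "('k, 'r) ring_scheme \<Rightarrow> ('k, 'b, 's) module_scheme \<Rightarrow> 'b set \<Rightarrow> 'b set"
  for K and B and S
  where
    gen: "s \<in> S \<Longrightarrow> s \<in> alg_span K B S"
  | one: "\<one>\<^bsub>B\<^esub> \<in> alg_span K B S"
  | add: "\<lbrakk>a \<in> alg_span K B S; b \<in> alg_span K B S\<rbrakk> \<Longrightarrow> a \<oplus>\<^bsub>B\<^esub> b \<in> alg_span K B S"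
  | mult: "\<lbrakk>a \<in> alg_span K B S; b \<in> alg_span K B S\<rbrakk> \<Longrightarrow> a \<otimes>\<^bsub>B\<^esub> b \<in> alg_span K B S"
  | smult: "\<lbrakk>k \<in> carrier K; a \<in> alg_span K B S\<rbrakk> \<Longrightarrow> k \<odot>\<^bsub>B\<^esub> a \<in> alg_span K B S"

definition generates ::
    "('k, 'r) ring_scheme \<Rightarrow> ('k, 'b, 's) module_scheme \<Rightarrow> 'b set \<Rightarrow> bool"
  where "generates K B S \<longleftrightarrow> S \<subseteq> carrier B \<and> carrier B \<subseteq> alg_span K B S"

lemma alg_span_closed:
  assumes "K_algebra K B" "S \<subseteq> carrier B" "a \<in> alg_span K B S"
  shows "a \<in> carrier B"
proof -
  interpret B: K_algebra K B by fact
  show ?thesis using assms(3) by induction (use assms(2) in auto)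
qed

lemma alg_span_subset:
  assumes "S \<subseteq> alg_span K B T"
  shows "alg_span K B S \<subseteq> alg_span K B T"
proof
  fix a assume "a \<in> alg_span K B S"
  then show "a \<in> alg_span K B T"
    by induction (use assms in \<open>auto intro: alg_span.intros\<close>)
qed

lemma alg_hom_image_span:
  assumes "K_algebra K B" "h \<in> alg_hom K B C" "S \<subseteq> carrier B" "a \<in> alg_span K B S"
  shows "h a \<in> alg_span K C (h ` S)"
  using assms(4)
proof induction
  case (gen s)
  then show ?case by (auto intro: alg_span.gen)
next
  case one
  then show ?case by (auto simp: alg_hom_one[OF assms(2)] intro: alg_span.one)
next
  case (add a b)
  then show ?case
    using alg_span_closed[OF assms(1,3)] by (auto simp: alg_hom_add[OF assms(2)] intro: alg_span.add)
next
  case (mult a b)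
  then show ?case
    using alg_span_closed[OF assms(1,3)] by (auto simp: alg_hom_mult[OF assms(2)] intro: alg_span.mult)
next
  case (smult k a)
  then show ?case
    using alg_span_closed[OF assms(1,3)] by (auto simp: alg_hom_smult[OF assms(2)] intro: alg_span.smult)
qed

lemma generates_image:
  assumes "K_algebra K B" "h \<in> alg_hom K B C" "h ` carrier B = carrier C" "generates K B S"
  shows "generates K C (h ` S)"
proof -
  have S: "S \<subseteq> carrier B" "carrier B \<subseteq> alg_span K B S"
    using assms(4) unfolding generates_def by auto
  have "h ` carrier B \<subseteq> alg_span K C (h ` S)"
    using alg_hom_image_span[OF assms(1,2) S(1)] S(2) by auto
  then show ?thesis
    using S(1) assms(3) unfolding generates_def by auto
qed

lemma generates_trans:
  assumes "generates K B S" "S \<subseteq> alg_span K B T" "T \<subseteq> carrier B"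
  shows "generates K B T"
  using assms alg_span_subset[OF assms(2)] unfolding generates_def by auto

lemma alg_hom_eqI:
  assumes "K_algebra K B" "generates K B S" "f \<in> alg_hom K B C" "g \<in> alg_hom K B C"
    and "\<And>s. s \<in> S \<Longrightarrow> f s = g s" and "a \<in> carrier B"
  shows "f a = g a"
proof -
  have S: "S \<subseteq> carrier B" using assms(2) unfolding generates_def by blast
  note cl = alg_span_closed[OF assms(1) S]
  have "a \<in> alg_span K B S" using assms(2,6) unfolding generates_def by blast
  then show ?thesis
  proof induction
    case (gen s)
    then show ?case by (rule assms(5))
  next
    case one
    then show ?case by (simp add: alg_hom_one[OF assms(3)] alg_hom_one[OF assms(4)])
  next
    case (add a b)
    then show ?case by (simp add: cl alg_hom_add[OF assms(3)] alg_hom_add[OF assms(4)])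
  next
    case (mult a b)
    then show ?case by (simp add: cl alg_hom_mult[OF assms(3)] alg_hom_mult[OF assms(4)])
  next
    case (smult k a)
    then show ?case by (simp add: cl alg_hom_smult[OF assms(3)] alg_hom_smult[OF assms(4)])
  qed
qed

text \<open>
  Both composites are homomorphisms that agree with the identity on generators, so the two maps
  are mutually inverse.
\<close>

lemma algebra_isomorphicI:
  assumes "K_algebra K B" "K_algebra K C" "generates K B S" "generates K C T"
    and f: "f \<in> alg_hom K B C" and g: "g \<in> alg_hom K C B"
    and "\<And>s. s \<in> S \<Longrightarrow> g (f s) = s" "\<And>t. t \<in> T \<Longrightarrow> f (g t) = t"
  shows "algebra_isomorphic K B C"
proof -
  have id: "(\<lambda>a. a) \<in> alg_hom K B B" "(\<lambda>a. a) \<in> alg_hom K C C"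
    unfolding alg_hom_def ring_hom_def by auto
  have "g (f a) = a" if "a \<in> carrier B" for a
    by (rule alg_hom_eqI[OF assms(1,3) alg_hom_comp[OF f g] id(1) assms(7) that])
  moreover have "f (g a) = a" if "a \<in> carrier C" for a
    by (rule alg_hom_eqI[OF assms(2,4) alg_hom_comp[OF g f] id(2) assms(8) that])
  ultimately have "bij_betw f (carrier B) (carrier C)"
    using alg_hom_closed[OF f] alg_hom_closed[OF g] by (intro bij_betw_byWitness[of _ g]) auto
  then have "f \<in> algebra_iso K B C"
    using f unfolding algebra_iso_def alg_hom_def ring_iso_def by auto
  then show ?thesis unfolding algebra_isomorphic_def by blast
qed

subsection \<open>Quotients of algebras\<close>

lemma relation_ideal_ideal:
  assumes "ring B" "R \<subseteq> carrier B \<times> carrier B"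
  shows "ideal (relation_ideal B R) B"
proof -
  interpret ring B by fact
  show ?thesis unfolding relation_ideal_def by (rule genideal_ideal) (use assms(2) in auto)
qed

lemma ideal_module_quotient:
  assumes "K_algebra K B" "ideal I B"
  shows "module_quotient K B I"
proof -
  interpret B: K_algebra K B by fact
  interpret I: ideal I B by fact
  have "k \<odot>\<^bsub>B\<^esub> a \<in> I" if "k \<in> carrier K" "a \<in> I" for k a
  proof -
    have "k \<odot>\<^bsub>B\<^esub> a = (k \<odot>\<^bsub>B\<^esub> \<one>\<^bsub>B\<^esub>) \<otimes>\<^bsub>B\<^esub> a"
      using that by (simp add: B.smult_mult_left)
    then show ?thesis using that by (simp add: I.I_l_closed)
  qed
  then have "submodule I K B"
    using I.a_subgroup by (intro submodule.intro submodule_axioms.intro) auto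
  then show ?thesis
    by (intro module_quotient.intro B.module_axioms)
qed

lemma cls_mult:
  assumes "ideal I B" "a \<in> carrier B" "b \<in> carrier B"
  shows "(I +>\<^bsub>B\<^esub> a) \<otimes>\<^bsub>quotient_module B I\<^esub> (I +>\<^bsub>B\<^esub> b) = I +>\<^bsub>B\<^esub> (a \<otimes>\<^bsub>B\<^esub> b)"
  using assms ideal.rcoset_mult_add by (simp add: quotient_module_simps) 

lemma quotient_K_algebra:
  assumes "K_algebra K B" "ideal I B"
  shows "K_algebra K (quotient_module B I)"
proof -
  interpret B: K_algebra K B by fact
  interpret Q: module_quotient K B I by (rule ideal_module_quotient[OF assms])
  note m = cls_mult[OF assms(2)]
  note s = quotient_module_simps(1)[of B I] quotient_module_simps(3)[of B I]
  show ?thesis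
  proof (rule K_algebraI)
    show "field K" ..
    show "module K Q.Q" by (rule Q.quotient_module)
    then have "abelian_group Q.Q" by (simp add: module_def)
    then show "ring Q.Q"
    proof (rule ringI)
      show "Group.monoid Q.Q"
        by (rule monoidI) (auto simp: s m B.A.m_assoc)
    qed (auto simp: s m Q.cls_add B.A.l_distr B.A.r_distr)
  qed (auto simp: s m Q.cls_smult B.smult_mult_left B.smult_mult_right)
qed

lemma quotient_cls_alg_hom:
  assumes "K_algebra K B" "ideal I B"
  shows "(\<lambda>a. I +>\<^bsub>B\<^esub> a) \<in> alg_hom K B (quotient_module B I)"
proof -
  interpret Q: module_quotient K B I by (rule ideal_module_quotient[OF assms])
  show ?thesis
    by (rule alg_homI) (auto simp: Q.cls_linear cls_mult[OF assms(2)] quotient_module_simps(3))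
qed

lemma quotient_alg_lift:
  assumes "K_algebra K B" "ideal I B" "K_algebra K C" "f \<in> alg_hom K B C"
    and "\<And>a. a \<in> I \<Longrightarrow> f a = \<zero>\<^bsub>C\<^esub>"
  shows "\<exists>h \<in> alg_hom K (quotient_module B I) C. \<forall>a \<in> carrier B. h (I +>\<^bsub>B\<^esub> a) = f a"
proof -
  interpret B: K_algebra K B by fact
  interpret Q: module_quotient K B I by (rule ideal_module_quotient[OF assms(1,2)])
  obtain h where h: "h \<in> linear_maps K Q.Q C" "\<forall>a \<in> carrier B. h (I +>\<^bsub>B\<^esub> a) = f a"
    using Q.quotient_lift[OF K_algebra_module[OF assms(3)] alg_hom_linear[OF assms(4)] assms(5)] by blast
  have "h \<in> alg_hom K Q.Q C"
  proof (rule alg_homI[OF h(1)])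
    show "h (a \<otimes>\<^bsub>Q.Q\<^esub> b) = h a \<otimes>\<^bsub>C\<^esub> h b" if "a \<in> carrier Q.Q" "b \<in> carrier Q.Q" for a b
      using that h(2) alg_hom_mult[OF assms(4)]
      by (auto simp: quotient_module_simps(1) cls_mult[OF assms(2)])
    show "h \<one>\<^bsub>Q.Q\<^esub> = \<one>\<^bsub>C\<^esub>"
      using h(2) alg_hom_one[OF assms(4)] by (simp add: quotient_module_simps(3))
  qed
  with h(2) show ?thesis by blast
qed

text \<open>
  All algebras given by relations go through this locale. Its two facts that matter are that
  related elements become equal and that a homomorphism respecting the relations descends.
\<close>

locale imposed = K_algebra K B for K (structure) and B (structure) +
  fixes R
  assumes relations: "R \<subseteq> carrier B \<times> carrier B"
begin

lemma B_algebra: "K_algebra K B" ..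

lemma relation_ideal: "ideal (relation_ideal B R) B"
  by (rule relation_ideal_ideal[OF _ relations]) (rule K_algebra_ring[OF B_algebra])

lemma impose_K_algebra: "K_algebra K (impose B R)"
  unfolding impose_def by (rule quotient_K_algebra[OF B_algebra relation_ideal])

lemma impose_class_hom: "impose_class B R \<in> alg_hom K B (impose B R)"
  unfolding impose_def impose_class_def by (rule quotient_cls_alg_hom[OF B_algebra relation_ideal])

lemma impose_class_surj: "impose_class B R ` carrier B = carrier (impose B R)"
  unfolding impose_def impose_class_def by (simp add: quotient_module_simps)

lemma impose_class_eq:
  assumes "(l, r) \<in> R"
  shows "impose_class B R l = impose_class B R r"
proof -
  interpret Q: module_quotient K B "relation_ideal B R"
    by (rule ideal_module_quotient[OF B_algebra relation_ideal])
  have lr: "l \<in> carrier B" "r \<in> carrier B" using assms relations by auto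
  have "l \<ominus>\<^bsub>B\<^esub> r \<in> relation_ideal B R"
    unfolding relation_ideal_def
    by (rule subsetD[OF A.genideal_self]) (use assms relations in auto)
  then show ?thesis unfolding impose_class_def using lr by (simp add: Q.cls_eq_iff)
qed

lemma impose_lift:
  assumes "K_algebra K C" "f \<in> alg_hom K B C" "\<And>l r. (l, r) \<in> R \<Longrightarrow> f l = f r"
  shows "\<exists>h \<in> alg_hom K (impose B R) C. \<forall>a \<in> carrier B. h (impose_class B R a) = f a"
  unfolding impose_def impose_class_def
proof (rule quotient_alg_lift[OF B_algebra relation_ideal assms(1,2)])
  interpret C: K_algebra K C by fact
  have "f \<in> ring_hom B C" using assms(2) unfolding alg_hom_def by simp
  then interpret rh: ring_hom_ring B C f
    by (rule ring_hom_ringI2[OF K_algebra_ring[OF B_algebra] K_algebra_ring[OF assms(1)]])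
  have N: "ideal (a_kernel B C f) B" by (rule rh.kernel_is_ideal)
  have "l \<ominus>\<^bsub>B\<^esub> r \<in> a_kernel B C f" if "(l, r) \<in> R" for l r
  proof -
    have l: "l \<in> carrier B" and r: "r \<in> carrier B"
      using relations that by auto
    have fr: "f r \<in> carrier C" using assms(2) r by (rule alg_hom_closed)
    have "f (l \<ominus>\<^bsub>B\<^esub> r) = f r \<ominus>\<^bsub>C\<^esub> f r"
      using alg_hom_minus[OF B_algebra assms(1,2) l r] assms(3)[OF that] by simp
    also have "\<dots> = \<zero>\<^bsub>C\<^esub>"
      unfolding a_minus_def using fr by (rule C.M.r_neg)
    finally have "f (l \<ominus>\<^bsub>B\<^esub> r) = \<zero>\<^bsub>C\<^esub>" .
    then show ?thesis
      using l r unfolding a_kernel_def' by blast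
  qed
  then have "{l \<ominus>\<^bsub>B\<^esub> r | l r. (l, r) \<in> R} \<subseteq> a_kernel B C f"
    by blast
  then have "relation_ideal B R \<subseteq> a_kernel B C f"
    unfolding relation_ideal_def by (rule A.genideal_minimal[OF N])
  then show "f a = \<zero>\<^bsub>C\<^esub>" if "a \<in> relation_ideal B R" for a
    using subsetD[OF _ that] unfolding a_kernel_def' by blast
qed

lemma impose_generates:
  "generates K B S \<Longrightarrow> generates K (impose B R) (impose_class B R ` S)"
  by (rule generates_image[OF B_algebra impose_class_hom impose_class_surj])

end


section \<open>Free modules and monoid algebras\<close>

text \<open>The linear extension of a map that is given on basis elements.\<close>

definition lin_ext :: "'k ring \<Rightarrow> ('k, 'c, 't) module_scheme \<Rightarrow> ('g \<Rightarrow> 'c) \<Rightarrow> ('g \<Rightarrow> 'k) \<Rightarrow> 'c"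
  where "lin_ext K C \<phi> f = (\<Oplus>\<^bsub>C\<^esub>g \<in> {g. f g \<noteq> \<zero>\<^bsub>K\<^esub>}. f g \<odot>\<^bsub>C\<^esub> \<phi> g)"

locale free_module = field K for K :: "'k ring" (structure) +
  fixes G :: "('g, 's) monoid_scheme"
begin

abbreviation F where "F \<equiv> monoid_algebra K G"
abbreviation e where "e \<equiv> basis_elem K"

lemma F_simps:
  "f \<in> carrier F \<longleftrightarrow> (\<forall>g. f g \<in> carrier K) \<and> finite {g. f g \<noteq> \<zero>} \<and> {g. f g \<noteq> \<zero>} \<subseteq> carrier G"
  "\<zero>\<^bsub>F\<^esub> = (\<lambda>g. \<zero>)"
  "\<one>\<^bsub>F\<^esub> = e \<one>\<^bsub>G\<^esub>"
  "f \<oplus>\<^bsub>F\<^esub> h = (\<lambda>g. f g \<oplus> h g)"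
  "k \<odot>\<^bsub>F\<^esub> f = (\<lambda>g. k \<otimes> f g)"
  by (auto simp: monoid_algebra_def basis_elem_def Pi_iff)

lemma F_closed_add: "\<lbrakk>f \<in> carrier F; h \<in> carrier F\<rbrakk> \<Longrightarrow> f \<oplus>\<^bsub>F\<^esub> h \<in> carrier F"
proof -
  assume f: "f \<in> carrier F" and h: "h \<in> carrier F"
  have "{g. f g \<oplus> h g \<noteq> \<zero>} \<subseteq> {g. f g \<noteq> \<zero>} \<union> {g. h g \<noteq> \<zero>}" by auto
  then show ?thesis
    using f h by (auto simp: F_simps intro: finite_subset)
qed

lemma F_closed_smult: "\<lbrakk>k \<in> carrier K; f \<in> carrier F\<rbrakk> \<Longrightarrow> k \<odot>\<^bsub>F\<^esub> f \<in> carrier F"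
  by (auto simp: F_simps intro: finite_subset[of _ "{g. f g \<noteq> \<zero>}"])

lemma F_module: "module K F"
proof (rule moduleI)
  show "cring K" ..
  show "abelian_group F"
  proof (rule abelian_groupI)
    show "\<exists>h\<in>carrier F. h \<oplus>\<^bsub>F\<^esub> f = \<zero>\<^bsub>F\<^esub>" if "f \<in> carrier F" for f
    proof (rule bexI)
      show "(\<lambda>g. \<ominus> f g) \<oplus>\<^bsub>F\<^esub> f = \<zero>\<^bsub>F\<^esub>"
        using that by (simp add: F_simps l_neg)
      have "(\<ominus> f g = \<zero>) = (f g = \<zero>)" for g
        using that by (simp add: F_simps)
      then show "(\<lambda>g. \<ominus> f g) \<in> carrier F"
        using that by (simp add: F_simps)
    qed
  qed (auto simp: F_closed_add, simp_all add: F_simps a_ac)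
qed (auto simp: F_closed_add F_closed_smult,
    (simp add: F_simps l_distr r_distr m_assoc)+)

lemma e_closed: "g \<in> carrier G \<Longrightarrow> e g \<in> carrier F"
  by (auto simp: F_simps basis_elem_def)

lemma F_induct [consumes 1, case_names zero smult add]:
  assumes "f \<in> carrier F"
    and zero: "P \<zero>\<^bsub>F\<^esub>"
    and smult: "\<And>k g. \<lbrakk>k \<in> carrier K; g \<in> carrier G\<rbrakk> \<Longrightarrow> P (k \<odot>\<^bsub>F\<^esub> e g)"
    and add: "\<And>f h. \<lbrakk>f \<in> carrier F; h \<in> carrier F; P f; P h\<rbrakk> \<Longrightarrow> P (f \<oplus>\<^bsub>F\<^esub> h)"
  shows "P f"
proof -
  have "P f" if "finite T" "f \<in> carrier F" "{g. f g \<noteq> \<zero>} = T" for f T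
    using that
  proof (induction T arbitrary: f rule: finite_induct)
    case empty
    then have "f = \<zero>\<^bsub>F\<^esub>" by (auto simp: F_simps)
    then show ?case using zero by simp
  next
    case (insert g T)
    let ?h = "f(g := \<zero>)"
    have g: "g \<in> carrier G" "f g \<in> carrier K" using insert.prems by (auto simp: F_simps)
    have supp: "{g. ?h g \<noteq> \<zero>} = T" using insert by auto
    then have h: "?h \<in> carrier F" using insert by (auto simp: F_simps)
    have e: "f g \<odot>\<^bsub>F\<^esub> e g \<in> carrier F" using g e_closed F_closed_smult by blast
    have "f = ?h \<oplus>\<^bsub>F\<^esub> (f g \<odot>\<^bsub>F\<^esub> e g)"
      using insert.prems g(2) by (auto simp: F_simps basis_elem_def)
    with add[OF h e insert.IH[OF h supp] smult[OF g(2,1)]] show ?case by metis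
  qed
  moreover have "finite {g. f g \<noteq> \<zero>}" using assms(1) by (simp add: F_simps)
  ultimately show ?thesis using assms(1) by blast
qed

lemma lin_ext_superset:
  assumes C: "module K C" and "\<phi> \<in> carrier G \<rightarrow> carrier C" "f \<in> carrier F"
    and "finite T" "{g. f g \<noteq> \<zero>} \<subseteq> T" "T \<subseteq> carrier G"
  shows "lin_ext K C \<phi> f = (\<Oplus>\<^bsub>C\<^esub>g \<in> T. f g \<odot>\<^bsub>C\<^esub> \<phi> g)"
proof -
  interpret C: module K C by fact
  show ?thesis
    unfolding lin_ext_def
    by (rule C.M.add.finprod_mono_neutral_cong_left) (use assms in \<open>auto simp: F_simps Pi_iff\<close>)
qed

lemma lin_ext_linear:
  assumes C: "module K C" and \<phi>: "\<phi> \<in> carrier G \<rightarrow> carrier C"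
  shows "lin_ext K C \<phi> \<in> linear_maps K F C"
proof (rule linear_mapsI)
  interpret C: module K C by fact
  have cl: "(\<lambda>g. f g \<odot>\<^bsub>C\<^esub> \<phi> g) \<in> T \<rightarrow> carrier C" if "f \<in> carrier F" "T \<subseteq> carrier G" for f T
    using that \<phi> by (auto simp: F_simps Pi_iff)
  show "lin_ext K C \<phi> f \<in> carrier C" if "f \<in> carrier F" for f
    unfolding lin_ext_def using cl[OF that] that by (intro C.M.finsum_closed) (auto simp: F_simps)
  show "lin_ext K C \<phi> (f \<oplus>\<^bsub>F\<^esub> h) = lin_ext K C \<phi> f \<oplus>\<^bsub>C\<^esub> lin_ext K C \<phi> h"
    if f: "f \<in> carrier F" and h: "h \<in> carrier F" for f h
  proof -
    let ?T = "{g. f g \<noteq> \<zero>} \<union> {g. h g \<noteq> \<zero>}"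
    have T: "finite ?T" "?T \<subseteq> carrier G" using f h by (auto simp: F_simps)
    have s: "{g. (f \<oplus>\<^bsub>F\<^esub> h) g \<noteq> \<zero>} \<subseteq> ?T" using f h by (auto simp: F_simps)
    have "lin_ext K C \<phi> (f \<oplus>\<^bsub>F\<^esub> h) = (\<Oplus>\<^bsub>C\<^esub>g \<in> ?T. (f \<oplus>\<^bsub>F\<^esub> h) g \<odot>\<^bsub>C\<^esub> \<phi> g)"
      by (rule lin_ext_superset[OF C \<phi> F_closed_add[OF f h] T(1) s T(2)])
    also have "\<dots> = (\<Oplus>\<^bsub>C\<^esub>g \<in> ?T. f g \<odot>\<^bsub>C\<^esub> \<phi> g \<oplus>\<^bsub>C\<^esub> h g \<odot>\<^bsub>C\<^esub> \<phi> g)"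
    proof (rule C.M.finsum_cong')
      show "(f \<oplus>\<^bsub>F\<^esub> h) g \<odot>\<^bsub>C\<^esub> \<phi> g = f g \<odot>\<^bsub>C\<^esub> \<phi> g \<oplus>\<^bsub>C\<^esub> h g \<odot>\<^bsub>C\<^esub> \<phi> g" if "g \<in> ?T" for g
      proof -
        have "\<phi> g \<in> carrier C" using that T(2) \<phi> by blast
        then show ?thesis using f h by (simp add: F_simps C.smult_l_distr)
      qed
    qed (use cl[OF f T(2)] cl[OF h T(2)] in auto)
    also have "\<dots> = lin_ext K C \<phi> f \<oplus>\<^bsub>C\<^esub> lin_ext K C \<phi> h"
      using cl[OF f T(2)] cl[OF h T(2)] lin_ext_superset[OF C \<phi> f T(1) _ T(2)]
        lin_ext_superset[OF C \<phi> h T(1) _ T(2)]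
      by (simp add: C.M.finsum_addf)
    finally show ?thesis .
  qed
  show "lin_ext K C \<phi> (k \<odot>\<^bsub>F\<^esub> f) = k \<odot>\<^bsub>C\<^esub> lin_ext K C \<phi> f"
    if k: "k \<in> carrier K" and f: "f \<in> carrier F" for k f
  proof -
    let ?T = "{g. f g \<noteq> \<zero>}"
    have T: "finite ?T" "?T \<subseteq> carrier G" using f by (auto simp: F_simps)
    have s: "{g. (k \<odot>\<^bsub>F\<^esub> f) g \<noteq> \<zero>} \<subseteq> ?T" using f k by (auto simp: F_simps)
    have "lin_ext K C \<phi> (k \<odot>\<^bsub>F\<^esub> f) = (\<Oplus>\<^bsub>C\<^esub>g \<in> ?T. (k \<odot>\<^bsub>F\<^esub> f) g \<odot>\<^bsub>C\<^esub> \<phi> g)"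
      by (rule lin_ext_superset[OF C \<phi> F_closed_smult[OF k f] T(1) s T(2)])
    also have "\<dots> = (\<Oplus>\<^bsub>C\<^esub>g \<in> ?T. k \<odot>\<^bsub>C\<^esub> (f g \<odot>\<^bsub>C\<^esub> \<phi> g))"
    proof (rule C.M.finsum_cong')
      show "(k \<odot>\<^bsub>F\<^esub> f) g \<odot>\<^bsub>C\<^esub> \<phi> g = k \<odot>\<^bsub>C\<^esub> (f g \<odot>\<^bsub>C\<^esub> \<phi> g)" if "g \<in> ?T" for g
      proof -
        have "\<phi> g \<in> carrier C" using that T(2) \<phi> by blast
        then show ?thesis using f k by (simp add: F_simps C.smult_assoc1)
      qed
    qed (use cl[OF f T(2)] k in auto)
    also have "\<dots> = k \<odot>\<^bsub>C\<^esub> lin_ext K C \<phi> f"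
      unfolding lin_ext_def using cl[OF f T(2)] T(1) k by (simp add: C.finsum_smult_ldistr)
    finally show ?thesis .
  qed
qed

lemma lin_ext_reindex:
  assumes C: "module K C" and \<phi>: "\<phi> \<in> carrier G \<rightarrow> carrier C" and f: "f \<in> carrier F"
    and t: "bij_betw t N {g. f g \<noteq> \<zero>}"
  shows "lin_ext K C \<phi> f = (\<Oplus>\<^bsub>C\<^esub>n \<in> N. f (t n) \<odot>\<^bsub>C\<^esub> \<phi> (t n))"
proof -
  interpret C: module K C by fact
  have t': "t ` N = {g. f g \<noteq> \<zero>}" "inj_on t N" using t by (auto simp: bij_betw_def)
  have "(\<lambda>g. f g \<odot>\<^bsub>C\<^esub> \<phi> g) \<in> t ` N \<rightarrow> carrier C"
    unfolding t' using f \<phi> by (auto simp: F_simps Pi_iff)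
  from C.M.finsum_reindex[OF this t'(2)] show ?thesis
    unfolding lin_ext_def t' .
qed

lemma lin_ext_basis:
  assumes "module K C" "\<phi> \<in> carrier G \<rightarrow> carrier C" "g \<in> carrier G"
  shows "lin_ext K C \<phi> (e g) = \<phi> g"
proof -
  interpret C: module K C by fact
  have "\<phi> g \<in> carrier C" using assms by auto
  then show ?thesis
    using lin_ext_superset[OF assms(1,2) e_closed[OF assms(3)], of "{g}"] assms(3)
    by (auto simp: basis_elem_def Pi_iff)
qed

lemma linear_maps_F_eqI:
  assumes "module K C" "f \<in> linear_maps K F C" "h \<in> linear_maps K F C"
    and "\<And>g. g \<in> carrier G \<Longrightarrow> f (e g) = h (e g)" "u \<in> carrier F"
  shows "f u = h u"
  using assms(5)
proof (induction rule: F_induct)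
  case zero
  show ?case
    using linear_maps_zero[OF F_module assms(1,2)] linear_maps_zero[OF F_module assms(1,3)] by simp
next
  case (smult k g)
  then show ?case
    using assms(4) by (simp add: linear_maps_smult[OF assms(2)] linear_maps_smult[OF assms(3)] e_closed)
next
  case (add u v)
  then show ?case
    by (simp add: linear_maps_add[OF assms(2)] linear_maps_add[OF assms(3)])
qed

lemma push_superset:
  assumes "f \<in> carrier F" "finite T" "{g. f g \<noteq> \<zero>} \<subseteq> T"
  shows "push K \<phi> f z = (\<Oplus>g \<in> T. if \<phi> g = z then f g else \<zero>)"
  unfolding push_def
  by (rule add.finprod_mono_neutral_cong_left) (use assms in \<open>auto simp: F_simps\<close>)

lemma push_linear:
  assumes \<phi>: "\<phi> \<in> carrier G \<rightarrow> carrier G"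
  shows "push K \<phi> \<in> linear_maps K F F"
proof (rule linear_mapsI)
  show "push K \<phi> f \<in> carrier F" if f: "f \<in> carrier F" for f
  proof -
    have T: "finite {g. f g \<noteq> \<zero>}" "{g. f g \<noteq> \<zero>} \<subseteq> carrier G" "\<And>g. f g \<in> carrier K"
      using f by (auto simp: F_simps)
    have "z \<in> \<phi> ` {g. f g \<noteq> \<zero>}" if "push K \<phi> f z \<noteq> \<zero>" for z
    proof (rule ccontr)
      assume "z \<notin> \<phi> ` {g. f g \<noteq> \<zero>}"
      then have none: "{g. f g \<noteq> \<zero> \<and> \<phi> g = z} = {}" by auto
      show False using \<open>push K \<phi> f z \<noteq> \<zero>\<close> unfolding push_def none by simp
    qed
    then have "{z. push K \<phi> f z \<noteq> \<zero>} \<subseteq> \<phi> ` {g. f g \<noteq> \<zero>}" by blast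
    moreover have "\<phi> ` {g. f g \<noteq> \<zero>} \<subseteq> carrier G" using \<phi> T(2) by blast
    moreover have "push K \<phi> f z \<in> carrier K" for z
      unfolding push_def using T(3) by (intro finsum_closed) auto
    ultimately show ?thesis
      using T(1) finite_subset[of "{z. push K \<phi> f z \<noteq> \<zero>}" "\<phi> ` {g. f g \<noteq> \<zero>}"]
      unfolding F_simps(1) by blast
  qed
  show "push K \<phi> (f \<oplus>\<^bsub>F\<^esub> h) = push K \<phi> f \<oplus>\<^bsub>F\<^esub> push K \<phi> h"
    if f: "f \<in> carrier F" and h: "h \<in> carrier F" for f h
  proof
    fix z
    let ?T = "{g. f g \<noteq> \<zero>} \<union> {g. h g \<noteq> \<zero>}"
    have T: "finite ?T" using f h by (auto simp: F_simps)
    have c: "f g \<in> carrier K" "h g \<in> carrier K" for g using f h by (auto simp: F_simps)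
    have s: "{g. (f \<oplus>\<^bsub>F\<^esub> h) g \<noteq> \<zero>} \<subseteq> ?T" by (auto simp: F_simps)
    have "push K \<phi> (f \<oplus>\<^bsub>F\<^esub> h) z = (\<Oplus>g \<in> ?T. if \<phi> g = z then (f \<oplus>\<^bsub>F\<^esub> h) g else \<zero>)"
      by (rule push_superset[OF F_closed_add[OF f h] T s])
    also have "\<dots> = (\<Oplus>g \<in> ?T. (if \<phi> g = z then f g else \<zero>) \<oplus> (if \<phi> g = z then h g else \<zero>))"
      by (rule finsum_cong') (use c in \<open>auto simp: F_simps\<close>)
    also have "\<dots> = push K \<phi> f z \<oplus> push K \<phi> h z"
      unfolding push_superset[OF f T Un_upper1] push_superset[OF h T Un_upper2]
      by (rule finsum_addf) (use c in auto)
    finally show "push K \<phi> (f \<oplus>\<^bsub>F\<^esub> h) z = (push K \<phi> f \<oplus>\<^bsub>F\<^esub> push K \<phi> h) z"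
      by (simp add: F_simps)
  qed
  show "push K \<phi> (k \<odot>\<^bsub>F\<^esub> f) = k \<odot>\<^bsub>F\<^esub> push K \<phi> f"
    if k: "k \<in> carrier K" and f: "f \<in> carrier F" for k f
  proof
    fix z
    let ?T = "{g. f g \<noteq> \<zero>}"
    have T: "finite ?T" using f by (auto simp: F_simps)
    have c: "f g \<in> carrier K" for g using f by (auto simp: F_simps)
    have s: "{g. (k \<odot>\<^bsub>F\<^esub> f) g \<noteq> \<zero>} \<subseteq> ?T" using k by (auto simp: F_simps)
    have "push K \<phi> (k \<odot>\<^bsub>F\<^esub> f) z = (\<Oplus>g \<in> ?T. if \<phi> g = z then (k \<odot>\<^bsub>F\<^esub> f) g else \<zero>)"
      by (rule push_superset[OF F_closed_smult[OF k f] T s])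
    also have "\<dots> = (\<Oplus>g \<in> ?T. k \<otimes> (if \<phi> g = z then f g else \<zero>))"
      by (rule finsum_cong') (use c k in \<open>auto simp: F_simps\<close>)
    also have "\<dots> = k \<otimes> push K \<phi> f z"
      unfolding push_superset[OF f T order_refl]
      by (rule finsum_rdistr[symmetric]) (use c k T in auto)
    finally show "push K \<phi> (k \<odot>\<^bsub>F\<^esub> f) z = (k \<odot>\<^bsub>F\<^esub> push K \<phi> f) z"
      by (simp add: F_simps)
  qed
qed

lemma push_basis:
  assumes "g \<in> carrier G"
  shows "push K \<phi> (e g) = e (\<phi> g)"
proof
  fix z
  have "push K \<phi> (e g) z = (\<Oplus>h \<in> {g}. if \<phi> h = z then e g h else \<zero>)"
    by (rule push_superset[OF e_closed[OF assms]]) (auto simp: basis_elem_def)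
  also have "\<dots> = e (\<phi> g) z" by (auto simp: basis_elem_def)
  finally show "push K \<phi> (e g) z = e (\<phi> g) z" .
qed

end

text \<open>
  The convolution product is a sum over the pairs of support elements, which change with the
  factors. Rewriting it over any finite sets containing the supports (\<open>mult_superset\<close>) makes
  both factors vary over a fixed index set, so bilinearity reduces to rules for finite sums. All
  further properties are then checked on basis elements, where the product is the one of the
  monoid.
\<close>

locale group_algebra = free_module K G + G: monoid G
  for K :: "'k ring" (structure) and G :: "('g, 's) monoid_scheme"
begin

lemma mult_superset:
  assumes "f \<in> carrier F" "h \<in> carrier F" "finite S" "finite T"
    and "{g. f g \<noteq> \<zero>} \<subseteq> S" "{g. h g \<noteq> \<zero>} \<subseteq> T"
  shows "(f \<otimes>\<^bsub>F\<^esub> h) z =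
    (\<Oplus>r \<in> S \<times> T. if fst r \<otimes>\<^bsub>G\<^esub> snd r = z then f (fst r) \<otimes> h (snd r) else \<zero>)"
proof -
  have c: "f g \<in> carrier K" "h g \<in> carrier K" for g using assms(1,2) by (auto simp: F_simps)
  have "(f \<otimes>\<^bsub>F\<^esub> h) z =
    (\<Oplus>r \<in> {(x, y). f x \<noteq> \<zero> \<and> h y \<noteq> \<zero> \<and> x \<otimes>\<^bsub>G\<^esub> y = z}. f (fst r) \<otimes> h (snd r))"
    by (simp add: monoid_algebra_def)
  also have "\<dots> = (\<Oplus>r \<in> S \<times> T. if fst r \<otimes>\<^bsub>G\<^esub> snd r = z then f (fst r) \<otimes> h (snd r) else \<zero>)"
    by (rule add.finprod_mono_neutral_cong_left) (use assms c in auto)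
  finally show ?thesis .
qed

lemma mult_add_left:
  assumes f: "f \<in> carrier F" and f': "f' \<in> carrier F" and h: "h \<in> carrier F"
  shows "(f \<oplus>\<^bsub>F\<^esub> f') \<otimes>\<^bsub>F\<^esub> h = f \<otimes>\<^bsub>F\<^esub> h \<oplus>\<^bsub>F\<^esub> f' \<otimes>\<^bsub>F\<^esub> h"
proof
  fix z
  let ?S = "{g. f g \<noteq> \<zero>} \<union> {g. f' g \<noteq> \<zero>}" and ?T = "{g. h g \<noteq> \<zero>}"
  have T: "finite ?S" "finite ?T" using f f' h by (auto simp: F_simps)
  have c: "f g \<in> carrier K" "f' g \<in> carrier K" "h g \<in> carrier K" for g
    using f f' h by (auto simp: F_simps)
  have s: "{g. (f \<oplus>\<^bsub>F\<^esub> f') g \<noteq> \<zero>} \<subseteq> ?S" by (auto simp: F_simps)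
  have "((f \<oplus>\<^bsub>F\<^esub> f') \<otimes>\<^bsub>F\<^esub> h) z =
      (\<Oplus>r \<in> ?S \<times> ?T. (if fst r \<otimes>\<^bsub>G\<^esub> snd r = z then f (fst r) \<otimes> h (snd r) else \<zero>) \<oplus>
        (if fst r \<otimes>\<^bsub>G\<^esub> snd r = z then f' (fst r) \<otimes> h (snd r) else \<zero>))"
    unfolding mult_superset[OF F_closed_add[OF f f'] h T s order_refl]
    by (rule finsum_cong') (use c in \<open>auto simp: F_simps l_distr\<close>)
  also have "\<dots> = (f \<otimes>\<^bsub>F\<^esub> h) z \<oplus> (f' \<otimes>\<^bsub>F\<^esub> h) z"
    using c mult_superset[OF f h T] mult_superset[OF f' h T] by (subst finsum_addf) auto
  finally show "((f \<oplus>\<^bsub>F\<^esub> f') \<otimes>\<^bsub>F\<^esub> h) z = (f \<otimes>\<^bsub>F\<^esub> h \<oplus>\<^bsub>F\<^esub> f' \<otimes>\<^bsub>F\<^esub> h) z"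
    by (simp add: F_simps)
qed

lemma mult_add_right:
  assumes f: "f \<in> carrier F" and f': "f' \<in> carrier F" and h: "h \<in> carrier F"
  shows "h \<otimes>\<^bsub>F\<^esub> (f \<oplus>\<^bsub>F\<^esub> f') = h \<otimes>\<^bsub>F\<^esub> f \<oplus>\<^bsub>F\<^esub> h \<otimes>\<^bsub>F\<^esub> f'"
proof
  fix z
  let ?S = "{g. f g \<noteq> \<zero>} \<union> {g. f' g \<noteq> \<zero>}" and ?T = "{g. h g \<noteq> \<zero>}"
  have T: "finite ?T" "finite ?S" using f f' h by (auto simp: F_simps)
  have c: "f g \<in> carrier K" "f' g \<in> carrier K" "h g \<in> carrier K" for g
    using f f' h by (auto simp: F_simps)
  have s: "{g. (f \<oplus>\<^bsub>F\<^esub> f') g \<noteq> \<zero>} \<subseteq> ?S" by (auto simp: F_simps)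
  have "(h \<otimes>\<^bsub>F\<^esub> (f \<oplus>\<^bsub>F\<^esub> f')) z =
      (\<Oplus>r \<in> ?T \<times> ?S. (if fst r \<otimes>\<^bsub>G\<^esub> snd r = z then h (fst r) \<otimes> f (snd r) else \<zero>) \<oplus>
        (if fst r \<otimes>\<^bsub>G\<^esub> snd r = z then h (fst r) \<otimes> f' (snd r) else \<zero>))"
    unfolding mult_superset[OF h F_closed_add[OF f f'] T order_refl s]
    by (rule finsum_cong') (use c in \<open>auto simp: F_simps r_distr\<close>)
  also have "\<dots> = (h \<otimes>\<^bsub>F\<^esub> f) z \<oplus> (h \<otimes>\<^bsub>F\<^esub> f') z"
    using c mult_superset[OF h f T] mult_superset[OF h f' T] by (subst finsum_addf) auto
  finally show "(h \<otimes>\<^bsub>F\<^esub> (f \<oplus>\<^bsub>F\<^esub> f')) z = (h \<otimes>\<^bsub>F\<^esub> f \<oplus>\<^bsub>F\<^esub> h \<otimes>\<^bsub>F\<^esub> f') z"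
    by (simp add: F_simps)
qed

lemma mult_smult_left:
  assumes k: "k \<in> carrier K" and f: "f \<in> carrier F" and h: "h \<in> carrier F"
  shows "(k \<odot>\<^bsub>F\<^esub> f) \<otimes>\<^bsub>F\<^esub> h = k \<odot>\<^bsub>F\<^esub> (f \<otimes>\<^bsub>F\<^esub> h)"
proof
  fix z
  let ?S = "{g. f g \<noteq> \<zero>}" and ?T = "{g. h g \<noteq> \<zero>}"
  have T: "finite ?S" "finite ?T" using f h by (auto simp: F_simps)
  have c: "f g \<in> carrier K" "h g \<in> carrier K" for g using f h by (auto simp: F_simps)
  have s: "{g. (k \<odot>\<^bsub>F\<^esub> f) g \<noteq> \<zero>} \<subseteq> ?S" using k by (auto simp: F_simps)
  have "((k \<odot>\<^bsub>F\<^esub> f) \<otimes>\<^bsub>F\<^esub> h) z =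
      (\<Oplus>r \<in> ?S \<times> ?T. k \<otimes> (if fst r \<otimes>\<^bsub>G\<^esub> snd r = z then f (fst r) \<otimes> h (snd r) else \<zero>))"
    unfolding mult_superset[OF F_closed_smult[OF k f] h T s order_refl]
    by (rule finsum_cong') (use c k in \<open>auto simp: F_simps m_assoc\<close>)
  also have "\<dots> = k \<otimes> (f \<otimes>\<^bsub>F\<^esub> h) z"
    using c k T mult_superset[OF f h T] by (subst finsum_rdistr[symmetric]) auto
  finally show "((k \<odot>\<^bsub>F\<^esub> f) \<otimes>\<^bsub>F\<^esub> h) z = (k \<odot>\<^bsub>F\<^esub> (f \<otimes>\<^bsub>F\<^esub> h)) z"
    by (simp add: F_simps)
qed

lemma mult_smult_right:
  assumes k: "k \<in> carrier K" and f: "f \<in> carrier F" and h: "h \<in> carrier F"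
  shows "f \<otimes>\<^bsub>F\<^esub> (k \<odot>\<^bsub>F\<^esub> h) = k \<odot>\<^bsub>F\<^esub> (f \<otimes>\<^bsub>F\<^esub> h)"
proof
  fix z
  let ?S = "{g. f g \<noteq> \<zero>}" and ?T = "{g. h g \<noteq> \<zero>}"
  have T: "finite ?S" "finite ?T" using f h by (auto simp: F_simps)
  have c: "f g \<in> carrier K" "h g \<in> carrier K" for g using f h by (auto simp: F_simps)
  have s: "{g. (k \<odot>\<^bsub>F\<^esub> h) g \<noteq> \<zero>} \<subseteq> ?T" using k by (auto simp: F_simps)
  have "(f \<otimes>\<^bsub>F\<^esub> (k \<odot>\<^bsub>F\<^esub> h)) z =
      (\<Oplus>r \<in> ?S \<times> ?T. k \<otimes> (if fst r \<otimes>\<^bsub>G\<^esub> snd r = z then f (fst r) \<otimes> h (snd r) else \<zero>))"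
    unfolding mult_superset[OF f F_closed_smult[OF k h] T order_refl s]
    by (rule finsum_cong') (use c k in \<open>auto simp: F_simps m_lcomm\<close>)
  also have "\<dots> = k \<otimes> (f \<otimes>\<^bsub>F\<^esub> h) z"
    using c k T mult_superset[OF f h T] by (subst finsum_rdistr[symmetric]) auto
  finally show "(f \<otimes>\<^bsub>F\<^esub> (k \<odot>\<^bsub>F\<^esub> h)) z = (k \<odot>\<^bsub>F\<^esub> (f \<otimes>\<^bsub>F\<^esub> h)) z"
    by (simp add: F_simps)
qed

lemma mult_basis:
  assumes "g \<in> carrier G" "h \<in> carrier G"
  shows "e g \<otimes>\<^bsub>F\<^esub> e h = e (g \<otimes>\<^bsub>G\<^esub> h)"
proof
  fix z
  have "(e g \<otimes>\<^bsub>F\<^esub> e h) z =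
    (\<Oplus>r \<in> {g} \<times> {h}. if fst r \<otimes>\<^bsub>G\<^esub> snd r = z then e g (fst r) \<otimes> e h (snd r) else \<zero>)"
    by (rule mult_superset[OF e_closed[OF assms(1)] e_closed[OF assms(2)]])
       (auto simp: basis_elem_def)
  also have "\<dots> = e (g \<otimes>\<^bsub>G\<^esub> h) z" by (auto simp: basis_elem_def)
  finally show "(e g \<otimes>\<^bsub>F\<^esub> e h) z = e (g \<otimes>\<^bsub>G\<^esub> h) z" .
qed

lemma mult_zero:
  assumes "f \<in> carrier F"
  shows "\<zero>\<^bsub>F\<^esub> \<otimes>\<^bsub>F\<^esub> f = \<zero>\<^bsub>F\<^esub>" "f \<otimes>\<^bsub>F\<^esub> \<zero>\<^bsub>F\<^esub> = \<zero>\<^bsub>F\<^esub>"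
  by (auto simp: monoid_algebra_def fun_eq_iff)

lemma mult_closed:
  assumes "f \<in> carrier F" "h \<in> carrier F"
  shows "f \<otimes>\<^bsub>F\<^esub> h \<in> carrier F"
proof -
  interpret F: module K F by (rule F_module)
  show ?thesis
    using assms(1)
  proof (induction rule: F_induct)
    case zero
    show ?case using assms(2) by (simp add: mult_zero)
  next
    case (smult k g)
    have "e g \<otimes>\<^bsub>F\<^esub> h \<in> carrier F"
      using assms(2)
    proof (induction rule: F_induct)
      case zero
      show ?case using smult by (simp add: mult_zero e_closed)
    next
      case (smult l g')
      then show ?case
        using \<open>g \<in> carrier G\<close> by (simp add: mult_smult_right e_closed mult_basis)
    next
      case (add u v)
      then show ?case
        using \<open>g \<in> carrier G\<close> by (simp add: mult_add_right e_closed)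
    qed
    then show ?case using smult assms(2) by (simp add: mult_smult_left e_closed)
  next
    case (add u v)
    then show ?case using assms(2) by (simp add: mult_add_left)
  qed
qed

lemmas F_bilinear = mult_add_left mult_add_right mult_smult_left mult_smult_right mult_closed mult_zero

lemma mult_assoc:
  assumes "f \<in> carrier F" "h \<in> carrier F" "u \<in> carrier F"
  shows "f \<otimes>\<^bsub>F\<^esub> h \<otimes>\<^bsub>F\<^esub> u = f \<otimes>\<^bsub>F\<^esub> (h \<otimes>\<^bsub>F\<^esub> u)"
proof -
  interpret F: module K F by (rule F_module)
  show ?thesis
    using assms(1)
  proof (induction rule: F_induct)
    case zero
    show ?case using assms(2,3) by (simp add: F_bilinear)
  next
    case (smult k g)
    then have g: "e g \<in> carrier F" by (simp add: e_closed)
    have "e g \<otimes>\<^bsub>F\<^esub> h \<otimes>\<^bsub>F\<^esub> u = e g \<otimes>\<^bsub>F\<^esub> (h \<otimes>\<^bsub>F\<^esub> u)"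
      using assms(2)
    proof (induction rule: F_induct)
      case zero
      show ?case using assms(3) g by (simp add: F_bilinear)
    next
      case (smult l g')
      then have g': "e g' \<in> carrier F" by (simp add: e_closed)
      have "e g \<otimes>\<^bsub>F\<^esub> e g' \<otimes>\<^bsub>F\<^esub> u = e g \<otimes>\<^bsub>F\<^esub> (e g' \<otimes>\<^bsub>F\<^esub> u)"
        using assms(3)
      proof (induction rule: F_induct)
        case zero
        show ?case using g g' by (simp add: F_bilinear)
      next
        case (smult l' g'')
        then show ?case
          using g g' \<open>g \<in> carrier G\<close> \<open>g' \<in> carrier G\<close>
          by (simp add: F_bilinear e_closed mult_basis G.m_assoc)
      next
        case (add v w)
        then show ?case using g g' by (simp add: F_bilinear)
      qed
      then show ?case using smult g g' assms(3) by (simp add: F_bilinear)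
    next
      case (add v w)
      then show ?case using g assms(3) by (simp add: F_bilinear)
    qed
    then show ?case using smult g assms(2,3) by (simp add: F_bilinear)
  next
    case (add v w)
    then show ?case using assms(2,3) by (simp add: F_bilinear)
  qed
qed

lemma one_closed: "\<one>\<^bsub>F\<^esub> \<in> carrier F"
  by (simp add: F_simps(3) e_closed)

lemma mult_one:
  assumes "f \<in> carrier F"
  shows "\<one>\<^bsub>F\<^esub> \<otimes>\<^bsub>F\<^esub> f = f" "f \<otimes>\<^bsub>F\<^esub> \<one>\<^bsub>F\<^esub> = f"
proof -
  have one: "\<one>\<^bsub>F\<^esub> \<in> carrier F" by (simp add: F_simps(3) e_closed)
  show "\<one>\<^bsub>F\<^esub> \<otimes>\<^bsub>F\<^esub> f = f"
    using assms
  proof (induction rule: F_induct)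
    case (smult k g)
    then show ?case using one by (simp add: F_bilinear e_closed) (simp add: F_simps(3) mult_basis)
  qed (use one in \<open>simp_all add: F_bilinear\<close>)
  show "f \<otimes>\<^bsub>F\<^esub> \<one>\<^bsub>F\<^esub> = f"
    using assms
  proof (induction rule: F_induct)
    case (smult k g)
    then show ?case using one by (simp add: F_bilinear e_closed) (simp add: F_simps(3) mult_basis)
  qed (use one in \<open>simp_all add: F_bilinear\<close>)
qed

lemma F_K_algebra: "K_algebra K F"
proof (rule K_algebraI)
  show "field K" ..
  show "module K F" by (rule F_module)
  then have "abelian_group F" by (simp add: module_def)
  then show "ring F"
  proof (rule ringI)
    show "Group.monoid F"
      by (rule monoidI) (auto simp: F_bilinear mult_assoc mult_one one_closed)
  qed (auto simp: F_bilinear)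
qed (auto simp: F_bilinear)

lemma F_alg_lift:
  assumes C: "K_algebra K C" and \<phi>: "\<phi> \<in> carrier G \<rightarrow> carrier C" "\<phi> \<one>\<^bsub>G\<^esub> = \<one>\<^bsub>C\<^esub>"
    and mult: "\<And>g h. \<lbrakk>g \<in> carrier G; h \<in> carrier G\<rbrakk> \<Longrightarrow> \<phi> (g \<otimes>\<^bsub>G\<^esub> h) = \<phi> g \<otimes>\<^bsub>C\<^esub> \<phi> h"
  shows "\<exists>h \<in> alg_hom K F C. \<forall>g \<in> carrier G. h (e g) = \<phi> g"
proof (rule bexI)
  interpret C: K_algebra K C by fact
  interpret F: K_algebra K F by (rule F_K_algebra)
  let ?h = "lin_ext K C \<phi>"
  have lin: "?h \<in> linear_maps K F C" by (rule lin_ext_linear[OF C.module_axioms \<phi>(1)])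
  note l = linear_maps_closed[OF lin] linear_maps_add[OF lin] linear_maps_smult[OF lin]
    linear_maps_zero[OF F_module C.module_axioms lin]
  have base: "?h (e g) = \<phi> g" if "g \<in> carrier G" for g
    by (rule lin_ext_basis[OF C.module_axioms \<phi>(1) that])
  then show "\<forall>g \<in> carrier G. ?h (e g) = \<phi> g" by blast
  show "?h \<in> alg_hom K F C"
  proof (rule alg_homI[OF lin])
    show "?h \<one>\<^bsub>F\<^esub> = \<one>\<^bsub>C\<^esub>" by (simp add: F_simps(3) base \<phi>(2))
    fix f u assume f: "f \<in> carrier F" and u: "u \<in> carrier F"
    show "?h (f \<otimes>\<^bsub>F\<^esub> u) = ?h f \<otimes>\<^bsub>C\<^esub> ?h u"
      using f
    proof (induction rule: F_induct)
      case zero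
      show ?case using u by (simp add: l F_bilinear)
    next
      case (smult k g)
      then have g: "e g \<in> carrier F" by (simp add: e_closed)
      have "?h (e g \<otimes>\<^bsub>F\<^esub> u) = ?h (e g) \<otimes>\<^bsub>C\<^esub> ?h u"
        using u
      proof (induction rule: F_induct)
        case zero
        show ?case using g by (simp add: l F_bilinear)
      next
        case (smult k' g')
        moreover have "\<phi> g \<in> carrier C" "\<phi> g' \<in> carrier C"
          using \<open>g \<in> carrier G\<close> \<open>g' \<in> carrier G\<close> \<phi>(1) by auto
        ultimately show ?case
          using g \<open>g \<in> carrier G\<close>
          by (simp add: l F_bilinear e_closed mult_basis base mult C.smult_mult_right)
      next
        case (add v w)
        then show ?case using g by (simp add: l F_bilinear C.A.r_distr)
      qed
      then show ?case using g u smult by (simp add: l F_bilinear C.smult_mult_left)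
    next
      case (add v w)
      then show ?case using u by (simp add: l F_bilinear C.A.l_distr)
    qed
  qed
qed

end


section \<open>Tensor products\<close>

definition bilinear_maps ::
    "('k, 'r) ring_scheme \<Rightarrow> ('k, 'v, 's) module_scheme \<Rightarrow> ('k, 'w, 't) module_scheme \<Rightarrow>
     ('k, 'c, 'u) module_scheme \<Rightarrow> ('v \<Rightarrow> 'w \<Rightarrow> 'c) set"
  where "bilinear_maps K V W C =
    {\<beta>. (\<forall>v \<in> carrier V. \<beta> v \<in> linear_maps K W C) \<and>
        (\<forall>w \<in> carrier W. (\<lambda>v. \<beta> v w) \<in> linear_maps K V C)}"

lemma bilinear_mapsI:
  assumes "\<And>v w. \<lbrakk>v \<in> carrier V; w \<in> carrier W\<rbrakk> \<Longrightarrow> \<beta> v w \<in> carrier C"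
    and "\<And>v v' w. \<lbrakk>v \<in> carrier V; v' \<in> carrier V; w \<in> carrier W\<rbrakk> \<Longrightarrow>
      \<beta> (v \<oplus>\<^bsub>V\<^esub> v') w = \<beta> v w \<oplus>\<^bsub>C\<^esub> \<beta> v' w"
    and "\<And>v w w'. \<lbrakk>v \<in> carrier V; w \<in> carrier W; w' \<in> carrier W\<rbrakk> \<Longrightarrow>
      \<beta> v (w \<oplus>\<^bsub>W\<^esub> w') = \<beta> v w \<oplus>\<^bsub>C\<^esub> \<beta> v w'"
    and "\<And>k v w. \<lbrakk>k \<in> carrier K; v \<in> carrier V; w \<in> carrier W\<rbrakk> \<Longrightarrow>
      \<beta> (k \<odot>\<^bsub>V\<^esub> v) w = k \<odot>\<^bsub>C\<^esub> \<beta> v w"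
    and "\<And>k v w. \<lbrakk>k \<in> carrier K; v \<in> carrier V; w \<in> carrier W\<rbrakk> \<Longrightarrow>
      \<beta> v (k \<odot>\<^bsub>W\<^esub> w) = k \<odot>\<^bsub>C\<^esub> \<beta> v w"
  shows "\<beta> \<in> bilinear_maps K V W C"
  using assms unfolding bilinear_maps_def by (auto intro!: linear_mapsI)

lemma bilinear_maps_left:
  "\<lbrakk>\<beta> \<in> bilinear_maps K V W C; w \<in> carrier W\<rbrakk> \<Longrightarrow> (\<lambda>v. \<beta> v w) \<in> linear_maps K V C"
  unfolding bilinear_maps_def by blast

lemma bilinear_maps_right:
  "\<lbrakk>\<beta> \<in> bilinear_maps K V W C; v \<in> carrier V\<rbrakk> \<Longrightarrow> \<beta> v \<in> linear_maps K W C"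
  unfolding bilinear_maps_def by blast

lemma bilinear_maps_closed:
  "\<lbrakk>\<beta> \<in> bilinear_maps K V W C; v \<in> carrier V; w \<in> carrier W\<rbrakk> \<Longrightarrow> \<beta> v w \<in> carrier C"
  by (rule linear_maps_closed[OF bilinear_maps_right])

lemmas bilinear_maps_add_left = linear_maps_add[OF bilinear_maps_left]
lemmas bilinear_maps_add_right = linear_maps_add[OF bilinear_maps_right]
lemmas bilinear_maps_smult_left = linear_maps_smult[OF bilinear_maps_left]
lemmas bilinear_maps_smult_right = linear_maps_smult[OF bilinear_maps_right]

lemma bilinear_maps_comp_linear:
  "\<lbrakk>\<beta> \<in> bilinear_maps K V W C; h \<in> linear_maps K C D\<rbrakk> \<Longrightarrow> (\<lambda>v w. h (\<beta> v w)) \<in> bilinear_maps K V W D"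
  by (simp add: bilinear_maps_def linear_maps_comp[of _ K _ C h D])

lemma bilinear_maps_comp:
  assumes "\<beta> \<in> bilinear_maps K V' W' C" "f \<in> linear_maps K V V'" "g \<in> linear_maps K W W'"
  shows "(\<lambda>v w. \<beta> (f v) (g w)) \<in> bilinear_maps K V W C"
  unfolding bilinear_maps_def
proof (intro CollectI conjI ballI)
  show "(\<lambda>w. \<beta> (f v) (g w)) \<in> linear_maps K W C" if "v \<in> carrier V" for v
    by (rule linear_maps_comp[OF assms(3) bilinear_maps_right[OF assms(1) linear_maps_closed[OF assms(2) that]]])
  show "(\<lambda>v. \<beta> (f v) (g w)) \<in> linear_maps K V C" if "w \<in> carrier W" for w
    by (rule linear_maps_comp[OF assms(2) bilinear_maps_left[OF assms(1) linear_maps_closed[OF assms(3) that]]])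
qed

lemma linear_maps_id: "(\<lambda>v. v) \<in> linear_maps K V V"
  unfolding linear_maps_def by auto

text \<open>
  The free module on pairs modulo bilinearity and further relations \<open>E\<close>: with \<open>E = {}\<close> this is
  the tensor product over \<open>K\<close>, and with \<open>E\<close> the balancing relations the one over \<open>A\<close>.
\<close>

locale pairs_quotient = field K + V: module K V + W: module K W
  for K :: "'k ring" (structure)
    and V :: "('k, 'v, 's) module_scheme" and W :: "('k, 'w, 't) module_scheme" +
  fixes E :: "('v \<times> 'w \<Rightarrow> 'k) set"
  assumes E_closed: "E \<subseteq> carrier (pairs K V W)"
begin

sublocale free: free_module K "V \<times>\<times> W" ..

abbreviation F where "F \<equiv> pairs K V W"
abbreviation J where "J \<equiv> lin_span K F (bilinearity K V W \<union> E)"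
abbreviation e where "e \<equiv> basis_elem K"
abbreviation elem where "elem v w \<equiv> J +>\<^bsub>F\<^esub> e (v, w)"

lemmas F_module = free.F_module[folded pairs_def]
lemmas F_induct [consumes 1, case_names zero smult add] = free.F_induct[folded pairs_def]
lemmas linear_maps_F_eqI = free.linear_maps_F_eqI[folded pairs_def]

lemma e_closed: "\<lbrakk>v \<in> carrier V; w \<in> carrier W\<rbrakk> \<Longrightarrow> e (v, w) \<in> carrier F"
  unfolding pairs_def by (rule free.e_closed) simp

lemma relations_closed: "bilinearity K V W \<union> E \<subseteq> carrier F"
proof -
  interpret F: module K F by (rule F_module)
  show ?thesis
    using E_closed unfolding bilinearity_def Let_def by (auto simp: e_closed)
qed

sublocale quot: module_quotient K F J
  by (intro module_quotient.intro F_module submodule_lin_span relations_closed)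

abbreviation Q where "Q \<equiv> quotient_module F J"

lemma cls_eqI:
  assumes "l \<in> carrier F" "r \<in> carrier F" "l \<ominus>\<^bsub>F\<^esub> r \<in> bilinearity K V W \<union> E"
  shows "J +>\<^bsub>F\<^esub> l = J +>\<^bsub>F\<^esub> r"
  using assms lin_span_superset[of "bilinearity K V W \<union> E" K F] by (subst quot.cls_eq_iff) auto

lemma elem_bilinear: "elem \<in> bilinear_maps K V W Q"
proof (rule bilinear_mapsI)
  interpret F: module K F by (rule F_module)
  show "elem v w \<in> carrier Q" if "v \<in> carrier V" "w \<in> carrier W" for v w
    by (rule quot.cls_closed[OF e_closed[OF that]])
  show "elem (v \<oplus>\<^bsub>V\<^esub> v') w = elem v w \<oplus>\<^bsub>Q\<^esub> elem v' w"
    if "v \<in> carrier V" "v' \<in> carrier V" "w \<in> carrier W" for v v' w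
  proof -
    have "elem (v \<oplus>\<^bsub>V\<^esub> v') w = J +>\<^bsub>F\<^esub> (e (v, w) \<oplus>\<^bsub>F\<^esub> e (v', w))"
      by (rule cls_eqI) (use that in \<open>auto simp: e_closed bilinearity_def Let_def\<close>)
    then show ?thesis using that by (simp add: quot.cls_add e_closed)
  qed
  show "elem v (w \<oplus>\<^bsub>W\<^esub> w') = elem v w \<oplus>\<^bsub>Q\<^esub> elem v w'"
    if "v \<in> carrier V" "w \<in> carrier W" "w' \<in> carrier W" for v w w'
  proof -
    have "elem v (w \<oplus>\<^bsub>W\<^esub> w') = J +>\<^bsub>F\<^esub> (e (v, w) \<oplus>\<^bsub>F\<^esub> e (v, w'))"
      by (rule cls_eqI) (use that in \<open>auto simp: e_closed bilinearity_def Let_def\<close>)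
    then show ?thesis using that by (simp add: quot.cls_add e_closed)
  qed
  show "elem (k \<odot>\<^bsub>V\<^esub> v) w = k \<odot>\<^bsub>Q\<^esub> elem v w"
    if "k \<in> carrier K" "v \<in> carrier V" "w \<in> carrier W" for k v w
  proof -
    have "elem (k \<odot>\<^bsub>V\<^esub> v) w = J +>\<^bsub>F\<^esub> (k \<odot>\<^bsub>F\<^esub> e (v, w))"
      by (rule cls_eqI) (use that in \<open>auto simp: e_closed bilinearity_def Let_def\<close>)
    then show ?thesis using that by (simp add: quot.cls_smult e_closed)
  qed
  show "elem v (k \<odot>\<^bsub>W\<^esub> w) = k \<odot>\<^bsub>Q\<^esub> elem v w"
    if "k \<in> carrier K" "v \<in> carrier V" "w \<in> carrier W" for k v w
  proof -
    have "elem v (k \<odot>\<^bsub>W\<^esub> w) = J +>\<^bsub>F\<^esub> (k \<odot>\<^bsub>F\<^esub> e (v, w))"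
      by (rule cls_eqI) (use that in \<open>auto simp: e_closed bilinearity_def Let_def\<close>)
    then show ?thesis using that by (simp add: quot.cls_smult e_closed)
  qed
qed

lemma elem_closed: "\<lbrakk>v \<in> carrier V; w \<in> carrier W\<rbrakk> \<Longrightarrow> elem v w \<in> carrier Q"
  by (rule bilinear_maps_closed[OF elem_bilinear])

lemma Q_induct [consumes 1, case_names elem add]:
  assumes "t \<in> carrier Q"
    and elem: "\<And>v w. \<lbrakk>v \<in> carrier V; w \<in> carrier W\<rbrakk> \<Longrightarrow> P (elem v w)"
    and add: "\<And>t u. \<lbrakk>t \<in> carrier Q; u \<in> carrier Q; P t; P u\<rbrakk> \<Longrightarrow> P (t \<oplus>\<^bsub>Q\<^esub> u)"
  shows "P t"
proof -
  have "P (J +>\<^bsub>F\<^esub> f)" if "f \<in> carrier F" for f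
    using that
  proof (induction rule: F_induct)
    case zero
    have "J +>\<^bsub>F\<^esub> \<zero>\<^bsub>F\<^esub> = \<zero>\<^bsub>Q\<^esub>"
      using quot.cls_zero by (simp add: quotient_module_simps(2))
    also have "\<zero>\<^bsub>Q\<^esub> = elem \<zero>\<^bsub>V\<^esub> \<zero>\<^bsub>W\<^esub>"
      using linear_maps_zero[OF W.module_axioms quot.quotient_module
          bilinear_maps_right[OF elem_bilinear V.M.zero_closed]] by simp
    finally show ?case using elem[of "\<zero>\<^bsub>V\<^esub>" "\<zero>\<^bsub>W\<^esub>"] by simp
  next
    case (smult k g)
    obtain v w where g: "g = (v, w)" "v \<in> carrier V" "w \<in> carrier W" using smult by auto
    have "J +>\<^bsub>F\<^esub> (k \<odot>\<^bsub>F\<^esub> e g) = elem (k \<odot>\<^bsub>V\<^esub> v) w"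
      using quot.cls_smult[OF smult(1) e_closed[OF g(2,3)]] g smult(1)
        bilinear_maps_smult_left[OF elem_bilinear g(3) smult(1) g(2)]
      by simp
    then show ?case using elem[of "k \<odot>\<^bsub>V\<^esub> v" w] g smult(1) by simp
  next
    case (add f h)
    then have fh: "f \<in> carrier F" "h \<in> carrier F" by simp_all
    have "P ((J +>\<^bsub>F\<^esub> f) \<oplus>\<^bsub>Q\<^esub> (J +>\<^bsub>F\<^esub> h))"
      using add by (intro assms(3) quot.cls_closed fh)
    then show ?case
      unfolding quot.cls_add[OF fh] .
  qed
  moreover obtain f where "f \<in> carrier F" "t = J +>\<^bsub>F\<^esub> f"
    using assms(1) unfolding quot.carrier_Q by blast
  ultimately show ?thesis by blast
qed

text \<open>
  A bilinear map \<open>\<beta>\<close> extends linearly to the free module on pairs and kills the bilinearity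
  relations. The hypothesis on \<open>E\<close> speaks of an arbitrary linear \<open>h\<close> that restricts to \<open>\<beta>\<close>,
  since the extension is an internal object of the proof.
\<close>

lemma pairs_lift:
  assumes C: "module K C" and \<beta>: "\<beta> \<in> bilinear_maps K V W C"
    and E: "\<And>f h. \<lbrakk>f \<in> E; h \<in> linear_maps K F C;
      \<And>v w. \<lbrakk>v \<in> carrier V; w \<in> carrier W\<rbrakk> \<Longrightarrow> h (e (v, w)) = \<beta> v w\<rbrakk> \<Longrightarrow> h f = \<zero>\<^bsub>C\<^esub>"
  shows "\<exists>h \<in> linear_maps K Q C. \<forall>v \<in> carrier V. \<forall>w \<in> carrier W. h (elem v w) = \<beta> v w"
proof -
  interpret C: module K C by fact
  interpret F: module K F by (rule F_module)
  let ?\<phi> = "\<lambda>(v, w). \<beta> v w"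
  let ?h = "lin_ext K C ?\<phi>"
  have \<phi>: "?\<phi> \<in> carrier (V \<times>\<times> W) \<rightarrow> carrier C"
    using bilinear_maps_closed[OF \<beta>] by auto
  have lin: "?h \<in> linear_maps K F C"
    unfolding pairs_def by (rule free.lin_ext_linear[OF C \<phi>])
  have base: "?h (e (v, w)) = \<beta> v w" if "v \<in> carrier V" "w \<in> carrier W" for v w
    using free.lin_ext_basis[OF C \<phi>, of "(v, w)"] that by simp
  note l = linear_maps_minus[OF F_module C lin] linear_maps_add[OF lin] linear_maps_smult[OF lin]
  note cl = bilinear_maps_closed[OF \<beta>]
  have mz: "a \<ominus>\<^bsub>C\<^esub> a = \<zero>\<^bsub>C\<^esub>" if "a \<in> carrier C" for a
    using that unfolding a_minus_def by (rule C.M.r_neg)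
  have bil: "?h f = \<zero>\<^bsub>C\<^esub>" if "f \<in> bilinearity K V W" for f
    using that unfolding bilinearity_def Let_def
    by (auto simp: l e_closed base bilinear_maps_add_left[OF \<beta>] bilinear_maps_add_right[OF \<beta>]
        bilinear_maps_smult_left[OF \<beta>] bilinear_maps_smult_right[OF \<beta>] cl mz)
  have "submodule {\<zero>\<^bsub>C\<^esub>} K C"
    by (rule C.submoduleI) auto
  then have ker: "submodule {f \<in> carrier F. ?h f \<in> {\<zero>\<^bsub>C\<^esub>}} K F"
    by (rule submodule_vimage[OF F_module C lin])
  have "J \<subseteq> {f \<in> carrier F. ?h f \<in> {\<zero>\<^bsub>C\<^esub>}}"
    by (rule lin_span_minimal[OF ker]) (use relations_closed bil E[OF _ lin base] in blast)
  then obtain h where "h \<in> linear_maps K Q C" "\<forall>f \<in> carrier F. h (J +>\<^bsub>F\<^esub> f) = ?h f"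
    using quot.quotient_lift[OF C lin] by blast
  then show ?thesis using e_closed base by (intro bexI[of _ h]) auto
qed

end

lemma bilinear_mult:
  assumes "K_algebra K D"
  shows "(\<lambda>a b. a \<otimes>\<^bsub>D\<^esub> b) \<in> bilinear_maps K D D D"
proof -
  interpret D: K_algebra K D by fact
  show ?thesis
    by (rule bilinear_mapsI) (auto simp: D.A.l_distr D.A.r_distr D.smult_mult_left D.smult_mult_right)
qed

locale tensor_product = field K + V: module K V + W: module K W
  for K :: "'k ring" (structure)
    and V :: "('k, 'v, 's) module_scheme" and W :: "('k, 'w, 't) module_scheme"
begin

sublocale pq: pairs_quotient K V W "{}"
  by unfold_locales auto

lemma tensor_eq: "tensor K V W = pq.Q" "tensor_elem K V W = pq.elem"
  unfolding tensor_def tensor_elem_def by (simp_all add: fun_eq_iff)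

lemma tensor_module: "module K (tensor K V W)"
  unfolding tensor_eq by (rule pq.quot.quotient_module)

lemma tensor_elem_bilinear: "tensor_elem K V W \<in> bilinear_maps K V W (tensor K V W)"
  unfolding tensor_eq by (rule pq.elem_bilinear)

lemma tensor_elem_closed:
  "\<lbrakk>v \<in> carrier V; w \<in> carrier W\<rbrakk> \<Longrightarrow> tensor_elem K V W v w \<in> carrier (tensor K V W)"
  by (rule bilinear_maps_closed[OF tensor_elem_bilinear])

lemma tensor_induct [consumes 1, case_names elem add]:
  assumes "t \<in> carrier (tensor K V W)"
    and "\<And>v w. \<lbrakk>v \<in> carrier V; w \<in> carrier W\<rbrakk> \<Longrightarrow> P (tensor_elem K V W v w)"
    and "\<And>t u. \<lbrakk>t \<in> carrier (tensor K V W); u \<in> carrier (tensor K V W); P t; P u\<rbrakk> \<Longrightarrow>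
      P (t \<oplus>\<^bsub>tensor K V W\<^esub> u)"
  shows "P t"
  using assms unfolding tensor_eq by (rule pq.Q_induct)

lemma tensor_lift:
  assumes "module K C" "\<beta> \<in> bilinear_maps K V W C"
  shows "\<exists>h \<in> linear_maps K (tensor K V W) C.
    \<forall>v \<in> carrier V. \<forall>w \<in> carrier W. h (tensor_elem K V W v w) = \<beta> v w"
  unfolding tensor_eq by (rule pq.pairs_lift[OF assms]) simp

end

locale algebra_tensor = V: K_algebra K V + W: K_algebra K W
  for K :: "'k ring" (structure)
    and V :: "('k, 'v, 's) module_scheme" and W :: "('k, 'w, 't) module_scheme"
begin

sublocale tensor_product K V W ..

sublocale ga: group_algebra K "V \<times>\<times> W"
  by (intro group_algebra.intro free_module.intro DirProd_monoid V.K.field_axioms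
      V.A.monoid_axioms W.A.monoid_axioms)

lemmas pairs_algebra = ga.F_K_algebra[folded pairs_def]
lemmas pairs_mult_basis = ga.mult_basis[folded pairs_def]
lemmas pairs_bilinear = ga.F_bilinear[folded pairs_def]
lemmas pairs_one = pq.free.F_simps(3)[folded pairs_def]

text \<open>
  The product of the tensor product of two algebras is that of the pairs modulo a linear span;
  for it to be well defined the span must be a two-sided ideal. It suffices to multiply by a
  basis element, and this is componentwise a pair of linear maps.
\<close>

lemma tensor_ideal: "ideal pq.J pq.F"
proof -
  interpret F: K_algebra K pq.F by (rule pairs_algebra)
  have mulL: "f \<in> carrier pq.F \<Longrightarrow> (\<lambda>h. f \<otimes>\<^bsub>pq.F\<^esub> h) \<in> linear_maps K pq.F pq.F"
    and mulR: "f \<in> carrier pq.F \<Longrightarrow> (\<lambda>h. h \<otimes>\<^bsub>pq.F\<^esub> f) \<in> linear_maps K pq.F pq.F" for f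
    using bilinear_mult[OF pairs_algebra] by (auto dest: bilinear_maps_right bilinear_maps_left)
  note Qm = pq.quot.quotient_module
  have Jsub: "J \<in> pq.J \<Longrightarrow> J \<in> carrier pq.F" for J
    using pq.quot.submoduleE(1)[OF pq.quot.submodule_axioms] by blast
  have basis0: "e' \<otimes>\<^bsub>pq.F\<^esub> j \<in> pq.J \<and> j \<otimes>\<^bsub>pq.F\<^esub> e' \<in> pq.J"
    if j: "j \<in> pq.J" and e': "e' = pq.e (a, b)" "a \<in> carrier V" "b \<in> carrier W" for a b e' j
  proof -
    have ec: "e' \<in> carrier pq.F" using e' pq.e_closed by simp
    have linV: "(\<lambda>v. a \<otimes>\<^bsub>V\<^esub> v) \<in> linear_maps K V V" "(\<lambda>v. v \<otimes>\<^bsub>V\<^esub> a) \<in> linear_maps K V V"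
      using e'(2) bilinear_mult[OF V.K_algebra_axioms]
      by (auto dest: bilinear_maps_right bilinear_maps_left)
    have linW: "(\<lambda>w. b \<otimes>\<^bsub>W\<^esub> w) \<in> linear_maps K W W" "(\<lambda>w. w \<otimes>\<^bsub>W\<^esub> b) \<in> linear_maps K W W"
      using e'(3) bilinear_mult[OF W.K_algebra_axioms]
      by (auto dest: bilinear_maps_right bilinear_maps_left)
    \<comment> \<open>Multiplication by a basis element descends to the quotient, so it preserves the kernel.\<close>
    have key: "m j \<in> pq.J"
      if m: "m \<in> linear_maps K pq.F pq.F"
        and f: "f \<in> linear_maps K V V" and g: "g \<in> linear_maps K W W"
        and mfg: "\<And>v w. \<lbrakk>v \<in> carrier V; w \<in> carrier W\<rbrakk> \<Longrightarrow> m (pq.e (v, w)) = pq.e (f v, g w)"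
      for m f g
    proof -
      obtain h where h: "h \<in> linear_maps K pq.Q pq.Q"
        "\<And>v w. \<lbrakk>v \<in> carrier V; w \<in> carrier W\<rbrakk> \<Longrightarrow> h (pq.elem v w) = pq.elem (f v) (g w)"
        using pq.pairs_lift[OF Qm bilinear_maps_comp[OF pq.elem_bilinear f g]] by auto
      have "pq.quot.cls (m u) = h (pq.quot.cls u)" if "u \<in> carrier pq.F" for u
      proof (rule pq.linear_maps_F_eqI[OF Qm linear_maps_comp[OF m pq.quot.cls_linear]
            linear_maps_comp[OF pq.quot.cls_linear h(1)] _ that])
        show "pq.quot.cls (m (pq.e g)) = h (pq.quot.cls (pq.e g))" if "g \<in> carrier (V \<times>\<times> W)" for g
          using that h(2) mfg by auto
      qed
      then have "pq.quot.cls (m j) = h (pq.quot.cls j)" using Jsub[OF j] .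
      also have "pq.quot.cls j = \<zero>\<^bsub>pq.Q\<^esub>"
        using pq.quot.cls_zero_iff[OF Jsub[OF j]] j by simp
      also have "h \<zero>\<^bsub>pq.Q\<^esub> = \<zero>\<^bsub>pq.Q\<^esub>" by (rule linear_maps_zero[OF Qm Qm h(1)])
      finally show ?thesis
        using pq.quot.cls_zero_iff[OF linear_maps_closed[OF m Jsub[OF j]]] by simp
    qed
    have mb: "pq.e (v, w) \<otimes>\<^bsub>pq.F\<^esub> pq.e (v', w') = pq.e (v \<otimes>\<^bsub>V\<^esub> v', w \<otimes>\<^bsub>W\<^esub> w')"
      if "v \<in> carrier V" "v' \<in> carrier V" "w \<in> carrier W" "w' \<in> carrier W" for v v' w w'
      using pairs_mult_basis[of "(v, w)" "(v', w')"] that by simp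
    show ?thesis
      using key[OF mulL[OF ec] linV(1) linW(1)] key[OF mulR[OF ec] linV(2) linW(2)] e' mb by simp
  qed
  have basis: "pq.e g \<otimes>\<^bsub>pq.F\<^esub> j \<in> pq.J \<and> j \<otimes>\<^bsub>pq.F\<^esub> pq.e g \<in> pq.J"
    if j: "j \<in> pq.J" and g: "g \<in> carrier (V \<times>\<times> W)" for j g
  proof -
    obtain a b where "g = (a, b)" "a \<in> carrier V" "b \<in> carrier W" using g by auto
    then show ?thesis using basis0[OF j refl, of a b] by simp
  qed
  have "f \<otimes>\<^bsub>pq.F\<^esub> j \<in> pq.J \<and> j \<otimes>\<^bsub>pq.F\<^esub> f \<in> pq.J"
    if j: "j \<in> pq.J" and f: "f \<in> carrier pq.F" for f j
    using f
  proof (induction rule: pq.F_induct)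
    case zero
    then show ?case
      using Jsub[OF j] submodule_zero[OF pq.quot.submodule_axioms] by (simp add: pairs_bilinear)
  next
    case (smult k g)
    have "pq.e g \<in> carrier pq.F" using smult(2) pq.e_closed by auto
    moreover have "k \<odot>\<^bsub>pq.F\<^esub> (pq.e g \<otimes>\<^bsub>pq.F\<^esub> j) \<in> pq.J" "k \<odot>\<^bsub>pq.F\<^esub> (j \<otimes>\<^bsub>pq.F\<^esub> pq.e g) \<in> pq.J"
      using basis[OF j smult(2)] pq.quot.submoduleE(4)[OF pq.quot.submodule_axioms smult(1)] by blast+
    ultimately show ?case
      using Jsub[OF j] smult(1) by (simp add: pairs_bilinear)
  next
    case (add u v)
    then show ?case
      using Jsub[OF j] pq.quot.submoduleE(5)[OF pq.quot.submodule_axioms] by (simp add: pairs_bilinear)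
  qed
  then show ?thesis
    using submodule.axioms(1)[OF pq.quot.submodule_axioms]
    by (intro idealI K_algebra_ring[OF pairs_algebra]) auto
qed

abbreviation AE where "AE \<equiv> tensor K V W"
abbreviation ae where "ae \<equiv> tensor_elem K V W"

lemma tensor_K_algebra: "K_algebra K AE"
  unfolding tensor_eq by (rule quotient_K_algebra[OF pairs_algebra tensor_ideal])

lemma tensor_elem_mult:
  assumes "v \<in> carrier V" "v' \<in> carrier V" "w \<in> carrier W" "w' \<in> carrier W"
  shows "ae v w \<otimes>\<^bsub>AE\<^esub> ae v' w' = ae (v \<otimes>\<^bsub>V\<^esub> v') (w \<otimes>\<^bsub>W\<^esub> w')"
proof -
  have "pq.e (v, w) \<otimes>\<^bsub>pq.F\<^esub> pq.e (v', w') = pq.e (v \<otimes>\<^bsub>V\<^esub> v', w \<otimes>\<^bsub>W\<^esub> w')"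
    using pairs_mult_basis[of "(v, w)" "(v', w')"] assms by simp
  then show ?thesis
    unfolding tensor_eq using assms cls_mult[OF tensor_ideal] pq.e_closed by metis
qed

lemma tensor_one: "\<one>\<^bsub>AE\<^esub> = ae \<one>\<^bsub>V\<^esub> \<one>\<^bsub>W\<^esub>"
proof -
  have "\<one>\<^bsub>pq.F\<^esub> = pq.e (\<one>\<^bsub>V\<^esub>, \<one>\<^bsub>W\<^esub>)"
    unfolding pairs_one by simp
  then show ?thesis unfolding tensor_eq quotient_module_simps(3) by simp
qed

lemma tensor_generates: "generates K AE {ae v w | v w. v \<in> carrier V \<and> w \<in> carrier W}"
  unfolding generates_def
proof (intro conjI subsetI)
  fix t assume "t \<in> carrier AE"
  then show "t \<in> alg_span K AE {ae v w | v w. v \<in> carrier V \<and> w \<in> carrier W}"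
    by (induction rule: tensor_induct) (auto intro: alg_span.gen alg_span.add)
qed (auto intro: tensor_elem_closed)

text \<open>
  The commutation of the images is what makes \<open>v \<otimes> w \<mapsto> f v g w\<close> multiplicative.
\<close>

lemma tensor_alg_lift:
  assumes D: "K_algebra K D" and f: "f \<in> alg_hom K V D" and g: "g \<in> alg_hom K W D"
    and comm: "\<And>v w. \<lbrakk>v \<in> carrier V; w \<in> carrier W\<rbrakk> \<Longrightarrow> f v \<otimes>\<^bsub>D\<^esub> g w = g w \<otimes>\<^bsub>D\<^esub> f v"
  shows "\<exists>h \<in> alg_hom K AE D. \<forall>v \<in> carrier V. \<forall>w \<in> carrier W. h (ae v w) = f v \<otimes>\<^bsub>D\<^esub> g w"
proof -
  interpret D: K_algebra K D by fact
  interpret T: K_algebra K AE by (rule tensor_K_algebra)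
  have \<beta>: "(\<lambda>v w. f v \<otimes>\<^bsub>D\<^esub> g w) \<in> bilinear_maps K V W D"
    by (rule bilinear_maps_comp[OF bilinear_mult[OF D] alg_hom_linear[OF f] alg_hom_linear[OF g]])
  then obtain h where h: "h \<in> linear_maps K AE D"
    "\<And>v w. \<lbrakk>v \<in> carrier V; w \<in> carrier W\<rbrakk> \<Longrightarrow> h (ae v w) = f v \<otimes>\<^bsub>D\<^esub> g w"
    using tensor_lift[OF D.module_axioms \<beta>] by auto
  note fc = alg_hom_closed[OF f] and gc = alg_hom_closed[OF g]
  note l = linear_maps_closed[OF h(1)] linear_maps_add[OF h(1)]
  have "h \<in> alg_hom K AE D"
  proof (rule alg_homI[OF h(1)])
    show "h \<one>\<^bsub>AE\<^esub> = \<one>\<^bsub>D\<^esub>"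
      by (simp add: tensor_one h(2) alg_hom_one[OF f] alg_hom_one[OF g])
    fix s t assume s: "s \<in> carrier AE" and t: "t \<in> carrier AE"
    show "h (s \<otimes>\<^bsub>AE\<^esub> t) = h s \<otimes>\<^bsub>D\<^esub> h t"
      using s
    proof (induction rule: tensor_induct)
      case (elem v w)
      note vw = this
      show ?case
        using t
      proof (induction rule: tensor_induct)
        case (elem v' w')
        have "f v \<otimes>\<^bsub>D\<^esub> f v' \<otimes>\<^bsub>D\<^esub> (g w \<otimes>\<^bsub>D\<^esub> g w') = f v \<otimes>\<^bsub>D\<^esub> (f v' \<otimes>\<^bsub>D\<^esub> g w) \<otimes>\<^bsub>D\<^esub> g w'"
          using vw elem fc gc by (simp add: D.A.m_assoc)
        also have "\<dots> = f v \<otimes>\<^bsub>D\<^esub> g w \<otimes>\<^bsub>D\<^esub> (f v' \<otimes>\<^bsub>D\<^esub> g w')"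
          unfolding comm[OF elem(1) vw(2)] using vw elem fc gc by (simp add: D.A.m_assoc)
        finally show ?case
          using vw elem by (simp add: tensor_elem_mult h(2) alg_hom_mult[OF f] alg_hom_mult[OF g])
      next
        case (add t u)
        then show ?case using vw by (simp add: l T.A.r_distr D.A.r_distr tensor_elem_closed)
      qed
    next
      case (add s u)
      then show ?case using t by (simp add: l T.A.l_distr D.A.l_distr)
    qed
  qed
  with h(2) show ?thesis by blast
qed

end


section \<open>Tensor products over the algebra\<close>

context bimodule
begin

lemma lact_linear:
  assumes "a \<in> carrier A"
  shows "(\<lambda>m. a \<triangleright>\<^bsub>M\<^esub> m) \<in> linear_maps K M M"
proof (rule linear_mapsI)
  fix k m assume km: "k \<in> carrier K" "m \<in> carrier M"
  have "a \<triangleright>\<^bsub>M\<^esub> (k \<odot>\<^bsub>M\<^esub> m) = a \<triangleright>\<^bsub>M\<^esub> ((k \<odot>\<^bsub>A\<^esub> \<one>\<^bsub>A\<^esub>) \<triangleright>\<^bsub>M\<^esub> m)"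
    using km by (simp add: smult_lact lact_one)
  also have "\<dots> = (a \<otimes>\<^bsub>A\<^esub> (k \<odot>\<^bsub>A\<^esub> \<one>\<^bsub>A\<^esub>)) \<triangleright>\<^bsub>M\<^esub> m"
    using km assms by (simp add: lact_mult)
  also have "\<dots> = k \<odot>\<^bsub>M\<^esub> (a \<triangleright>\<^bsub>M\<^esub> m)"
    using km assms by (simp add: smult_mult_right smult_lact)
  finally show "a \<triangleright>\<^bsub>M\<^esub> (k \<odot>\<^bsub>M\<^esub> m) = k \<odot>\<^bsub>M\<^esub> (a \<triangleright>\<^bsub>M\<^esub> m)" .
qed (use assms in \<open>auto simp: lact_closed lact_add\<close>)

lemma ract_linear:
  assumes "a \<in> carrier A"
  shows "(\<lambda>m. m \<triangleleft>\<^bsub>M\<^esub> a) \<in> linear_maps K M M"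
proof (rule linear_mapsI)
  fix k m assume km: "k \<in> carrier K" "m \<in> carrier M"
  have "(k \<odot>\<^bsub>M\<^esub> m) \<triangleleft>\<^bsub>M\<^esub> a = (m \<triangleleft>\<^bsub>M\<^esub> (k \<odot>\<^bsub>A\<^esub> \<one>\<^bsub>A\<^esub>)) \<triangleleft>\<^bsub>M\<^esub> a"
    using km by (simp add: smult_ract ract_one)
  also have "\<dots> = m \<triangleleft>\<^bsub>M\<^esub> ((k \<odot>\<^bsub>A\<^esub> \<one>\<^bsub>A\<^esub>) \<otimes>\<^bsub>A\<^esub> a)"
    using km assms by (simp add: ract_mult)
  also have "\<dots> = k \<odot>\<^bsub>M\<^esub> (m \<triangleleft>\<^bsub>M\<^esub> a)"
    using km assms by (simp add: smult_mult_left smult_ract)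
  finally show "(k \<odot>\<^bsub>M\<^esub> m) \<triangleleft>\<^bsub>M\<^esub> a = k \<odot>\<^bsub>M\<^esub> (m \<triangleleft>\<^bsub>M\<^esub> a)" .
qed (use assms in \<open>auto simp: ract_closed ract_add\<close>)

lemma lact_bilinear: "(\<lambda>a m. a \<triangleright>\<^bsub>M\<^esub> m) \<in> bilinear_maps K A M M"
  unfolding bilinear_maps_def
  by (auto intro!: linear_mapsI simp: lact_closed add_lact smult_lact lact_linear)

lemma ract_bilinear: "(\<lambda>m a. m \<triangleleft>\<^bsub>M\<^esub> a) \<in> bilinear_maps K M A M"
  unfolding bilinear_maps_def
  by (auto intro!: linear_mapsI simp: ract_closed add_ract smult_ract ract_linear)

end

locale bimodule_pair = M: bimodule K A M + N: bimodule K A N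
  for K :: "'k ring" (structure) and A :: "('k, 'a) module"
    and M :: "('k, 'a, 'm) bimodule" and N :: "('k, 'a, 'n) bimodule"
begin

abbreviation balancing where
  "balancing \<equiv> {basis_elem K (m \<triangleleft>\<^bsub>M\<^esub> a, n) \<ominus>\<^bsub>pairs K M N\<^esub> basis_elem K (m, a \<triangleright>\<^bsub>N\<^esub> n) | m a n.
     m \<in> carrier M \<and> a \<in> carrier A \<and> n \<in> carrier N}"

sublocale fm: free_module K "M \<times>\<times> N" ..

sublocale pq: pairs_quotient K M N balancing
proof (unfold_locales, safe)
  interpret F: module K "pairs K M N" unfolding pairs_def by (rule fm.F_module)
  have "basis_elem K (m, n) \<in> carrier (pairs K M N)" if "m \<in> carrier M" "n \<in> carrier N" for m n
    using fm.e_closed[of "(m, n)"] that unfolding pairs_def by simp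
  then show "basis_elem K (m \<triangleleft>\<^bsub>M\<^esub> a, n) \<ominus>\<^bsub>pairs K M N\<^esub> basis_elem K (m, a \<triangleright>\<^bsub>N\<^esub> n) \<in> carrier (pairs K M N)"
    if "m \<in> carrier M" "a \<in> carrier A" "n \<in> carrier N" for m a n
    using that by (intro F.minus_closed) (simp_all add: M.ract_closed N.lact_closed)
qed

abbreviation BT where "BT \<equiv> bimodule_tensor K A M N"

lemma balanced_span_eq: "balanced_span K A M N = pq.J"
  unfolding balanced_span_def ..

lemma bimodule_tensor_elem_eq: "bimodule_tensor_elem K A M N = pq.elem"
  unfolding bimodule_tensor_elem_def balanced_span_eq by (rule refl)

lemma BT_simps:
  "carrier BT = carrier pq.Q"
  "t \<oplus>\<^bsub>BT\<^esub> u = t \<oplus>\<^bsub>pq.Q\<^esub> u"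
  "k \<odot>\<^bsub>BT\<^esub> t = k \<odot>\<^bsub>pq.Q\<^esub> t"
  "a \<triangleright>\<^bsub>BT\<^esub> t = (\<Union>f \<in> t. pq.quot.cls (push K (\<lambda>(m, n). (a \<triangleright>\<^bsub>M\<^esub> m, n)) f))"
  "t \<triangleleft>\<^bsub>BT\<^esub> a = (\<Union>f \<in> t. pq.quot.cls (push K (\<lambda>(m, n). (m, n \<triangleleft>\<^bsub>N\<^esub> a)) f))"
  by (simp_all add: bimodule_tensor_def Let_def balanced_span_eq module.defs bimodule.defs)

lemma elem_balanced:
  assumes "m \<in> carrier M" "a \<in> carrier A" "n \<in> carrier N"
  shows "pq.elem (m \<triangleleft>\<^bsub>M\<^esub> a) n = pq.elem m (a \<triangleright>\<^bsub>N\<^esub> n)"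
  by (rule pq.cls_eqI)
     (use assms in \<open>auto simp: pq.e_closed M.ract_closed N.lact_closed\<close>)

text \<open>
  The actions on the tensor product over \<open>A\<close> are defined by pushing representatives along a map
  of pairs. For a pair of linear maps compatible with the balancing, the induced map of the
  quotient given by the universal property agrees with the class of any pushed representative,
  so the union in the definition runs over a single class.
\<close>

lemma push_elem:
  assumes f: "f \<in> linear_maps K M M" and g: "g \<in> linear_maps K N N"
    and bal: "\<And>m a n. \<lbrakk>m \<in> carrier M; a \<in> carrier A; n \<in> carrier N\<rbrakk> \<Longrightarrow>
      pq.elem (f (m \<triangleleft>\<^bsub>M\<^esub> a)) (g n) = pq.elem (f m) (g (a \<triangleright>\<^bsub>N\<^esub> n))"
    and m: "m \<in> carrier M" and n: "n \<in> carrier N"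
  shows "(\<Union>u \<in> pq.elem m n. pq.quot.cls (push K (\<lambda>(m, n). (f m, g n)) u)) = pq.elem (f m) (g n)"
proof -
  let ?\<phi> = "\<lambda>(m, n). (f m, g n)"
  note Qm = pq.quot.quotient_module
  have \<phi>: "?\<phi> \<in> carrier (M \<times>\<times> N) \<rightarrow> carrier (M \<times>\<times> N)"
    using linear_maps_closed[OF f] linear_maps_closed[OF g] by auto
  have push: "push K ?\<phi> \<in> linear_maps K pq.F pq.F"
    using fm.push_linear[OF \<phi>] unfolding pairs_def .
  have push_e: "push K ?\<phi> (pq.e (m, n)) = pq.e (f m, g n)" if "m \<in> carrier M" "n \<in> carrier N" for m n
    using fm.push_basis[of "(m, n)" ?\<phi>] that by simp
  have \<beta>: "(\<lambda>m n. pq.elem (f m) (g n)) \<in> bilinear_maps K M N pq.Q"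
    by (rule bilinear_maps_comp[OF pq.elem_bilinear f g])
  have "h u = \<zero>\<^bsub>pq.Q\<^esub>" if u: "u \<in> balancing" and h: "h \<in> linear_maps K pq.F pq.Q"
    and he: "\<And>m n. \<lbrakk>m \<in> carrier M; n \<in> carrier N\<rbrakk> \<Longrightarrow> h (pq.e (m, n)) = pq.elem (f m) (g n)" for u h
  proof -
    obtain m a n where u: "u = pq.e (m \<triangleleft>\<^bsub>M\<^esub> a, n) \<ominus>\<^bsub>pq.F\<^esub> pq.e (m, a \<triangleright>\<^bsub>N\<^esub> n)"
      and c: "m \<in> carrier M" "a \<in> carrier A" "n \<in> carrier N" using u by blast
    then have c': "m \<triangleleft>\<^bsub>M\<^esub> a \<in> carrier M" "a \<triangleright>\<^bsub>N\<^esub> n \<in> carrier N"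
      by (simp_all add: M.ract_closed N.lact_closed)
    have "h u = h (pq.e (m \<triangleleft>\<^bsub>M\<^esub> a, n)) \<ominus>\<^bsub>pq.Q\<^esub> h (pq.e (m, a \<triangleright>\<^bsub>N\<^esub> n))"
      unfolding u by (rule linear_maps_minus[OF pq.F_module Qm h]) (use c c' pq.e_closed in auto)
    also have "\<dots> = pq.elem (f m) (g (a \<triangleright>\<^bsub>N\<^esub> n)) \<ominus>\<^bsub>pq.Q\<^esub> pq.elem (f m) (g (a \<triangleright>\<^bsub>N\<^esub> n))"
      using c c' he bal by simp
    also have "\<dots> = \<zero>\<^bsub>pq.Q\<^esub>"
      by (rule module_minus_self[OF Qm]) (rule bilinear_maps_closed[OF \<beta> c(1) c'(2)])
    finally show ?thesis .
  qed
  then obtain h where h: "h \<in> linear_maps K pq.Q pq.Q"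
    "\<And>m n. \<lbrakk>m \<in> carrier M; n \<in> carrier N\<rbrakk> \<Longrightarrow> h (pq.elem m n) = pq.elem (f m) (g n)"
    using pq.pairs_lift[OF Qm \<beta>] by blast
  have comm: "pq.quot.cls (push K ?\<phi> u) = h (pq.quot.cls u)" if "u \<in> carrier pq.F" for u
  proof (rule pq.linear_maps_F_eqI[OF Qm linear_maps_comp[OF push pq.quot.cls_linear]
        linear_maps_comp[OF pq.quot.cls_linear h(1)] _ that])
    show "pq.quot.cls (push K ?\<phi> (pq.e r)) = h (pq.quot.cls (pq.e r))" if r: "r \<in> carrier (M \<times>\<times> N)" for r
    proof -
      obtain m' n' where "r = (m', n')" "m' \<in> carrier M" "n' \<in> carrier N" using r by auto
      then show ?thesis using push_e h(2) by simp
    qed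
  qed
  have "pq.quot.cls (push K ?\<phi> u) = pq.elem (f m) (g n)" if u: "u \<in> pq.elem m n" for u
  proof -
    note ec = pq.e_closed[OF m n]
    have uF: "u \<in> carrier pq.F" by (rule pq.quot.a_elemrcos_carrier[OF ec u])
    have "pq.quot.cls u = pq.elem m n"
      using pq.quot.a_repr_independence'[OF u ec] by simp
    then show ?thesis using comm[OF uF] h(2)[OF m n] by simp
  qed
  moreover have "pq.e (m, n) \<in> pq.elem m n"
    using pq.e_closed[OF m n] by (rule pq.quot.a_rcos_self)
  ultimately show ?thesis by blast
qed

lemma lact_elem:
  assumes "a \<in> carrier A" "m \<in> carrier M" "n \<in> carrier N"
  shows "a \<triangleright>\<^bsub>BT\<^esub> pq.elem m n = pq.elem (a \<triangleright>\<^bsub>M\<^esub> m) n"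
  unfolding BT_simps
  by (rule push_elem[OF M.lact_linear[OF assms(1)] linear_maps_id _ assms(2,3)])
     (use assms(1) in \<open>simp add: elem_balanced M.lact_closed flip: M.lact_ract\<close>)

lemma ract_elem:
  assumes "a \<in> carrier A" "m \<in> carrier M" "n \<in> carrier N"
  shows "pq.elem m n \<triangleleft>\<^bsub>BT\<^esub> a = pq.elem m (n \<triangleleft>\<^bsub>N\<^esub> a)"
  unfolding BT_simps
  by (rule push_elem[OF linear_maps_id N.ract_linear[OF assms(1)] _ assms(2,3)])
     (use assms(1) in \<open>simp add: elem_balanced N.ract_closed N.lact_ract\<close>)

lemma regular_simps:
  "carrier (regular_bimodule A) = carrier A"
  "a \<oplus>\<^bsub>regular_bimodule A\<^esub> b = a \<oplus>\<^bsub>A\<^esub> b"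
  "k \<odot>\<^bsub>regular_bimodule A\<^esub> b = k \<odot>\<^bsub>A\<^esub> b"
  "a \<triangleright>\<^bsub>regular_bimodule A\<^esub> b = a \<otimes>\<^bsub>A\<^esub> b"
  "b \<triangleleft>\<^bsub>regular_bimodule A\<^esub> a = b \<otimes>\<^bsub>A\<^esub> a"
  by (simp_all add: regular_bimodule_def module.defs bimodule.defs)

text \<open>
  What is used of an evaluation map is the bilinear pairing it restricts to on elementary
  tensors.
\<close>

lemma pairing:
  assumes "ev \<in> bimodule_maps K A BT (regular_bimodule A)"
  defines "\<beta> \<equiv> \<lambda>m n. ev (bimodule_tensor_elem K A M N m n)"
  shows "\<beta> \<in> bilinear_maps K M N A"
    and "\<lbrakk>m \<in> carrier M; a \<in> carrier A; n \<in> carrier N\<rbrakk> \<Longrightarrow> \<beta> (m \<triangleleft>\<^bsub>M\<^esub> a) n = \<beta> m (a \<triangleright>\<^bsub>N\<^esub> n)"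
    and "\<lbrakk>a \<in> carrier A; m \<in> carrier M; n \<in> carrier N\<rbrakk> \<Longrightarrow> \<beta> (a \<triangleright>\<^bsub>M\<^esub> m) n = a \<otimes>\<^bsub>A\<^esub> \<beta> m n"
    and "\<lbrakk>a \<in> carrier A; m \<in> carrier M; n \<in> carrier N\<rbrakk> \<Longrightarrow> \<beta> m (n \<triangleleft>\<^bsub>N\<^esub> a) = \<beta> m n \<otimes>\<^bsub>A\<^esub> a"
proof -
  have lin: "ev \<in> linear_maps K pq.Q A"
    using assms(1) unfolding bimodule_maps_def linear_maps_def by (simp add: BT_simps regular_simps)
  show "\<beta> \<in> bilinear_maps K M N A"
    unfolding \<beta>_def bimodule_tensor_elem_eq by (rule bilinear_maps_comp_linear[OF pq.elem_bilinear lin])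
  show "\<beta> (m \<triangleleft>\<^bsub>M\<^esub> a) n = \<beta> m (a \<triangleright>\<^bsub>N\<^esub> n)"
    if "m \<in> carrier M" "a \<in> carrier A" "n \<in> carrier N"
    unfolding \<beta>_def bimodule_tensor_elem_eq elem_balanced[OF that] ..
  have ev: "ev (a \<triangleright>\<^bsub>BT\<^esub> t) = a \<otimes>\<^bsub>A\<^esub> ev t" "ev (t \<triangleleft>\<^bsub>BT\<^esub> a) = ev t \<otimes>\<^bsub>A\<^esub> a"
    if "a \<in> carrier A" "t \<in> carrier pq.Q" for a t
    using assms(1) that unfolding bimodule_maps_def by (auto simp: regular_simps BT_simps(1))
  show "\<beta> (a \<triangleright>\<^bsub>M\<^esub> m) n = a \<otimes>\<^bsub>A\<^esub> \<beta> m n" "\<beta> m (n \<triangleleft>\<^bsub>N\<^esub> a) = \<beta> m n \<otimes>\<^bsub>A\<^esub> a"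
    if a: "a \<in> carrier A" and m: "m \<in> carrier M" and n: "n \<in> carrier N"
    unfolding \<beta>_def bimodule_tensor_elem_eq
    using ev[OF a pq.elem_closed[OF m n]] lact_elem[OF a m n] ract_elem[OF a m n] by auto
qed

end


section \<open>Tensor algebras and free products\<close>

locale tensor_alg = field K + V: module K V
  for K :: "'k ring" (structure) and V :: "('k, 'v, 's) module_scheme"
begin

abbreviation word_monoid where
  "word_monoid \<equiv> \<lparr>carrier = lists (carrier V), mult = (@), one = []\<rparr>"

sublocale ga: group_algebra K word_monoid
  by (intro group_algebra.intro free_module.intro field_axioms monoidI) auto

abbreviation FA where "FA \<equiv> free_algebra K (carrier V)"
abbreviation e where "e \<equiv> basis_elem K"

lemmas FA_algebra = ga.F_K_algebra[folded free_algebra_def]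
lemmas FA_induct [consumes 1, case_names zero smult add] = ga.F_induct[folded free_algebra_def]

lemma FA_basis:
  "w \<in> lists (carrier V) \<Longrightarrow> e w \<in> carrier FA"
  "\<lbrakk>w \<in> lists (carrier V); w' \<in> lists (carrier V)\<rbrakk> \<Longrightarrow> e w \<otimes>\<^bsub>FA\<^esub> e w' = e (w @ w')"
  "\<one>\<^bsub>FA\<^esub> = e []"
  using ga.e_closed ga.mult_basis ga.F_simps(3) unfolding free_algebra_def by auto

lemma FA_letter: "v \<in> carrier V \<Longrightarrow> e [v] \<in> carrier FA"
  by (rule FA_basis) simp

text \<open>A word is the product of its letters.\<close>

lemma FA_generates: "generates K FA ((\<lambda>v. e [v]) ` carrier V)"
  unfolding generates_def
proof (intro conjI subsetI)
  let ?S = "(\<lambda>v. e [v]) ` carrier V"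
  interpret FA: K_algebra K FA by (rule FA_algebra)
  have w: "e w \<in> alg_span K FA ?S" if "w \<in> lists (carrier V)" for w
    using that
  proof (induction w)
    case Nil
    show ?case using alg_span.one[of FA K ?S] by (simp add: FA_basis(3))
  next
    case (Cons v w)
    then have "e [v] \<otimes>\<^bsub>FA\<^esub> e w \<in> alg_span K FA ?S"
      by (intro alg_span.mult[OF alg_span.gen]) auto
    then show ?case using Cons by (simp add: FA_basis(2))
  qed
  fix f assume "f \<in> carrier FA"
  then show "f \<in> alg_span K FA ?S"
  proof (induction rule: FA_induct)
    case zero
    have "\<zero>\<^bsub>FA\<^esub> = \<zero> \<odot>\<^bsub>FA\<^esub> \<one>\<^bsub>FA\<^esub>" by simp
    then show ?case using alg_span.smult[OF zero_closed alg_span.one] by metis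
  next
    case (smult k w)
    then show ?case using w by (intro alg_span.smult) auto
  next
    case (add f h)
    then show ?case by (intro alg_span.add)
  qed
qed (auto intro: FA_letter)

sublocale imp: imposed K FA "linearity K V"
proof (intro imposed.intro imposed_axioms.intro FA_algebra)
  interpret FA: K_algebra K FA by (rule FA_algebra)
  show "linearity K V \<subseteq> carrier FA \<times> carrier FA"
    unfolding linearity_def Let_def by (auto simp: FA_letter)
qed

lemma tensor_algebra_K_algebra: "K_algebra K (tensor_algebra K V)"
  unfolding tensor_algebra_def by (rule imp.impose_K_algebra)

lemma tensor_incl_linear: "tensor_incl K V \<in> linear_maps K V (tensor_algebra K V)"
proof (rule linear_mapsI)
  note h = imp.impose_class_hom
  show "tensor_incl K V v \<in> carrier (tensor_algebra K V)" if "v \<in> carrier V" for v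
    unfolding tensor_incl_def tensor_algebra_def using that by (intro alg_hom_closed[OF h] FA_letter)
  show "tensor_incl K V (v \<oplus>\<^bsub>V\<^esub> w) = tensor_incl K V v \<oplus>\<^bsub>tensor_algebra K V\<^esub> tensor_incl K V w"
    if "v \<in> carrier V" "w \<in> carrier V" for v w
  proof -
    have "(e [v \<oplus>\<^bsub>V\<^esub> w], e [v] \<oplus>\<^bsub>FA\<^esub> e [w]) \<in> linearity K V"
      using that unfolding linearity_def Let_def by auto
    from imp.impose_class_eq[OF this] show ?thesis
      unfolding tensor_incl_def tensor_algebra_def using that by (simp add: alg_hom_add[OF h] FA_letter)
  qed
  show "tensor_incl K V (k \<odot>\<^bsub>V\<^esub> v) = k \<odot>\<^bsub>tensor_algebra K V\<^esub> tensor_incl K V v"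
    if "k \<in> carrier K" "v \<in> carrier V" for k v
  proof -
    have "(e [k \<odot>\<^bsub>V\<^esub> v], k \<odot>\<^bsub>FA\<^esub> e [v]) \<in> linearity K V"
      using that unfolding linearity_def Let_def by auto
    from imp.impose_class_eq[OF this] show ?thesis
      unfolding tensor_incl_def tensor_algebra_def using that by (simp add: alg_hom_smult[OF h] FA_letter)
  qed
qed

lemma tensor_algebra_generates: "generates K (tensor_algebra K V) (tensor_incl K V ` carrier V)"
  using imp.impose_generates[OF FA_generates]
  unfolding tensor_incl_def tensor_algebra_def image_image .

text \<open>
  A linear \<open>\<phi>\<close> sends the word \<open>v\<^sub>1 \<dots> v\<^sub>n\<close> to the product of the values \<open>\<phi> v\<^sub>k\<close>; this is a
  homomorphism of the free algebra, and linearity of \<open>\<phi>\<close> is what the relations require.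
\<close>

lemma tensor_algebra_lift:
  assumes C: "K_algebra K C" and \<phi>: "\<phi> \<in> linear_maps K V C"
  shows "\<exists>h \<in> alg_hom K (tensor_algebra K V) C. \<forall>v \<in> carrier V. h (tensor_incl K V v) = \<phi> v"
proof -
  interpret C: K_algebra K C by fact
  interpret FA: K_algebra K FA by (rule FA_algebra)
  note cl = linear_maps_closed[OF \<phi>]
  define W where "W w = foldr (\<lambda>v c. \<phi> v \<otimes>\<^bsub>C\<^esub> c) w \<one>\<^bsub>C\<^esub>" for w
  have W_closed: "W w \<in> carrier C" if "w \<in> lists (carrier V)" for w
    using that unfolding W_def by induction (auto simp: cl)
  have W_app: "W (w @ w') = W w \<otimes>\<^bsub>C\<^esub> W w'"
    if w: "w \<in> lists (carrier V)" and w': "w' \<in> lists (carrier V)" for w w'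
    using w
  proof induction
    case Nil
    show ?case using W_closed[OF w'] by (simp add: W_def)
  next
    case (Cons v w)
    have "W (v # w @ w') = \<phi> v \<otimes>\<^bsub>C\<^esub> W (w @ w')" by (simp add: W_def)
    also have "\<dots> = \<phi> v \<otimes>\<^bsub>C\<^esub> W w \<otimes>\<^bsub>C\<^esub> W w'"
      using Cons W_closed w' by (simp add: cl C.A.m_assoc)
    also have "\<phi> v \<otimes>\<^bsub>C\<^esub> W w = W (v # w)" by (simp add: W_def)
    finally show ?case by simp
  qed
  obtain f where f: "f \<in> alg_hom K FA C" "\<And>w. w \<in> lists (carrier V) \<Longrightarrow> f (e w) = W w"
    using ga.F_alg_lift[OF C, of W] W_closed W_app unfolding free_algebra_def by (auto simp: W_def)
  have fl: "f (e [v]) = \<phi> v" if "v \<in> carrier V" for v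
    using that f(2)[of "[v]"] by (simp add: W_def cl)
  have rel: "f l = f r" if "(l, r) \<in> linearity K V" for l r
    using that unfolding linearity_def Let_def
    by (auto simp: fl FA_letter alg_hom_add[OF f(1)] alg_hom_smult[OF f(1)]
        linear_maps_add[OF \<phi>] linear_maps_smult[OF \<phi>])
  obtain h where "h \<in> alg_hom K (tensor_algebra K V) C"
    "\<forall>a \<in> carrier FA. h (impose_class FA (linearity K V) a) = f a"
    using imp.impose_lift[OF C f(1) rel] unfolding tensor_algebra_def by blast
  then show ?thesis
    using fl FA_letter unfolding tensor_incl_def by (intro bexI[of _ h]) auto
qed

end

locale free_prod = B: K_algebra K B + C: K_algebra K C
  for K :: "'k ring" (structure) and B :: "('k, 'b) module" and C :: "('k, 'c) module"
begin

abbreviation BC where "BC \<equiv> direct_sum B C"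

lemma direct_sum_simps:
  "carrier BC = carrier B \<times> carrier C"
  "\<zero>\<^bsub>BC\<^esub> = (\<zero>\<^bsub>B\<^esub>, \<zero>\<^bsub>C\<^esub>)"
  "(b, c) \<oplus>\<^bsub>BC\<^esub> (b', c') = (b \<oplus>\<^bsub>B\<^esub> b', c \<oplus>\<^bsub>C\<^esub> c')"
  "k \<odot>\<^bsub>BC\<^esub> (b, c) = (k \<odot>\<^bsub>B\<^esub> b, k \<odot>\<^bsub>C\<^esub> c)"
  by (simp_all add: direct_sum_def)

lemma direct_sum_module: "module K BC"
proof (rule moduleI)
  show "cring K" ..
  show "abelian_group BC"
  proof (rule abelian_groupI)
    show "x \<oplus>\<^bsub>BC\<^esub> y \<oplus>\<^bsub>BC\<^esub> z = x \<oplus>\<^bsub>BC\<^esub> (y \<oplus>\<^bsub>BC\<^esub> z)"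
      if "x \<in> carrier BC" "y \<in> carrier BC" "z \<in> carrier BC" for x y z
      using that by (auto simp: direct_sum_simps B.M.a_assoc C.M.a_assoc)
    show "x \<oplus>\<^bsub>BC\<^esub> y = y \<oplus>\<^bsub>BC\<^esub> x" if "x \<in> carrier BC" "y \<in> carrier BC" for x y
      using that by (auto simp: direct_sum_simps B.M.a_comm C.M.a_comm)
    show "\<exists>y\<in>carrier BC. y \<oplus>\<^bsub>BC\<^esub> x = \<zero>\<^bsub>BC\<^esub>" if "x \<in> carrier BC" for x
      using that
      by (intro bexI[of _ "(\<ominus>\<^bsub>B\<^esub> fst x, \<ominus>\<^bsub>C\<^esub> snd x)"])
         (auto simp: direct_sum_simps B.M.l_neg C.M.l_neg)
  qed (auto simp: direct_sum_simps)
qed (auto simp: direct_sum_simps B.smult_l_distr C.smult_l_distr B.smult_r_distr C.smult_r_distr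
    B.smult_assoc1 C.smult_assoc1)

sublocale ta: tensor_alg K BC
  by (intro tensor_alg.intro direct_sum_module B.K.field_axioms)

abbreviation TA where "TA \<equiv> tensor_algebra K BC"
abbreviation i where "i b \<equiv> tensor_incl K BC (b, \<zero>\<^bsub>C\<^esub>)"
abbreviation j where "j c \<equiv> tensor_incl K BC (\<zero>\<^bsub>B\<^esub>, c)"
abbreviation R where "R \<equiv> free_product_relations K B C"
abbreviation FP where "FP \<equiv> free_product K B C"

lemma i_linear: "i \<in> linear_maps K B TA"
  by (rule linear_maps_comp[OF _ ta.tensor_incl_linear])
     (auto intro!: linear_mapsI simp: direct_sum_simps)

lemma j_linear: "j \<in> linear_maps K C TA"
  by (rule linear_maps_comp[OF _ ta.tensor_incl_linear])
     (auto intro!: linear_mapsI simp: direct_sum_simps)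

sublocale imp: imposed K TA R
proof (intro imposed.intro imposed_axioms.intro ta.tensor_algebra_K_algebra)
  interpret TA: K_algebra K TA by (rule ta.tensor_algebra_K_algebra)
  show "R \<subseteq> carrier TA \<times> carrier TA"
    using linear_maps_closed[OF i_linear] linear_maps_closed[OF j_linear]
    unfolding free_product_relations_def Let_def by auto
qed

lemma free_product_K_algebra: "K_algebra K FP"
  unfolding free_product_def by (rule imp.impose_K_algebra)

lemma cls_hom: "impose_class TA R \<in> alg_hom K TA FP"
  unfolding free_product_def by (rule imp.impose_class_hom)

lemma free_inl_hom: "free_inl K B C \<in> alg_hom K B FP"
proof (rule alg_homI)
  note icl = linear_maps_closed[OF i_linear]
  show "free_inl K B C \<in> linear_maps K B FP"
    unfolding free_inl_def by (rule linear_maps_comp[OF i_linear alg_hom_linear[OF cls_hom]])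
  show "free_inl K B C (b \<otimes>\<^bsub>B\<^esub> b') = free_inl K B C b \<otimes>\<^bsub>FP\<^esub> free_inl K B C b'"
    if "b \<in> carrier B" "b' \<in> carrier B" for b b'
  proof -
    have "(i b \<otimes>\<^bsub>TA\<^esub> i b', i (b \<otimes>\<^bsub>B\<^esub> b')) \<in> R"
      using that unfolding free_product_relations_def Let_def by blast
    then show ?thesis
      unfolding free_inl_def using that alg_hom_mult[OF cls_hom] icl imp.impose_class_eq by metis
  qed
  have "(i \<one>\<^bsub>B\<^esub>, \<one>\<^bsub>TA\<^esub>) \<in> R"
    unfolding free_product_relations_def Let_def by blast
  then show "free_inl K B C \<one>\<^bsub>B\<^esub> = \<one>\<^bsub>FP\<^esub>"
    unfolding free_inl_def using alg_hom_one[OF cls_hom] imp.impose_class_eq by metis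
qed

lemma free_inr_hom: "free_inr K B C \<in> alg_hom K C FP"
proof (rule alg_homI)
  note jcl = linear_maps_closed[OF j_linear]
  show "free_inr K B C \<in> linear_maps K C FP"
    unfolding free_inr_def by (rule linear_maps_comp[OF j_linear alg_hom_linear[OF cls_hom]])
  show "free_inr K B C (c \<otimes>\<^bsub>C\<^esub> c') = free_inr K B C c \<otimes>\<^bsub>FP\<^esub> free_inr K B C c'"
    if "c \<in> carrier C" "c' \<in> carrier C" for c c'
  proof -
    have "(j c \<otimes>\<^bsub>TA\<^esub> j c', j (c \<otimes>\<^bsub>C\<^esub> c')) \<in> R"
      using that unfolding free_product_relations_def Let_def by blast
    then show ?thesis
      unfolding free_inr_def using that alg_hom_mult[OF cls_hom] jcl imp.impose_class_eq by metis
  qed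
  have "(j \<one>\<^bsub>C\<^esub>, \<one>\<^bsub>TA\<^esub>) \<in> R"
    unfolding free_product_relations_def Let_def by blast
  then show "free_inr K B C \<one>\<^bsub>C\<^esub> = \<one>\<^bsub>FP\<^esub>"
    unfolding free_inr_def using alg_hom_one[OF cls_hom] imp.impose_class_eq by metis
qed

text \<open>
  The free product is a quotient of the tensor algebra of the direct sum, hence generated by the
  classes of pairs \<open>(b, c) = (b, 0) + (0, c)\<close>.
\<close>

lemma free_product_generates:
  assumes S: "generates K B S" and T: "generates K C T"
  shows "generates K FP (free_inl K B C ` S \<union> free_inr K B C ` T)"
proof (rule generates_trans[OF imp.impose_generates[OF ta.tensor_algebra_generates,
      folded free_product_def]])
  let ?G = "free_inl K B C ` S \<union> free_inr K B C ` T"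
  have sub: "S \<subseteq> carrier B" "T \<subseteq> carrier C" using S T unfolding generates_def by auto
  then show "?G \<subseteq> carrier FP"
    using alg_hom_closed[OF free_inl_hom] alg_hom_closed[OF free_inr_hom] by auto
  show "impose_class TA R ` tensor_incl K BC ` carrier BC \<subseteq> alg_span K FP ?G"
  proof clarify
    fix b c assume "(b, c) \<in> carrier BC"
    then have bc: "b \<in> carrier B" "c \<in> carrier C" by (auto simp: direct_sum_simps)
    have "tensor_incl K BC (b, c) = i b \<oplus>\<^bsub>TA\<^esub> j c"
      using bc linear_maps_add[OF ta.tensor_incl_linear, of "(b, \<zero>\<^bsub>C\<^esub>)" "(\<zero>\<^bsub>B\<^esub>, c)"]
      by (simp add: direct_sum_simps)
    then have eq: "impose_class TA R (tensor_incl K BC (b, c)) = free_inl K B C b \<oplus>\<^bsub>FP\<^esub> free_inr K B C c"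
      unfolding free_inl_def free_inr_def
      using bc linear_maps_closed[OF i_linear] linear_maps_closed[OF j_linear]
      by (simp add: alg_hom_add[OF cls_hom])
    have "free_inl K B C b \<in> alg_span K FP (free_inl K B C ` S)"
      using S bc by (intro alg_hom_image_span[OF B.K_algebra_axioms free_inl_hom]) (auto simp: generates_def)
    moreover have "free_inr K B C c \<in> alg_span K FP (free_inr K B C ` T)"
      using T bc by (intro alg_hom_image_span[OF C.K_algebra_axioms free_inr_hom]) (auto simp: generates_def)
    ultimately show "impose_class TA R (tensor_incl K BC (b, c)) \<in> alg_span K FP ?G"
      unfolding eq
      using alg_span_subset[of "free_inl K B C ` S" K FP ?G] alg_span_subset[of "free_inr K B C ` T" K FP ?G]
      by (intro alg_span.add) (auto intro: alg_span.gen)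
  qed
qed

text \<open>
  The homomorphism is induced by the linear map \<open>(b, c) \<mapsto> f b + g c\<close> on the direct sum; it
  respects the relations because \<open>f\<close> and \<open>g\<close> are unital and multiplicative.
\<close>

lemma free_product_lift:
  assumes D: "K_algebra K D" and f: "f \<in> alg_hom K B D" and g: "g \<in> alg_hom K C D"
  shows "\<exists>h \<in> alg_hom K FP D.
    (\<forall>b \<in> carrier B. h (free_inl K B C b) = f b) \<and> (\<forall>c \<in> carrier C. h (free_inr K B C c) = g c)"
proof -
  interpret D: K_algebra K D by fact
  note fc = alg_hom_closed[OF f] and gc = alg_hom_closed[OF g]
  have "(\<lambda>(b, c). f b \<oplus>\<^bsub>D\<^esub> g c) \<in> linear_maps K BC D"
  proof (rule linear_mapsI)
    show "(case m \<oplus>\<^bsub>BC\<^esub> m' of (b, c) \<Rightarrow> f b \<oplus>\<^bsub>D\<^esub> g c) =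
        (case m of (b, c) \<Rightarrow> f b \<oplus>\<^bsub>D\<^esub> g c) \<oplus>\<^bsub>D\<^esub> (case m' of (b, c) \<Rightarrow> f b \<oplus>\<^bsub>D\<^esub> g c)"
      if "m \<in> carrier BC" "m' \<in> carrier BC" for m m'
      using that
      by (auto simp: direct_sum_simps fc gc alg_hom_add[OF f] alg_hom_add[OF g] D.M.a_ac)
  qed (auto simp: direct_sum_simps fc gc alg_hom_smult[OF f] alg_hom_smult[OF g] D.smult_r_distr)
  then obtain h0 where h0: "h0 \<in> alg_hom K TA D"
    "\<And>b c. \<lbrakk>b \<in> carrier B; c \<in> carrier C\<rbrakk> \<Longrightarrow> h0 (tensor_incl K BC (b, c)) = f b \<oplus>\<^bsub>D\<^esub> g c"
    using ta.tensor_algebra_lift[OF D] by (fastforce simp: direct_sum_simps)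
  have f0: "f \<zero>\<^bsub>B\<^esub> = \<zero>\<^bsub>D\<^esub>" by (rule alg_hom_zero[OF B.K_algebra_axioms D f])
  have g0: "g \<zero>\<^bsub>C\<^esub> = \<zero>\<^bsub>D\<^esub>" by (rule alg_hom_zero[OF C.K_algebra_axioms D g])
  have hi: "h0 (i b) = f b" if "b \<in> carrier B" for b
    using that by (simp add: h0(2) g0 fc)
  have hj: "h0 (j c) = g c" if "c \<in> carrier C" for c
    using that by (simp add: h0(2) f0 gc)
  note icl = linear_maps_closed[OF i_linear] and jcl = linear_maps_closed[OF j_linear]
  have rel: "h0 l = h0 r" if "(l, r) \<in> R" for l r
    using that unfolding free_product_relations_def Let_def
    by (auto simp: alg_hom_mult[OF h0(1)] alg_hom_one[OF h0(1)] icl jcl hi hj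
        alg_hom_mult[OF f] alg_hom_mult[OF g] alg_hom_one[OF f] alg_hom_one[OF g])
  obtain h where "h \<in> alg_hom K FP D" "\<forall>a \<in> carrier TA. h (impose_class TA R a) = h0 a"
    using imp.impose_lift[OF D h0(1) rel] unfolding free_product_def by blast
  then show ?thesis
    using hi hj icl jcl unfolding free_inl_def free_inr_def by (intro bexI[of _ h]) auto
qed

end


section \<open>The calculus and its pairings\<close>

lemma opposite_simps:
  "carrier (opposite A) = carrier A" "a \<oplus>\<^bsub>opposite A\<^esub> b = a \<oplus>\<^bsub>A\<^esub> b" "k \<odot>\<^bsub>opposite A\<^esub> a = k \<odot>\<^bsub>A\<^esub> a"
  "\<zero>\<^bsub>opposite A\<^esub> = \<zero>\<^bsub>A\<^esub>" "\<one>\<^bsub>opposite A\<^esub> = \<one>\<^bsub>A\<^esub>" "a \<otimes>\<^bsub>opposite A\<^esub> b = b \<otimes>\<^bsub>A\<^esub> a"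
  by (simp_all add: opposite_def)

lemma opposite_K_algebra:
  assumes "K_algebra K A"
  shows "K_algebra K (opposite A)"
proof -
  interpret A: K_algebra K A by fact
  have ab: "abelian_group (opposite A)"
    by (rule abelian_groupI)
       (auto simp: opposite_simps A.a_ac intro: A.l_neg bexI[of _ "\<ominus>\<^bsub>A\<^esub> a" for a])
  show ?thesis
  proof (rule K_algebraI)
    show "field K" ..
    show "module K (opposite A)"
      by (rule moduleI)
         (auto simp: opposite_simps ab A.smult_l_distr A.smult_r_distr A.smult_assoc1 intro: A.K.is_cring)
    show "ring (opposite A)"
      by (rule ringI[OF ab]) (auto intro!: monoidI simp: opposite_simps A.A.m_assoc A.A.l_distr A.A.r_distr)
  qed (auto simp: opposite_simps A.smult_mult_left A.smult_mult_right)
qed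

lemma (in abelian_monoid) finsum_swap:
  assumes "finite I" "finite J" "\<And>i j. \<lbrakk>i \<in> I; j \<in> J\<rbrakk> \<Longrightarrow> f i j \<in> carrier G"
  shows "(\<Oplus>i\<in>I. \<Oplus>j\<in>J. f i j) = (\<Oplus>j\<in>J. \<Oplus>i\<in>I. f i j)"
  using assms(1,3)
proof (induction rule: finite_induct)
  case empty
  show ?case using assms(2) by simp
next
  case (insert i I)
  then have "(\<Oplus>j\<in>J. f i j \<oplus> (\<Oplus>i\<in>I. f i j)) = (\<Oplus>j\<in>J. f i j) \<oplus> (\<Oplus>j\<in>J. \<Oplus>i\<in>I. f i j)"
    by (intro finsum_addf) auto
  moreover have "(\<Oplus>j\<in>J. \<Oplus>i\<in>insert i I. f i j) = (\<Oplus>j\<in>J. f i j \<oplus> (\<Oplus>i\<in>I. f i j))"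
    by (rule finsum_cong') (use insert in \<open>auto intro!: finsum_closed\<close>)
  ultimately show ?case
    using insert by (subst finsum_insert) (auto intro!: finsum_closed)
qed

lemma submodule_image:
  assumes "module K M" "module K V" "f \<in> linear_maps K M V"
  shows "submodule (f ` carrier M) K V"
proof -
  interpret M: module K M by fact
  interpret V: module K V by fact
  note l = linear_maps_closed[OF assms(3)]
  show ?thesis
  proof (rule V.submoduleI)
    show "\<zero>\<^bsub>V\<^esub> \<in> f ` carrier M"
      using linear_maps_zero[OF assms] by (intro image_eqI[of _ _ "\<zero>\<^bsub>M\<^esub>"]) auto
    show "\<ominus>\<^bsub>V\<^esub> v \<in> f ` carrier M" if v: "v \<in> f ` carrier M" for v
    proof -
      obtain m where "m \<in> carrier M" "v = f m" using v by blast
      then show ?thesis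
        by (intro image_eqI[of _ _ "\<ominus>\<^bsub>M\<^esub> m"]) (simp_all add: linear_maps_uminus[OF assms])
    qed
    show "v \<oplus>\<^bsub>V\<^esub> w \<in> f ` carrier M" if v: "v \<in> f ` carrier M" "w \<in> f ` carrier M" for v w
    proof -
      obtain m n where "m \<in> carrier M" "v = f m" "n \<in> carrier M" "w = f n" using v by blast
      then show ?thesis
        by (intro image_eqI[of _ _ "m \<oplus>\<^bsub>M\<^esub> n"]) (simp_all add: linear_maps_add[OF assms(3)])
    qed
    show "k \<odot>\<^bsub>V\<^esub> v \<in> f ` carrier M" if k: "k \<in> carrier K" and v: "v \<in> f ` carrier M" for k v
    proof -
      obtain m where "m \<in> carrier M" "v = f m" using v by blast
      then show ?thesis
        using k by (intro image_eqI[of _ _ "k \<odot>\<^bsub>M\<^esub> m"]) (simp_all add: linear_maps_smult[OF assms(3)])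
    qed
  qed (use l in blast)
qed

text \<open>
  A linear map out of \<open>V\<close> may be prescribed on a spanning family \<open>\<beta> r s\<close>, bilinear in \<open>r, s\<close>, as
  soon as it kills those sums of members of the family that vanish in \<open>V\<close>: scalars are absorbed
  into \<open>r\<close>, so plain sums suffice.
\<close>

lemma linear_map_on_family:
  fixes K :: "'k ring" and A :: "('k, 'a, 's) module_scheme"
  assumes K: "field K" and A: "module K A" and V: "module K V" and W: "module K W"
    and \<beta>: "\<beta> \<in> bilinear_maps K A A V" and \<gamma>: "\<gamma> \<in> bilinear_maps K A A W"
    and span: "lin_span K V {\<beta> r s | r s. r \<in> carrier A \<and> s \<in> carrier A} = carrier V"
    and zero: "\<And>N r s. \<lbrakk>r \<in> {..<N::nat} \<rightarrow> carrier A; s \<in> {..<N} \<rightarrow> carrier A;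
      (\<Oplus>\<^bsub>V\<^esub>n\<in>{..<N}. \<beta> (r n) (s n)) = \<zero>\<^bsub>V\<^esub>\<rbrakk> \<Longrightarrow> (\<Oplus>\<^bsub>W\<^esub>n\<in>{..<N}. \<gamma> (r n) (s n)) = \<zero>\<^bsub>W\<^esub>"
  shows "\<exists>h \<in> linear_maps K V W. \<forall>r \<in> carrier A. \<forall>s \<in> carrier A. h (\<beta> r s) = \<gamma> r s"
proof -
  interpret A: module K A by fact
  interpret free: free_module K "A \<times>\<times> A" using K by (rule free_module.intro)
  let ?M = "free.F" and ?e = "\<lambda>r s. basis_elem K (r, s)"
  let ?\<pi> = "lin_ext K V (\<lambda>(r, s). \<beta> r s)" and ?\<psi> = "lin_ext K W (\<lambda>(r, s). \<gamma> r s)"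
  note M = free.F_module
  have \<beta>': "(\<lambda>(r, s). \<beta> r s) \<in> carrier (A \<times>\<times> A) \<rightarrow> carrier V"
    and \<gamma>': "(\<lambda>(r, s). \<gamma> r s) \<in> carrier (A \<times>\<times> A) \<rightarrow> carrier W"
    using bilinear_maps_closed[OF \<beta>] bilinear_maps_closed[OF \<gamma>] by auto
  note \<pi> = free.lin_ext_linear[OF V \<beta>'] and \<psi> = free.lin_ext_linear[OF W \<gamma>']
  have \<pi>e: "?\<pi> (?e r s) = \<beta> r s" and \<psi>e: "?\<psi> (?e r s) = \<gamma> r s"
    if "r \<in> carrier A" "s \<in> carrier A" for r s
    using that free.lin_ext_basis[OF V \<beta>', of "(r, s)"] free.lin_ext_basis[OF W \<gamma>', of "(r, s)"]
    by simp_all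
  have ec: "?e r s \<in> carrier ?M" if "r \<in> carrier A" "s \<in> carrier A" for r s
    using that by (intro free.e_closed) simp
  have "{\<beta> r s | r s. r \<in> carrier A \<and> s \<in> carrier A} \<subseteq> ?\<pi> ` carrier ?M"
  proof clarify
    fix r s assume rs: "r \<in> carrier A" "s \<in> carrier A"
    show "\<beta> r s \<in> ?\<pi> ` carrier ?M"
      using imageI[OF ec[OF rs], of ?\<pi>] unfolding \<pi>e[OF rs] .
  qed
  then have "lin_span K V {\<beta> r s | r s. r \<in> carrier A \<and> s \<in> carrier A} \<subseteq> ?\<pi> ` carrier ?M"
    by (rule lin_span_minimal[OF submodule_image[OF M V \<pi>]])
  then have surj: "?\<pi> ` carrier ?M = carrier V"
    using linear_maps_closed[OF \<pi>] unfolding span by blast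
  have ker: "?\<psi> m = \<zero>\<^bsub>W\<^esub>" if m: "m \<in> carrier ?M" and m0: "?\<pi> m = \<zero>\<^bsub>V\<^esub>" for m
  proof -
    let ?T = "{g. m g \<noteq> \<zero>\<^bsub>K\<^esub>}"
    have T: "finite ?T" "?T \<subseteq> carrier A \<times> carrier A" "\<And>g. m g \<in> carrier K"
      using m by (auto simp: free.F_simps)
    obtain t where t: "bij_betw t {..<card ?T} ?T"
      using ex_bij_betw_nat_finite[OF T(1)] unfolding atLeast0LessThan by blast
    define r where "r n = m (t n) \<odot>\<^bsub>A\<^esub> fst (t n)" for n
    define s where "s n = snd (t n)" for n
    have tA: "t n \<in> carrier A \<times> carrier A" if "n < card ?T" for n
      using bij_betwE[OF t] T(2) that by blast
    have r: "r \<in> {..<card ?T} \<rightarrow> carrier A" and s: "s \<in> {..<card ?T} \<rightarrow> carrier A"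
      using tA T(3) unfolding r_def s_def by (auto simp: mem_Times_iff)
    \<comment> \<open>Coefficients are moved into the first argument, leaving plain sums as in the
      assumption.\<close>
    have absorb: "m (t n) \<odot>\<^bsub>V\<^esub> (case t n of (r, s) \<Rightarrow> \<beta> r s) = \<beta> (r n) (s n)"
      "m (t n) \<odot>\<^bsub>W\<^esub> (case t n of (r, s) \<Rightarrow> \<gamma> r s) = \<gamma> (r n) (s n)" if "n < card ?T" for n
      using tA[OF that] T(3) bilinear_maps_smult_left[OF \<beta>] bilinear_maps_smult_left[OF \<gamma>]
      unfolding r_def s_def by (cases "t n"; simp)+
    have "(\<Oplus>\<^bsub>V\<^esub>n\<in>{..<card ?T}. \<beta> (r n) (s n)) = ?\<pi> m"
      unfolding free.lin_ext_reindex[OF V \<beta>' m t]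
      using r s bilinear_maps_closed[OF \<beta>]
      by (intro abelian_monoid.finsum_cong' abelian_group.axioms module.axioms(2)[OF V])
         (auto simp: absorb(1) Pi_iff)
    then have "(\<Oplus>\<^bsub>W\<^esub>n\<in>{..<card ?T}. \<gamma> (r n) (s n)) = \<zero>\<^bsub>W\<^esub>"
      using m0 by (intro zero r s) simp
    also have "(\<Oplus>\<^bsub>W\<^esub>n\<in>{..<card ?T}. \<gamma> (r n) (s n)) = ?\<psi> m"
      unfolding free.lin_ext_reindex[OF W \<gamma>' m t]
      using r s bilinear_maps_closed[OF \<gamma>]
      by (intro abelian_monoid.finsum_cong' abelian_group.axioms module.axioms(2)[OF W])
         (auto simp: absorb(2) Pi_iff)
    finally show ?thesis .
  qed
  obtain h where h: "h \<in> linear_maps K V W" "\<forall>m \<in> carrier ?M. h (?\<pi> m) = ?\<psi> m"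
    using linear_map_factors[OF M V W \<pi> surj \<psi> ker] by blast
  show ?thesis
  proof (intro bexI[OF _ h(1)] ballI)
    fix r s assume rs: "r \<in> carrier A" "s \<in> carrier A"
    show "h (\<beta> r s) = \<gamma> r s"
      using h(2) ec[OF rs] \<pi>e[OF rs] \<psi>e[OF rs] by metis
  qed
qed

context surjective_calculus
begin

lemma d_closed [simp]: "a \<in> carrier A \<Longrightarrow> d a \<in> carrier \<Omega>"
  by (rule linear_maps_closed[OF d_linear])

lemma d_one: "d \<one>\<^bsub>A\<^esub> = \<zero>\<^bsub>\<Omega>\<^esub>"
proof -
  have "d \<one>\<^bsub>A\<^esub> = d \<one>\<^bsub>A\<^esub> \<oplus>\<^bsub>\<Omega>\<^esub> d \<one>\<^bsub>A\<^esub>"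
    using d_Leibniz[of "\<one>\<^bsub>A\<^esub>" "\<one>\<^bsub>A\<^esub>"] by (simp add: ract_one lact_one)
  then show ?thesis
    by (metis A.one_closed M.M.add.r_cancel_one d_closed)
qed

lemma Omega_left_bilinear: "(\<lambda>r s. r \<triangleright>\<^bsub>\<Omega>\<^esub> d s) \<in> bilinear_maps K A A \<Omega>"
  by (rule bilinear_maps_comp[OF lact_bilinear linear_maps_id d_linear])

lemma Omega_right_bilinear: "(\<lambda>r s. d r \<triangleleft>\<^bsub>\<Omega>\<^esub> s) \<in> bilinear_maps K A A \<Omega>"
  by (rule bilinear_maps_comp[OF ract_bilinear d_linear linear_maps_id])

text \<open>By the Leibniz rule \<open>a db = d(ab) 1 - (da) b\<close>, so the products \<open>(da) b\<close> span as well.\<close>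

lemma Omega_right_span:
  "lin_span K \<Omega> {d r \<triangleleft>\<^bsub>\<Omega>\<^esub> s | r s. r \<in> carrier A \<and> s \<in> carrier A} = carrier \<Omega>"
proof (rule antisym)
  let ?S = "{d r \<triangleleft>\<^bsub>\<Omega>\<^esub> s | r s. r \<in> carrier A \<and> s \<in> carrier A}"
  have S: "?S \<subseteq> carrier \<Omega>" by (auto intro: ract_closed)
  have sub: "submodule (lin_span K \<Omega> ?S) K \<Omega>" by (rule submodule_lin_span[OF M.module_axioms S])
  show "lin_span K \<Omega> ?S \<subseteq> carrier \<Omega>" using M.submoduleE(1)[OF sub] .
  have "a \<triangleright>\<^bsub>\<Omega>\<^esub> d b \<in> lin_span K \<Omega> ?S" if "a \<in> carrier A" "b \<in> carrier A" for a b
  proof -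
    have gen: "d r \<triangleleft>\<^bsub>\<Omega>\<^esub> s \<in> lin_span K \<Omega> ?S" if "r \<in> carrier A" "s \<in> carrier A" for r s
      using lin_span_superset[of ?S K \<Omega>] that by blast
    have "\<ominus>\<^bsub>\<Omega>\<^esub> (d a \<triangleleft>\<^bsub>\<Omega>\<^esub> b) \<oplus>\<^bsub>\<Omega>\<^esub> d (a \<otimes>\<^bsub>A\<^esub> b) \<triangleleft>\<^bsub>\<Omega>\<^esub> \<one>\<^bsub>A\<^esub> = a \<triangleright>\<^bsub>\<Omega>\<^esub> d b"
      using that by (simp add: ract_one d_Leibniz ract_closed lact_closed M.M.r_neg2 M.M.r_neg1)
    moreover have "\<ominus>\<^bsub>\<Omega>\<^esub> (d a \<triangleleft>\<^bsub>\<Omega>\<^esub> b) \<oplus>\<^bsub>\<Omega>\<^esub> d (a \<otimes>\<^bsub>A\<^esub> b) \<triangleleft>\<^bsub>\<Omega>\<^esub> \<one>\<^bsub>A\<^esub> \<in> lin_span K \<Omega> ?S"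
      using that by (intro M.submoduleE(5)[OF sub] M.submoduleE(3)[OF sub] gen) auto
    ultimately show ?thesis by simp
  qed
  then show "carrier \<Omega> \<subseteq> lin_span K \<Omega> ?S"
    unfolding d_surjective[symmetric] by (intro lin_span_minimal[OF sub]) blast
qed

text \<open>
  If the spanning set is stable under scalars, its elements reach everything by sums alone. The
  predicate \<open>P\<close> need not be stable under scalars, so the induction runs on the set of \<open>w\<close> for
  which \<open>P\<close> holds at all multiples \<open>k w\<close>.
\<close>

lemma span_induct:
  assumes "lin_span K \<Omega> S = carrier \<Omega>" "\<And>k w. \<lbrakk>k \<in> carrier K; w \<in> S\<rbrakk> \<Longrightarrow> k \<odot>\<^bsub>\<Omega>\<^esub> w \<in> S"
    and "S \<subseteq> carrier \<Omega>" "S \<noteq> {}"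
    and "\<And>w. w \<in> S \<Longrightarrow> P w"
    and "\<And>v w. \<lbrakk>v \<in> carrier \<Omega>; w \<in> carrier \<Omega>; P v; P w\<rbrakk> \<Longrightarrow> P (v \<oplus>\<^bsub>\<Omega>\<^esub> w)"
    and "w \<in> carrier \<Omega>"
  shows "P w"
proof -
  let ?T = "{w \<in> carrier \<Omega>. \<forall>k \<in> carrier K. P (k \<odot>\<^bsub>\<Omega>\<^esub> w)}"
  have P0: "P \<zero>\<^bsub>\<Omega>\<^esub>"
  proof -
    obtain s where s: "s \<in> S" using assms(4) by blast
    then have "\<zero>\<^bsub>K\<^esub> \<odot>\<^bsub>\<Omega>\<^esub> s = \<zero>\<^bsub>\<Omega>\<^esub>" using assms(3) by (intro M.smult_l_null) blast
    then show ?thesis using assms(2)[of "\<zero>\<^bsub>K\<^esub>" s] assms(5) s by fastforce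
  qed
  have sub: "submodule ?T K \<Omega>"
  proof (rule M.submoduleI)
    show "\<ominus>\<^bsub>\<Omega>\<^esub> v \<in> ?T" if "v \<in> ?T" for v
    proof (safe)
      show "\<ominus>\<^bsub>\<Omega>\<^esub> v \<in> carrier \<Omega>" using that by simp
      fix k assume k: "k \<in> carrier K"
      have "k \<odot>\<^bsub>\<Omega>\<^esub> (\<ominus>\<^bsub>\<Omega>\<^esub> v) = (\<ominus>\<^bsub>K\<^esub> k) \<odot>\<^bsub>\<Omega>\<^esub> v"
        using k that by (simp add: M.smult_l_minus M.smult_r_minus)
      moreover have "\<ominus>\<^bsub>K\<^esub> k \<in> carrier K" using k by simp
      ultimately show "P (k \<odot>\<^bsub>\<Omega>\<^esub> (\<ominus>\<^bsub>\<Omega>\<^esub> v))" using that by simp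
    qed
    show "v \<oplus>\<^bsub>\<Omega>\<^esub> v' \<in> ?T" if "v \<in> ?T" "v' \<in> ?T" for v v'
      using that assms(6) by (simp add: M.smult_r_distr)
    show "k \<odot>\<^bsub>\<Omega>\<^esub> v \<in> ?T" if "k \<in> carrier K" "v \<in> ?T" for k v
      using that by (simp flip: M.smult_assoc1)
  qed (use P0 in auto)
  have "S \<subseteq> ?T" using assms(2,3,5) by blast
  then have "w \<in> ?T" using lin_span_minimal[OF sub, of S] assms(1,7) by blast
  then have "P (\<one>\<^bsub>K\<^esub> \<odot>\<^bsub>\<Omega>\<^esub> w)" by blast
  then show ?thesis using assms(7) by simp
qed

lemma Omega_induct_left [consumes 1, case_names gen add]:
  assumes "w \<in> carrier \<Omega>"
    and gen: "\<And>r s. \<lbrakk>r \<in> carrier A; s \<in> carrier A\<rbrakk> \<Longrightarrow> P (r \<triangleright>\<^bsub>\<Omega>\<^esub> d s)"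
    and add: "\<And>v w. \<lbrakk>v \<in> carrier \<Omega>; w \<in> carrier \<Omega>; P v; P w\<rbrakk> \<Longrightarrow> P (v \<oplus>\<^bsub>\<Omega>\<^esub> w)"
  shows "P w"
proof (rule span_induct[OF d_surjective _ _ _ _ _ assms(1)])
  fix k w assume "k \<in> carrier K" "w \<in> {a \<triangleright>\<^bsub>\<Omega>\<^esub> d b |a b. a \<in> carrier A \<and> b \<in> carrier A}"
  then show "k \<odot>\<^bsub>\<Omega>\<^esub> w \<in> {a \<triangleright>\<^bsub>\<Omega>\<^esub> d b |a b. a \<in> carrier A \<and> b \<in> carrier A}"
    using smult_lact[symmetric] smult_closed by fastforce
qed (use gen add in \<open>auto simp: lact_closed\<close>)

lemma Omega_induct_right [consumes 1, case_names gen add]: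
  assumes "w \<in> carrier \<Omega>"
    and gen: "\<And>r s. \<lbrakk>r \<in> carrier A; s \<in> carrier A\<rbrakk> \<Longrightarrow> P (d r \<triangleleft>\<^bsub>\<Omega>\<^esub> s)"
    and add: "\<And>v w. \<lbrakk>v \<in> carrier \<Omega>; w \<in> carrier \<Omega>; P v; P w\<rbrakk> \<Longrightarrow> P (v \<oplus>\<^bsub>\<Omega>\<^esub> w)"
  shows "P w"
proof (rule span_induct[OF Omega_right_span _ _ _ _ _ assms(1)])
  fix k w assume "k \<in> carrier K" "w \<in> {d r \<triangleleft>\<^bsub>\<Omega>\<^esub> s |r s. r \<in> carrier A \<and> s \<in> carrier A}"
  then show "k \<odot>\<^bsub>\<Omega>\<^esub> w \<in> {d r \<triangleleft>\<^bsub>\<Omega>\<^esub> s |r s. r \<in> carrier A \<and> s \<in> carrier A}"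
    using smult_ract[symmetric] smult_closed d_closed by fastforce
qed (use gen add in \<open>auto simp: ract_closed\<close>)

end

context surjective_calculus
begin

text \<open>
  For a null family the left side and the last sum vanish, hence so does \<open>\<Sum> (dr) s\<close>: the
  condition on a null family is symmetric in the two factors.
\<close>

lemma d_sum_mult:
  assumes r: "r \<in> {..<N::nat} \<rightarrow> carrier A" and s: "s \<in> {..<N} \<rightarrow> carrier A"
  shows "d (\<Oplus>\<^bsub>A\<^esub>m\<in>{..<N}. r m \<otimes>\<^bsub>A\<^esub> s m) =
    (\<Oplus>\<^bsub>\<Omega>\<^esub>m\<in>{..<N}. d (r m) \<triangleleft>\<^bsub>\<Omega>\<^esub> s m) \<oplus>\<^bsub>\<Omega>\<^esub> (\<Oplus>\<^bsub>\<Omega>\<^esub>m\<in>{..<N}. r m \<triangleright>\<^bsub>\<Omega>\<^esub> d (s m))"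
proof -
  have rs: "r m \<in> carrier A" "s m \<in> carrier A" if "m < N" for m using r s that by auto
  have "d (\<Oplus>\<^bsub>A\<^esub>m\<in>{..<N}. r m \<otimes>\<^bsub>A\<^esub> s m) = (\<Oplus>\<^bsub>\<Omega>\<^esub>m\<in>{..<N}. d (r m \<otimes>\<^bsub>A\<^esub> s m))"
    using rs by (intro linear_maps_finsum[OF module_axioms M.module_axioms d_linear]) auto
  also have "\<dots> = (\<Oplus>\<^bsub>\<Omega>\<^esub>m\<in>{..<N}. d (r m) \<triangleleft>\<^bsub>\<Omega>\<^esub> s m \<oplus>\<^bsub>\<Omega>\<^esub> r m \<triangleright>\<^bsub>\<Omega>\<^esub> d (s m))"
    using rs by (intro M.M.finsum_cong') (auto simp: d_Leibniz ract_closed lact_closed)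
  also have "\<dots> = (\<Oplus>\<^bsub>\<Omega>\<^esub>m\<in>{..<N}. d (r m) \<triangleleft>\<^bsub>\<Omega>\<^esub> s m) \<oplus>\<^bsub>\<Omega>\<^esub> (\<Oplus>\<^bsub>\<Omega>\<^esub>m\<in>{..<N}. r m \<triangleright>\<^bsub>\<Omega>\<^esub> d (s m))"
    using rs by (intro M.M.finsum_addf) (auto simp: ract_closed lact_closed)
  finally show ?thesis .
qed

end

context pivotal_calculus
begin

sublocale calculus_data K A \<Omega> d X ev uev .

sublocale xw: bimodule_pair K A X \<Omega> ..
sublocale wx: bimodule_pair K A \<Omega> X ..

lemma ev_bimodule_map: "ev \<in> bimodule_maps K A xw.BT (regular_bimodule A)"
  using duality unfolding duality_def by blast

lemma uev_bimodule_map: "uev \<in> bimodule_maps K A wx.BT (regular_bimodule A)"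
  using uduality unfolding duality_def by blast

lemmas ev_pair_bilinear = xw.pairing(1)[OF ev_bimodule_map, folded ev_pair_def]
lemmas ev_pair_balanced = xw.pairing(2)[OF ev_bimodule_map, folded ev_pair_def]
lemmas ev_pair_ract = xw.pairing(4)[OF ev_bimodule_map, folded ev_pair_def]
lemmas uev_pair_bilinear = wx.pairing(1)[OF uev_bimodule_map, folded uev_pair_def]
lemmas uev_pair_lact = wx.pairing(3)[OF uev_bimodule_map, folded uev_pair_def]

lemmas ev_pair_closed [simp] = bilinear_maps_closed[OF ev_pair_bilinear]
lemmas uev_pair_closed [simp] = bilinear_maps_closed[OF uev_pair_bilinear]

lemma b_in [simp]: "i < p \<Longrightarrow> b i \<in> carrier A" using b_closed by auto
lemma c_in [simp]: "j < q \<Longrightarrow> c j \<in> carrier A" using c_closed by auto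
lemma x_in [simp]: "i < p \<Longrightarrow> x i \<in> carrier X" using duality unfolding duality_def by auto
lemma y_in [simp]: "j < q \<Longrightarrow> y j \<in> carrier X" using uduality unfolding duality_def by auto

lemma zigzag_X: "u \<in> carrier X \<Longrightarrow> (\<Oplus>\<^bsub>X\<^esub>i\<in>{..<p}. ev_pair u (d (b i)) \<triangleright>\<^bsub>X\<^esub> x i) = u"
  using duality unfolding duality_def ev_pair_def by blast

lemma zigzag_Omega: "w \<in> carrier \<Omega> \<Longrightarrow> (\<Oplus>\<^bsub>\<Omega>\<^esub>i\<in>{..<p}. d (b i) \<triangleleft>\<^bsub>\<Omega>\<^esub> ev_pair (x i) w) = w"
  using duality unfolding duality_def ev_pair_def by blast

end


section \<open>Data in an algebra satisfying the two sets of relations\<close>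

text \<open>
  Throughout, an algebra \<open>D\<close> with the images \<open>ia\<close>, \<open>ib\<close> of \<open>A\<close> and its opposite is given, as it
  is needed for a homomorphism out of either algebra.
\<close>

locale envelope_rep =
  pivotal_calculus K A \<Omega> d X coev ev ucoev uev p b x q y c + D: K_algebra K D
  for K :: "'k ring" and A :: "('k, 'a) module" and \<Omega> :: "('k, 'a, 'w) bimodule" and d
    and X :: "('k, 'a, 'x) bimodule" and coev ev ucoev uev p b x q y c
    and D :: "('k, 'e) module" +
  fixes ia ib :: "'a \<Rightarrow> 'e"
  assumes ia_hom: "ia \<in> alg_hom K A D" and ib_hom: "ib \<in> alg_hom K (opposite A) D"
    and ia_ib: "\<lbrakk>r \<in> carrier A; s \<in> carrier A\<rbrakk> \<Longrightarrow> ia r \<otimes>\<^bsub>D\<^esub> ib s = ib s \<otimes>\<^bsub>D\<^esub> ia r"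
begin

abbreviation mul (infixl \<open>\<cdot>\<close> 70) where "u \<cdot> v \<equiv> u \<otimes>\<^bsub>D\<^esub> v"
abbreviation add (infixl \<open>\<^bold>+\<close> 65) where "u \<^bold>+ v \<equiv> u \<oplus>\<^bsub>D\<^esub> v"
abbreviation sub (infixl \<open>\<^bold>-\<close> 65) where "u \<^bold>- v \<equiv> u \<ominus>\<^bsub>D\<^esub> v"
abbreviation comm where "comm u v \<equiv> commutator D u v"

lemma ia_closed [simp]: "r \<in> carrier A \<Longrightarrow> ia r \<in> carrier D"
  by (rule alg_hom_closed[OF ia_hom])

lemma ib_closed [simp]: "r \<in> carrier A \<Longrightarrow> ib r \<in> carrier D"
  using alg_hom_closed[OF ib_hom] by (simp add: opposite_simps)

lemma ia_one [simp]: "ia \<one>\<^bsub>A\<^esub> = \<one>\<^bsub>D\<^esub>" by (rule alg_hom_one[OF ia_hom])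
lemma ib_one [simp]: "ib \<one>\<^bsub>A\<^esub> = \<one>\<^bsub>D\<^esub>" using alg_hom_one[OF ib_hom] by (simp add: opposite_simps)

lemma ia_mult: "\<lbrakk>r \<in> carrier A; s \<in> carrier A\<rbrakk> \<Longrightarrow> ia (r \<otimes>\<^bsub>A\<^esub> s) = ia r \<cdot> ia s"
  by (rule alg_hom_mult[OF ia_hom])

lemma ib_mult: "\<lbrakk>r \<in> carrier A; s \<in> carrier A\<rbrakk> \<Longrightarrow> ib (r \<otimes>\<^bsub>A\<^esub> s) = ib s \<cdot> ib r"
  using alg_hom_mult[OF ib_hom, of s r] by (simp add: opposite_simps)

lemma ia_linear: "ia \<in> linear_maps K A D" by (rule alg_hom_linear[OF ia_hom])

lemma ib_linear: "ib \<in> linear_maps K A D"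
  using alg_hom_linear[OF ib_hom] unfolding linear_maps_def by (simp add: opposite_simps)

lemmas ia_finsum = linear_maps_finsum[OF module_axioms D.module_axioms ia_linear]
lemmas ib_finsum = linear_maps_finsum[OF module_axioms D.module_axioms ib_linear]
lemmas ia_uminus = linear_maps_uminus[OF module_axioms D.module_axioms ia_linear]
lemmas ib_uminus = linear_maps_uminus[OF module_axioms D.module_axioms ib_linear]
lemmas ia_add = linear_maps_add[OF ia_linear]
lemmas ib_add = linear_maps_add[OF ib_linear]

lemma comm_eqI: "\<lbrakk>u \<in> carrier D; v \<in> carrier D; w \<in> carrier D; u \<cdot> v = v \<cdot> u \<^bold>+ w\<rbrakk> \<Longrightarrow> comm u v = w"
  unfolding commutator_def a_minus_def
  by (simp add: D.M.a_comm[of "v \<cdot> u"] D.M.a_assoc D.M.r_neg)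

lemma comm_closed [simp]: "\<lbrakk>u \<in> carrier D; v \<in> carrier D\<rbrakk> \<Longrightarrow> comm u v \<in> carrier D"
  unfolding commutator_def by simp

lemma comm_eq: "\<lbrakk>u \<in> carrier D; v \<in> carrier D\<rbrakk> \<Longrightarrow> v \<cdot> u \<^bold>+ comm u v = u \<cdot> v"
  unfolding commutator_def a_minus_def
  by (simp add: D.M.a_comm[of "u \<cdot> v"] D.M.r_neg2)

end

text \<open>
  The relation for a pair multiplied from both sides is split into one-sided multiplications by
  \<open>ia\<close> and \<open>ib\<close>: these are the cases where three of the four coefficients are \<open>1\<close>, and together
  they give back the general case.
\<close>

locale H_rep = envelope_rep K A \<Omega> d X coev ev ucoev uev p b x q y c D ia ib
  for K :: "'k ring" and A :: "('k, 'a) module" and \<Omega> :: "('k, 'a, 'w) bimodule" and d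
    and X :: "('k, 'a, 'x) bimodule" and coev ev ucoev uev p b x q y c
    and D :: "('k, 'e) module" and ia ib +
  fixes ix :: "'x \<Rightarrow> 'e" and ixw :: "'x \<Rightarrow> 'w \<Rightarrow> 'e" and iwx :: "'w \<Rightarrow> 'x \<Rightarrow> 'e"
  assumes ix_linear: "ix \<in> linear_maps K X D"
    and ixw_bilinear: "ixw \<in> bilinear_maps K X \<Omega> D"
    and iwx_bilinear: "iwx \<in> bilinear_maps K \<Omega> X D"
    and ia_ix: "\<lbrakk>r \<in> carrier A; u \<in> carrier X\<rbrakk> \<Longrightarrow> ia r \<cdot> ix u = ix (r \<triangleright>\<^bsub>X\<^esub> u)"
    and ix_ia: "\<lbrakk>r \<in> carrier A; u \<in> carrier X\<rbrakk> \<Longrightarrow> ix u \<cdot> ia r = ix (u \<triangleleft>\<^bsub>X\<^esub> r) \<^bold>+ ia (ev_pair u (d r))"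
    and ix_ib: "\<lbrakk>r \<in> carrier A; u \<in> carrier X\<rbrakk> \<Longrightarrow> ix u \<cdot> ib r = ib r \<cdot> ix u \<^bold>+ ixw u (d r)"
    and ia_ixw: "\<lbrakk>r \<in> carrier A; u \<in> carrier X; w \<in> carrier \<Omega>\<rbrakk> \<Longrightarrow> ia r \<cdot> ixw u w = ixw (r \<triangleright>\<^bsub>X\<^esub> u) w"
    and ib_ixw: "\<lbrakk>r \<in> carrier A; u \<in> carrier X; w \<in> carrier \<Omega>\<rbrakk> \<Longrightarrow> ib r \<cdot> ixw u w = ixw u (w \<triangleleft>\<^bsub>\<Omega>\<^esub> r)"
    and ixw_ia: "\<lbrakk>r \<in> carrier A; u \<in> carrier X; w \<in> carrier \<Omega>\<rbrakk> \<Longrightarrow> ixw u w \<cdot> ia r = ixw (u \<triangleleft>\<^bsub>X\<^esub> r) w"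
    and ixw_ib: "\<lbrakk>r \<in> carrier A; u \<in> carrier X; w \<in> carrier \<Omega>\<rbrakk> \<Longrightarrow> ixw u w \<cdot> ib r = ixw u (r \<triangleright>\<^bsub>\<Omega>\<^esub> w)"
    and ia_iwx: "\<lbrakk>r \<in> carrier A; u \<in> carrier X; w \<in> carrier \<Omega>\<rbrakk> \<Longrightarrow> ia r \<cdot> iwx w u = iwx (r \<triangleright>\<^bsub>\<Omega>\<^esub> w) u"
    and ib_iwx: "\<lbrakk>r \<in> carrier A; u \<in> carrier X; w \<in> carrier \<Omega>\<rbrakk> \<Longrightarrow> ib r \<cdot> iwx w u = iwx w (u \<triangleleft>\<^bsub>X\<^esub> r)"
    and iwx_ia: "\<lbrakk>r \<in> carrier A; u \<in> carrier X; w \<in> carrier \<Omega>\<rbrakk> \<Longrightarrow> iwx w u \<cdot> ia r = iwx (w \<triangleleft>\<^bsub>\<Omega>\<^esub> r) u"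
    and iwx_ib: "\<lbrakk>r \<in> carrier A; u \<in> carrier X; w \<in> carrier \<Omega>\<rbrakk> \<Longrightarrow> iwx w u \<cdot> ib r = iwx w (r \<triangleright>\<^bsub>X\<^esub> u)"
    and sum_iwx_ixw: "\<lbrakk>u \<in> carrier X; w \<in> carrier \<Omega>\<rbrakk> \<Longrightarrow>
      (\<Oplus>\<^bsub>D\<^esub>i\<in>{..<p}. iwx (d (b i)) u \<cdot> ixw (x i) w) = ib (uev_pair w u)"
    and sum_ixw_iwx: "\<lbrakk>u \<in> carrier X; w \<in> carrier \<Omega>\<rbrakk> \<Longrightarrow>
      (\<Oplus>\<^bsub>D\<^esub>j\<in>{..<q}. ixw u (d (c j)) \<cdot> iwx w (y j)) = ia (ev_pair u w)"
    and sum_ixw_iwx': "\<lbrakk>u \<in> carrier X; w \<in> carrier \<Omega>\<rbrakk> \<Longrightarrow>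
      (\<Oplus>\<^bsub>D\<^esub>j\<in>{..<q}. ixw (y j) w \<cdot> iwx (d (c j)) u) = ib (ev_pair u w)"
    and sum_iwx_ixw': "\<lbrakk>u \<in> carrier X; w \<in> carrier \<Omega>\<rbrakk> \<Longrightarrow>
      (\<Oplus>\<^bsub>D\<^esub>i\<in>{..<p}. iwx w (x i) \<cdot> ixw u (d (b i))) = ia (uev_pair w u)"

locale B_rep = envelope_rep K A \<Omega> d X coev ev ucoev uev p b x q y c D ia ib
  for K :: "'k ring" and A :: "('k, 'a) module" and \<Omega> :: "('k, 'a, 'w) bimodule" and d
    and X :: "('k, 'a, 'x) bimodule" and coev ev ucoev uev p b x q y c
    and D :: "('k, 'e) module" and ia ib +
  fixes ix iy :: "'x \<Rightarrow> 'e"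
  assumes ix_linear: "ix \<in> linear_maps K X D" and iy_linear: "iy \<in> linear_maps K X D"
    and ia_ix: "\<lbrakk>r \<in> carrier A; u \<in> carrier X\<rbrakk> \<Longrightarrow> ia r \<cdot> ix u = ix (r \<triangleright>\<^bsub>X\<^esub> u)"
    and ix_ia: "\<lbrakk>r \<in> carrier A; u \<in> carrier X\<rbrakk> \<Longrightarrow> ix u \<cdot> ia r = ix (u \<triangleleft>\<^bsub>X\<^esub> r) \<^bold>+ ia (ev_pair u (d r))"
    and ib_iy: "\<lbrakk>r \<in> carrier A; u \<in> carrier X\<rbrakk> \<Longrightarrow> ib r \<cdot> iy u = iy (u \<triangleleft>\<^bsub>X\<^esub> r)"
    and iy_ib: "\<lbrakk>r \<in> carrier A; u \<in> carrier X\<rbrakk> \<Longrightarrow> iy u \<cdot> ib r = iy (r \<triangleright>\<^bsub>X\<^esub> u) \<^bold>+ ib (uev_pair (d r) u)"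
    and null_ix: "\<lbrakk>null_family N f g; u \<in> carrier X\<rbrakk> \<Longrightarrow>
      (\<Oplus>\<^bsub>D\<^esub>m\<in>{..<N}. ib (g m) \<cdot> ix u \<cdot> ib (f m)) = \<zero>\<^bsub>D\<^esub>"
    and null_iy: "\<lbrakk>null_family N f g; u \<in> carrier X\<rbrakk> \<Longrightarrow>
      (\<Oplus>\<^bsub>D\<^esub>m\<in>{..<N}. ia (f m) \<cdot> iy u \<cdot> ia (g m)) = \<zero>\<^bsub>D\<^esub>"
    and sum_comm_ix: "u \<in> carrier X \<Longrightarrow> (\<Oplus>\<^bsub>D\<^esub>i\<in>{..<p}. comm (iy u) (ia (b i)) \<cdot> ix (x i)) = iy u"
    and sum_comm_iy: "u \<in> carrier X \<Longrightarrow> (\<Oplus>\<^bsub>D\<^esub>j\<in>{..<q}. comm (ix u) (ib (c j)) \<cdot> iy (y j)) = ix u"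
    and extra1: "\<lbrakk>r \<in> carrier A; u \<in> carrier X\<rbrakk> \<Longrightarrow>
      (\<Oplus>\<^bsub>D\<^esub>j\<in>{..<q}. comm (ix (y j)) (ib r) \<cdot> comm (iy u) (ia (c j))) = ib (ev_pair u (d r))"
    and extra2: "\<lbrakk>r \<in> carrier A; u \<in> carrier X\<rbrakk> \<Longrightarrow>
      (\<Oplus>\<^bsub>D\<^esub>i\<in>{..<p}. comm (iy (x i)) (ia r) \<cdot> comm (ix u) (ib (b i))) = ia (uev_pair (d r) u)"

subsection \<open>Recovering the barred generators from the pairs\<close>

context H_rep
begin

text \<open>
  The only possible choice: the relation recovering the barred \<open>u\<close> from the commutators
  \<open>[bar u, b i]\<close>, combined with \<open>[bar u, a] = (da, u)\<close>, forces this formula.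
\<close>

definition iy where "iy u = (\<Oplus>\<^bsub>D\<^esub>i\<in>{..<p}. iwx (d (b i)) u \<cdot> ix (x i))"

lemma ix_closed [simp]: "u \<in> carrier X \<Longrightarrow> ix u \<in> carrier D"
  by (rule linear_maps_closed[OF ix_linear])
lemma ixw_closed [simp]: "\<lbrakk>u \<in> carrier X; w \<in> carrier \<Omega>\<rbrakk> \<Longrightarrow> ixw u w \<in> carrier D"
  by (rule bilinear_maps_closed[OF ixw_bilinear])
lemma iwx_closed [simp]: "\<lbrakk>u \<in> carrier X; w \<in> carrier \<Omega>\<rbrakk> \<Longrightarrow> iwx w u \<in> carrier D"
  by (rule bilinear_maps_closed[OF iwx_bilinear])

lemma iy_closed [simp]: "u \<in> carrier X \<Longrightarrow> iy u \<in> carrier D"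
  unfolding iy_def by (intro D.M.finsum_closed) auto

lemma iy_linear: "iy \<in> linear_maps K X D"
proof (rule linear_mapsI)
  show "iy u \<in> carrier D" if "u \<in> carrier X" for u using that by simp
  show "iy (u \<oplus>\<^bsub>X\<^esub> v) = iy u \<^bold>+ iy v" if "u \<in> carrier X" "v \<in> carrier X" for u v
  proof -
    have "iy (u \<oplus>\<^bsub>X\<^esub> v) = (\<Oplus>\<^bsub>D\<^esub>i\<in>{..<p}. iwx (d (b i)) u \<cdot> ix (x i) \<^bold>+ iwx (d (b i)) v \<cdot> ix (x i))"
      unfolding iy_def using that
      by (intro D.M.finsum_cong') (auto simp: bilinear_maps_add_right[OF iwx_bilinear] D.A.l_distr)
    also have "\<dots> = iy u \<^bold>+ iy v"
      unfolding iy_def using that by (intro D.M.finsum_addf) auto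
    finally show ?thesis .
  qed
  show "iy (k \<odot>\<^bsub>X\<^esub> u) = k \<odot>\<^bsub>D\<^esub> iy u" if "k \<in> carrier K" "u \<in> carrier X" for k u
  proof -
    have "iy (k \<odot>\<^bsub>X\<^esub> u) = (\<Oplus>\<^bsub>D\<^esub>i\<in>{..<p}. k \<odot>\<^bsub>D\<^esub> (iwx (d (b i)) u \<cdot> ix (x i)))"
      unfolding iy_def using that
      by (intro D.M.finsum_cong')
         (auto simp: bilinear_maps_smult_right[OF iwx_bilinear] D.smult_mult_left)
    also have "\<dots> = k \<odot>\<^bsub>D\<^esub> iy u"
      unfolding iy_def using that by (intro D.finsum_smult_ldistr[symmetric]) auto
    finally show ?thesis .
  qed
qed

lemma ib_iy:
  assumes "r \<in> carrier A" "u \<in> carrier X"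
  shows "ib r \<cdot> iy u = iy (u \<triangleleft>\<^bsub>X\<^esub> r)"
proof -
  have "ib r \<cdot> iy u = (\<Oplus>\<^bsub>D\<^esub>i\<in>{..<p}. ib r \<cdot> (iwx (d (b i)) u \<cdot> ix (x i)))"
    unfolding iy_def using assms by (intro D.A.finsum_rdistr) auto
  also have "\<dots> = iy (u \<triangleleft>\<^bsub>X\<^esub> r)"
    unfolding iy_def using assms
    by (intro D.M.finsum_cong') (auto simp: ib_iwx X.ract_closed simp flip: D.A.m_assoc)
  finally show ?thesis .
qed

text \<open>
  Moving \<open>ib r\<close> past \<open>ix (x i)\<close> produces \<open>ixw (x i) (d r)\<close>, and the sum of the resulting terms
  is evaluated by \<open>sum_iwx_ixw\<close>.
\<close>

lemma iy_ib:
  assumes "r \<in> carrier A" "u \<in> carrier X"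
  shows "iy u \<cdot> ib r = iy (r \<triangleright>\<^bsub>X\<^esub> u) \<^bold>+ ib (uev_pair (d r) u)"
proof -
  have "iy u \<cdot> ib r = (\<Oplus>\<^bsub>D\<^esub>i\<in>{..<p}. iwx (d (b i)) u \<cdot> ix (x i) \<cdot> ib r)"
    unfolding iy_def using assms by (intro D.A.finsum_ldistr) auto
  also have "\<dots> = (\<Oplus>\<^bsub>D\<^esub>i\<in>{..<p}. iwx (d (b i)) (r \<triangleright>\<^bsub>X\<^esub> u) \<cdot> ix (x i) \<^bold>+ iwx (d (b i)) u \<cdot> ixw (x i) (d r))"
  proof (rule D.M.finsum_cong')
    fix i assume "i \<in> {..<p}"
    then have i: "i < p" by simp
    have "iwx (d (b i)) u \<cdot> ix (x i) \<cdot> ib r = iwx (d (b i)) u \<cdot> (ix (x i) \<cdot> ib r)"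
      using assms i by (simp add: D.A.m_assoc)
    also have "\<dots> = iwx (d (b i)) u \<cdot> ib r \<cdot> ix (x i) \<^bold>+ iwx (d (b i)) u \<cdot> ixw (x i) (d r)"
      using assms i by (simp add: ix_ib D.A.r_distr D.A.m_assoc)
    also have "iwx (d (b i)) u \<cdot> ib r = iwx (d (b i)) (r \<triangleright>\<^bsub>X\<^esub> u)"
      using assms i by (simp add: iwx_ib)
    finally show "iwx (d (b i)) u \<cdot> ix (x i) \<cdot> ib r =
        iwx (d (b i)) (r \<triangleright>\<^bsub>X\<^esub> u) \<cdot> ix (x i) \<^bold>+ iwx (d (b i)) u \<cdot> ixw (x i) (d r)" .
  qed (use assms in \<open>auto simp: X.lact_closed\<close>)
  also have "\<dots> = iy (r \<triangleright>\<^bsub>X\<^esub> u) \<^bold>+ (\<Oplus>\<^bsub>D\<^esub>i\<in>{..<p}. iwx (d (b i)) u \<cdot> ixw (x i) (d r))"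
    unfolding iy_def using assms by (intro D.M.finsum_addf) (auto simp: X.lact_closed)
  finally show ?thesis using assms by (simp add: sum_iwx_ixw)
qed

text \<open>
  This is \<open>r coev(1) = coev(1) r\<close>, with \<open>r\<close> moved from the first to the last tensor factor. The
  argument expands \<open>r d(b i)\<close> by one zig-zag identity and contracts the resulting double sum by
  the other.
\<close>

lemma ia_iy:
  assumes r: "r \<in> carrier A" and u: "u \<in> carrier X"
  shows "ia r \<cdot> iy u = (\<Oplus>\<^bsub>D\<^esub>k\<in>{..<p}. iwx (d (b k)) u \<cdot> ix (x k \<triangleleft>\<^bsub>X\<^esub> r))"
proof -
  let ?e = "\<lambda>k i. ev_pair (x k \<triangleleft>\<^bsub>X\<^esub> r) (d (b i))"
  have e: "?e k i \<in> carrier A" if "k < p" "i < p" for k i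
    using that r by (simp add: X.ract_closed)
  have "ia r \<cdot> iy u = (\<Oplus>\<^bsub>D\<^esub>i\<in>{..<p}. ia r \<cdot> (iwx (d (b i)) u \<cdot> ix (x i)))"
    unfolding iy_def using assms by (intro D.A.finsum_rdistr) auto
  also have "\<dots> = (\<Oplus>\<^bsub>D\<^esub>i\<in>{..<p}. \<Oplus>\<^bsub>D\<^esub>k\<in>{..<p}. iwx (d (b k)) u \<cdot> ix (?e k i \<triangleright>\<^bsub>X\<^esub> x i))"
  proof (rule D.M.finsum_cong')
    fix i assume "i \<in> {..<p}"
    then have i: "i < p" by simp
    let ?w = "r \<triangleright>\<^bsub>\<Omega>\<^esub> d (b i)"
    have w: "?w \<in> carrier \<Omega>" using r i by (simp add: lact_closed)
    have "iwx ?w u = iwx (\<Oplus>\<^bsub>\<Omega>\<^esub>k\<in>{..<p}. d (b k) \<triangleleft>\<^bsub>\<Omega>\<^esub> ev_pair (x k) ?w) u"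
      using zigzag_Omega[OF w] by simp
    also have "\<dots> = (\<Oplus>\<^bsub>D\<^esub>k\<in>{..<p}. iwx (d (b k) \<triangleleft>\<^bsub>\<Omega>\<^esub> ev_pair (x k) ?w) u)"
      using w by (intro linear_maps_finsum[OF M.module_axioms D.module_axioms
            bilinear_maps_left[OF iwx_bilinear u]]) (auto simp: ract_closed)
    also have "\<dots> = (\<Oplus>\<^bsub>D\<^esub>k\<in>{..<p}. iwx (d (b k)) u \<cdot> ia (?e k i))"
      using r u w i e by (intro D.M.finsum_cong') (auto simp: iwx_ia ev_pair_balanced)
    finally have "ia r \<cdot> iwx (d (b i)) u = (\<Oplus>\<^bsub>D\<^esub>k\<in>{..<p}. iwx (d (b k)) u \<cdot> ia (?e k i))"
      using r u i by (simp add: ia_iwx)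
    then have "ia r \<cdot> (iwx (d (b i)) u \<cdot> ix (x i)) =
        (\<Oplus>\<^bsub>D\<^esub>k\<in>{..<p}. iwx (d (b k)) u \<cdot> ia (?e k i)) \<cdot> ix (x i)"
      using r u i by (simp flip: D.A.m_assoc)
    also have "\<dots> = (\<Oplus>\<^bsub>D\<^esub>k\<in>{..<p}. iwx (d (b k)) u \<cdot> ia (?e k i) \<cdot> ix (x i))"
      using u i e by (intro D.A.finsum_ldistr) auto
    also have "\<dots> = (\<Oplus>\<^bsub>D\<^esub>k\<in>{..<p}. iwx (d (b k)) u \<cdot> ix (?e k i \<triangleright>\<^bsub>X\<^esub> x i))"
      using u i e by (intro D.M.finsum_cong') (auto simp: D.A.m_assoc ia_ix X.lact_closed)
    finally show "ia r \<cdot> (iwx (d (b i)) u \<cdot> ix (x i)) =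
        (\<Oplus>\<^bsub>D\<^esub>k\<in>{..<p}. iwx (d (b k)) u \<cdot> ix (?e k i \<triangleright>\<^bsub>X\<^esub> x i))" .
  qed (use u e in \<open>auto intro!: D.M.finsum_closed simp: X.lact_closed\<close>)
  also have "\<dots> = (\<Oplus>\<^bsub>D\<^esub>k\<in>{..<p}. \<Oplus>\<^bsub>D\<^esub>i\<in>{..<p}. iwx (d (b k)) u \<cdot> ix (?e k i \<triangleright>\<^bsub>X\<^esub> x i))"
    using u e by (intro D.M.finsum_swap) (auto simp: X.lact_closed)
  also have "\<dots> = (\<Oplus>\<^bsub>D\<^esub>k\<in>{..<p}. iwx (d (b k)) u \<cdot> ix (x k \<triangleleft>\<^bsub>X\<^esub> r))"
  proof (rule D.M.finsum_cong')
    fix k assume "k \<in> {..<p}"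
    then have k: "k < p" by simp
    then have xk: "x k \<triangleleft>\<^bsub>X\<^esub> r \<in> carrier X" using r by (simp add: X.ract_closed)
    have "ix (x k \<triangleleft>\<^bsub>X\<^esub> r) = ix (\<Oplus>\<^bsub>X\<^esub>i\<in>{..<p}. ?e k i \<triangleright>\<^bsub>X\<^esub> x i)"
      using zigzag_X[OF xk] by simp
    also have "\<dots> = (\<Oplus>\<^bsub>D\<^esub>i\<in>{..<p}. ix (?e k i \<triangleright>\<^bsub>X\<^esub> x i))"
      using k e by (intro linear_maps_finsum[OF X.M.module_axioms D.module_axioms ix_linear])
        (auto simp: X.lact_closed)
    finally show "(\<Oplus>\<^bsub>D\<^esub>i\<in>{..<p}. iwx (d (b k)) u \<cdot> ix (?e k i \<triangleright>\<^bsub>X\<^esub> x i)) = iwx (d (b k)) u \<cdot> ix (x k \<triangleleft>\<^bsub>X\<^esub> r)"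
      using u k e by (subst D.A.finsum_rdistr[symmetric]) (auto simp: X.lact_closed)
  qed (use r u in \<open>auto simp: X.ract_closed\<close>)
  finally show ?thesis .
qed

text \<open>
  The product \<open>ix (x k) \<cdot> ia r\<close> splits into \<open>ix (x k r)\<close> and \<open>ia (ev (x k \<otimes> dr))\<close>. The first
  parts sum to \<open>ia r \<cdot> iy u\<close> by the previous lemma, the second parts to \<open>iwx (d r) u\<close> by the
  zig-zag identity for \<open>\<Omega>\<close>. This identification of the pair with a commutator is the heart of
  the translation.
\<close>

lemma iy_ia:
  assumes r: "r \<in> carrier A" and u: "u \<in> carrier X"
  shows "iy u \<cdot> ia r = ia r \<cdot> iy u \<^bold>+ iwx (d r) u"
proof -
  have "iy u \<cdot> ia r = (\<Oplus>\<^bsub>D\<^esub>k\<in>{..<p}. iwx (d (b k)) u \<cdot> ix (x k) \<cdot> ia r)"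
    unfolding iy_def using assms by (intro D.A.finsum_ldistr) auto
  also have "\<dots> = (\<Oplus>\<^bsub>D\<^esub>k\<in>{..<p}. iwx (d (b k)) u \<cdot> ix (x k \<triangleleft>\<^bsub>X\<^esub> r) \<^bold>+
      iwx (d (b k) \<triangleleft>\<^bsub>\<Omega>\<^esub> ev_pair (x k) (d r)) u)"
  proof (rule D.M.finsum_cong')
    fix k assume "k \<in> {..<p}"
    then show "iwx (d (b k)) u \<cdot> ix (x k) \<cdot> ia r = iwx (d (b k)) u \<cdot> ix (x k \<triangleleft>\<^bsub>X\<^esub> r) \<^bold>+
        iwx (d (b k) \<triangleleft>\<^bsub>\<Omega>\<^esub> ev_pair (x k) (d r)) u"
      using r u by (simp add: D.A.m_assoc ix_ia D.A.r_distr X.ract_closed iwx_ia)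
  qed (use r u in \<open>auto simp: X.ract_closed ract_closed\<close>)
  also have "\<dots> = (\<Oplus>\<^bsub>D\<^esub>k\<in>{..<p}. iwx (d (b k)) u \<cdot> ix (x k \<triangleleft>\<^bsub>X\<^esub> r)) \<^bold>+
      (\<Oplus>\<^bsub>D\<^esub>k\<in>{..<p}. iwx (d (b k) \<triangleleft>\<^bsub>\<Omega>\<^esub> ev_pair (x k) (d r)) u)"
    using r u by (intro D.M.finsum_addf) (auto simp: X.ract_closed ract_closed)
  also have "(\<Oplus>\<^bsub>D\<^esub>k\<in>{..<p}. iwx (d (b k) \<triangleleft>\<^bsub>\<Omega>\<^esub> ev_pair (x k) (d r)) u) =
      iwx (\<Oplus>\<^bsub>\<Omega>\<^esub>k\<in>{..<p}. d (b k) \<triangleleft>\<^bsub>\<Omega>\<^esub> ev_pair (x k) (d r)) u"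
    using r by (intro linear_maps_finsum[OF M.module_axioms D.module_axioms
          bilinear_maps_left[OF iwx_bilinear u], symmetric]) (auto simp: ract_closed)
  finally show ?thesis using r by (simp add: ia_iy[OF r u] zigzag_Omega)
qed

lemma comm_iy_ia: "\<lbrakk>r \<in> carrier A; u \<in> carrier X\<rbrakk> \<Longrightarrow> comm (iy u) (ia r) = iwx (d r) u"
  by (rule comm_eqI) (simp_all add: iy_ia)

lemma comm_ix_ib: "\<lbrakk>r \<in> carrier A; u \<in> carrier X\<rbrakk> \<Longrightarrow> comm (ix u) (ib r) = ixw u (d r)"
  by (rule comm_eqI) (simp_all add: ix_ib)

text \<open>
  The sum equals \<open>ib (\<Sum> r s) \<cdot> ix u + ixw u (\<Sum> (dr) s)\<close>, and \<open>\<Sum> (dr) s\<close> vanishes by the Leibniz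
  rule.
\<close>

lemma null_ix:
  assumes null: "null_family N r s" and u: "u \<in> carrier X"
  shows "(\<Oplus>\<^bsub>D\<^esub>m\<in>{..<N}. ib (s m) \<cdot> ix u \<cdot> ib (r m)) = \<zero>\<^bsub>D\<^esub>"
proof -
  have r: "r \<in> {..<N} \<rightarrow> carrier A" and s: "s \<in> {..<N} \<rightarrow> carrier A"
    and z: "(\<Oplus>\<^bsub>A\<^esub>m\<in>{..<N}. r m \<otimes>\<^bsub>A\<^esub> s m) = \<zero>\<^bsub>A\<^esub>" "(\<Oplus>\<^bsub>\<Omega>\<^esub>m\<in>{..<N}. r m \<triangleright>\<^bsub>\<Omega>\<^esub> d (s m)) = \<zero>\<^bsub>\<Omega>\<^esub>"
    using null unfolding null_family_def by auto
  have rs: "r m \<in> carrier A" "s m \<in> carrier A" if "m < N" for m using r s that by auto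
  have sc: "(\<Oplus>\<^bsub>\<Omega>\<^esub>m\<in>{..<N}. d (r m) \<triangleleft>\<^bsub>\<Omega>\<^esub> s m) \<in> carrier \<Omega>"
    using rs by (intro M.M.finsum_closed) (auto simp: ract_closed)
  have z': "(\<Oplus>\<^bsub>\<Omega>\<^esub>m\<in>{..<N}. d (r m) \<triangleleft>\<^bsub>\<Omega>\<^esub> s m) = \<zero>\<^bsub>\<Omega>\<^esub>"
    using d_sum_mult[OF r s] sc unfolding z
    by (simp add: linear_maps_zero[OF module_axioms M.module_axioms d_linear])
  have "(\<Oplus>\<^bsub>D\<^esub>m\<in>{..<N}. ib (s m) \<cdot> ix u \<cdot> ib (r m)) =
      (\<Oplus>\<^bsub>D\<^esub>m\<in>{..<N}. ib (r m \<otimes>\<^bsub>A\<^esub> s m) \<cdot> ix u \<^bold>+ ixw u (d (r m) \<triangleleft>\<^bsub>\<Omega>\<^esub> s m))"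
    using rs u by (intro D.M.finsum_cong')
      (auto simp: D.A.m_assoc ix_ib D.A.r_distr ib_ixw ib_mult ract_closed)
  also have "\<dots> = (\<Oplus>\<^bsub>D\<^esub>m\<in>{..<N}. ib (r m \<otimes>\<^bsub>A\<^esub> s m) \<cdot> ix u) \<^bold>+ (\<Oplus>\<^bsub>D\<^esub>m\<in>{..<N}. ixw u (d (r m) \<triangleleft>\<^bsub>\<Omega>\<^esub> s m))"
    using rs u by (intro D.M.finsum_addf) (auto simp: ract_closed)
  also have "(\<Oplus>\<^bsub>D\<^esub>m\<in>{..<N}. ib (r m \<otimes>\<^bsub>A\<^esub> s m) \<cdot> ix u) = ib (\<Oplus>\<^bsub>A\<^esub>m\<in>{..<N}. r m \<otimes>\<^bsub>A\<^esub> s m) \<cdot> ix u"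
    using rs u by (subst ib_finsum) (auto intro!: D.A.finsum_ldistr[symmetric])
  also have "(\<Oplus>\<^bsub>D\<^esub>m\<in>{..<N}. ixw u (d (r m) \<triangleleft>\<^bsub>\<Omega>\<^esub> s m)) = ixw u (\<Oplus>\<^bsub>\<Omega>\<^esub>m\<in>{..<N}. d (r m) \<triangleleft>\<^bsub>\<Omega>\<^esub> s m)"
    using rs by (intro linear_maps_finsum[OF M.module_axioms D.module_axioms
          bilinear_maps_right[OF ixw_bilinear u], symmetric]) (auto simp: ract_closed)
  finally show ?thesis
    using u unfolding z z'
    by (simp add: linear_maps_zero[OF module_axioms D.module_axioms ib_linear]
        linear_maps_zero[OF M.module_axioms D.module_axioms bilinear_maps_right[OF ixw_bilinear u]])
qed

text \<open>
  The sum equals \<open>ia (\<Sum> r s) \<cdot> iy u + iwx (\<Sum> r ds) u\<close>.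
\<close>

lemma null_iy:
  assumes null: "null_family N r s" and u: "u \<in> carrier X"
  shows "(\<Oplus>\<^bsub>D\<^esub>m\<in>{..<N}. ia (r m) \<cdot> iy u \<cdot> ia (s m)) = \<zero>\<^bsub>D\<^esub>"
proof -
  have r: "r \<in> {..<N} \<rightarrow> carrier A" and s: "s \<in> {..<N} \<rightarrow> carrier A"
    and z: "(\<Oplus>\<^bsub>A\<^esub>m\<in>{..<N}. r m \<otimes>\<^bsub>A\<^esub> s m) = \<zero>\<^bsub>A\<^esub>" "(\<Oplus>\<^bsub>\<Omega>\<^esub>m\<in>{..<N}. r m \<triangleright>\<^bsub>\<Omega>\<^esub> d (s m)) = \<zero>\<^bsub>\<Omega>\<^esub>"
    using null unfolding null_family_def by auto
  have rs: "r m \<in> carrier A" "s m \<in> carrier A" if "m < N" for m using r s that by auto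
  have "(\<Oplus>\<^bsub>D\<^esub>m\<in>{..<N}. ia (r m) \<cdot> iy u \<cdot> ia (s m)) =
      (\<Oplus>\<^bsub>D\<^esub>m\<in>{..<N}. ia (r m \<otimes>\<^bsub>A\<^esub> s m) \<cdot> iy u \<^bold>+ iwx (r m \<triangleright>\<^bsub>\<Omega>\<^esub> d (s m)) u)"
    using rs u by (intro D.M.finsum_cong')
      (auto simp: D.A.m_assoc iy_ia D.A.r_distr ia_iwx ia_mult lact_closed)
  also have "\<dots> = (\<Oplus>\<^bsub>D\<^esub>m\<in>{..<N}. ia (r m \<otimes>\<^bsub>A\<^esub> s m) \<cdot> iy u) \<^bold>+ (\<Oplus>\<^bsub>D\<^esub>m\<in>{..<N}. iwx (r m \<triangleright>\<^bsub>\<Omega>\<^esub> d (s m)) u)"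
    using rs u by (intro D.M.finsum_addf) (auto simp: lact_closed)
  also have "(\<Oplus>\<^bsub>D\<^esub>m\<in>{..<N}. ia (r m \<otimes>\<^bsub>A\<^esub> s m) \<cdot> iy u) = ia (\<Oplus>\<^bsub>A\<^esub>m\<in>{..<N}. r m \<otimes>\<^bsub>A\<^esub> s m) \<cdot> iy u"
    using rs u by (subst ia_finsum) (auto intro!: D.A.finsum_ldistr[symmetric])
  also have "(\<Oplus>\<^bsub>D\<^esub>m\<in>{..<N}. iwx (r m \<triangleright>\<^bsub>\<Omega>\<^esub> d (s m)) u) = iwx (\<Oplus>\<^bsub>\<Omega>\<^esub>m\<in>{..<N}. r m \<triangleright>\<^bsub>\<Omega>\<^esub> d (s m)) u"
    using rs by (intro linear_maps_finsum[OF M.module_axioms D.module_axioms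
          bilinear_maps_left[OF iwx_bilinear u], symmetric]) (auto simp: lact_closed)
  finally show ?thesis
    using u unfolding z
    by (simp add: linear_maps_zero[OF module_axioms D.module_axioms ia_linear]
        linear_maps_zero[OF M.module_axioms D.module_axioms bilinear_maps_left[OF iwx_bilinear u]])
qed

text \<open>
  After inserting the definition of \<open>iy\<close> the sum over \<open>j\<close> is evaluated by \<open>sum_ixw_iwx\<close>; what
  remains is the zig-zag identity for \<open>X\<close>.
\<close>

lemma sum_comm_iy:
  assumes u: "u \<in> carrier X"
  shows "(\<Oplus>\<^bsub>D\<^esub>j\<in>{..<q}. comm (ix u) (ib (c j)) \<cdot> iy (y j)) = ix u"
proof -
  have "(\<Oplus>\<^bsub>D\<^esub>j\<in>{..<q}. comm (ix u) (ib (c j)) \<cdot> iy (y j)) =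
      (\<Oplus>\<^bsub>D\<^esub>j\<in>{..<q}. \<Oplus>\<^bsub>D\<^esub>i\<in>{..<p}. ixw u (d (c j)) \<cdot> iwx (d (b i)) (y j) \<cdot> ix (x i))"
  proof (rule D.M.finsum_cong')
    fix j assume "j \<in> {..<q}"
    then show "comm (ix u) (ib (c j)) \<cdot> iy (y j) =
        (\<Oplus>\<^bsub>D\<^esub>i\<in>{..<p}. ixw u (d (c j)) \<cdot> iwx (d (b i)) (y j) \<cdot> ix (x i))"
      unfolding iy_def using u
      by (simp add: comm_ix_ib) (subst D.A.finsum_rdistr, auto intro!: D.M.finsum_cong' simp: D.A.m_assoc)
  qed (use u in \<open>auto intro!: D.M.finsum_closed\<close>)
  also have "\<dots> = (\<Oplus>\<^bsub>D\<^esub>i\<in>{..<p}. \<Oplus>\<^bsub>D\<^esub>j\<in>{..<q}. ixw u (d (c j)) \<cdot> iwx (d (b i)) (y j) \<cdot> ix (x i))"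
    using u by (intro D.M.finsum_swap) auto
  also have "\<dots> = (\<Oplus>\<^bsub>D\<^esub>i\<in>{..<p}. ix (ev_pair u (d (b i)) \<triangleright>\<^bsub>X\<^esub> x i))"
  proof (rule D.M.finsum_cong')
    fix i assume "i \<in> {..<p}"
    then have i: "i < p" by simp
    have "(\<Oplus>\<^bsub>D\<^esub>j\<in>{..<q}. ixw u (d (c j)) \<cdot> iwx (d (b i)) (y j) \<cdot> ix (x i)) =
        (\<Oplus>\<^bsub>D\<^esub>j\<in>{..<q}. ixw u (d (c j)) \<cdot> iwx (d (b i)) (y j)) \<cdot> ix (x i)"
      using u i by (intro D.A.finsum_ldistr[symmetric]) auto
    then show "(\<Oplus>\<^bsub>D\<^esub>j\<in>{..<q}. ixw u (d (c j)) \<cdot> iwx (d (b i)) (y j) \<cdot> ix (x i)) =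
        ix (ev_pair u (d (b i)) \<triangleright>\<^bsub>X\<^esub> x i)"
      using u i by (simp add: sum_ixw_iwx ia_ix)
  qed (use u in \<open>auto simp: X.lact_closed\<close>)
  also have "\<dots> = ix (\<Oplus>\<^bsub>X\<^esub>i\<in>{..<p}. ev_pair u (d (b i)) \<triangleright>\<^bsub>X\<^esub> x i)"
    using u by (intro linear_maps_finsum[OF X.M.module_axioms D.module_axioms ix_linear, symmetric])
      (auto simp: X.lact_closed)
  finally show ?thesis using zigzag_X[OF u] by simp
qed

text \<open>
  As \<open>iwx (d r) u\<close> and \<open>ixw u (d r)\<close> are commutators, the two additional relations are
  \<open>sum_ixw_iwx'\<close> and \<open>sum_iwx_ixw'\<close> at the exact form \<open>w = d r\<close>.
\<close>

theorem H_rep_imp_B_rep: "B_rep K A \<Omega> d X coev ev ucoev uev p b x q y c D ia ib ix iy"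
proof unfold_locales
  show "(\<Oplus>\<^bsub>D\<^esub>i\<in>{..<p}. comm (iy u) (ia (b i)) \<cdot> ix (x i)) = iy u" if "u \<in> carrier X" for u
    unfolding iy_def[of u] using that
    by (intro D.M.finsum_cong') (auto simp: comm_iy_ia simp flip: iy_def)
  show "(\<Oplus>\<^bsub>D\<^esub>j\<in>{..<q}. comm (ix (y j)) (ib r) \<cdot> comm (iy u) (ia (c j))) = ib (ev_pair u (d r))"
    if "r \<in> carrier A" "u \<in> carrier X" for r u
  proof -
    have "(\<Oplus>\<^bsub>D\<^esub>j\<in>{..<q}. comm (ix (y j)) (ib r) \<cdot> comm (iy u) (ia (c j))) =
        (\<Oplus>\<^bsub>D\<^esub>j\<in>{..<q}. ixw (y j) (d r) \<cdot> iwx (d (c j)) u)"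
      using that by (intro D.M.finsum_cong') (auto simp: comm_iy_ia comm_ix_ib)
    then show ?thesis using that by (simp add: sum_ixw_iwx')
  qed
  show "(\<Oplus>\<^bsub>D\<^esub>i\<in>{..<p}. comm (iy (x i)) (ia r) \<cdot> comm (ix u) (ib (b i))) = ia (uev_pair (d r) u)"
    if "r \<in> carrier A" "u \<in> carrier X" for r u
  proof -
    have "(\<Oplus>\<^bsub>D\<^esub>i\<in>{..<p}. comm (iy (x i)) (ia r) \<cdot> comm (ix u) (ib (b i))) =
        (\<Oplus>\<^bsub>D\<^esub>i\<in>{..<p}. iwx (d r) (x i) \<cdot> ixw u (d (b i)))"
      using that by (intro D.M.finsum_cong') (auto simp: comm_iy_ia comm_ix_ib)
    then show ?thesis using that by (simp add: sum_iwx_ixw')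
  qed
qed (simp_all add: ix_linear iy_linear ia_ix ix_ia ib_iy iy_ib null_ix null_iy sum_comm_iy)

end


subsection \<open>Recovering the pairs as commutators\<close>

lemma bilinear_maps_flip: "\<beta> \<in> bilinear_maps K V W C \<Longrightarrow> (\<lambda>w v. \<beta> v w) \<in> bilinear_maps K W V C"
  unfolding bilinear_maps_def by simp

lemma commutator_bilinear:
  assumes "K_algebra K D"
  shows "commutator D \<in> bilinear_maps K D D D"
proof -
  interpret D: K_algebra K D by fact
  show ?thesis
    by (rule bilinear_mapsI)
       (auto simp: commutator_def a_minus_def D.A.l_distr D.A.r_distr D.smult_mult_left
         D.smult_mult_right D.smult_r_distr D.smult_r_minus D.M.minus_add D.M.a_ac)
qed

context envelope_rep
begin

lemmas comm_bilinear = commutator_bilinear[OF D.K_algebra_axioms]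

text \<open>
  Commutation with \<open>u\<close> is a derivation; this mirrors the Leibniz rule for \<open>d\<close> and makes the
  prescriptions below compatible with both actions of \<open>A\<close> on \<open>\<Omega>\<close>.
\<close>

lemma comm_Leibniz:
  "\<lbrakk>u \<in> carrier D; v \<in> carrier D; w \<in> carrier D\<rbrakk> \<Longrightarrow> comm u v \<cdot> w \<^bold>+ v \<cdot> comm u w = comm u (v \<cdot> w)"
  unfolding commutator_def a_minus_def
  by (simp add: D.A.l_distr D.A.r_distr D.A.l_minus D.A.r_minus D.A.m_assoc D.M.a_ac D.M.r_neg D.M.r_neg1 D.M.r_neg2)

lemma mult_comm_left:
  "\<lbrakk>a \<in> carrier D; u \<in> carrier D; v \<in> carrier D; a \<cdot> v = v \<cdot> a\<rbrakk> \<Longrightarrow> a \<cdot> comm u v = comm (a \<cdot> u) v"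
  unfolding commutator_def a_minus_def
  by (simp add: D.A.r_distr D.A.r_minus flip: D.A.m_assoc)

lemma mult_comm_right:
  "\<lbrakk>a \<in> carrier D; u \<in> carrier D; v \<in> carrier D; a \<cdot> v = v \<cdot> a\<rbrakk> \<Longrightarrow> comm u v \<cdot> a = comm (u \<cdot> a) v"
  unfolding commutator_def a_minus_def
  by (simp add: D.A.l_distr D.A.l_minus D.A.m_assoc)

lemma comm_zero: "\<lbrakk>u \<in> carrier D; v \<in> carrier D; u \<cdot> v = v \<cdot> u\<rbrakk> \<Longrightarrow> comm u v = \<zero>\<^bsub>D\<^esub>"
  unfolding commutator_def a_minus_def by (simp add: D.M.r_neg)

lemma comm_ia_ib: "\<lbrakk>r \<in> carrier A; s \<in> carrier A\<rbrakk> \<Longrightarrow> comm (ia r) (ib s) = \<zero>\<^bsub>D\<^esub>"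
  by (rule comm_zero) (simp_all add: ia_ib)

lemma comm_ib_ia: "\<lbrakk>r \<in> carrier A; s \<in> carrier A\<rbrakk> \<Longrightarrow> comm (ib s) (ia r) = \<zero>\<^bsub>D\<^esub>"
  by (rule comm_zero) (simp_all add: ia_ib)

lemmas comm_add_left = bilinear_maps_add_left[OF comm_bilinear]

lemma neg_add_zeroD:
  assumes "a \<in> carrier D" "u \<in> carrier D" "\<ominus>\<^bsub>D\<^esub> a \<^bold>+ u = \<zero>\<^bsub>D\<^esub>"
  shows "u = a"
proof -
  have "u = a \<^bold>+ (\<ominus>\<^bsub>D\<^esub> a \<^bold>+ u)"
    using assms(1,2) by (rule D.M.r_neg2[symmetric])
  then show ?thesis using assms(1) unfolding assms(3) by simp
qed

lemma add_eq_selfD: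
  assumes "a \<in> carrier D" "u \<in> carrier D" "a \<^bold>+ u = a"
  shows "u = \<zero>\<^bsub>D\<^esub>"
proof -
  have "u = \<ominus>\<^bsub>D\<^esub> a \<^bold>+ (a \<^bold>+ u)"
    using assms(1,2) by (rule D.M.r_neg1[symmetric])
  then show ?thesis using assms(1) unfolding assms(3) by (simp add: D.M.l_neg)
qed

lemma sum_add:
  assumes "\<And>i. i < n \<Longrightarrow> F i \<in> carrier D" "\<And>i. i < n \<Longrightarrow> G i \<in> carrier D"
    and "\<And>i. i < n \<Longrightarrow> H i = F i \<^bold>+ G i"
  shows "(\<Oplus>\<^bsub>D\<^esub>i\<in>{..<n::nat}. H i) = (\<Oplus>\<^bsub>D\<^esub>i\<in>{..<n}. F i) \<^bold>+ (\<Oplus>\<^bsub>D\<^esub>i\<in>{..<n}. G i)"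
proof -
  have "(\<Oplus>\<^bsub>D\<^esub>i\<in>{..<n}. H i) = (\<Oplus>\<^bsub>D\<^esub>i\<in>{..<n}. F i \<^bold>+ G i)"
    by (rule D.M.finsum_cong') (use assms in auto)
  also have "\<dots> = (\<Oplus>\<^bsub>D\<^esub>i\<in>{..<n}. F i) \<^bold>+ (\<Oplus>\<^bsub>D\<^esub>i\<in>{..<n}. G i)"
    by (rule D.M.finsum_addf) (use assms in auto)
  finally show ?thesis .
qed

lemma sum_Suc:
  assumes "H N \<in> carrier D" "\<And>n. n < N \<Longrightarrow> F n \<in> carrier D" "\<And>n. n < N \<Longrightarrow> H n = F n"
  shows "(\<Oplus>\<^bsub>D\<^esub>n\<in>{..<Suc N}. H n) = H N \<^bold>+ (\<Oplus>\<^bsub>D\<^esub>n\<in>{..<N}. F n)"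
proof -
  have "(\<Oplus>\<^bsub>D\<^esub>n\<in>{..<N}. H n) = (\<Oplus>\<^bsub>D\<^esub>n\<in>{..<N}. F n)"
    by (rule D.M.finsum_cong') (use assms in auto)
  then show ?thesis
    unfolding lessThan_Suc using assms by (subst D.M.finsum_insert) auto
qed

lemma sum_mult_left:
  assumes "a \<in> carrier D" "\<And>i. i < n \<Longrightarrow> F i \<in> carrier D" "\<And>i. i < n \<Longrightarrow> H i = a \<cdot> F i"
  shows "(\<Oplus>\<^bsub>D\<^esub>i\<in>{..<n::nat}. H i) = a \<cdot> (\<Oplus>\<^bsub>D\<^esub>i\<in>{..<n}. F i)"
proof -
  have "(\<Oplus>\<^bsub>D\<^esub>i\<in>{..<n}. H i) = (\<Oplus>\<^bsub>D\<^esub>i\<in>{..<n}. a \<cdot> F i)"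
    by (rule D.M.finsum_cong') (use assms in auto)
  also have "\<dots> = a \<cdot> (\<Oplus>\<^bsub>D\<^esub>i\<in>{..<n}. F i)"
    by (rule D.A.finsum_rdistr[symmetric]) (use assms in auto)
  finally show ?thesis .
qed

lemma sum_mult_right:
  assumes "a \<in> carrier D" "\<And>i. i < n \<Longrightarrow> F i \<in> carrier D" "\<And>i. i < n \<Longrightarrow> H i = F i \<cdot> a"
  shows "(\<Oplus>\<^bsub>D\<^esub>i\<in>{..<n::nat}. H i) = (\<Oplus>\<^bsub>D\<^esub>i\<in>{..<n}. F i) \<cdot> a"
proof -
  have "(\<Oplus>\<^bsub>D\<^esub>i\<in>{..<n}. H i) = (\<Oplus>\<^bsub>D\<^esub>i\<in>{..<n}. F i \<cdot> a)"
    by (rule D.M.finsum_cong') (use assms in auto)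
  also have "\<dots> = (\<Oplus>\<^bsub>D\<^esub>i\<in>{..<n}. F i) \<cdot> a"
    by (rule D.A.finsum_ldistr[symmetric]) (use assms in auto)
  finally show ?thesis .
qed

end

context surjective_calculus
begin

text \<open>
  A vanishing sum in \<open>\<Omega>\<close> becomes a null family after one term is appended that corrects the sum of
  the products: \<open>(-\<Sum> r s, 1)\<close> does not contribute to \<open>\<Sum> r ds\<close> since \<open>d 1 = 0\<close>, and \<open>(1, -\<Sum> r s)\<close>
  turns \<open>\<Sum> r ds\<close> into \<open>-\<Sum> (dr) s\<close>.
\<close>

lemma null_family_left:
  assumes r: "r \<in> {..<N} \<rightarrow> carrier A" and s: "s \<in> {..<N} \<rightarrow> carrier A"
    and zero: "(\<Oplus>\<^bsub>\<Omega>\<^esub>n\<in>{..<N}. r n \<triangleright>\<^bsub>\<Omega>\<^esub> d (s n)) = \<zero>\<^bsub>\<Omega>\<^esub>"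
  defines "t \<equiv> \<Oplus>\<^bsub>A\<^esub>n\<in>{..<N}. r n \<otimes>\<^bsub>A\<^esub> s n"
  shows "calculus_data.null_family A \<Omega> d (Suc N) (r(N := \<ominus>\<^bsub>A\<^esub> t)) (s(N := \<one>\<^bsub>A\<^esub>))"
proof -
  have rs: "r n \<in> carrier A" "s n \<in> carrier A" if "n < N" for n using r s that by auto
  have t: "t \<in> carrier A" unfolding t_def using rs by (intro finsum_closed) auto
  have "(\<Oplus>\<^bsub>A\<^esub>n\<in>{..<N}. (r(N := \<ominus>\<^bsub>A\<^esub> t)) n \<otimes>\<^bsub>A\<^esub> (s(N := \<one>\<^bsub>A\<^esub>)) n) = t"
    unfolding t_def by (rule finsum_cong') (use rs in auto)
  moreover have "(\<Oplus>\<^bsub>\<Omega>\<^esub>n\<in>{..<N}. (r(N := \<ominus>\<^bsub>A\<^esub> t)) n \<triangleright>\<^bsub>\<Omega>\<^esub> d ((s(N := \<one>\<^bsub>A\<^esub>)) n)) = \<zero>\<^bsub>\<Omega>\<^esub>"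
    unfolding zero[symmetric] by (rule M.M.finsum_cong') (use rs in \<open>auto simp: lact_closed\<close>)
  moreover have "(\<ominus>\<^bsub>A\<^esub> t) \<triangleright>\<^bsub>\<Omega>\<^esub> \<zero>\<^bsub>\<Omega>\<^esub> = \<zero>\<^bsub>\<Omega>\<^esub>"
    using t by (intro linear_maps_zero[OF M.module_axioms M.module_axioms lact_linear]) simp
  ultimately show ?thesis
    unfolding calculus_data.null_family_def lessThan_Suc using rs t
    by (auto simp: lact_closed l_neg d_one Pi_iff)
qed

lemma null_family_right:
  assumes r: "r \<in> {..<N} \<rightarrow> carrier A" and s: "s \<in> {..<N} \<rightarrow> carrier A"
    and zero: "(\<Oplus>\<^bsub>\<Omega>\<^esub>n\<in>{..<N}. d (r n) \<triangleleft>\<^bsub>\<Omega>\<^esub> s n) = \<zero>\<^bsub>\<Omega>\<^esub>"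
  defines "t \<equiv> \<Oplus>\<^bsub>A\<^esub>n\<in>{..<N}. r n \<otimes>\<^bsub>A\<^esub> s n"
  shows "calculus_data.null_family A \<Omega> d (Suc N) (r(N := \<one>\<^bsub>A\<^esub>)) (s(N := \<ominus>\<^bsub>A\<^esub> t))"
proof -
  have rs: "r n \<in> carrier A" "s n \<in> carrier A" if "n < N" for n using r s that by auto
  have t: "t \<in> carrier A" unfolding t_def using rs by (intro finsum_closed) auto
  have "(\<Oplus>\<^bsub>A\<^esub>n\<in>{..<N}. (r(N := \<one>\<^bsub>A\<^esub>)) n \<otimes>\<^bsub>A\<^esub> (s(N := \<ominus>\<^bsub>A\<^esub> t)) n) = t"
    unfolding t_def by (rule finsum_cong') (use rs in auto)
  moreover have "(\<Oplus>\<^bsub>\<Omega>\<^esub>n\<in>{..<N}. r n \<triangleright>\<^bsub>\<Omega>\<^esub> d (s n)) \<in> carrier \<Omega>"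
    using rs by (intro M.M.finsum_closed) (auto simp: lact_closed)
  then have "(\<Oplus>\<^bsub>\<Omega>\<^esub>n\<in>{..<N}. r n \<triangleright>\<^bsub>\<Omega>\<^esub> d (s n)) = d t"
    using d_sum_mult[OF r s] unfolding zero t_def[symmetric] by simp
  then have "(\<Oplus>\<^bsub>\<Omega>\<^esub>n\<in>{..<N}. (r(N := \<one>\<^bsub>A\<^esub>)) n \<triangleright>\<^bsub>\<Omega>\<^esub> d ((s(N := \<ominus>\<^bsub>A\<^esub> t)) n)) = d t"
    by (subst M.M.finsum_cong'[where B = "{..<N}" and g = "\<lambda>n. r n \<triangleright>\<^bsub>\<Omega>\<^esub> d (s n)"])
       (use rs in \<open>auto simp: lact_closed\<close>)
  moreover have "d (\<ominus>\<^bsub>A\<^esub> t) = \<ominus>\<^bsub>\<Omega>\<^esub> d t"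
    using t by (rule linear_maps_uminus[OF module_axioms M.module_axioms d_linear])
  ultimately show ?thesis
    unfolding calculus_data.null_family_def lessThan_Suc using rs t
    by (auto simp: lact_closed l_neg lact_one M.M.l_neg Pi_iff)
qed

end

context B_rep
begin

lemma ix_closed [simp]: "u \<in> carrier X \<Longrightarrow> ix u \<in> carrier D"
  by (rule linear_maps_closed[OF ix_linear])
lemma iy_closed [simp]: "u \<in> carrier X \<Longrightarrow> iy u \<in> carrier D"
  by (rule linear_maps_closed[OF iy_linear])

lemma right_family_bilinear:
  assumes "u \<in> carrier X"
  shows "(\<lambda>r s. ib s \<cdot> comm (ix u) (ib r)) \<in> bilinear_maps K A A D"
  by (rule bilinear_maps_comp[OF bilinear_maps_flip[OF bilinear_mult[OF D.K_algebra_axioms]]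
        linear_maps_comp[OF ib_linear bilinear_maps_right[OF comm_bilinear]] ib_linear])
     (use assms in simp)

lemma left_family_bilinear:
  assumes "u \<in> carrier X"
  shows "(\<lambda>r s. ia r \<cdot> comm (iy u) (ia s)) \<in> bilinear_maps K A A D"
  by (rule bilinear_maps_comp[OF bilinear_mult[OF D.K_algebra_axioms] ia_linear
        linear_maps_comp[OF ia_linear bilinear_maps_right[OF comm_bilinear]]])
     (use assms in simp)

text \<open>
  Expanding the commutators turns the sum to be killed into
  \<open>\<Sum> ib s \<cdot> ix u \<cdot> ib r - ib (\<Sum> r s) \<cdot> ix u\<close>, which is the relation for the null family obtained
  by appending \<open>(1, -\<Sum> r s)\<close>.
\<close>

lemma ixw_exists:
  assumes u: "u \<in> carrier X"
  shows "\<exists>h \<in> linear_maps K \<Omega> D. \<forall>r \<in> carrier A. \<forall>s \<in> carrier A.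
    h (d r \<triangleleft>\<^bsub>\<Omega>\<^esub> s) = ib s \<cdot> comm (ix u) (ib r)"
proof (rule linear_map_on_family[OF K.field_axioms module_axioms M.module_axioms D.module_axioms
      Omega_right_bilinear right_family_bilinear[OF u] Omega_right_span])
  fix N r s
  assume r: "r \<in> {..<N::nat} \<rightarrow> carrier A" and s: "s \<in> {..<N} \<rightarrow> carrier A"
    and zero: "(\<Oplus>\<^bsub>\<Omega>\<^esub>n\<in>{..<N}. d (r n) \<triangleleft>\<^bsub>\<Omega>\<^esub> s n) = \<zero>\<^bsub>\<Omega>\<^esub>"
  have rs: "r n \<in> carrier A" "s n \<in> carrier A" if "n < N" for n using r s that by auto
  define t where "t = (\<Oplus>\<^bsub>A\<^esub>n\<in>{..<N}. r n \<otimes>\<^bsub>A\<^esub> s n)"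
  have t: "t \<in> carrier A" unfolding t_def using rs by (intro finsum_closed) auto
  let ?P = "\<Oplus>\<^bsub>D\<^esub>n\<in>{..<N}. ib (s n) \<cdot> ix u \<cdot> ib (r n)"
  let ?S = "\<Oplus>\<^bsub>D\<^esub>n\<in>{..<N}. ib (s n) \<cdot> comm (ix u) (ib (r n))"
  have P: "?P \<in> carrier D" and S: "?S \<in> carrier D"
    using rs u by (auto intro!: D.M.finsum_closed)
  have "(\<Oplus>\<^bsub>D\<^esub>n\<in>{..<Suc N}. ib ((s(N := \<ominus>\<^bsub>A\<^esub> t)) n) \<cdot> ix u \<cdot> ib ((r(N := \<one>\<^bsub>A\<^esub>)) n)) =
      ib (\<ominus>\<^bsub>A\<^esub> t) \<cdot> ix u \<^bold>+ ?P"
    using rs u t by (subst sum_Suc[where F = "\<lambda>n. ib (s n) \<cdot> ix u \<cdot> ib (r n)"]) simp_all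
  then have "ib (\<ominus>\<^bsub>A\<^esub> t) \<cdot> ix u \<^bold>+ ?P = \<zero>\<^bsub>D\<^esub>"
    using null_ix[OF null_family_right[OF r s zero, folded t_def] u] by simp
  then have "\<ominus>\<^bsub>D\<^esub> (ib t \<cdot> ix u) \<^bold>+ ?P = \<zero>\<^bsub>D\<^esub>"
    using t u by (simp add: ib_uminus D.A.l_minus)
  then have P_eq: "?P = ib t \<cdot> ix u"
    by (rule neg_add_zeroD[rotated 2]) (use t u P in auto)
  have "ib t \<cdot> ix u \<^bold>+ ?S = ?P"
  proof -
    have "ib t = (\<Oplus>\<^bsub>D\<^esub>n\<in>{..<N}. ib (s n) \<cdot> ib (r n))"
      unfolding t_def using rs
      by (subst ib_finsum) (auto simp: ib_mult intro!: D.M.finsum_cong')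
    moreover have "(\<Oplus>\<^bsub>D\<^esub>n\<in>{..<N}. ib (s n) \<cdot> ib (r n)) \<cdot> ix u =
        (\<Oplus>\<^bsub>D\<^esub>n\<in>{..<N}. ib (s n) \<cdot> ib (r n) \<cdot> ix u)"
      by (rule D.A.finsum_ldistr) (use rs u in auto)
    moreover have "?P = (\<Oplus>\<^bsub>D\<^esub>n\<in>{..<N}. ib (s n) \<cdot> ib (r n) \<cdot> ix u) \<^bold>+ ?S"
    proof (rule sum_add)
      fix n assume "n < N"
      then have n: "r n \<in> carrier A" "s n \<in> carrier A" by (rule rs)+
      have "ib (s n) \<cdot> ix u \<cdot> ib (r n) = ib (s n) \<cdot> (ib (r n) \<cdot> ix u \<^bold>+ comm (ix u) (ib (r n)))"
        using n u by (simp add: D.A.m_assoc comm_eq)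
      then show "ib (s n) \<cdot> ix u \<cdot> ib (r n) =
          ib (s n) \<cdot> ib (r n) \<cdot> ix u \<^bold>+ ib (s n) \<cdot> comm (ix u) (ib (r n))"
        using n u by (simp add: D.A.m_assoc D.A.r_distr)
    qed (use rs u in auto)
    ultimately show ?thesis by simp
  qed
  then show "?S = \<zero>\<^bsub>D\<^esub>"
    using P S unfolding P_eq by (intro add_eq_selfD[OF _ S]) auto
qed

text \<open>
  As for \<open>ixw\<close>, with the pair \<open>(-\<Sum> r s, 1)\<close> appended.
\<close>

lemma iwx_exists:
  assumes u: "u \<in> carrier X"
  shows "\<exists>h \<in> linear_maps K \<Omega> D. \<forall>r \<in> carrier A. \<forall>s \<in> carrier A.
    h (r \<triangleright>\<^bsub>\<Omega>\<^esub> d s) = ia r \<cdot> comm (iy u) (ia s)"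
proof (rule linear_map_on_family[OF K.field_axioms module_axioms M.module_axioms D.module_axioms
      Omega_left_bilinear left_family_bilinear[OF u] d_surjective])
  fix N r s
  assume r: "r \<in> {..<N::nat} \<rightarrow> carrier A" and s: "s \<in> {..<N} \<rightarrow> carrier A"
    and zero: "(\<Oplus>\<^bsub>\<Omega>\<^esub>n\<in>{..<N}. r n \<triangleright>\<^bsub>\<Omega>\<^esub> d (s n)) = \<zero>\<^bsub>\<Omega>\<^esub>"
  have rs: "r n \<in> carrier A" "s n \<in> carrier A" if "n < N" for n using r s that by auto
  define t where "t = (\<Oplus>\<^bsub>A\<^esub>n\<in>{..<N}. r n \<otimes>\<^bsub>A\<^esub> s n)"
  have t: "t \<in> carrier A" unfolding t_def using rs by (intro finsum_closed) auto
  let ?P = "\<Oplus>\<^bsub>D\<^esub>n\<in>{..<N}. ia (r n) \<cdot> iy u \<cdot> ia (s n)"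
  let ?S = "\<Oplus>\<^bsub>D\<^esub>n\<in>{..<N}. ia (r n) \<cdot> comm (iy u) (ia (s n))"
  have P: "?P \<in> carrier D" and S: "?S \<in> carrier D"
    using rs u by (auto intro!: D.M.finsum_closed)
  have "(\<Oplus>\<^bsub>D\<^esub>n\<in>{..<Suc N}. ia ((r(N := \<ominus>\<^bsub>A\<^esub> t)) n) \<cdot> iy u \<cdot> ia ((s(N := \<one>\<^bsub>A\<^esub>)) n)) =
      ia (\<ominus>\<^bsub>A\<^esub> t) \<cdot> iy u \<^bold>+ ?P"
    using rs u t by (subst sum_Suc[where F = "\<lambda>n. ia (r n) \<cdot> iy u \<cdot> ia (s n)"]) simp_all
  then have "ia (\<ominus>\<^bsub>A\<^esub> t) \<cdot> iy u \<^bold>+ ?P = \<zero>\<^bsub>D\<^esub>"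
    using null_iy[OF null_family_left[OF r s zero, folded t_def] u] by simp
  then have "\<ominus>\<^bsub>D\<^esub> (ia t \<cdot> iy u) \<^bold>+ ?P = \<zero>\<^bsub>D\<^esub>"
    using t u by (simp add: ia_uminus D.A.l_minus)
  then have P_eq: "?P = ia t \<cdot> iy u"
    by (rule neg_add_zeroD[rotated 2]) (use t u P in auto)
  have "ia t \<cdot> iy u \<^bold>+ ?S = ?P"
  proof -
    have "ia t = (\<Oplus>\<^bsub>D\<^esub>n\<in>{..<N}. ia (r n) \<cdot> ia (s n))"
      unfolding t_def using rs
      by (subst ia_finsum) (auto simp: ia_mult intro!: D.M.finsum_cong')
    moreover have "(\<Oplus>\<^bsub>D\<^esub>n\<in>{..<N}. ia (r n) \<cdot> ia (s n)) \<cdot> iy u =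
        (\<Oplus>\<^bsub>D\<^esub>n\<in>{..<N}. ia (r n) \<cdot> ia (s n) \<cdot> iy u)"
      by (rule D.A.finsum_ldistr) (use rs u in auto)
    moreover have "?P = (\<Oplus>\<^bsub>D\<^esub>n\<in>{..<N}. ia (r n) \<cdot> ia (s n) \<cdot> iy u) \<^bold>+ ?S"
    proof (rule sum_add)
      fix n assume "n < N"
      then have n: "r n \<in> carrier A" "s n \<in> carrier A" by (rule rs)+
      have "ia (r n) \<cdot> iy u \<cdot> ia (s n) = ia (r n) \<cdot> (ia (s n) \<cdot> iy u \<^bold>+ comm (iy u) (ia (s n)))"
        using n u by (simp add: D.A.m_assoc comm_eq)
      then show "ia (r n) \<cdot> iy u \<cdot> ia (s n) =
          ia (r n) \<cdot> ia (s n) \<cdot> iy u \<^bold>+ ia (r n) \<cdot> comm (iy u) (ia (s n))"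
        using n u by (simp add: D.A.m_assoc D.A.r_distr)
    qed (use rs u in auto)
    ultimately show ?thesis by simp
  qed
  then show "?S = \<zero>\<^bsub>D\<^esub>"
    using P S unfolding P_eq by (intro add_eq_selfD[OF _ S]) auto
qed

text \<open>
  The values on the spanning families \<open>(dr) s\<close> and \<open>r ds\<close> determine these maps. The two families
  are chosen so that one of the actions, \<open>ib\<close> on the left of \<open>ixw\<close> and \<open>ia\<close> on the left of
  \<open>iwx\<close>, is visible in the formula.
\<close>

definition ixw where "ixw u = (SOME h. h \<in> linear_maps K \<Omega> D \<and>
  (\<forall>r \<in> carrier A. \<forall>s \<in> carrier A. h (d r \<triangleleft>\<^bsub>\<Omega>\<^esub> s) = ib s \<cdot> comm (ix u) (ib r)))"

definition iwx where "iwx w u = (SOME h. h \<in> linear_maps K \<Omega> D \<and>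
  (\<forall>r \<in> carrier A. \<forall>s \<in> carrier A. h (r \<triangleright>\<^bsub>\<Omega>\<^esub> d s) = ia r \<cdot> comm (iy u) (ia s))) w"

lemma ixw:
  assumes "u \<in> carrier X"
  shows ixw_linear: "ixw u \<in> linear_maps K \<Omega> D"
    and ixw_gen: "\<lbrakk>r \<in> carrier A; s \<in> carrier A\<rbrakk> \<Longrightarrow> ixw u (d r \<triangleleft>\<^bsub>\<Omega>\<^esub> s) = ib s \<cdot> comm (ix u) (ib r)"
proof -
  have "ixw u \<in> linear_maps K \<Omega> D \<and>
      (\<forall>r \<in> carrier A. \<forall>s \<in> carrier A. ixw u (d r \<triangleleft>\<^bsub>\<Omega>\<^esub> s) = ib s \<cdot> comm (ix u) (ib r))"
    using someI_ex[OF ixw_exists[OF assms, unfolded Bex_def]] unfolding ixw_def .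
  then show "ixw u \<in> linear_maps K \<Omega> D"
    and "\<lbrakk>r \<in> carrier A; s \<in> carrier A\<rbrakk> \<Longrightarrow> ixw u (d r \<triangleleft>\<^bsub>\<Omega>\<^esub> s) = ib s \<cdot> comm (ix u) (ib r)"
    by blast+
qed

lemma iwx:
  assumes "u \<in> carrier X"
  shows iwx_linear: "(\<lambda>w. iwx w u) \<in> linear_maps K \<Omega> D"
    and iwx_gen: "\<lbrakk>r \<in> carrier A; s \<in> carrier A\<rbrakk> \<Longrightarrow> iwx (r \<triangleright>\<^bsub>\<Omega>\<^esub> d s) u = ia r \<cdot> comm (iy u) (ia s)"
proof -
  have "(\<lambda>w. iwx w u) \<in> linear_maps K \<Omega> D \<and>
      (\<forall>r \<in> carrier A. \<forall>s \<in> carrier A. (\<lambda>w. iwx w u) (r \<triangleright>\<^bsub>\<Omega>\<^esub> d s) = ia r \<cdot> comm (iy u) (ia s))"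
    using someI_ex[OF iwx_exists[OF assms, unfolded Bex_def]] unfolding iwx_def .
  then show "(\<lambda>w. iwx w u) \<in> linear_maps K \<Omega> D"
    and "\<lbrakk>r \<in> carrier A; s \<in> carrier A\<rbrakk> \<Longrightarrow> iwx (r \<triangleright>\<^bsub>\<Omega>\<^esub> d s) u = ia r \<cdot> comm (iy u) (ia s)"
    by blast+
qed

lemma ixw_closed [simp]: "\<lbrakk>u \<in> carrier X; w \<in> carrier \<Omega>\<rbrakk> \<Longrightarrow> ixw u w \<in> carrier D"
  by (rule linear_maps_closed[OF ixw_linear])
lemma iwx_closed [simp]: "\<lbrakk>u \<in> carrier X; w \<in> carrier \<Omega>\<rbrakk> \<Longrightarrow> iwx w u \<in> carrier D"
  by (rule linear_maps_closed[OF iwx_linear])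

lemmas ixw_add = linear_maps_add[OF ixw_linear]
lemmas iwx_add = linear_maps_add[OF iwx_linear]
lemmas ixw_smult = linear_maps_smult[OF ixw_linear]
lemmas iwx_smult = linear_maps_smult[OF iwx_linear]

lemma ixw_d: "\<lbrakk>u \<in> carrier X; r \<in> carrier A\<rbrakk> \<Longrightarrow> ixw u (d r) = comm (ix u) (ib r)"
  using ixw_gen[of u r "\<one>\<^bsub>A\<^esub>"] by (simp add: ract_one)

lemma iwx_d: "\<lbrakk>u \<in> carrier X; r \<in> carrier A\<rbrakk> \<Longrightarrow> iwx (d r) u = comm (iy u) (ia r)"
  using iwx_gen[of u "\<one>\<^bsub>A\<^esub>" r] by (simp add: lact_one)

lemmas comm_ix_linear = linear_maps_comp[OF ix_linear bilinear_maps_left[OF comm_bilinear]]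
lemmas comm_iy_linear = linear_maps_comp[OF iy_linear bilinear_maps_left[OF comm_bilinear]]

lemma ixw_bilinear: "ixw \<in> bilinear_maps K X \<Omega> D"
proof (rule bilinear_mapsI)
  fix u v w assume u: "u \<in> carrier X" and v: "v \<in> carrier X" and w: "w \<in> carrier \<Omega>"
  show "ixw (u \<oplus>\<^bsub>X\<^esub> v) w = ixw u w \<^bold>+ ixw v w"
    using w
  proof (induction rule: Omega_induct_right)
    case (gen r s)
    then show ?case
      using u v by (simp add: ixw_gen linear_maps_add[OF comm_ix_linear] D.A.r_distr)
  next
    case (add w w')
    then show ?case using u v by (simp add: ixw_add D.M.a_ac)
  qed
next
  fix k u w assume k: "k \<in> carrier K" and u: "u \<in> carrier X" and w: "w \<in> carrier \<Omega>"
  show "ixw (k \<odot>\<^bsub>X\<^esub> u) w = k \<odot>\<^bsub>D\<^esub> ixw u w"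
    using w
  proof (induction rule: Omega_induct_right)
    case (gen r s)
    then show ?case
      using u k by (simp add: ixw_gen linear_maps_smult[OF comm_ix_linear] D.smult_mult_right)
  next
    case (add w w')
    then show ?case using u k by (simp add: ixw_add D.smult_r_distr)
  qed
qed (simp_all add: ixw_add ixw_smult)

lemma iwx_bilinear: "iwx \<in> bilinear_maps K \<Omega> X D"
proof (rule bilinear_mapsI)
  fix u v w assume u: "u \<in> carrier X" and v: "v \<in> carrier X" and w: "w \<in> carrier \<Omega>"
  show "iwx w (u \<oplus>\<^bsub>X\<^esub> v) = iwx w u \<^bold>+ iwx w v"
    using w
  proof (induction rule: Omega_induct_left)
    case (gen r s)
    then show ?case
      using u v by (simp add: iwx_gen linear_maps_add[OF comm_iy_linear] D.A.r_distr)
  next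
    case (add w w')
    then show ?case using u v by (simp add: iwx_add D.M.a_ac)
  qed
next
  fix k u w assume k: "k \<in> carrier K" and u: "u \<in> carrier X" and w: "w \<in> carrier \<Omega>"
  show "iwx w (k \<odot>\<^bsub>X\<^esub> u) = k \<odot>\<^bsub>D\<^esub> iwx w u"
    using w
  proof (induction rule: Omega_induct_left)
    case (gen r s)
    then show ?case
      using u k by (simp add: iwx_gen linear_maps_smult[OF comm_iy_linear] D.smult_mult_right)
  next
    case (add w w')
    then show ?case using u k by (simp add: iwx_add D.smult_r_distr)
  qed
qed (simp_all add: iwx_add iwx_smult)

lemma ia_comm_ix: "\<lbrakk>a \<in> carrier A; r \<in> carrier A; u \<in> carrier X\<rbrakk> \<Longrightarrow>
    ia a \<cdot> comm (ix u) (ib r) = comm (ix (a \<triangleright>\<^bsub>X\<^esub> u)) (ib r)"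
  by (simp add: mult_comm_left ia_ib ia_ix)

lemma comm_ix_ia: "\<lbrakk>a \<in> carrier A; r \<in> carrier A; u \<in> carrier X\<rbrakk> \<Longrightarrow>
    comm (ix u) (ib r) \<cdot> ia a = comm (ix (u \<triangleleft>\<^bsub>X\<^esub> a)) (ib r)"
  by (simp add: mult_comm_right ia_ib ix_ia comm_add_left comm_ia_ib X.ract_closed)

lemma ib_comm_iy: "\<lbrakk>a \<in> carrier A; r \<in> carrier A; u \<in> carrier X\<rbrakk> \<Longrightarrow>
    ib a \<cdot> comm (iy u) (ia r) = comm (iy (u \<triangleleft>\<^bsub>X\<^esub> a)) (ia r)"
  by (simp add: mult_comm_left ia_ib ib_iy)

lemma comm_iy_ib: "\<lbrakk>a \<in> carrier A; r \<in> carrier A; u \<in> carrier X\<rbrakk> \<Longrightarrow>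
    comm (iy u) (ia r) \<cdot> ib a = comm (iy (a \<triangleright>\<^bsub>X\<^esub> u)) (ia r)"
  by (simp add: mult_comm_right ia_ib iy_ib comm_add_left comm_ib_ia X.lact_closed)

lemma ia_ixw:
  assumes a: "a \<in> carrier A" and u: "u \<in> carrier X" and w: "w \<in> carrier \<Omega>"
  shows "ia a \<cdot> ixw u w = ixw (a \<triangleright>\<^bsub>X\<^esub> u) w"
  using w
proof (induction rule: Omega_induct_right)
  case (gen r s)
  have "ia a \<cdot> (ib s \<cdot> comm (ix u) (ib r)) = ib s \<cdot> (ia a \<cdot> comm (ix u) (ib r))"
    using a u gen by (simp add: ia_ib flip: D.A.m_assoc)
  then show ?case using a u gen by (simp add: ixw_gen ia_comm_ix X.lact_closed)
next
  case (add v w)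
  then show ?case using a u by (simp add: ixw_add D.A.r_distr X.lact_closed)
qed

lemma ib_ixw:
  assumes a: "a \<in> carrier A" and u: "u \<in> carrier X" and w: "w \<in> carrier \<Omega>"
  shows "ib a \<cdot> ixw u w = ixw u (w \<triangleleft>\<^bsub>\<Omega>\<^esub> a)"
  using w
proof (induction rule: Omega_induct_right)
  case (gen r s)
  then show ?case using a u by (simp add: ixw_gen ib_mult D.A.m_assoc flip: ract_mult)
next
  case (add v w)
  then show ?case using a u by (simp add: ixw_add D.A.r_distr ract_add ract_closed)
qed

lemma ixw_ia:
  assumes a: "a \<in> carrier A" and u: "u \<in> carrier X" and w: "w \<in> carrier \<Omega>"
  shows "ixw u w \<cdot> ia a = ixw (u \<triangleleft>\<^bsub>X\<^esub> a) w"
  using w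
proof (induction rule: Omega_induct_right)
  case (gen r s)
  then show ?case using a u by (simp add: ixw_gen D.A.m_assoc comm_ix_ia X.ract_closed)
next
  case (add v w)
  then show ?case using a u by (simp add: ixw_add D.A.l_distr X.ract_closed)
qed

text \<open>
  The product \<open>a (dr) s = d(a r) s - (da) r s\<close> brings the argument back into the family on which
  \<open>ixw\<close> is prescribed; on the side of \<open>D\<close> the Leibniz rule for commutators gives the same two
  terms.
\<close>

lemma ixw_ib:
  assumes a: "a \<in> carrier A" and u: "u \<in> carrier X" and w: "w \<in> carrier \<Omega>"
  shows "ixw u w \<cdot> ib a = ixw u (a \<triangleright>\<^bsub>\<Omega>\<^esub> w)"
  using w
proof (induction rule: Omega_induct_right)
  case (gen r s)
  let ?w = "d r \<triangleleft>\<^bsub>\<Omega>\<^esub> s"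
  have w: "?w \<in> carrier \<Omega>" using gen by (simp add: ract_closed)
  have split: "a \<triangleright>\<^bsub>\<Omega>\<^esub> ?w \<oplus>\<^bsub>\<Omega>\<^esub> d a \<triangleleft>\<^bsub>\<Omega>\<^esub> (r \<otimes>\<^bsub>A\<^esub> s) = d (a \<otimes>\<^bsub>A\<^esub> r) \<triangleleft>\<^bsub>\<Omega>\<^esub> s"
    using a gen by (simp add: d_Leibniz ract_add ract_closed lact_closed ract_mult lact_ract M.M.a_comm)
  have "ixw u (a \<triangleright>\<^bsub>\<Omega>\<^esub> ?w) \<^bold>+ ib (r \<otimes>\<^bsub>A\<^esub> s) \<cdot> comm (ix u) (ib a) =
      ixw u (a \<triangleright>\<^bsub>\<Omega>\<^esub> ?w \<oplus>\<^bsub>\<Omega>\<^esub> d a \<triangleleft>\<^bsub>\<Omega>\<^esub> (r \<otimes>\<^bsub>A\<^esub> s))"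
    using a u gen by (simp add: ixw_add ixw_gen lact_closed ract_closed)
  also have "\<dots> = ib s \<cdot> comm (ix u) (ib r \<cdot> ib a)"
    unfolding split using a u gen by (simp add: ixw_gen ib_mult)
  also have "\<dots> = ib s \<cdot> (comm (ix u) (ib r) \<cdot> ib a \<^bold>+ ib r \<cdot> comm (ix u) (ib a))"
    using a u gen by (simp add: comm_Leibniz)
  also have "\<dots> = ixw u ?w \<cdot> ib a \<^bold>+ ib (r \<otimes>\<^bsub>A\<^esub> s) \<cdot> comm (ix u) (ib a)"
    using a u gen by (simp add: ixw_gen ib_mult D.A.r_distr D.A.m_assoc)
  finally show ?case using a u gen w by (simp add: lact_closed D.M.add.right_cancel)
next
  case (add v w)
  then show ?case using a u by (simp add: ixw_add D.A.l_distr lact_add lact_closed)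
qed

lemma ia_iwx:
  assumes a: "a \<in> carrier A" and u: "u \<in> carrier X" and w: "w \<in> carrier \<Omega>"
  shows "ia a \<cdot> iwx w u = iwx (a \<triangleright>\<^bsub>\<Omega>\<^esub> w) u"
  using w
proof (induction rule: Omega_induct_left)
  case (gen r s)
  then show ?case using a u by (simp add: iwx_gen ia_mult D.A.m_assoc flip: lact_mult)
next
  case (add v w)
  then show ?case using a u by (simp add: iwx_add D.A.r_distr lact_add lact_closed)
qed

lemma ib_iwx:
  assumes a: "a \<in> carrier A" and u: "u \<in> carrier X" and w: "w \<in> carrier \<Omega>"
  shows "ib a \<cdot> iwx w u = iwx w (u \<triangleleft>\<^bsub>X\<^esub> a)"
  using w
proof (induction rule: Omega_induct_left)
  case (gen r s)
  have "ib a \<cdot> (ia r \<cdot> comm (iy u) (ia s)) = ia r \<cdot> (ib a \<cdot> comm (iy u) (ia s))"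
    using a u gen by (simp add: ia_ib flip: D.A.m_assoc)
  then show ?case using a u gen by (simp add: iwx_gen ib_comm_iy X.ract_closed)
next
  case (add v w)
  then show ?case using a u by (simp add: iwx_add D.A.r_distr X.ract_closed)
qed

text \<open>
  As for \<open>ixw_ib\<close>, now with \<open>r (ds) a = r d(s a) - r s da\<close>.
\<close>

lemma iwx_ia:
  assumes a: "a \<in> carrier A" and u: "u \<in> carrier X" and w: "w \<in> carrier \<Omega>"
  shows "iwx w u \<cdot> ia a = iwx (w \<triangleleft>\<^bsub>\<Omega>\<^esub> a) u"
  using w
proof (induction rule: Omega_induct_left)
  case (gen r s)
  let ?w = "r \<triangleright>\<^bsub>\<Omega>\<^esub> d s"
  have w: "?w \<in> carrier \<Omega>" using gen by (simp add: lact_closed)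
  have split: "?w \<triangleleft>\<^bsub>\<Omega>\<^esub> a \<oplus>\<^bsub>\<Omega>\<^esub> (r \<otimes>\<^bsub>A\<^esub> s) \<triangleright>\<^bsub>\<Omega>\<^esub> d a = r \<triangleright>\<^bsub>\<Omega>\<^esub> d (s \<otimes>\<^bsub>A\<^esub> a)"
    using a gen by (simp add: d_Leibniz lact_add ract_closed lact_closed lact_mult lact_ract)
  have "iwx (?w \<triangleleft>\<^bsub>\<Omega>\<^esub> a) u \<^bold>+ ia (r \<otimes>\<^bsub>A\<^esub> s) \<cdot> comm (iy u) (ia a) =
      iwx (?w \<triangleleft>\<^bsub>\<Omega>\<^esub> a \<oplus>\<^bsub>\<Omega>\<^esub> (r \<otimes>\<^bsub>A\<^esub> s) \<triangleright>\<^bsub>\<Omega>\<^esub> d a) u"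
    using a u gen by (simp add: iwx_add iwx_gen lact_closed ract_closed)
  also have "\<dots> = ia r \<cdot> comm (iy u) (ia s \<cdot> ia a)"
    unfolding split using a u gen by (simp add: iwx_gen ia_mult)
  also have "\<dots> = ia r \<cdot> (comm (iy u) (ia s) \<cdot> ia a \<^bold>+ ia s \<cdot> comm (iy u) (ia a))"
    using a u gen by (simp add: comm_Leibniz)
  also have "\<dots> = iwx ?w u \<cdot> ia a \<^bold>+ ia (r \<otimes>\<^bsub>A\<^esub> s) \<cdot> comm (iy u) (ia a)"
    using a u gen by (simp add: iwx_gen ia_mult D.A.r_distr D.A.m_assoc)
  finally show ?case using a u gen w by (simp add: ract_closed D.M.add.right_cancel)
next
  case (add v w)
  then show ?case using a u by (simp add: iwx_add D.A.l_distr ract_add ract_closed)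
qed

lemma iwx_ib:
  assumes a: "a \<in> carrier A" and u: "u \<in> carrier X" and w: "w \<in> carrier \<Omega>"
  shows "iwx w u \<cdot> ib a = iwx w (a \<triangleright>\<^bsub>X\<^esub> u)"
  using w
proof (induction rule: Omega_induct_left)
  case (gen r s)
  then show ?case using a u by (simp add: iwx_gen D.A.m_assoc comm_iy_ib X.lact_closed)
next
  case (add v w)
  then show ?case using a u by (simp add: iwx_add D.A.l_distr X.lact_closed)
qed

text \<open>
  For \<open>w = ds\<close>, multiply \<open>\<Sum> [iy u, ia (b i)] \<cdot> ix (x i) = iy u\<close> by \<open>ib s\<close> from the right and
  move it through on the left side. The terms in which \<open>ib s\<close> passes \<open>ix (x i)\<close> give the same
  relation for \<open>s u\<close>, hence \<open>iy (s u)\<close>, and the commutators that remain form the required sum.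
  Comparison with the relation for \<open>iy u \<cdot> ib s\<close> leaves \<open>ib (uev (ds \<otimes> u))\<close>. A coefficient \<open>r\<close>
  in \<open>w = r ds\<close> becomes a factor \<open>ib r\<close> on the right.
\<close>

lemma sum_iwx_ixw:
  assumes u: "u \<in> carrier X" and w: "w \<in> carrier \<Omega>"
  shows "(\<Oplus>\<^bsub>D\<^esub>i\<in>{..<p}. iwx (d (b i)) u \<cdot> ixw (x i) w) = ib (uev_pair w u)"
  using w
proof (induction rule: Omega_induct_left)
  case (gen r s)
  let ?S = "\<Oplus>\<^bsub>D\<^esub>i\<in>{..<p}. comm (iy u) (ia (b i)) \<cdot> comm (ix (x i)) (ib s)"
  have S: "?S \<in> carrier D" using u gen by (intro D.M.finsum_closed) auto
  have summand: "comm (iy u) (ia (b i)) \<cdot> ix (x i) \<cdot> ib s =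
      comm (iy u) (ia (b i)) \<cdot> comm (ix (x i)) (ib s) \<^bold>+ comm (iy (s \<triangleright>\<^bsub>X\<^esub> u)) (ia (b i)) \<cdot> ix (x i)"
    if "i < p" for i
  proof -
    have "comm (iy u) (ia (b i)) \<cdot> ix (x i) \<cdot> ib s =
        comm (iy u) (ia (b i)) \<cdot> (ib s \<cdot> ix (x i) \<^bold>+ comm (ix (x i)) (ib s))"
      using u gen that by (simp add: D.A.m_assoc comm_eq)
    also have "\<dots> = comm (iy u) (ia (b i)) \<cdot> ib s \<cdot> ix (x i) \<^bold>+
        comm (iy u) (ia (b i)) \<cdot> comm (ix (x i)) (ib s)"
      using u gen that by (simp add: D.A.r_distr D.A.m_assoc)
    finally show ?thesis
      using u gen that by (simp add: comm_iy_ib D.M.a_comm X.lact_closed)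
  qed
  have "iy u \<cdot> ib s = (\<Oplus>\<^bsub>D\<^esub>i\<in>{..<p}. comm (iy u) (ia (b i)) \<cdot> ix (x i) \<cdot> ib s)"
    using u gen sum_mult_right[of "ib s" p "\<lambda>i. comm (iy u) (ia (b i)) \<cdot> ix (x i)"]
    by (simp add: sum_comm_ix)
  also have "\<dots> = ?S \<^bold>+ iy (s \<triangleright>\<^bsub>X\<^esub> u)"
    using u gen sum_add[OF _ _ summand] by (simp add: sum_comm_ix X.lact_closed)
  finally have "?S \<^bold>+ iy (s \<triangleright>\<^bsub>X\<^esub> u) = ib (uev_pair (d s) u) \<^bold>+ iy (s \<triangleright>\<^bsub>X\<^esub> u)"
    using u gen by (simp add: iy_ib D.M.a_comm X.lact_closed)
  then have "?S = ib (uev_pair (d s) u)"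
    using u gen S by (simp add: D.M.add.right_cancel X.lact_closed)
  moreover have "(\<Oplus>\<^bsub>D\<^esub>i\<in>{..<p}. iwx (d (b i)) u \<cdot> ixw (x i) (r \<triangleright>\<^bsub>\<Omega>\<^esub> d s)) = ?S \<cdot> ib r"
    by (rule sum_mult_right)
       (use u gen in \<open>simp_all add: iwx_d ixw_d D.A.m_assoc flip: ixw_ib\<close>)
  ultimately show ?case using u gen by (simp add: uev_pair_lact ib_mult)
next
  case (add v w)
  have "(\<Oplus>\<^bsub>D\<^esub>i\<in>{..<p}. iwx (d (b i)) u \<cdot> ixw (x i) (v \<oplus>\<^bsub>\<Omega>\<^esub> w)) =
      (\<Oplus>\<^bsub>D\<^esub>i\<in>{..<p}. iwx (d (b i)) u \<cdot> ixw (x i) v) \<^bold>+ (\<Oplus>\<^bsub>D\<^esub>i\<in>{..<p}. iwx (d (b i)) u \<cdot> ixw (x i) w)"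
    by (rule sum_add) (use u add in \<open>simp_all add: ixw_add D.A.r_distr\<close>)
  then show ?case
    using u add by (simp add: bilinear_maps_add_left[OF uev_pair_bilinear] ib_add)
qed

text \<open>
  The same argument with \<open>\<Sum> [ix u, ib (c j)] \<cdot> iy (y j) = ix u\<close> multiplied by \<open>ia r\<close> from the
  right.
\<close>

lemma sum_ixw_iwx:
  assumes u: "u \<in> carrier X" and w: "w \<in> carrier \<Omega>"
  shows "(\<Oplus>\<^bsub>D\<^esub>j\<in>{..<q}. ixw u (d (c j)) \<cdot> iwx w (y j)) = ia (ev_pair u w)"
  using w
proof (induction rule: Omega_induct_right)
  case (gen r s)
  let ?S = "\<Oplus>\<^bsub>D\<^esub>j\<in>{..<q}. comm (ix u) (ib (c j)) \<cdot> comm (iy (y j)) (ia r)"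
  have S: "?S \<in> carrier D" using u gen by (intro D.M.finsum_closed) auto
  have summand: "comm (ix u) (ib (c j)) \<cdot> iy (y j) \<cdot> ia r =
      comm (ix u) (ib (c j)) \<cdot> comm (iy (y j)) (ia r) \<^bold>+ comm (ix (u \<triangleleft>\<^bsub>X\<^esub> r)) (ib (c j)) \<cdot> iy (y j)"
    if "j < q" for j
  proof -
    have "comm (ix u) (ib (c j)) \<cdot> iy (y j) \<cdot> ia r =
        comm (ix u) (ib (c j)) \<cdot> (ia r \<cdot> iy (y j) \<^bold>+ comm (iy (y j)) (ia r))"
      using u gen that by (simp add: D.A.m_assoc comm_eq)
    also have "\<dots> = comm (ix u) (ib (c j)) \<cdot> ia r \<cdot> iy (y j) \<^bold>+
        comm (ix u) (ib (c j)) \<cdot> comm (iy (y j)) (ia r)"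
      using u gen that by (simp add: D.A.r_distr D.A.m_assoc)
    finally show ?thesis
      using u gen that by (simp add: comm_ix_ia D.M.a_comm X.ract_closed)
  qed
  have "ix u \<cdot> ia r = (\<Oplus>\<^bsub>D\<^esub>j\<in>{..<q}. comm (ix u) (ib (c j)) \<cdot> iy (y j) \<cdot> ia r)"
    using u gen sum_mult_right[of "ia r" q "\<lambda>j. comm (ix u) (ib (c j)) \<cdot> iy (y j)"]
    by (simp add: sum_comm_iy)
  also have "\<dots> = ?S \<^bold>+ ix (u \<triangleleft>\<^bsub>X\<^esub> r)"
    using u gen sum_add[OF _ _ summand] by (simp add: sum_comm_iy X.ract_closed)
  finally have "?S \<^bold>+ ix (u \<triangleleft>\<^bsub>X\<^esub> r) = ia (ev_pair u (d r)) \<^bold>+ ix (u \<triangleleft>\<^bsub>X\<^esub> r)"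
    using u gen by (simp add: ix_ia D.M.a_comm X.ract_closed)
  then have "?S = ia (ev_pair u (d r))"
    using u gen S by (simp add: D.M.add.right_cancel X.ract_closed)
  moreover have "(\<Oplus>\<^bsub>D\<^esub>j\<in>{..<q}. ixw u (d (c j)) \<cdot> iwx (d r \<triangleleft>\<^bsub>\<Omega>\<^esub> s) (y j)) = ?S \<cdot> ia s"
    by (rule sum_mult_right)
       (use u gen in \<open>simp_all add: iwx_d ixw_d D.A.m_assoc flip: iwx_ia\<close>)
  ultimately show ?case using u gen by (simp add: ev_pair_ract ia_mult)
next
  case (add v w)
  have "(\<Oplus>\<^bsub>D\<^esub>j\<in>{..<q}. ixw u (d (c j)) \<cdot> iwx (v \<oplus>\<^bsub>\<Omega>\<^esub> w) (y j)) =
      (\<Oplus>\<^bsub>D\<^esub>j\<in>{..<q}. ixw u (d (c j)) \<cdot> iwx v (y j)) \<^bold>+ (\<Oplus>\<^bsub>D\<^esub>j\<in>{..<q}. ixw u (d (c j)) \<cdot> iwx w (y j))"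
    by (rule sum_add) (use u add in \<open>simp_all add: iwx_add D.A.r_distr\<close>)
  then show ?case
    using u add by (simp add: bilinear_maps_add_right[OF ev_pair_bilinear] ia_add)
qed

text \<open>
  For exact \<open>w\<close> this is the first additional relation; a coefficient becomes a factor \<open>ib s\<close> on
  the left. The other one is obtained in the same way.
\<close>

lemma sum_ixw_iwx':
  assumes u: "u \<in> carrier X" and w: "w \<in> carrier \<Omega>"
  shows "(\<Oplus>\<^bsub>D\<^esub>j\<in>{..<q}. ixw (y j) w \<cdot> iwx (d (c j)) u) = ib (ev_pair u w)"
  using w
proof (induction rule: Omega_induct_right)
  case (gen r s)
  have "(\<Oplus>\<^bsub>D\<^esub>j\<in>{..<q}. ixw (y j) (d r \<triangleleft>\<^bsub>\<Omega>\<^esub> s) \<cdot> iwx (d (c j)) u) =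
      ib s \<cdot> (\<Oplus>\<^bsub>D\<^esub>j\<in>{..<q}. comm (ix (y j)) (ib r) \<cdot> comm (iy u) (ia (c j)))"
    by (rule sum_mult_left) (use u gen in \<open>simp_all add: ixw_gen iwx_d D.A.m_assoc\<close>)
  then show ?case using u gen by (simp add: extra1 ev_pair_ract ib_mult)
next
  case (add v w)
  have "(\<Oplus>\<^bsub>D\<^esub>j\<in>{..<q}. ixw (y j) (v \<oplus>\<^bsub>\<Omega>\<^esub> w) \<cdot> iwx (d (c j)) u) =
      (\<Oplus>\<^bsub>D\<^esub>j\<in>{..<q}. ixw (y j) v \<cdot> iwx (d (c j)) u) \<^bold>+ (\<Oplus>\<^bsub>D\<^esub>j\<in>{..<q}. ixw (y j) w \<cdot> iwx (d (c j)) u)"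
    by (rule sum_add) (use u add in \<open>simp_all add: ixw_add D.A.l_distr\<close>)
  then show ?case
    using u add by (simp add: bilinear_maps_add_right[OF ev_pair_bilinear] ib_add)
qed

lemma sum_iwx_ixw':
  assumes u: "u \<in> carrier X" and w: "w \<in> carrier \<Omega>"
  shows "(\<Oplus>\<^bsub>D\<^esub>i\<in>{..<p}. iwx w (x i) \<cdot> ixw u (d (b i))) = ia (uev_pair w u)"
  using w
proof (induction rule: Omega_induct_left)
  case (gen r s)
  have "(\<Oplus>\<^bsub>D\<^esub>i\<in>{..<p}. iwx (r \<triangleright>\<^bsub>\<Omega>\<^esub> d s) (x i) \<cdot> ixw u (d (b i))) =
      ia r \<cdot> (\<Oplus>\<^bsub>D\<^esub>i\<in>{..<p}. comm (iy (x i)) (ia s) \<cdot> comm (ix u) (ib (b i)))"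
    by (rule sum_mult_left) (use u gen in \<open>simp_all add: iwx_gen ixw_d D.A.m_assoc\<close>)
  then show ?case using u gen by (simp add: extra2 uev_pair_lact ia_mult)
next
  case (add v w)
  have "(\<Oplus>\<^bsub>D\<^esub>i\<in>{..<p}. iwx (v \<oplus>\<^bsub>\<Omega>\<^esub> w) (x i) \<cdot> ixw u (d (b i))) =
      (\<Oplus>\<^bsub>D\<^esub>i\<in>{..<p}. iwx v (x i) \<cdot> ixw u (d (b i))) \<^bold>+ (\<Oplus>\<^bsub>D\<^esub>i\<in>{..<p}. iwx w (x i) \<cdot> ixw u (d (b i)))"
    by (rule sum_add) (use u add in \<open>simp_all add: iwx_add D.A.l_distr\<close>)
  then show ?case
    using u add by (simp add: bilinear_maps_add_left[OF uev_pair_bilinear] ia_add)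
qed

theorem B_rep_imp_H_rep: "H_rep K A \<Omega> d X coev ev ucoev uev p b x q y c D ia ib ix ixw iwx"
proof unfold_locales
  show "ix u \<cdot> ib r = ib r \<cdot> ix u \<^bold>+ ixw u (d r)" if "r \<in> carrier A" "u \<in> carrier X" for r u
    using that by (simp add: ixw_d comm_eq)
qed (simp_all add: ix_linear ixw_bilinear iwx_bilinear ia_ix ix_ia ia_ixw ib_ixw ixw_ia ixw_ib
    ia_iwx ib_iwx iwx_ia iwx_ib sum_iwx_ixw sum_ixw_iwx sum_ixw_iwx' sum_iwx_ixw')

end


section \<open>The presented algebras\<close>

lemma alg_hom_finsum_eq:
  assumes "K_algebra K B" "K_algebra K C" "h \<in> alg_hom K B C"
    and F: "\<And>i. i < n \<Longrightarrow> F i \<in> carrier B" and G: "\<And>i. i < n \<Longrightarrow> h (F i) = G i"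
  shows "h (\<Oplus>\<^bsub>B\<^esub>i\<in>{..<n::nat}. F i) = (\<Oplus>\<^bsub>C\<^esub>i\<in>{..<n}. G i)"
proof -
  interpret C: K_algebra K C by fact
  have "h (\<Oplus>\<^bsub>B\<^esub>i\<in>{..<n}. F i) = (\<Oplus>\<^bsub>C\<^esub>i\<in>{..<n}. h (F i))"
    by (rule alg_hom_finsum[OF assms(1-3)]) (use F in auto)
  also have "\<dots> = (\<Oplus>\<^bsub>C\<^esub>i\<in>{..<n}. G i)"
  proof (rule C.M.finsum_cong')
    show "G \<in> {..<n} \<rightarrow> carrier C"
    proof
      fix i assume "i \<in> {..<n}"
      then show "G i \<in> carrier C"
        using alg_hom_closed[OF assms(3) F[of i]] G[of i] by simp
    qed
  qed (use G in auto)
  finally show ?thesis .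
qed

context algebra_tensor
begin

lemma tensor_inl_hom: "(\<lambda>v. ae v \<one>\<^bsub>W\<^esub>) \<in> alg_hom K V AE"
  by (rule alg_homI[OF bilinear_maps_left[OF tensor_elem_bilinear]])
     (simp_all add: tensor_elem_mult tensor_one)

lemma tensor_inr_hom: "(\<lambda>w. ae \<one>\<^bsub>V\<^esub> w) \<in> alg_hom K W AE"
  by (rule alg_homI[OF bilinear_maps_right[OF tensor_elem_bilinear]])
     (simp_all add: tensor_elem_mult tensor_one)

lemma tensor_split:
  "\<lbrakk>v \<in> carrier V; w \<in> carrier W\<rbrakk> \<Longrightarrow> ae v \<one>\<^bsub>W\<^esub> \<otimes>\<^bsub>AE\<^esub> ae \<one>\<^bsub>V\<^esub> w = ae v w"
  "\<lbrakk>v \<in> carrier V; w \<in> carrier W\<rbrakk> \<Longrightarrow> ae \<one>\<^bsub>V\<^esub> w \<otimes>\<^bsub>AE\<^esub> ae v \<one>\<^bsub>W\<^esub> = ae v w"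
  by (simp_all add: tensor_elem_mult)

end

context pivotal_calculus
begin

lemma A_algebra: "K_algebra K A" ..

lemma Ae: "algebra_tensor K A (opposite A)"
  by (intro algebra_tensor.intro A_algebra opposite_K_algebra)

lemmas Ae_algebra = algebra_tensor.tensor_K_algebra[OF Ae]

lemma tensor_alg_X: "tensor_alg K X"
  by (intro tensor_alg.intro K.field_axioms X.M.module_axioms)

lemma tensor_X_Omega: "tensor_product K X \<Omega>"
  by (intro tensor_product.intro K.field_axioms X.M.module_axioms M.module_axioms)

lemma tensor_Omega_X: "tensor_product K \<Omega> X"
  by (intro tensor_product.intro K.field_axioms X.M.module_axioms M.module_axioms)

lemma tensor_alg_XW: "tensor_alg K XW"
  by (intro tensor_alg.intro K.field_axioms tensor_product.tensor_module[OF tensor_X_Omega])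

lemma tensor_alg_WX: "tensor_alg K WX"
  by (intro tensor_alg.intro K.field_axioms tensor_product.tensor_module[OF tensor_Omega_X])

lemmas TX_algebra = tensor_alg.tensor_algebra_K_algebra[OF tensor_alg_X]
lemmas TXW_algebra = tensor_alg.tensor_algebra_K_algebra[OF tensor_alg_XW]
lemmas TWX_algebra = tensor_alg.tensor_algebra_K_algebra[OF tensor_alg_WX]

lemma fp1: "free_prod K Ae TX"
  by (intro free_prod.intro Ae_algebra TX_algebra)

lemmas H1_algebra = free_prod.free_product_K_algebra[OF fp1]

lemma fp2: "free_prod K H1 (tensor_algebra K XW)"
  by (intro free_prod.intro H1_algebra TXW_algebra)

lemmas H2_algebra = free_prod.free_product_K_algebra[OF fp2]

lemma fp3: "free_prod K H2 (tensor_algebra K WX)"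
  by (intro free_prod.intro H2_algebra TWX_algebra)

lemma H_free_algebra: "K_algebra K H_free"
  unfolding H_free_def by (rule free_prod.free_product_K_algebra[OF fp3])

lemma fpB: "free_prod K B1 TX"
  by (intro free_prod.intro H1_algebra TX_algebra)

lemma B_free_algebra: "K_algebra K B_free"
  unfolding B_free_def by (rule free_prod.free_product_K_algebra[OF fpB])

definition H_incl where
  "H_incl t = free_inl K H2 (tensor_algebra K WX) (free_inl K H1 (tensor_algebra K XW) (free_inl K Ae TX t))"

definition B_incl where "B_incl t = free_inl K B1 TX (free_inl K Ae TX t)"

lemma H_incl_hom: "H_incl \<in> alg_hom K Ae H_free"
  unfolding H_incl_def H_free_def
  by (intro alg_hom_comp[OF alg_hom_comp[OF free_prod.free_inl_hom[OF fp1] free_prod.free_inl_hom[OF fp2]]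
        free_prod.free_inl_hom[OF fp3]])

lemma B_incl_hom: "B_incl \<in> alg_hom K Ae B_free"
  unfolding B_incl_def B_free_def
  by (rule alg_hom_comp[OF free_prod.free_inl_hom[OF fp1] free_prod.free_inl_hom[OF fpB]])

lemma H_iab_eq: "H_iab r s = H_incl (ae r s)"
  unfolding H_iab_def H_incl_def ..

lemma B_iab_eq: "B_iab r s = B_incl (ae r s)"
  unfolding B_iab_def B_incl_def ..

text \<open>
  The part of both algebras generated by \<open>A\<close> and its opposite is treated once, for an arbitrary
  homomorphism out of the enveloping algebra.
\<close>

lemma envelope:
  assumes h: "h \<in> alg_hom K Ae D"
  shows "(\<lambda>r. h (ae r \<one>\<^bsub>A\<^esub>)) \<in> alg_hom K A D"
    and "(\<lambda>s. h (ae \<one>\<^bsub>A\<^esub> s)) \<in> alg_hom K (opposite A) D"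
    and "\<lbrakk>r \<in> carrier A; s \<in> carrier A\<rbrakk> \<Longrightarrow> h (ae r \<one>\<^bsub>A\<^esub>) \<otimes>\<^bsub>D\<^esub> h (ae \<one>\<^bsub>A\<^esub> s) = h (ae r s)"
    and "\<lbrakk>r \<in> carrier A; s \<in> carrier A\<rbrakk> \<Longrightarrow> h (ae \<one>\<^bsub>A\<^esub> s) \<otimes>\<^bsub>D\<^esub> h (ae r \<one>\<^bsub>A\<^esub>) = h (ae r s)"
proof -
  note inl = algebra_tensor.tensor_inl_hom[OF Ae, unfolded opposite_simps]
  note inr = algebra_tensor.tensor_inr_hom[OF Ae]
  show "(\<lambda>r. h (ae r \<one>\<^bsub>A\<^esub>)) \<in> alg_hom K A D" by (rule alg_hom_comp[OF inl h])
  show "(\<lambda>s. h (ae \<one>\<^bsub>A\<^esub> s)) \<in> alg_hom K (opposite A) D" by (rule alg_hom_comp[OF inr h])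
  have c: "ae r \<one>\<^bsub>A\<^esub> \<in> carrier Ae" "ae \<one>\<^bsub>A\<^esub> s \<in> carrier Ae" if "r \<in> carrier A" "s \<in> carrier A" for r s
    using that alg_hom_closed[OF inl] alg_hom_closed[OF inr] by (simp_all add: opposite_simps)
  note split = algebra_tensor.tensor_split[OF Ae, unfolded opposite_simps]
  show "h (ae r \<one>\<^bsub>A\<^esub>) \<otimes>\<^bsub>D\<^esub> h (ae \<one>\<^bsub>A\<^esub> s) = h (ae r s)"
    and "h (ae \<one>\<^bsub>A\<^esub> s) \<otimes>\<^bsub>D\<^esub> h (ae r \<one>\<^bsub>A\<^esub>) = h (ae r s)"
    if "r \<in> carrier A" "s \<in> carrier A" for r s
    using that split[of r s] c alg_hom_mult[OF h] by metis+
qed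

lemma H_ix_linear: "H_ix \<in> linear_maps K X H_free"
  unfolding H_ix_def H_free_def
  by (intro linear_maps_comp[OF linear_maps_comp[OF linear_maps_comp[OF
        tensor_alg.tensor_incl_linear[OF tensor_alg_X] alg_hom_linear[OF free_prod.free_inr_hom[OF fp1]]]
        alg_hom_linear[OF free_prod.free_inl_hom[OF fp2]]] alg_hom_linear[OF free_prod.free_inl_hom[OF fp3]]])

lemma H_ixw_bilinear: "H_ixw \<in> bilinear_maps K X \<Omega> H_free"
  unfolding H_ixw_def H_free_def
  by (intro bilinear_maps_comp_linear[OF tensor_product.tensor_elem_bilinear[OF tensor_X_Omega]
        linear_maps_comp[OF linear_maps_comp[OF tensor_alg.tensor_incl_linear[OF tensor_alg_XW]
          alg_hom_linear[OF free_prod.free_inr_hom[OF fp2]]]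
          alg_hom_linear[OF free_prod.free_inl_hom[OF fp3]]]])

lemma H_iwx_bilinear: "H_iwx \<in> bilinear_maps K \<Omega> X H_free"
  unfolding H_iwx_def H_free_def
  by (intro bilinear_maps_comp_linear[OF tensor_product.tensor_elem_bilinear[OF tensor_Omega_X]
        linear_maps_comp[OF tensor_alg.tensor_incl_linear[OF tensor_alg_WX]
          alg_hom_linear[OF free_prod.free_inr_hom[OF fp3]]]])

lemma B_ix_linear: "B_ix \<in> linear_maps K X B_free"
  unfolding B_ix_def B_free_def
  by (intro linear_maps_comp[OF linear_maps_comp[OF tensor_alg.tensor_incl_linear[OF tensor_alg_X]
        alg_hom_linear[OF free_prod.free_inr_hom[OF fp1]]] alg_hom_linear[OF free_prod.free_inl_hom[OF fpB]]])

lemma B_iy_linear: "B_iy \<in> linear_maps K X B_free"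
  unfolding B_iy_def B_free_def
  by (intro linear_maps_comp[OF tensor_alg.tensor_incl_linear[OF tensor_alg_X]
        alg_hom_linear[OF free_prod.free_inr_hom[OF fpB]]])

lemmas H_envelope = envelope[OF H_incl_hom, folded H_iab_eq, folded H_ia_def H_ib_def]
lemmas B_envelope = envelope[OF B_incl_hom, folded B_iab_eq, folded B_ia_def B_ib_def]

lemma H_closed [simp]:
  "r \<in> carrier A \<Longrightarrow> H_ia r \<in> carrier H_free" "r \<in> carrier A \<Longrightarrow> H_ib r \<in> carrier H_free"
  "\<lbrakk>r \<in> carrier A; s \<in> carrier A\<rbrakk> \<Longrightarrow> H_iab r s \<in> carrier H_free"
  "u \<in> carrier X \<Longrightarrow> H_ix u \<in> carrier H_free"
  "\<lbrakk>u \<in> carrier X; w \<in> carrier \<Omega>\<rbrakk> \<Longrightarrow> H_ixw u w \<in> carrier H_free"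
  "\<lbrakk>u \<in> carrier X; w \<in> carrier \<Omega>\<rbrakk> \<Longrightarrow> H_iwx w u \<in> carrier H_free"
proof -
  interpret H: K_algebra K H_free by (rule H_free_algebra)
  show ia: "r \<in> carrier A \<Longrightarrow> H_ia r \<in> carrier H_free" for r
    by (rule alg_hom_closed[OF H_envelope(1)])
  show ib: "r \<in> carrier A \<Longrightarrow> H_ib r \<in> carrier H_free" for r
    using alg_hom_closed[OF H_envelope(2)] by (simp add: opposite_simps)
  show "\<lbrakk>r \<in> carrier A; s \<in> carrier A\<rbrakk> \<Longrightarrow> H_iab r s \<in> carrier H_free"
    using H_envelope(3)[of r s] ia[of r] ib[of s] by (metis H.A.m_closed)
qed (auto intro: linear_maps_closed[OF H_ix_linear] bilinear_maps_closed[OF H_ixw_bilinear]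
    bilinear_maps_closed[OF H_iwx_bilinear])

lemma B_closed [simp]:
  "r \<in> carrier A \<Longrightarrow> B_ia r \<in> carrier B_free" "r \<in> carrier A \<Longrightarrow> B_ib r \<in> carrier B_free"
  "u \<in> carrier X \<Longrightarrow> B_ix u \<in> carrier B_free" "u \<in> carrier X \<Longrightarrow> B_iy u \<in> carrier B_free"
  using alg_hom_closed[OF B_envelope(2)]
  by (auto intro: linear_maps_closed[OF B_ix_linear] linear_maps_closed[OF B_iy_linear]
      alg_hom_closed[OF B_envelope(1)] simp: opposite_simps)

text \<open>
  The universal properties of the nested free products, of the tensor algebras and of the tensor
  products combine into one statement about the images of the generators.
\<close>

lemma H_free_lift:
  assumes D: "K_algebra K D" and ia: "ia \<in> alg_hom K A D" and ib: "ib \<in> alg_hom K (opposite A) D"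
    and comm: "\<And>r s. \<lbrakk>r \<in> carrier A; s \<in> carrier A\<rbrakk> \<Longrightarrow> ia r \<otimes>\<^bsub>D\<^esub> ib s = ib s \<otimes>\<^bsub>D\<^esub> ia r"
    and ix: "ix \<in> linear_maps K X D"
    and ixw: "ixw \<in> bilinear_maps K X \<Omega> D" and iwx: "iwx \<in> bilinear_maps K \<Omega> X D"
  shows "\<exists>h \<in> alg_hom K H_free D.
    (\<forall>r \<in> carrier A. \<forall>s \<in> carrier A. h (H_iab r s) = ia r \<otimes>\<^bsub>D\<^esub> ib s) \<and>
    (\<forall>u \<in> carrier X. h (H_ix u) = ix u) \<and>
    (\<forall>u \<in> carrier X. \<forall>w \<in> carrier \<Omega>. h (H_ixw u w) = ixw u w) \<and>
    (\<forall>u \<in> carrier X. \<forall>w \<in> carrier \<Omega>. h (H_iwx w u) = iwx w u)"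
proof -
  obtain f1 where f1: "f1 \<in> alg_hom K Ae D"
    "\<And>r s. \<lbrakk>r \<in> carrier A; s \<in> carrier A\<rbrakk> \<Longrightarrow> f1 (ae r s) = ia r \<otimes>\<^bsub>D\<^esub> ib s"
    using algebra_tensor.tensor_alg_lift[OF Ae D ia ib] comm by (auto simp: opposite_simps)
  obtain f2 where f2: "f2 \<in> alg_hom K TX D" "\<And>u. u \<in> carrier X \<Longrightarrow> f2 (tensor_incl K X u) = ix u"
    using tensor_alg.tensor_algebra_lift[OF tensor_alg_X D ix] by blast
  obtain l3 where l3: "l3 \<in> linear_maps K XW D"
    "\<And>u w. \<lbrakk>u \<in> carrier X; w \<in> carrier \<Omega>\<rbrakk> \<Longrightarrow> l3 (tensor_elem K X \<Omega> u w) = ixw u w"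
    using tensor_product.tensor_lift[OF tensor_X_Omega K_algebra_module[OF D] ixw] by blast
  obtain l4 where l4: "l4 \<in> linear_maps K WX D"
    "\<And>u w. \<lbrakk>u \<in> carrier X; w \<in> carrier \<Omega>\<rbrakk> \<Longrightarrow> l4 (tensor_elem K \<Omega> X w u) = iwx w u"
    using tensor_product.tensor_lift[OF tensor_Omega_X K_algebra_module[OF D] iwx] by blast
  obtain f3 where f3: "f3 \<in> alg_hom K (tensor_algebra K XW) D"
    "\<And>t. t \<in> carrier XW \<Longrightarrow> f3 (tensor_incl K XW t) = l3 t"
    using tensor_alg.tensor_algebra_lift[OF tensor_alg_XW D l3(1)] by blast
  obtain f4 where f4: "f4 \<in> alg_hom K (tensor_algebra K WX) D"
    "\<And>t. t \<in> carrier WX \<Longrightarrow> f4 (tensor_incl K WX t) = l4 t"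
    using tensor_alg.tensor_algebra_lift[OF tensor_alg_WX D l4(1)] by blast
  obtain g1 where g1: "g1 \<in> alg_hom K H1 D" "\<And>t. t \<in> carrier Ae \<Longrightarrow> g1 (free_inl K Ae TX t) = f1 t"
    "\<And>t. t \<in> carrier TX \<Longrightarrow> g1 (free_inr K Ae TX t) = f2 t"
    using free_prod.free_product_lift[OF fp1 D f1(1) f2(1)] by blast
  obtain g2 where g2: "g2 \<in> alg_hom K H2 D"
    "\<And>t. t \<in> carrier H1 \<Longrightarrow> g2 (free_inl K H1 (tensor_algebra K XW) t) = g1 t"
    "\<And>t. t \<in> carrier (tensor_algebra K XW) \<Longrightarrow> g2 (free_inr K H1 (tensor_algebra K XW) t) = f3 t"
    using free_prod.free_product_lift[OF fp2 D g1(1) f3(1)] by blast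
  obtain g3 where g3: "g3 \<in> alg_hom K H_free D"
    "\<And>t. t \<in> carrier H2 \<Longrightarrow> g3 (free_inl K H2 (tensor_algebra K WX) t) = g2 t"
    "\<And>t. t \<in> carrier (tensor_algebra K WX) \<Longrightarrow> g3 (free_inr K H2 (tensor_algebra K WX) t) = f4 t"
    using free_prod.free_product_lift[OF fp3 D g2(1) f4(1)] unfolding H_free_def by blast
  have tX: "tensor_incl K X u \<in> carrier TX" if "u \<in> carrier X" for u
    by (rule linear_maps_closed[OF tensor_alg.tensor_incl_linear[OF tensor_alg_X] that])
  have tXW: "tensor_incl K XW t \<in> carrier (tensor_algebra K XW)" if "t \<in> carrier XW" for t
    by (rule linear_maps_closed[OF tensor_alg.tensor_incl_linear[OF tensor_alg_XW] that])
  have tWX: "tensor_incl K WX t \<in> carrier (tensor_algebra K WX)" if "t \<in> carrier WX" for t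
    by (rule linear_maps_closed[OF tensor_alg.tensor_incl_linear[OF tensor_alg_WX] that])
  have eXW: "tensor_elem K X \<Omega> u w \<in> carrier XW" and eWX: "tensor_elem K \<Omega> X w u \<in> carrier WX"
    if "u \<in> carrier X" "w \<in> carrier \<Omega>" for u w
    using that tensor_product.tensor_elem_closed[OF tensor_X_Omega]
      tensor_product.tensor_elem_closed[OF tensor_Omega_X] by auto
  have eAe: "ae r s \<in> carrier Ae" if "r \<in> carrier A" "s \<in> carrier A" for r s
  proof -
    interpret at: algebra_tensor K A "opposite A" by (rule Ae)
    show ?thesis using that by (intro at.tensor_elem_closed) (simp_all add: opposite_simps)
  qed
  note cl = alg_hom_closed[OF free_prod.free_inl_hom[OF fp1]] alg_hom_closed[OF free_prod.free_inr_hom[OF fp1]]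
    alg_hom_closed[OF free_prod.free_inl_hom[OF fp2]] alg_hom_closed[OF free_prod.free_inr_hom[OF fp2]]
    alg_hom_closed[OF free_prod.free_inl_hom[OF fp3]] alg_hom_closed[OF free_prod.free_inr_hom[OF fp3]]
  show ?thesis
  proof (intro bexI[OF _ g3(1)] conjI ballI)
    show "g3 (H_iab r s) = ia r \<otimes>\<^bsub>D\<^esub> ib s" if "r \<in> carrier A" "s \<in> carrier A" for r s
      unfolding H_iab_def using that by (simp add: g3 g2 g1 f1 cl eAe)
    show "g3 (H_ix u) = ix u" if "u \<in> carrier X" for u
      unfolding H_ix_def using that by (simp add: g3 g2 g1 f2 cl tX)
    show "g3 (H_ixw u w) = ixw u w" "g3 (H_iwx w u) = iwx w u" if "u \<in> carrier X" "w \<in> carrier \<Omega>" for u w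
      unfolding H_ixw_def H_iwx_def using that
      by (simp_all add: g3 g2 f3 f4 l3 l4 cl tXW tWX eXW eWX)
  qed
qed

lemma B_free_lift:
  assumes D: "K_algebra K D" and ia: "ia \<in> alg_hom K A D" and ib: "ib \<in> alg_hom K (opposite A) D"
    and comm: "\<And>r s. \<lbrakk>r \<in> carrier A; s \<in> carrier A\<rbrakk> \<Longrightarrow> ia r \<otimes>\<^bsub>D\<^esub> ib s = ib s \<otimes>\<^bsub>D\<^esub> ia r"
    and ix: "ix \<in> linear_maps K X D" and iy: "iy \<in> linear_maps K X D"
  shows "\<exists>h \<in> alg_hom K B_free D.
    (\<forall>r \<in> carrier A. \<forall>s \<in> carrier A. h (B_iab r s) = ia r \<otimes>\<^bsub>D\<^esub> ib s) \<and>
    (\<forall>u \<in> carrier X. h (B_ix u) = ix u) \<and> (\<forall>u \<in> carrier X. h (B_iy u) = iy u)"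
proof -
  obtain f1 where f1: "f1 \<in> alg_hom K Ae D"
    "\<And>r s. \<lbrakk>r \<in> carrier A; s \<in> carrier A\<rbrakk> \<Longrightarrow> f1 (ae r s) = ia r \<otimes>\<^bsub>D\<^esub> ib s"
    using algebra_tensor.tensor_alg_lift[OF Ae D ia ib] comm by (auto simp: opposite_simps)
  obtain f2 where f2: "f2 \<in> alg_hom K TX D" "\<And>u. u \<in> carrier X \<Longrightarrow> f2 (tensor_incl K X u) = ix u"
    using tensor_alg.tensor_algebra_lift[OF tensor_alg_X D ix] by blast
  obtain f3 where f3: "f3 \<in> alg_hom K TX D" "\<And>u. u \<in> carrier X \<Longrightarrow> f3 (tensor_incl K X u) = iy u"
    using tensor_alg.tensor_algebra_lift[OF tensor_alg_X D iy] by blast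
  obtain g1 where g1: "g1 \<in> alg_hom K B1 D" "\<And>t. t \<in> carrier Ae \<Longrightarrow> g1 (free_inl K Ae TX t) = f1 t"
    "\<And>t. t \<in> carrier TX \<Longrightarrow> g1 (free_inr K Ae TX t) = f2 t"
    using free_prod.free_product_lift[OF fp1 D f1(1) f2(1)] by blast
  obtain g2 where g2: "g2 \<in> alg_hom K B_free D"
    "\<And>t. t \<in> carrier B1 \<Longrightarrow> g2 (free_inl K B1 TX t) = g1 t"
    "\<And>t. t \<in> carrier TX \<Longrightarrow> g2 (free_inr K B1 TX t) = f3 t"
    using free_prod.free_product_lift[OF fpB D g1(1) f3(1)] unfolding B_free_def by blast
  have tX: "tensor_incl K X u \<in> carrier TX" if "u \<in> carrier X" for u
    by (rule linear_maps_closed[OF tensor_alg.tensor_incl_linear[OF tensor_alg_X] that])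
  have eAe: "ae r s \<in> carrier Ae" if "r \<in> carrier A" "s \<in> carrier A" for r s
  proof -
    interpret at: algebra_tensor K A "opposite A" by (rule Ae)
    show ?thesis using that by (intro at.tensor_elem_closed) (simp_all add: opposite_simps)
  qed
  note cl = alg_hom_closed[OF free_prod.free_inl_hom[OF fp1]] alg_hom_closed[OF free_prod.free_inr_hom[OF fp1]]
  show ?thesis
  proof (intro bexI[OF _ g2(1)] conjI ballI)
    show "g2 (B_iab r s) = ia r \<otimes>\<^bsub>D\<^esub> ib s" if "r \<in> carrier A" "s \<in> carrier A" for r s
      unfolding B_iab_def using that by (simp add: g2 g1 f1 cl eAe)
    show "g2 (B_ix u) = ix u" "g2 (B_iy u) = iy u" if "u \<in> carrier X" for u
      unfolding B_ix_def B_iy_def using that by (simp_all add: g2 g1 f2 f3 cl tX)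
  qed
qed

lemma bilinear_image_spans:
  assumes V: "tensor_product K V W" and C: "K_algebra K C" and l: "l \<in> linear_maps K (tensor K V W) C"
  shows "l ` carrier (tensor K V W) \<subseteq>
    alg_span K C {l (tensor_elem K V W v w) | v w. v \<in> carrier V \<and> w \<in> carrier W}"
proof clarify
  fix t assume "t \<in> carrier (tensor K V W)"
  then show "l t \<in> alg_span K C {l (tensor_elem K V W v w) | v w. v \<in> carrier V \<and> w \<in> carrier W}"
  proof (induction rule: tensor_product.tensor_induct[OF V, consumes 1, case_names elem add])
    case (elem v w)
    then show ?case by (intro alg_span.gen) auto
  next
    case (add t u)
    then show ?case by (simp add: linear_maps_add[OF l] alg_span.add)
  qed
qed

lemma Ae_generates: "generates K Ae ((\<lambda>r. ae r \<one>\<^bsub>A\<^esub>) ` carrier A \<union> (\<lambda>s. ae \<one>\<^bsub>A\<^esub> s) ` carrier A)"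
proof (rule generates_trans[OF algebra_tensor.tensor_generates[OF Ae]])
  interpret at: algebra_tensor K A "opposite A" by (rule Ae)
  let ?G = "(\<lambda>r. ae r \<one>\<^bsub>A\<^esub>) ` carrier A \<union> (\<lambda>s. ae \<one>\<^bsub>A\<^esub> s) ` carrier A"
  show "?G \<subseteq> carrier Ae"
    by (auto intro!: at.tensor_elem_closed simp: opposite_simps)
  show "{ae v w | v w. v \<in> carrier A \<and> w \<in> carrier (opposite A)} \<subseteq> alg_span K Ae ?G"
  proof clarify
    fix r s assume rs: "r \<in> carrier A" "s \<in> carrier (opposite A)"
    then have "ae r \<one>\<^bsub>A\<^esub> \<otimes>\<^bsub>Ae\<^esub> ae \<one>\<^bsub>A\<^esub> s \<in> alg_span K Ae ?G"
      by (intro alg_span.mult alg_span.gen) (auto simp: opposite_simps)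
    then show "ae r s \<in> alg_span K Ae ?G"
      using at.tensor_split(1)[OF rs] by (simp add: opposite_simps)
  qed
qed

lemmas H1_generates = free_prod.free_product_generates[OF fp1 Ae_generates
    tensor_alg.tensor_algebra_generates[OF tensor_alg_X]]

lemma B_free_generates:
  "generates K B_free (B_ia ` carrier A \<union> B_ib ` carrier A \<union> B_ix ` carrier X \<union> B_iy ` carrier X)"
  using free_prod.free_product_generates[OF fpB H1_generates
      tensor_alg.tensor_algebra_generates[OF tensor_alg_X]]
  unfolding B_free_def B_ia_def B_ib_def B_iab_def B_ix_def B_iy_def
  by (simp add: image_Un image_image)

lemma H_free_generates:
  "generates K H_free (H_ia ` carrier A \<union> H_ib ` carrier A \<union> H_ix ` carrier X \<union>
    {H_ixw u w | u w. u \<in> carrier X \<and> w \<in> carrier \<Omega>} \<union> {H_iwx w u | w u. w \<in> carrier \<Omega> \<and> u \<in> carrier X})"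
    (is "generates K H_free ?G")
proof (rule generates_trans)
  let ?i = "free_inl K H2 (tensor_algebra K WX)" and ?j = "free_inl K H1 (tensor_algebra K XW)"
  let ?lxw = "\<lambda>t. ?i (free_inr K H1 (tensor_algebra K XW) (tensor_incl K XW t))"
  let ?lwx = "\<lambda>t. free_inr K H2 (tensor_algebra K WX) (tensor_incl K WX t)"
  show "generates K H_free (H_ia ` carrier A \<union> H_ib ` carrier A \<union> H_ix ` carrier X \<union>
      ?lxw ` carrier XW \<union> ?lwx ` carrier WX)"
    using free_prod.free_product_generates[OF fp3
        free_prod.free_product_generates[OF fp2 H1_generates
          tensor_alg.tensor_algebra_generates[OF tensor_alg_XW]]
        tensor_alg.tensor_algebra_generates[OF tensor_alg_WX]]
    unfolding H_free_def H_ia_def H_ib_def H_iab_def H_ix_def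
    by (simp add: image_Un image_image)
  have lxw: "?lxw \<in> linear_maps K XW H_free" and lwx: "?lwx \<in> linear_maps K WX H_free"
    unfolding H_free_def
    by (intro linear_maps_comp[OF linear_maps_comp[OF tensor_alg.tensor_incl_linear[OF tensor_alg_XW]
          alg_hom_linear[OF free_prod.free_inr_hom[OF fp2]]]
          alg_hom_linear[OF free_prod.free_inl_hom[OF fp3]]]
        linear_maps_comp[OF tensor_alg.tensor_incl_linear[OF tensor_alg_WX]
          alg_hom_linear[OF free_prod.free_inr_hom[OF fp3]]])+
  show "?G \<subseteq> carrier H_free" by auto
  have xw: "{?lxw (tensor_elem K X \<Omega> u w) | u w. u \<in> carrier X \<and> w \<in> carrier \<Omega>} =
      {H_ixw u w | u w. u \<in> carrier X \<and> w \<in> carrier \<Omega>}"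
    unfolding H_ixw_def ..
  have wx: "{?lwx (tensor_elem K \<Omega> X w u) | w u. w \<in> carrier \<Omega> \<and> u \<in> carrier X} =
      {H_iwx w u | w u. w \<in> carrier \<Omega> \<and> u \<in> carrier X}"
    unfolding H_iwx_def ..
  have gen: "alg_span K H_free S \<subseteq> alg_span K H_free ?G" if "S \<subseteq> ?G" for S
    by (rule alg_span_subset) (use that in \<open>auto intro: alg_span.gen\<close>)
  have "?lxw ` carrier XW \<subseteq> alg_span K H_free ?G"
    using bilinear_image_spans[OF tensor_X_Omega H_free_algebra lxw] unfolding xw
    by (rule order_trans) (rule gen, rule order_trans[OF Un_upper2 Un_upper1])
  moreover have "?lwx ` carrier WX \<subseteq> alg_span K H_free ?G"
    using bilinear_image_spans[OF tensor_Omega_X H_free_algebra lwx] unfolding wx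
    by (rule order_trans) (rule gen, rule Un_upper2)
  moreover have "H_ia ` carrier A \<union> H_ib ` carrier A \<union> H_ix ` carrier X \<subseteq> alg_span K H_free ?G"
    by (rule subsetI, rule alg_span.gen) simp
  ultimately show "H_ia ` carrier A \<union> H_ib ` carrier A \<union> H_ix ` carrier X \<union>
      ?lxw ` carrier XW \<union> ?lwx ` carrier WX \<subseteq> alg_span K H_free ?G"
    by (intro Un_least) simp_all
qed

end


section \<open>Universal properties of the two algebras and the isomorphism\<close>

context H_rep
begin

lemma iab_ixw:
  assumes "r \<in> carrier A" "r' \<in> carrier A" "s \<in> carrier A" "s' \<in> carrier A" "u \<in> carrier X" "w \<in> carrier \<Omega>"
  shows "ia r \<cdot> ib r' \<cdot> ixw u w \<cdot> (ia s \<cdot> ib s') = ixw ((r \<triangleright>\<^bsub>X\<^esub> u) \<triangleleft>\<^bsub>X\<^esub> s) ((s' \<triangleright>\<^bsub>\<Omega>\<^esub> w) \<triangleleft>\<^bsub>\<Omega>\<^esub> r')"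
proof -
  have "ia r \<cdot> ib r' \<cdot> ixw u w \<cdot> (ia s \<cdot> ib s') = ia r \<cdot> (ib r' \<cdot> ixw u w) \<cdot> ia s \<cdot> ib s'"
    using assms by (simp add: D.A.m_assoc)
  also have "\<dots> = ixw ((r \<triangleright>\<^bsub>X\<^esub> u) \<triangleleft>\<^bsub>X\<^esub> s) (s' \<triangleright>\<^bsub>\<Omega>\<^esub> (w \<triangleleft>\<^bsub>\<Omega>\<^esub> r'))"
    using assms by (simp add: ia_ixw ib_ixw ixw_ia ixw_ib X.lact_closed X.ract_closed ract_closed lact_closed)
  finally show ?thesis using assms by (simp add: lact_ract)
qed

lemma iab_iwx:
  assumes "r \<in> carrier A" "r' \<in> carrier A" "s \<in> carrier A" "s' \<in> carrier A" "u \<in> carrier X" "w \<in> carrier \<Omega>"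
  shows "ia r \<cdot> ib r' \<cdot> iwx w u \<cdot> (ia s \<cdot> ib s') = iwx ((r \<triangleright>\<^bsub>\<Omega>\<^esub> w) \<triangleleft>\<^bsub>\<Omega>\<^esub> s) ((s' \<triangleright>\<^bsub>X\<^esub> u) \<triangleleft>\<^bsub>X\<^esub> r')"
proof -
  have "ia r \<cdot> ib r' \<cdot> iwx w u \<cdot> (ia s \<cdot> ib s') = ia r \<cdot> (ib r' \<cdot> iwx w u) \<cdot> ia s \<cdot> ib s'"
    using assms by (simp add: D.A.m_assoc)
  also have "\<dots> = iwx ((r \<triangleright>\<^bsub>\<Omega>\<^esub> w) \<triangleleft>\<^bsub>\<Omega>\<^esub> s) (s' \<triangleright>\<^bsub>X\<^esub> (u \<triangleleft>\<^bsub>X\<^esub> r'))"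
    using assms by (simp add: ia_iwx ib_iwx iwx_ia iwx_ib X.lact_closed X.ract_closed ract_closed lact_closed)
  finally show ?thesis using assms by (simp add: X.lact_ract)
qed

end

context pivotal_calculus
begin

definition Hrel where "Hrel = H_relations p (\<lambda>i. d (b i)) x q y (\<lambda>j. d (c j))"
definition Hcls where "Hcls = impose_class H_free Hrel"
abbreviation HA where "HA \<equiv> HX p (\<lambda>i. d (b i)) x q y (\<lambda>j. d (c j))"

lemma HA_eq: "HA = impose H_free Hrel"
  unfolding HX_def Hrel_def ..

lemma H_imposed: "imposed K H_free Hrel"
proof (intro imposed.intro imposed_axioms.intro H_free_algebra)
  interpret H: K_algebra K H_free by (rule H_free_algebra)
  show "Hrel \<subseteq> carrier H_free \<times> carrier H_free"
    unfolding Hrel_def H_relations_def Let_def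
    by (intro Un_least)
       (auto intro!: H.M.finsum_closed simp: X.lact_closed X.ract_closed lact_closed ract_closed)
qed

lemmas HA_algebra = imposed.impose_K_algebra[OF H_imposed, folded HA_eq]
lemmas Hcls_hom = imposed.impose_class_hom[OF H_imposed, folded HA_eq Hcls_def]
lemmas Hcls_eq = imposed.impose_class_eq[OF H_imposed, folded Hcls_def]

lemma Hrel_memI:
  "\<lbrakk>r \<in> carrier A; u \<in> carrier X\<rbrakk> \<Longrightarrow> (H_ia r \<otimes>\<^bsub>H_free\<^esub> H_ix u, H_ix (r \<triangleright>\<^bsub>X\<^esub> u)) \<in> Hrel"
  "\<lbrakk>r \<in> carrier A; u \<in> carrier X\<rbrakk> \<Longrightarrow>
    (H_ix u \<otimes>\<^bsub>H_free\<^esub> H_ia r, H_ix (u \<triangleleft>\<^bsub>X\<^esub> r) \<oplus>\<^bsub>H_free\<^esub> H_ia (ev_pair u (d r))) \<in> Hrel"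
  "\<lbrakk>r \<in> carrier A; u \<in> carrier X\<rbrakk> \<Longrightarrow>
    (H_ix u \<otimes>\<^bsub>H_free\<^esub> H_ib r, H_ib r \<otimes>\<^bsub>H_free\<^esub> H_ix u \<oplus>\<^bsub>H_free\<^esub> H_ixw u (d r)) \<in> Hrel"
  "\<lbrakk>r \<in> carrier A; r' \<in> carrier A; s \<in> carrier A; s' \<in> carrier A; u \<in> carrier X; w \<in> carrier \<Omega>\<rbrakk> \<Longrightarrow>
    (H_iab r r' \<otimes>\<^bsub>H_free\<^esub> H_ixw u w \<otimes>\<^bsub>H_free\<^esub> H_iab s s',
      H_ixw ((r \<triangleright>\<^bsub>X\<^esub> u) \<triangleleft>\<^bsub>X\<^esub> s) ((s' \<triangleright>\<^bsub>\<Omega>\<^esub> w) \<triangleleft>\<^bsub>\<Omega>\<^esub> r')) \<in> Hrel"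
  "\<lbrakk>r \<in> carrier A; r' \<in> carrier A; s \<in> carrier A; s' \<in> carrier A; u \<in> carrier X; w \<in> carrier \<Omega>\<rbrakk> \<Longrightarrow>
    (H_iab r r' \<otimes>\<^bsub>H_free\<^esub> H_iwx w u \<otimes>\<^bsub>H_free\<^esub> H_iab s s',
      H_iwx ((r \<triangleright>\<^bsub>\<Omega>\<^esub> w) \<triangleleft>\<^bsub>\<Omega>\<^esub> s) ((s' \<triangleright>\<^bsub>X\<^esub> u) \<triangleleft>\<^bsub>X\<^esub> r')) \<in> Hrel"
  "\<lbrakk>u \<in> carrier X; w \<in> carrier \<Omega>\<rbrakk> \<Longrightarrow>
    (\<Oplus>\<^bsub>H_free\<^esub>i\<in>{..<p}. H_iwx (d (b i)) u \<otimes>\<^bsub>H_free\<^esub> H_ixw (x i) w, H_ib (uev_pair w u)) \<in> Hrel"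
  "\<lbrakk>u \<in> carrier X; w \<in> carrier \<Omega>\<rbrakk> \<Longrightarrow>
    (\<Oplus>\<^bsub>H_free\<^esub>j\<in>{..<q}. H_ixw u (d (c j)) \<otimes>\<^bsub>H_free\<^esub> H_iwx w (y j), H_ia (ev_pair u w)) \<in> Hrel"
  "\<lbrakk>u \<in> carrier X; w \<in> carrier \<Omega>\<rbrakk> \<Longrightarrow>
    (\<Oplus>\<^bsub>H_free\<^esub>j\<in>{..<q}. H_ixw (y j) w \<otimes>\<^bsub>H_free\<^esub> H_iwx (d (c j)) u, H_ib (ev_pair u w)) \<in> Hrel"
  "\<lbrakk>u \<in> carrier X; w \<in> carrier \<Omega>\<rbrakk> \<Longrightarrow>
    (\<Oplus>\<^bsub>H_free\<^esub>i\<in>{..<p}. H_iwx w (x i) \<otimes>\<^bsub>H_free\<^esub> H_ixw u (d (b i)), H_ia (uev_pair w u)) \<in> Hrel"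
  unfolding Hrel_def H_relations_def Let_def
proof goal_cases
  case 1
  show ?case by (rule UnI1, rule UnI1, rule UnI1, rule UnI1, rule UnI1, rule UnI1, rule UnI1, rule UnI1, use 1 in blast)
next
  case 2
  show ?case by (rule UnI1, rule UnI1, rule UnI1, rule UnI1, rule UnI1, rule UnI1, rule UnI1, rule UnI2, use 2 in blast)
next
  case 3
  show ?case by (rule UnI1, rule UnI1, rule UnI1, rule UnI1, rule UnI1, rule UnI1, rule UnI2, use 3 in blast)
next
  case 4
  show ?case by (rule UnI1, rule UnI1, rule UnI1, rule UnI1, rule UnI1, rule UnI2, use 4 in blast)
next
  case 5
  show ?case by (rule UnI1, rule UnI1, rule UnI1, rule UnI1, rule UnI2, use 5 in blast)
next
  case 6
  show ?case by (rule UnI1, rule UnI1, rule UnI1, rule UnI2, use 6 in blast)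
next
  case 7
  show ?case by (rule UnI1, rule UnI1, rule UnI2, use 7 in blast)
next
  case 8
  show ?case by (rule UnI1, rule UnI2, use 8 in blast)
next
  case 9
  show ?case by (rule UnI2, use 9 in blast)
qed

lemma H_free_mult_closed: "\<lbrakk>s \<in> carrier H_free; t \<in> carrier H_free\<rbrakk> \<Longrightarrow> s \<otimes>\<^bsub>H_free\<^esub> t \<in> carrier H_free"
  using K_algebra_ring[OF H_free_algebra] by (simp add: monoid.m_closed ring.is_monoid)

lemma H_hom_sums:
  assumes D: "K_algebra K D" and h: "h \<in> alg_hom K H_free D"
    and ixw: "\<And>u w. \<lbrakk>u \<in> carrier X; w \<in> carrier \<Omega>\<rbrakk> \<Longrightarrow> h (H_ixw u w) = ixw u w"
    and iwx: "\<And>u w. \<lbrakk>u \<in> carrier X; w \<in> carrier \<Omega>\<rbrakk> \<Longrightarrow> h (H_iwx w u) = iwx w u"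
    and u: "u \<in> carrier X" and w: "w \<in> carrier \<Omega>"
  shows "h (\<Oplus>\<^bsub>H_free\<^esub>i\<in>{..<p}. H_iwx (d (b i)) u \<otimes>\<^bsub>H_free\<^esub> H_ixw (x i) w) =
      (\<Oplus>\<^bsub>D\<^esub>i\<in>{..<p}. iwx (d (b i)) u \<otimes>\<^bsub>D\<^esub> ixw (x i) w)"
    and "h (\<Oplus>\<^bsub>H_free\<^esub>j\<in>{..<q}. H_ixw u (d (c j)) \<otimes>\<^bsub>H_free\<^esub> H_iwx w (y j)) =
      (\<Oplus>\<^bsub>D\<^esub>j\<in>{..<q}. ixw u (d (c j)) \<otimes>\<^bsub>D\<^esub> iwx w (y j))"
    and "h (\<Oplus>\<^bsub>H_free\<^esub>j\<in>{..<q}. H_ixw (y j) w \<otimes>\<^bsub>H_free\<^esub> H_iwx (d (c j)) u) =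
      (\<Oplus>\<^bsub>D\<^esub>j\<in>{..<q}. ixw (y j) w \<otimes>\<^bsub>D\<^esub> iwx (d (c j)) u)"
    and "h (\<Oplus>\<^bsub>H_free\<^esub>i\<in>{..<p}. H_iwx w (x i) \<otimes>\<^bsub>H_free\<^esub> H_ixw u (d (b i))) =
      (\<Oplus>\<^bsub>D\<^esub>i\<in>{..<p}. iwx w (x i) \<otimes>\<^bsub>D\<^esub> ixw u (d (b i)))"
  by (rule alg_hom_finsum_eq[OF H_free_algebra D h];
      simp add: alg_hom_mult[OF h] H_free_mult_closed u w ixw iwx)+

lemma H_hom_iab:
  assumes "K_algebra K D" "h \<in> alg_hom K H_free D" "r \<in> carrier A" "s \<in> carrier A"
  shows "h (H_iab r s) = h (H_ia r) \<otimes>\<^bsub>D\<^esub> h (H_ib s)"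
  using assms(3,4) by (simp add: alg_hom_mult[OF assms(2)] flip: H_envelope(3))

text \<open>
  The generators satisfy their own relations; setting all but one of the coefficients in the
  two-sided relations for pairs to \<open>1\<close> yields the one-sided ones.
\<close>

lemma H_rep_HA:
  "H_rep K A \<Omega> d X coev ev ucoev uev p b x q y c HA (\<lambda>r. Hcls (H_ia r)) (\<lambda>r. Hcls (H_ib r))
    (\<lambda>u. Hcls (H_ix u)) (\<lambda>u w. Hcls (H_ixw u w)) (\<lambda>w u. Hcls (H_iwx w u))"
proof -
  interpret HA: K_algebra K HA by (rule HA_algebra)
  interpret H: K_algebra K H_free by (rule H_free_algebra)
  note h = Hcls_hom
  note hom = alg_hom_mult[OF h] alg_hom_add[OF h] H_hom_iab[OF HA_algebra h]
  have ia1: "Hcls (H_ia \<one>\<^bsub>A\<^esub>) = \<one>\<^bsub>HA\<^esub>" and ib1: "Hcls (H_ib \<one>\<^bsub>A\<^esub>) = \<one>\<^bsub>HA\<^esub>"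
    using alg_hom_one[OF alg_hom_comp[OF H_envelope(1) h]] alg_hom_one[OF alg_hom_comp[OF H_envelope(2) h]]
    by (simp_all add: opposite_simps)
  have cl: "Hcls t \<in> carrier HA" if "t \<in> carrier H_free" for t by (rule alg_hom_closed[OF h that])
  have R4: "Hcls (H_ia r) \<otimes>\<^bsub>HA\<^esub> Hcls (H_ib r') \<otimes>\<^bsub>HA\<^esub> Hcls (H_ixw u w) \<otimes>\<^bsub>HA\<^esub> (Hcls (H_ia s) \<otimes>\<^bsub>HA\<^esub> Hcls (H_ib s')) =
      Hcls (H_ixw ((r \<triangleright>\<^bsub>X\<^esub> u) \<triangleleft>\<^bsub>X\<^esub> s) ((s' \<triangleright>\<^bsub>\<Omega>\<^esub> w) \<triangleleft>\<^bsub>\<Omega>\<^esub> r'))"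
    if "r \<in> carrier A" "r' \<in> carrier A" "s \<in> carrier A" "s' \<in> carrier A" "u \<in> carrier X" "w \<in> carrier \<Omega>"
    for r r' s s' u w
    using Hcls_eq[OF Hrel_memI(4)[OF that]] that by (simp add: hom)
  have R4': "Hcls (H_ia r) \<otimes>\<^bsub>HA\<^esub> Hcls (H_ib r') \<otimes>\<^bsub>HA\<^esub> Hcls (H_iwx w u) \<otimes>\<^bsub>HA\<^esub> (Hcls (H_ia s) \<otimes>\<^bsub>HA\<^esub> Hcls (H_ib s')) =
      Hcls (H_iwx ((r \<triangleright>\<^bsub>\<Omega>\<^esub> w) \<triangleleft>\<^bsub>\<Omega>\<^esub> s) ((s' \<triangleright>\<^bsub>X\<^esub> u) \<triangleleft>\<^bsub>X\<^esub> r'))"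
    if "r \<in> carrier A" "r' \<in> carrier A" "s \<in> carrier A" "s' \<in> carrier A" "u \<in> carrier X" "w \<in> carrier \<Omega>"
    for r r' s s' u w
    using Hcls_eq[OF Hrel_memI(5)[OF that]] that by (simp add: hom)
  note one = ia1 ib1 lact_one ract_one X.lact_one X.ract_one lact_closed ract_closed X.lact_closed X.ract_closed cl
  show ?thesis
  proof (unfold_locales, goal_cases)
    case 1
    show ?case by (rule alg_hom_comp[OF H_envelope(1) h])
  next
    case 2
    show ?case by (rule alg_hom_comp[OF H_envelope(2) h])
  next
    case (3 r s)
    have "Hcls (H_ia r \<otimes>\<^bsub>H_free\<^esub> H_ib s) = Hcls (H_ib s \<otimes>\<^bsub>H_free\<^esub> H_ia r)"
      using H_envelope(3,4)[OF 3] by simp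
    then show ?case using 3 by (simp add: alg_hom_mult[OF h])
  next
    case 4
    show ?case by (rule linear_maps_comp[OF H_ix_linear alg_hom_linear[OF h]])
  next
    case 5
    show ?case by (rule bilinear_maps_comp_linear[OF H_ixw_bilinear alg_hom_linear[OF h]])
  next
    case 6
    show ?case by (rule bilinear_maps_comp_linear[OF H_iwx_bilinear alg_hom_linear[OF h]])
  next
    case (7 r u)
    then show ?case using Hcls_eq[OF Hrel_memI(1)[OF 7]] by (simp add: hom)
  next
    case (8 r u)
    then show ?case using Hcls_eq[OF Hrel_memI(2)[OF 8]] by (simp add: hom X.ract_closed)
  next
    case (9 r u)
    then show ?case using Hcls_eq[OF Hrel_memI(3)[OF 9]] by (simp add: hom)
  next
    case (10 r u w)
    then show ?case using R4[of r "\<one>\<^bsub>A\<^esub>" "\<one>\<^bsub>A\<^esub>" "\<one>\<^bsub>A\<^esub>" u w] by (simp add: one)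
  next
    case (11 r u w)
    then show ?case using R4[of "\<one>\<^bsub>A\<^esub>" r "\<one>\<^bsub>A\<^esub>" "\<one>\<^bsub>A\<^esub>" u w] by (simp add: one)
  next
    case (12 r u w)
    then show ?case using R4[of "\<one>\<^bsub>A\<^esub>" "\<one>\<^bsub>A\<^esub>" r "\<one>\<^bsub>A\<^esub>" u w] by (simp add: one)
  next
    case (13 r u w)
    then show ?case using R4[of "\<one>\<^bsub>A\<^esub>" "\<one>\<^bsub>A\<^esub>" "\<one>\<^bsub>A\<^esub>" r u w] by (simp add: one)
  next
    case (14 r u w)
    then show ?case using R4'[of r "\<one>\<^bsub>A\<^esub>" "\<one>\<^bsub>A\<^esub>" "\<one>\<^bsub>A\<^esub>" u w] by (simp add: one)
  next
    case (15 r u w)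
    then show ?case using R4'[of "\<one>\<^bsub>A\<^esub>" r "\<one>\<^bsub>A\<^esub>" "\<one>\<^bsub>A\<^esub>" u w] by (simp add: one)
  next
    case (16 r u w)
    then show ?case using R4'[of "\<one>\<^bsub>A\<^esub>" "\<one>\<^bsub>A\<^esub>" r "\<one>\<^bsub>A\<^esub>" u w] by (simp add: one)
  next
    case (17 r u w)
    then show ?case using R4'[of "\<one>\<^bsub>A\<^esub>" "\<one>\<^bsub>A\<^esub>" "\<one>\<^bsub>A\<^esub>" r u w] by (simp add: one)
  next
    case (18 u w)
    then show ?case using Hcls_eq[OF Hrel_memI(6)[OF 18]] H_hom_sums(1)[OF HA_algebra h refl refl 18] by simp
  next
    case (19 u w)
    then show ?case using Hcls_eq[OF Hrel_memI(7)[OF 19]] H_hom_sums(2)[OF HA_algebra h refl refl 19] by simp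
  next
    case (20 u w)
    then show ?case using Hcls_eq[OF Hrel_memI(8)[OF 20]] H_hom_sums(3)[OF HA_algebra h refl refl 20] by simp
  next
    case (21 u w)
    then show ?case using Hcls_eq[OF Hrel_memI(9)[OF 21]] H_hom_sums(4)[OF HA_algebra h refl refl 21] by simp
  qed
qed

lemma HA_lift:
  assumes "H_rep K A \<Omega> d X coev ev ucoev uev p b x q y c D ia ib ix ixw iwx"
  shows "\<exists>h \<in> alg_hom K HA D.
    (\<forall>r \<in> carrier A. h (Hcls (H_ia r)) = ia r \<and> h (Hcls (H_ib r)) = ib r) \<and>
    (\<forall>u \<in> carrier X. h (Hcls (H_ix u)) = ix u) \<and>
    (\<forall>u \<in> carrier X. \<forall>w \<in> carrier \<Omega>. h (Hcls (H_ixw u w)) = ixw u w \<and> h (Hcls (H_iwx w u)) = iwx w u)"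
proof -
  interpret R: H_rep K A \<Omega> d X coev ev ucoev uev p b x q y c D ia ib ix ixw iwx by fact
  note D = R.D.K_algebra_axioms
  interpret H: K_algebra K H_free by (rule H_free_algebra)
  obtain h0 where h0: "h0 \<in> alg_hom K H_free D"
    and iab: "\<And>r s. \<lbrakk>r \<in> carrier A; s \<in> carrier A\<rbrakk> \<Longrightarrow> h0 (H_iab r s) = ia r \<otimes>\<^bsub>D\<^esub> ib s"
    and ix: "\<And>u. u \<in> carrier X \<Longrightarrow> h0 (H_ix u) = ix u"
    and ixw: "\<And>u w. \<lbrakk>u \<in> carrier X; w \<in> carrier \<Omega>\<rbrakk> \<Longrightarrow> h0 (H_ixw u w) = ixw u w"
    and iwx: "\<And>u w. \<lbrakk>u \<in> carrier X; w \<in> carrier \<Omega>\<rbrakk> \<Longrightarrow> h0 (H_iwx w u) = iwx w u"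
    using H_free_lift[OF D R.ia_hom R.ib_hom R.ia_ib R.ix_linear R.ixw_bilinear R.iwx_bilinear] by blast
  have ia: "h0 (H_ia r) = ia r" and ib: "h0 (H_ib r) = ib r" if "r \<in> carrier A" for r
    unfolding H_ia_def H_ib_def using that by (simp_all add: iab)
  note hom = alg_hom_mult[OF h0] alg_hom_add[OF h0] iab ia ib ix ixw iwx
  note cl = X.lact_closed X.ract_closed lact_closed ract_closed
  note sums = H_hom_sums[where h = h0 and ixw = ixw and iwx = iwx, OF D h0 ixw iwx]
    R.sum_iwx_ixw R.sum_ixw_iwx R.sum_ixw_iwx' R.sum_iwx_ixw'
  have rel: "h0 l = h0 r" if "(l, r) \<in> Hrel" for l r
    using that unfolding Hrel_def H_relations_def Let_def
    by (elim UnE CollectE exE conjE Pair_inject)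
       (simp_all add: hom sums cl R.ia_ix R.ix_ia R.ix_ib R.iab_ixw R.iab_iwx)
  obtain h where "h \<in> alg_hom K HA D" "\<forall>t \<in> carrier H_free. h (Hcls t) = h0 t"
    using imposed.impose_lift[OF H_imposed D h0 rel] unfolding HA_eq Hcls_def by blast
  then show ?thesis by (intro bexI[of _ h]) (simp_all add: ia ib ix ixw iwx)
qed

lemma HA_generates:
  "generates K HA (Hcls ` (H_ia ` carrier A \<union> H_ib ` carrier A \<union> H_ix ` carrier X \<union>
    {H_ixw u w | u w. u \<in> carrier X \<and> w \<in> carrier \<Omega>} \<union> {H_iwx w u | w u. w \<in> carrier \<Omega> \<and> u \<in> carrier X}))"
  using imposed.impose_generates[OF H_imposed H_free_generates] unfolding HA_eq Hcls_def .

end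


context pivotal_calculus
begin

definition Brel where "Brel = IB_relations p b x q y c"
abbreviation BA where "BA \<equiv> IBX p b x q y c"
definition Brel_extra where "Brel_extra = IBX_extra_relations p b x q y c"
abbreviation BQ where "BQ \<equiv> IBX_quotient p b x q y c"
definition Bcls1 where "Bcls1 = impose_class B_free Brel"
definition Bcls where "Bcls t = impose_class BA Brel_extra (Bcls1 t)"

lemma BA_eq: "BA = impose B_free Brel"
  unfolding IBX_def Brel_def ..

lemma BQ_eq: "BQ = impose BA Brel_extra"
  unfolding IBX_quotient_def Brel_extra_def ..

lemma null_family_closed:
  assumes "null_family N r s" "n < N"
  shows "r n \<in> carrier A" "s n \<in> carrier A"
  using assms unfolding null_family_def by auto

lemma B_imposed: "imposed K B_free Brel"
proof (intro imposed.intro imposed_axioms.intro B_free_algebra)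
  interpret B: K_algebra K B_free by (rule B_free_algebra)
  show "Brel \<subseteq> carrier B_free \<times> carrier B_free"
    unfolding Brel_def IB_relations_def Let_def commutator_def
    by (intro Un_least)
       (auto intro!: B.M.finsum_closed simp: X.lact_closed X.ract_closed null_family_closed)
qed

lemmas BA_algebra = imposed.impose_K_algebra[OF B_imposed, folded BA_eq]
lemmas Bcls1_hom = imposed.impose_class_hom[OF B_imposed, folded BA_eq Bcls1_def]
lemmas Bcls1_eq = imposed.impose_class_eq[OF B_imposed, folded Bcls1_def]
lemmas Bcls1_closed = alg_hom_closed[OF Bcls1_hom]

lemma Brel_extra_eq:
  "Brel_extra =
    {(\<Oplus>\<^bsub>BA\<^esub>j\<in>{..<q}. commutator BA (Bcls1 (B_ix (y j))) (Bcls1 (B_ib r)) \<otimes>\<^bsub>BA\<^esub>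
        commutator BA (Bcls1 (B_iy u)) (Bcls1 (B_ia (c j))), Bcls1 (B_ib (ev_pair u (d r)))) | r u.
      r \<in> carrier A \<and> u \<in> carrier X} \<union>
    {(\<Oplus>\<^bsub>BA\<^esub>i\<in>{..<p}. commutator BA (Bcls1 (B_iy (x i))) (Bcls1 (B_ia r)) \<otimes>\<^bsub>BA\<^esub>
        commutator BA (Bcls1 (B_ix u)) (Bcls1 (B_ib (b i))), Bcls1 (B_ia (uev_pair (d r) u))) | r u.
      r \<in> carrier A \<and> u \<in> carrier X}"
  unfolding Brel_extra_def IBX_extra_relations_def Let_def Bcls1_def Brel_def ..

lemma extra_imposed: "imposed K BA Brel_extra"
proof (intro imposed.intro imposed_axioms.intro BA_algebra)
  interpret B: K_algebra K BA by (rule BA_algebra)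
  show "Brel_extra \<subseteq> carrier BA \<times> carrier BA"
    unfolding Brel_extra_eq commutator_def
    by (intro Un_least) (auto intro!: B.M.finsum_closed simp: Bcls1_closed)
qed

lemmas BQ_algebra = imposed.impose_K_algebra[OF extra_imposed, folded BQ_eq]
lemmas extra_hom = imposed.impose_class_hom[OF extra_imposed, folded BQ_eq]
lemmas extra_eq = imposed.impose_class_eq[OF extra_imposed]

lemma Bcls_hom: "Bcls \<in> alg_hom K B_free BQ"
  using alg_hom_comp[OF Bcls1_hom extra_hom] unfolding Bcls_def .

lemma Bcls_eq: "(l, r) \<in> Brel \<Longrightarrow> Bcls l = Bcls r"
  unfolding Bcls_def by (simp add: Bcls1_eq)

lemma Brel_memI:
  "\<lbrakk>r \<in> carrier A; u \<in> carrier X\<rbrakk> \<Longrightarrow> (B_ia r \<otimes>\<^bsub>B_free\<^esub> B_ix u, B_ix (r \<triangleright>\<^bsub>X\<^esub> u)) \<in> Brel"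
  "\<lbrakk>r \<in> carrier A; u \<in> carrier X\<rbrakk> \<Longrightarrow>
    (B_ix u \<otimes>\<^bsub>B_free\<^esub> B_ia r, B_ix (u \<triangleleft>\<^bsub>X\<^esub> r) \<oplus>\<^bsub>B_free\<^esub> B_ia (ev_pair u (d r))) \<in> Brel"
  "\<lbrakk>r \<in> carrier A; u \<in> carrier X\<rbrakk> \<Longrightarrow> (B_ib r \<otimes>\<^bsub>B_free\<^esub> B_iy u, B_iy (u \<triangleleft>\<^bsub>X\<^esub> r)) \<in> Brel"
  "\<lbrakk>r \<in> carrier A; u \<in> carrier X\<rbrakk> \<Longrightarrow>
    (B_iy u \<otimes>\<^bsub>B_free\<^esub> B_ib r, B_iy (r \<triangleright>\<^bsub>X\<^esub> u) \<oplus>\<^bsub>B_free\<^esub> B_ib (uev_pair (d r) u)) \<in> Brel"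
  "\<lbrakk>null_family N f g; u \<in> carrier X\<rbrakk> \<Longrightarrow>
    (\<Oplus>\<^bsub>B_free\<^esub>m\<in>{..<N}. B_ib (g m) \<otimes>\<^bsub>B_free\<^esub> B_ix u \<otimes>\<^bsub>B_free\<^esub> B_ib (f m), \<zero>\<^bsub>B_free\<^esub>) \<in> Brel"
  "\<lbrakk>null_family N f g; u \<in> carrier X\<rbrakk> \<Longrightarrow>
    (\<Oplus>\<^bsub>B_free\<^esub>m\<in>{..<N}. B_ia (f m) \<otimes>\<^bsub>B_free\<^esub> B_iy u \<otimes>\<^bsub>B_free\<^esub> B_ia (g m), \<zero>\<^bsub>B_free\<^esub>) \<in> Brel"
  "u \<in> carrier X \<Longrightarrow>
    (\<Oplus>\<^bsub>B_free\<^esub>i\<in>{..<p}. commutator B_free (B_iy u) (B_ia (b i)) \<otimes>\<^bsub>B_free\<^esub> B_ix (x i), B_iy u) \<in> Brel"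
  "u \<in> carrier X \<Longrightarrow>
    (\<Oplus>\<^bsub>B_free\<^esub>j\<in>{..<q}. commutator B_free (B_ix u) (B_ib (c j)) \<otimes>\<^bsub>B_free\<^esub> B_iy (y j), B_ix u) \<in> Brel"
  unfolding Brel_def IB_relations_def Let_def
proof goal_cases
  case 1
  show ?case by (rule UnI1, rule UnI1, rule UnI1, rule UnI1, rule UnI1, rule UnI1, rule UnI1, use 1 in blast)
next
  case 2
  show ?case by (rule UnI1, rule UnI1, rule UnI1, rule UnI1, rule UnI1, rule UnI1, rule UnI2, use 2 in blast)
next
  case 3
  show ?case by (rule UnI1, rule UnI1, rule UnI1, rule UnI1, rule UnI1, rule UnI2, use 3 in blast)
next
  case 4
  show ?case by (rule UnI1, rule UnI1, rule UnI1, rule UnI1, rule UnI2, use 4 in blast)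
next
  case 5
  show ?case by (rule UnI1, rule UnI1, rule UnI1, rule UnI2, use 5 in blast)
next
  case 6
  show ?case by (rule UnI1, rule UnI1, rule UnI2, use 6 in blast)
next
  case 7
  show ?case by (rule UnI1, rule UnI2, use 7 in blast)
next
  case 8
  show ?case by (rule UnI2, use 8 in blast)
qed

lemma B_free_closed:
  "\<lbrakk>s \<in> carrier B_free; t \<in> carrier B_free\<rbrakk> \<Longrightarrow> s \<otimes>\<^bsub>B_free\<^esub> t \<in> carrier B_free"
  "\<lbrakk>s \<in> carrier B_free; t \<in> carrier B_free\<rbrakk> \<Longrightarrow> commutator B_free s t \<in> carrier B_free"
proof -
  interpret B: K_algebra K B_free by (rule B_free_algebra)
  show "s \<otimes>\<^bsub>B_free\<^esub> t \<in> carrier B_free" "commutator B_free s t \<in> carrier B_free"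
    if "s \<in> carrier B_free" "t \<in> carrier B_free"
    using that by (simp_all add: commutator_def)
qed

lemma B_hom_sums:
  assumes D: "K_algebra K D" and h: "h \<in> alg_hom K B_free D"
    and ia: "\<And>r. r \<in> carrier A \<Longrightarrow> h (B_ia r) = ia r" and ib: "\<And>r. r \<in> carrier A \<Longrightarrow> h (B_ib r) = ib r"
    and ix: "\<And>u. u \<in> carrier X \<Longrightarrow> h (B_ix u) = ix u" and iy: "\<And>u. u \<in> carrier X \<Longrightarrow> h (B_iy u) = iy u"
    and u: "u \<in> carrier X"
  shows "null_family N f g \<Longrightarrow>
      h (\<Oplus>\<^bsub>B_free\<^esub>m\<in>{..<N}. B_ib (g m) \<otimes>\<^bsub>B_free\<^esub> B_ix u \<otimes>\<^bsub>B_free\<^esub> B_ib (f m)) =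
      (\<Oplus>\<^bsub>D\<^esub>m\<in>{..<N}. ib (g m) \<otimes>\<^bsub>D\<^esub> ix u \<otimes>\<^bsub>D\<^esub> ib (f m))"
    and "null_family N f g \<Longrightarrow>
      h (\<Oplus>\<^bsub>B_free\<^esub>m\<in>{..<N}. B_ia (f m) \<otimes>\<^bsub>B_free\<^esub> B_iy u \<otimes>\<^bsub>B_free\<^esub> B_ia (g m)) =
      (\<Oplus>\<^bsub>D\<^esub>m\<in>{..<N}. ia (f m) \<otimes>\<^bsub>D\<^esub> iy u \<otimes>\<^bsub>D\<^esub> ia (g m))"
    and "h (\<Oplus>\<^bsub>B_free\<^esub>i\<in>{..<p}. commutator B_free (B_iy u) (B_ia (b i)) \<otimes>\<^bsub>B_free\<^esub> B_ix (x i)) =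
      (\<Oplus>\<^bsub>D\<^esub>i\<in>{..<p}. commutator D (iy u) (ia (b i)) \<otimes>\<^bsub>D\<^esub> ix (x i))"
    and "h (\<Oplus>\<^bsub>B_free\<^esub>j\<in>{..<q}. commutator B_free (B_ix u) (B_ib (c j)) \<otimes>\<^bsub>B_free\<^esub> B_iy (y j)) =
      (\<Oplus>\<^bsub>D\<^esub>j\<in>{..<q}. commutator D (ix u) (ib (c j)) \<otimes>\<^bsub>D\<^esub> iy (y j))"
  by (rule alg_hom_finsum_eq[OF B_free_algebra D h];
      simp add: alg_hom_mult[OF h] alg_hom_commutator[OF B_free_algebra D h] B_free_closed
        null_family_closed u ia ib ix iy)+

text \<open>
  The relations of \<open>IBX\<close> hold in the quotient because classes are taken in two steps, the first
  of which identifies them.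
\<close>

lemma B_rep_BQ:
  "B_rep K A \<Omega> d X coev ev ucoev uev p b x q y c BQ (\<lambda>r. Bcls (B_ia r)) (\<lambda>r. Bcls (B_ib r))
    (\<lambda>u. Bcls (B_ix u)) (\<lambda>u. Bcls (B_iy u))"
proof -
  interpret BQ: K_algebra K BQ by (rule BQ_algebra)
  interpret BA: K_algebra K BA by (rule BA_algebra)
  note h = Bcls_hom
  have comm_closed': "commutator BA s t \<in> carrier BA" if "s \<in> carrier BA" "t \<in> carrier BA" for s t
    using that unfolding commutator_def by simp
  note hom = alg_hom_mult[OF h] alg_hom_add[OF h] alg_hom_zero[OF B_free_algebra BQ_algebra h]
    alg_hom_commutator[OF B_free_algebra BQ_algebra h] B_free_closed
  note sums = B_hom_sums[OF BQ_algebra h refl refl refl refl]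
  note hom' = alg_hom_mult[OF extra_hom] alg_hom_commutator[OF BA_algebra BQ_algebra extra_hom]
    comm_closed' Bcls1_closed
  note sum' = alg_hom_finsum_eq[OF BA_algebra BQ_algebra extra_hom]
  show ?thesis
  proof (unfold_locales, goal_cases)
    case 1
    show ?case by (rule alg_hom_comp[OF B_envelope(1) h])
  next
    case 2
    show ?case by (rule alg_hom_comp[OF B_envelope(2) h])
  next
    case (3 r s)
    have "Bcls (B_ia r \<otimes>\<^bsub>B_free\<^esub> B_ib s) = Bcls (B_ib s \<otimes>\<^bsub>B_free\<^esub> B_ia r)"
      using B_envelope(3,4)[OF 3] by simp
    then show ?case using 3 by (simp add: hom)
  next
    case 4
    show ?case by (rule linear_maps_comp[OF B_ix_linear alg_hom_linear[OF h]])
  next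
    case 5
    show ?case by (rule linear_maps_comp[OF B_iy_linear alg_hom_linear[OF h]])
  next
    case (6 r u)
    then show ?case using Bcls_eq[OF Brel_memI(1)[OF 6]] by (simp add: hom)
  next
    case (7 r u)
    then show ?case using Bcls_eq[OF Brel_memI(2)[OF 7]] by (simp add: hom X.ract_closed)
  next
    case (8 r u)
    then show ?case using Bcls_eq[OF Brel_memI(3)[OF 8]] by (simp add: hom)
  next
    case (9 r u)
    then show ?case using Bcls_eq[OF Brel_memI(4)[OF 9]] by (simp add: hom X.lact_closed)
  next
    case (10 N f g u)
    then show ?case
      using Bcls_eq[OF Brel_memI(5)[OF 10]] sums(1)[OF 10(2,1)] by (simp add: hom)
  next
    case (11 N f g u)
    then show ?case
      using Bcls_eq[OF Brel_memI(6)[OF 11]] sums(2)[OF 11(2,1)] by (simp add: hom)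
  next
    case (12 u)
    then show ?case using Bcls_eq[OF Brel_memI(7)[OF 12]] sums(3)[OF 12] by simp
  next
    case (13 u)
    then show ?case using Bcls_eq[OF Brel_memI(8)[OF 13]] sums(4)[OF 13] by simp
  next
    case (14 r u)
    have "(\<Oplus>\<^bsub>BA\<^esub>j\<in>{..<q}. commutator BA (Bcls1 (B_ix (y j))) (Bcls1 (B_ib r)) \<otimes>\<^bsub>BA\<^esub>
        commutator BA (Bcls1 (B_iy u)) (Bcls1 (B_ia (c j))), Bcls1 (B_ib (ev_pair u (d r)))) \<in> Brel_extra"
      unfolding Brel_extra_eq by (rule UnI1) (use 14 in blast)
    note mem = this
    have "impose_class BA Brel_extra (\<Oplus>\<^bsub>BA\<^esub>j\<in>{..<q}. commutator BA (Bcls1 (B_ix (y j))) (Bcls1 (B_ib r)) \<otimes>\<^bsub>BA\<^esub>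
        commutator BA (Bcls1 (B_iy u)) (Bcls1 (B_ia (c j)))) =
        (\<Oplus>\<^bsub>BQ\<^esub>j\<in>{..<q}. commutator BQ (Bcls (B_ix (y j))) (Bcls (B_ib r)) \<otimes>\<^bsub>BQ\<^esub>
        commutator BQ (Bcls (B_iy u)) (Bcls (B_ia (c j))))"
      by (rule sum') (use 14 in \<open>simp_all add: hom' Bcls_def\<close>)
    from trans[OF this[symmetric] extra_eq[OF mem]] show ?case
      unfolding Bcls_def .
  next
    case (15 r u)
    have "(\<Oplus>\<^bsub>BA\<^esub>i\<in>{..<p}. commutator BA (Bcls1 (B_iy (x i))) (Bcls1 (B_ia r)) \<otimes>\<^bsub>BA\<^esub>
        commutator BA (Bcls1 (B_ix u)) (Bcls1 (B_ib (b i))), Bcls1 (B_ia (uev_pair (d r) u))) \<in> Brel_extra"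
      unfolding Brel_extra_eq by (rule UnI2) (use 15 in blast)
    note mem = this
    have "impose_class BA Brel_extra (\<Oplus>\<^bsub>BA\<^esub>i\<in>{..<p}. commutator BA (Bcls1 (B_iy (x i))) (Bcls1 (B_ia r)) \<otimes>\<^bsub>BA\<^esub>
        commutator BA (Bcls1 (B_ix u)) (Bcls1 (B_ib (b i)))) =
        (\<Oplus>\<^bsub>BQ\<^esub>i\<in>{..<p}. commutator BQ (Bcls (B_iy (x i))) (Bcls (B_ia r)) \<otimes>\<^bsub>BQ\<^esub>
        commutator BQ (Bcls (B_ix u)) (Bcls (B_ib (b i))))"
      by (rule sum') (use 15 in \<open>simp_all add: hom' Bcls_def\<close>)
    from trans[OF this[symmetric] extra_eq[OF mem]] show ?case
      unfolding Bcls_def .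
  qed
qed

lemma BQ_lift:
  assumes "B_rep K A \<Omega> d X coev ev ucoev uev p b x q y c D ia ib ix iy"
  shows "\<exists>h \<in> alg_hom K BQ D.
    (\<forall>r \<in> carrier A. h (Bcls (B_ia r)) = ia r \<and> h (Bcls (B_ib r)) = ib r) \<and>
    (\<forall>u \<in> carrier X. h (Bcls (B_ix u)) = ix u \<and> h (Bcls (B_iy u)) = iy u)"
proof -
  interpret R: B_rep K A \<Omega> d X coev ev ucoev uev p b x q y c D ia ib ix iy by fact
  note D = R.D.K_algebra_axioms
  interpret BA: K_algebra K BA by (rule BA_algebra)
  have comm_closed': "commutator BA s t \<in> carrier BA" if "s \<in> carrier BA" "t \<in> carrier BA" for s t
    using that unfolding commutator_def by simp
  obtain h0 where h0: "h0 \<in> alg_hom K B_free D"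
    and iab: "\<And>r s. \<lbrakk>r \<in> carrier A; s \<in> carrier A\<rbrakk> \<Longrightarrow> h0 (B_iab r s) = ia r \<otimes>\<^bsub>D\<^esub> ib s"
    and ix: "\<And>u. u \<in> carrier X \<Longrightarrow> h0 (B_ix u) = ix u"
    and iy: "\<And>u. u \<in> carrier X \<Longrightarrow> h0 (B_iy u) = iy u"
    using B_free_lift[OF D R.ia_hom R.ib_hom R.ia_ib R.ix_linear R.iy_linear] by blast
  have ia: "h0 (B_ia r) = ia r" and ib: "h0 (B_ib r) = ib r" if "r \<in> carrier A" for r
    unfolding B_ia_def B_ib_def using that by (simp_all add: iab)
  note hom = alg_hom_mult[OF h0] alg_hom_add[OF h0] alg_hom_zero[OF B_free_algebra D h0]
    alg_hom_commutator[OF B_free_algebra D h0] B_free_closed ia ib ix iy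
  note sums = B_hom_sums[where h = h0 and ia = ia and ib = ib and ix = ix and iy = iy, OF D h0 ia ib ix iy]
    R.null_ix R.null_iy R.sum_comm_ix R.sum_comm_iy
  have rel: "h0 l = h0 r" if "(l, r) \<in> Brel" for l r
    using that unfolding Brel_def IB_relations_def Let_def
    by (elim UnE CollectE exE conjE Pair_inject)
       (simp_all add: hom sums X.lact_closed X.ract_closed R.ia_ix R.ix_ia R.ib_iy R.iy_ib)
  obtain h1 where h1: "h1 \<in> alg_hom K BA D" "\<And>t. t \<in> carrier B_free \<Longrightarrow> h1 (Bcls1 t) = h0 t"
    using imposed.impose_lift[OF B_imposed D h0 rel] unfolding BA_eq Bcls1_def by blast
  note hom' = alg_hom_mult[OF h1(1)] alg_hom_commutator[OF BA_algebra D h1(1)]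
    comm_closed' Bcls1_closed h1(2) ia ib ix iy
  note sum' = alg_hom_finsum_eq[OF BA_algebra D h1(1)]
  have extra: "h1 (\<Oplus>\<^bsub>BA\<^esub>j\<in>{..<q}. commutator BA (Bcls1 (B_ix (y j))) (Bcls1 (B_ib r)) \<otimes>\<^bsub>BA\<^esub>
        commutator BA (Bcls1 (B_iy u)) (Bcls1 (B_ia (c j)))) = ib (ev_pair u (d r))"
    "h1 (\<Oplus>\<^bsub>BA\<^esub>i\<in>{..<p}. commutator BA (Bcls1 (B_iy (x i))) (Bcls1 (B_ia r)) \<otimes>\<^bsub>BA\<^esub>
        commutator BA (Bcls1 (B_ix u)) (Bcls1 (B_ib (b i)))) = ia (uev_pair (d r) u)"
    if r: "r \<in> carrier A" and u: "u \<in> carrier X" for r u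
  proof -
    show "h1 (\<Oplus>\<^bsub>BA\<^esub>j\<in>{..<q}. commutator BA (Bcls1 (B_ix (y j))) (Bcls1 (B_ib r)) \<otimes>\<^bsub>BA\<^esub>
        commutator BA (Bcls1 (B_iy u)) (Bcls1 (B_ia (c j)))) = ib (ev_pair u (d r))"
      unfolding R.extra1[OF r u, symmetric] by (rule sum') (use r u in \<open>simp_all add: hom'\<close>)
    show "h1 (\<Oplus>\<^bsub>BA\<^esub>i\<in>{..<p}. commutator BA (Bcls1 (B_iy (x i))) (Bcls1 (B_ia r)) \<otimes>\<^bsub>BA\<^esub>
        commutator BA (Bcls1 (B_ix u)) (Bcls1 (B_ib (b i)))) = ia (uev_pair (d r) u)"
      unfolding R.extra2[OF r u, symmetric] by (rule sum') (use r u in \<open>simp_all add: hom'\<close>)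
  qed
  have rel': "h1 l = h1 r" if "(l, r) \<in> Brel_extra" for l r
    using that unfolding Brel_extra_eq
    by (elim UnE CollectE exE conjE Pair_inject) (simp_all add: extra h1(2) ia ib)
  obtain h where "h \<in> alg_hom K BQ D"
    "\<forall>t \<in> carrier BA. h (impose_class BA Brel_extra t) = h1 t"
    using imposed.impose_lift[OF extra_imposed D h1(1) rel'] unfolding BQ_eq by blast
  then show ?thesis
    by (intro bexI[of _ h]) (simp_all add: Bcls_def Bcls1_closed h1(2) ia ib ix iy)
qed

lemma BQ_generates:
  "generates K BQ (Bcls ` (B_ia ` carrier A \<union> B_ib ` carrier A \<union> B_ix ` carrier X \<union> B_iy ` carrier X))"
proof -
  have eq: "Bcls ` S = impose_class BA Brel_extra ` Bcls1 ` S" for S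
    unfolding Bcls_def image_image ..
  show ?thesis
    unfolding eq
    by (rule imposed.impose_generates[OF extra_imposed
          imposed.impose_generates[OF B_imposed B_free_generates, folded BA_eq Bcls1_def], folded BQ_eq])
qed

text \<open>
  The homomorphism \<open>f\<close> from left to right sends the pairs to the maps constructed from
  commutators, \<open>g\<close> sends the barred generators to \<open>\<Sum> (d (b i), u) x i\<close>. To see that \<open>g\<close> maps
  these commutators back to the pairs, it is enough to look at the spanning families of \<open>\<Omega>\<close>;
  that \<open>f\<close> recovers the barred generators is one of the relations of \<open>IBX\<close>.
\<close>

lemma HA_isomorphic_BQ: "algebra_isomorphic K HA BQ"
proof -
  interpret H: H_rep K A \<Omega> d X coev ev ucoev uev p b x q y c HA "\<lambda>r. Hcls (H_ia r)" "\<lambda>r. Hcls (H_ib r)"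
    "\<lambda>u. Hcls (H_ix u)" "\<lambda>u w. Hcls (H_ixw u w)" "\<lambda>w u. Hcls (H_iwx w u)"
    by (rule H_rep_HA)
  interpret Q: B_rep K A \<Omega> d X coev ev ucoev uev p b x q y c BQ "\<lambda>r. Bcls (B_ia r)" "\<lambda>r. Bcls (B_ib r)"
    "\<lambda>u. Bcls (B_ix u)" "\<lambda>u. Bcls (B_iy u)"
    by (rule B_rep_BQ)
  obtain f where f: "f \<in> alg_hom K HA BQ"
    and fa: "\<And>r. r \<in> carrier A \<Longrightarrow> f (Hcls (H_ia r)) = Bcls (B_ia r)"
    and fb: "\<And>r. r \<in> carrier A \<Longrightarrow> f (Hcls (H_ib r)) = Bcls (B_ib r)"
    and fx: "\<And>u. u \<in> carrier X \<Longrightarrow> f (Hcls (H_ix u)) = Bcls (B_ix u)"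
    and fxw: "\<And>u w. \<lbrakk>u \<in> carrier X; w \<in> carrier \<Omega>\<rbrakk> \<Longrightarrow> f (Hcls (H_ixw u w)) = Q.ixw u w"
    and fwx: "\<And>u w. \<lbrakk>u \<in> carrier X; w \<in> carrier \<Omega>\<rbrakk> \<Longrightarrow> f (Hcls (H_iwx w u)) = Q.iwx w u"
    using HA_lift[OF Q.B_rep_imp_H_rep] by (elim bexE conjE) (rule that, assumption, simp_all)
  obtain g where g: "g \<in> alg_hom K BQ HA"
    and ga: "\<And>r. r \<in> carrier A \<Longrightarrow> g (Bcls (B_ia r)) = Hcls (H_ia r)"
    and gb: "\<And>r. r \<in> carrier A \<Longrightarrow> g (Bcls (B_ib r)) = Hcls (H_ib r)"
    and gx: "\<And>u. u \<in> carrier X \<Longrightarrow> g (Bcls (B_ix u)) = Hcls (H_ix u)"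
    and gy: "\<And>u. u \<in> carrier X \<Longrightarrow> g (Bcls (B_iy u)) = H.iy u"
    using BQ_lift[OF H.H_rep_imp_B_rep] by (elim bexE conjE) (rule that, assumption, simp_all)
  note gcomm = alg_hom_commutator[OF BQ_algebra HA_algebra g]
  have gxw: "g (Q.ixw u w) = Hcls (H_ixw u w)" if u: "u \<in> carrier X" and w: "w \<in> carrier \<Omega>" for u w
    using w
  proof (induction rule: Omega_induct_right)
    case (gen r s)
    then show ?case
      using u by (simp add: Q.ixw_gen alg_hom_mult[OF g] gcomm gb gx H.comm_ix_ib H.ib_ixw)
  next
    case (add v w)
    then show ?case
      using u by (simp add: Q.ixw_add alg_hom_add[OF g] bilinear_maps_add_right[OF H.ixw_bilinear])
  qed
  have gwx: "g (Q.iwx w u) = Hcls (H_iwx w u)" if u: "u \<in> carrier X" and w: "w \<in> carrier \<Omega>" for u w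
    using w
  proof (induction rule: Omega_induct_left)
    case (gen r s)
    then show ?case
      using u by (simp add: Q.iwx_gen alg_hom_mult[OF g] gcomm ga gy H.comm_iy_ia H.ia_iwx)
  next
    case (add v w)
    then show ?case
      using u by (simp add: Q.iwx_add alg_hom_add[OF g] bilinear_maps_add_left[OF H.iwx_bilinear])
  qed
  have fy: "f (H.iy u) = Bcls (B_iy u)" if u: "u \<in> carrier X" for u
  proof -
    have "f (H.iy u) = (\<Oplus>\<^bsub>BQ\<^esub>i\<in>{..<p}. commutator BQ (Bcls (B_iy u)) (Bcls (B_ia (b i))) \<otimes>\<^bsub>BQ\<^esub> Bcls (B_ix (x i)))"
      unfolding H.iy_def
      by (rule alg_hom_finsum_eq[OF HA_algebra BQ_algebra f])
         (use u in \<open>simp_all add: alg_hom_mult[OF f] fwx fx Q.iwx_d\<close>)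
    then show ?thesis by (simp add: Q.sum_comm_ix[OF u])
  qed
  show ?thesis
  proof (rule algebra_isomorphicI[OF HA_algebra BQ_algebra HA_generates BQ_generates f g])
    show "g (f s) = s" if "s \<in> Hcls ` (H_ia ` carrier A \<union> H_ib ` carrier A \<union> H_ix ` carrier X \<union>
        {H_ixw u w | u w. u \<in> carrier X \<and> w \<in> carrier \<Omega>} \<union> {H_iwx w u | w u. w \<in> carrier \<Omega> \<and> u \<in> carrier X})" for s
      using that by (auto simp: fa fb fx fxw fwx ga gb gx gxw gwx)
    show "f (g t) = t"
      if "t \<in> Bcls ` (B_ia ` carrier A \<union> B_ib ` carrier A \<union> B_ix ` carrier X \<union> B_iy ` carrier X)" for t
      using that by (auto simp: ga gb gx gy fa fb fx fy)
  qed
qed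

end

theorem corollary4p3:
  fixes K :: "'k ring" and A :: "('k, 'a) module" and \<Omega> :: "('k, 'a, 'w) bimodule"
    and d :: "'a \<Rightarrow> 'w" and X :: "('k, 'a, 'x) bimodule"
    and coev :: "'a \<Rightarrow> ('w \<times> 'x \<Rightarrow> 'k) set" and ev :: "('x \<times> 'w \<Rightarrow> 'k) set \<Rightarrow> 'a"
    and ucoev :: "'a \<Rightarrow> ('x \<times> 'w \<Rightarrow> 'k) set" and uev :: "('w \<times> 'x \<Rightarrow> 'k) set \<Rightarrow> 'a"
    and p q :: nat and b c :: "nat \<Rightarrow> 'a" and x y :: "nat \<Rightarrow> 'x"
  assumes "pivotal_calculus K A \<Omega> d X coev ev ucoev uev p b x q y c"
  shows "algebra_isomorphic K
    (calculus_data.HX K A \<Omega> d X ev uev p (\<lambda>i. d (b i)) x q y (\<lambda>j. d (c j)))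
    (calculus_data.IBX_quotient K A \<Omega> d X ev uev p b x q y c)"
  using assms by (rule pivotal_calculus.HA_isomorphic_BQ)

end
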